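(* Let $n>1$ be an odd integer, let $f\in\mathbb{Z}[x]$ be a monic polynomial of degree $d\ge 1$ with discriminant $\Delta_f$, and suppose $\gcd(n,\Delta_f f(0))=1$. Let $\sigma\in S_d$. Then $(f,n)$ is a Frobenius pseudoprime (using the Jacobi step) with cycle structure $\sigma$ if and only if for every prime power $p^r\,\|\,n$ we have 1. the map $\phi_n:\alpha\mapsto\alpha^n$ permutes the roots of $f$ modulo $p^r$ with cycle structure $\sigma$ (i.e. the induced permutation has the same cycle type as $\sigma$), and 2. $\left(\frac{\Delta_f}{n}\right)=\operatorname{sgn}(\sigma)$ (Jacobi symbol).
   Context: $p^r\,\|\,n$ means $p$ is prime, $r\geq 1$, $p^r\mid n$ and $p^{r+1}\nmid n$. For monic polynomials $g_1,g_2$ over a commutative ring $R$ with identity, their greatest common monic divisor (gcmd) is the monic polynomial $h$ such that the ideal generated by $g_1,g_2$ in $R[x]$ equals the ideal generated by $h$, if such an $h$ exists. Write $\operatorname{gcmd}_n$ when $R=\mathbb{Z}/n\mathbb{Z}$. Let $n>1$ be odd and $f$ monic of degree $d$ with $\gcd(n,f(0)\Delta_f)=1$. Factorization step: put $f_0=f$, and for $i\ge1$ let $F_i=\operatorname{gcmd}_n(x^{n^i}-x,f_{i-1})$ and $f_i=f_{i-1}/F_i$, provided the gcmd exists; if it does not exist for $i=j$, then $F_i$ is undefined for all $i\ge j$. The pair $(f,n)$ passes if all $F_i$ are defined and $f_d=1$. In this case $f=F_1\cdots F_d\pmod n$, and the cycle structure of $(f,n)$ is the sequence $(\deg F_1/1,\deg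 F_2/2,\ldots,\deg F_d/d)$; it is identified with the conjugacy class in $S_d$ of permutations having exactly $\deg F_i/i$ cycles of length $i$. Frobenius step: for $2\le i\le d$, $F_i(x^n)\equiv 0\pmod{(n,F_i(x))}$. Jacobi step: with $S=\sum_{2\mid i}\deg(F_i)/i$, one has $(-1)^S=\left(\frac{\Delta_f}{n}\right)$. $(f,n)$ is a Frobenius pseudoprime if it passes the Factorization step, the Frobenius step and the Jacobi step. A root of $f$ modulo $p^r$ is an element $\alpha\in\overline{\mathbb{Z}_p}^{\mathrm{ur}}/p^r\overline{\mathbb{Z}_p}^{\mathrm{ur}}$ with $f(\alpha)=0$, where $\overline{\mathbb{Z}_p}^{\mathrm{ur}}$ is the ring of integers of the maximal unramified extension of $\mathbb{Q}_p$; when $p\nmid\Delta_f$ there are exactly $d$ such roots. *)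

theory Defs
  imports
    "HOL-Algebra.Algebra"
    "Subresultants.Resultant_Prelim"
    "HOL-Number_Theory.Number_Theory"
    "HOL-Combinatorics.Combinatorics"
begin

section \<open>Discriminants, Jacobi symbols, cycle types\<close>

text \<open>The discriminant is \<open>(-1)\<^bsup>d(d-1)/2\<^esup> Res(f, f') / lc(f)\<close>; the division is exact.\<close>

definition discriminant :: "int poly \<Rightarrow> int" where
  "discriminant f =
     (-1) ^ (Polynomial.degree f * (Polynomial.degree f - 1) div 2)
     * resultant f (pderiv f) div Polynomial.lead_coeff f"

definition Jacobi :: "int \<Rightarrow> nat \<Rightarrow> int" where
  "Jacobi a n = (\<Prod>p\<in>#prime_factorization n. Legendre a (int p))"

definition exactly_divides :: "nat \<Rightarrow> nat \<Rightarrow> nat \<Rightarrow> bool" where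
  "exactly_divides p r n \<longleftrightarrow> Factorial_Ring.prime p \<and> r \<ge> 1 \<and> p ^ r dvd n \<and> \<not> p ^ (r + 1) dvd n"

text \<open>For a map \<open>\<pi>\<close> that permutes the finite set \<open>A\<close>: the number of cycles of length \<open>i\<close>,
  fixed points being the cycles of length 1.\<close>

definition cycle_type :: "('a \<Rightarrow> 'a) \<Rightarrow> 'a set \<Rightarrow> nat \<Rightarrow> nat" where
  "cycle_type \<pi> A i = card {C \<in> orbit \<pi> ` A. card C = i}"


section \<open>Greatest common monic divisors\<close>

definition monic_UP :: "('a, 'm) ring_scheme \<Rightarrow> (nat \<Rightarrow> 'a) \<Rightarrow> bool" where
  "monic_UP R h \<longleftrightarrow> h \<in> carrier (UP R) \<and> up_ring.coeff (UP R) h (deg R h) = \<one>\<^bsub>R\<^esub>"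

definition is_gcmd ::
    "('a, 'm) ring_scheme \<Rightarrow> (nat \<Rightarrow> 'a) \<Rightarrow> (nat \<Rightarrow> 'a) \<Rightarrow> (nat \<Rightarrow> 'a) \<Rightarrow> bool" where
  "is_gcmd R g1 g2 h \<longleftrightarrow> monic_UP R h \<and> Idl\<^bsub>UP R\<^esub> {g1, g2} = Idl\<^bsub>UP R\<^esub> {h}"

definition gcmd ::
    "('a, 'm) ring_scheme \<Rightarrow> (nat \<Rightarrow> 'a) \<Rightarrow> (nat \<Rightarrow> 'a) \<Rightarrow> (nat \<Rightarrow> 'a) option" where
  "gcmd R g1 g2 =
     (if \<exists>h. is_gcmd R g1 g2 h then Some (THE h. is_gcmd R g1 g2 h) else None)"

text \<open>The quotient \<open>g / h\<close>, for monic \<open>h\<close> dividing \<open>g\<close>; it is unique since \<open>h\<close> is monic.\<close>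

definition exact_quotient ::
    "('a, 'm) ring_scheme \<Rightarrow> (nat \<Rightarrow> 'a) \<Rightarrow> (nat \<Rightarrow> 'a) \<Rightarrow> (nat \<Rightarrow> 'a)" where
  "exact_quotient R g h = (THE q. q \<in> carrier (UP R) \<and> g = h \<otimes>\<^bsub>UP R\<^esub> q)"


section \<open>Frobenius pseudoprimes\<close>

abbreviation ZMod :: "nat \<Rightarrow> int ring" where
  "ZMod n \<equiv> residue_ring (int n)"

definition poly_mod :: "nat \<Rightarrow> int poly \<Rightarrow> (nat \<Rightarrow> int)" where
  "poly_mod n f = (\<lambda>i. Polynomial.coeff f i mod int n)"

definition xpow :: "nat \<Rightarrow> nat \<Rightarrow> (nat \<Rightarrow> int)" where
  "xpow n k = up_ring.monom (UP (ZMod n)) \<one>\<^bsub>ZMod n\<^esub> k"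

text \<open>The polynomials \<open>f\<^sub>i\<close> and \<open>F\<^sub>i\<close> (for \<open>i \<ge> 1\<close>) of the Factorization step;
  \<open>None\<close> stands for undefined.\<close>

primrec frob_rest :: "nat \<Rightarrow> int poly \<Rightarrow> nat \<Rightarrow> (nat \<Rightarrow> int) option" where
  "frob_rest n f 0 = Some (poly_mod n f)"
| "frob_rest n f (Suc i) =
     (case frob_rest n f i of
        None \<Rightarrow> None
      | Some g \<Rightarrow>
         (case gcmd (ZMod n) (xpow n (n ^ Suc i) \<ominus>\<^bsub>UP (ZMod n)\<^esub> xpow n 1) g of
            None \<Rightarrow> None
          | Some h \<Rightarrow> Some (exact_quotient (ZMod n) g h)))"

definition frob_factor :: "nat \<Rightarrow> int poly \<Rightarrow> nat \<Rightarrow> (nat \<Rightarrow> int) option" where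
  "frob_factor n f i =
     (case frob_rest n f (i - 1) of
        None \<Rightarrow> None
      | Some g \<Rightarrow> gcmd (ZMod n) (xpow n (n ^ i) \<ominus>\<^bsub>UP (ZMod n)\<^esub> xpow n 1) g)"

definition factorization_step :: "nat \<Rightarrow> int poly \<Rightarrow> bool" where
  "factorization_step n f \<longleftrightarrow>
     (\<forall>i\<in>{1..Polynomial.degree f}. frob_factor n f i \<noteq> None) \<and>
     frob_rest n f (Polynomial.degree f) = Some \<one>\<^bsub>UP (ZMod n)\<^esub>"

text \<open>\<open>F(x\<^sup>n)\<close>, as an element of \<open>(\<int>/n\<int>)[x]\<close>\<close>

definition subst_xpow :: "nat \<Rightarrow> (nat \<Rightarrow> int) \<Rightarrow> (nat \<Rightarrow> int)" where
  "subst_xpow n F =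
     UnivPoly.eval (ZMod n) (UP (ZMod n)) (\<lambda>a. up_ring.monom (UP (ZMod n)) a 0) (xpow n n) F"

definition frobenius_step :: "nat \<Rightarrow> int poly \<Rightarrow> bool" where
  "frobenius_step n f \<longleftrightarrow>
     (\<forall>i\<in>{2..Polynomial.degree f}.
        subst_xpow n (the (frob_factor n f i)) \<in> Idl\<^bsub>UP (ZMod n)\<^esub> {the (frob_factor n f i)})"

definition frob_cycles :: "nat \<Rightarrow> int poly \<Rightarrow> nat \<Rightarrow> rat" where
  "frob_cycles n f i = of_nat (deg (ZMod n) (the (frob_factor n f i))) / of_nat i"

text \<open>The quotients \<open>deg F\<^sub>i / i\<close> are not truncated; their sum \<open>S\<close> over even \<open>i\<close> has to be
  an integer for \<open>(-1)\<^sup>S\<close> to make sense, which the Frobenius step guarantees.\<close>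

definition jacobi_step :: "nat \<Rightarrow> int poly \<Rightarrow> bool" where
  "jacobi_step n f \<longleftrightarrow>
     (\<exists>S. of_nat S = (\<Sum>i | i \<in> {1..Polynomial.degree f} \<and> even i. frob_cycles n f i) \<and>
          (-1) ^ S = Jacobi (discriminant f) n)"

definition frobenius_pseudoprime :: "int poly \<Rightarrow> nat \<Rightarrow> bool" where
  "frobenius_pseudoprime f n \<longleftrightarrow>
     factorization_step n f \<and> frobenius_step n f \<and> jacobi_step n f"

text \<open>The cycle structure of \<open>(f, n)\<close> is the conjugacy class of the permutation \<open>\<sigma>\<close>
  of \<open>{1..d}\<close>, where \<open>d = deg f\<close>.\<close>

definition has_cycle_structure :: "int poly \<Rightarrow> nat \<Rightarrow> (nat \<Rightarrow> nat) \<Rightarrow> bool" where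
  "has_cycle_structure f n \<sigma> \<longleftrightarrow>
     (\<forall>i\<in>{1..Polynomial.degree f}.
        frob_cycles n f i = of_nat (cycle_type \<sigma> {1..Polynomial.degree f} i))"


section \<open>The \<open>p\<close>-adic numbers\<close>

text \<open>The field \<open>\<rat>\<^sub>p\<close> is the completion of \<open>\<rat>\<close>: the ring of Cauchy sequences for the
  \<open>p\<close>-adic absolute value modulo the ideal of null sequences.\<close>

definition padic_abs :: "nat \<Rightarrow> rat \<Rightarrow> real" where
  "padic_abs p x =
     (if x = 0 then 0
      else real p powi (int (multiplicity (int p) (snd (quotient_of x)))
                        - int (multiplicity (int p) (fst (quotient_of x)))))"

definition padic_cauchy :: "nat \<Rightarrow> (nat \<Rightarrow> rat) set" where
  "padic_cauchy p = {s. \<forall>e>0. \<exists>N. \<forall>i\<ge>N. \<forall>j\<ge>N. padic_abs p (s i - s j) < e}"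

definition padic_null :: "nat \<Rightarrow> (nat \<Rightarrow> rat) set" where
  "padic_null p = {s. (\<lambda>i. padic_abs p (s i)) \<longlonglongrightarrow> 0}"

definition padic_cauchy_ring :: "nat \<Rightarrow> (nat \<Rightarrow> rat) ring" where
  "padic_cauchy_ring p =
     \<lparr>carrier = padic_cauchy p,
      monoid.mult = (\<lambda>s t i. s i * t i),
      monoid.one = (\<lambda>_. 1),
      ring.zero = (\<lambda>_. 0),
      ring.add = (\<lambda>s t i. s i + t i)\<rparr>"

definition Qp :: "nat \<Rightarrow> (nat \<Rightarrow> rat) set ring" where
  "Qp p = padic_cauchy_ring p Quot padic_null p"

definition Zp :: "nat \<Rightarrow> (nat \<Rightarrow> rat) set set" where
  "Zp p = {padic_null p +>\<^bsub>padic_cauchy_ring p\<^esub> s | s.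
             s \<in> padic_cauchy p \<and> (\<forall>i. padic_abs p (s i) \<le> 1)}"

type_synonym padic_alg = "((nat \<Rightarrow> rat) set list \<times> nat) multiset \<Rightarrow> (nat \<Rightarrow> rat) set"

definition Qp_closure :: "nat \<Rightarrow> padic_alg ring" where
  "Qp_closure p = field.alg_closure (Qp p)"

text \<open>The library embeds a field in its algebraic closure by \<open>indexed_const\<close>; these are the
  images of \<open>\<rat>\<^sub>p\<close> and \<open>\<int>\<^sub>p\<close>.\<close>

definition Qp_emb :: "nat \<Rightarrow> padic_alg set" where
  "Qp_emb p = ring.indexed_const (Qp p) ` carrier (Qp p)"

definition Zp_emb :: "nat \<Rightarrow> padic_alg set" where
  "Zp_emb p = ring.indexed_const (Qp p) ` Zp p"


section \<open>The maximal unramified extension of \<open>\<rat>\<^sub>p\<close>\<close>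

definition integral_over :: "('a, 'm) ring_scheme \<Rightarrow> 'a set \<Rightarrow> 'a \<Rightarrow> bool" where
  "integral_over L A x \<longleftrightarrow>
     (\<exists>P \<in> carrier (A [X]\<^bsub>L\<^esub>). P \<noteq> [] \<and> Polynomials.lead_coeff P = \<one>\<^bsub>L\<^esub> \<and> ring.eval L P x = \<zero>\<^bsub>L\<^esub>)"

text \<open>The ring of integers of an algebraic extension \<open>E\<close> of \<open>\<rat>\<^sub>p\<close> inside the algebraic closure:
  the integral closure of \<open>\<int>\<^sub>p\<close> in \<open>E\<close>\<close>

definition integers_of :: "nat \<Rightarrow> padic_alg set \<Rightarrow> padic_alg ring" where
  "integers_of p E = Qp_closure p \<lparr>carrier := {x \<in> E. integral_over (Qp_closure p) (Zp_emb p) x}\<rparr>"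

text \<open>A finite extension \<open>E\<close> of \<open>\<rat>\<^sub>p\<close> is unramified if \<open>p\<close> generates the maximal ideal of its
  (local) ring of integers, i.e. if its ramification index is 1; its residue extension is always
  separable, as finite fields are perfect.\<close>

definition finite_unramified :: "nat \<Rightarrow> padic_alg set \<Rightarrow> bool" where
  "finite_unramified p E \<longleftrightarrow>
     subfield E (Qp_closure p) \<and> Qp_emb p \<subseteq> E \<and>
     ring.finite_dimension (Qp_closure p) (Qp_emb p) E \<and>
     maximalideal (PIdl\<^bsub>integers_of p E\<^esub> (add_pow (integers_of p E) p \<one>\<^bsub>integers_of p E\<^esub>))
       (integers_of p E)"

text \<open>The maximal unramified extension is the compositum of all finite unramified extensions.\<close>

definition Qp_ur :: "nat \<Rightarrow> padic_alg set" where
  "Qp_ur p = generate_field (Qp_closure p) (\<Union>{E. finite_unramified p E})"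

definition Zp_ur :: "nat \<Rightarrow> padic_alg ring" where
  "Zp_ur p = integers_of p (Qp_ur p)"

definition Zp_ur_mod :: "nat \<Rightarrow> nat \<Rightarrow> padic_alg set ring" where
  "Zp_ur_mod p r = Zp_ur p Quot (PIdl\<^bsub>Zp_ur p\<^esub> (add_pow (Zp_ur p) (p ^ r) \<one>\<^bsub>Zp_ur p\<^esub>))"


section \<open>Roots modulo \<open>p\<^sup>r\<close>\<close>

definition int_poly_eval :: "('a, 'm) ring_scheme \<Rightarrow> int poly \<Rightarrow> 'a \<Rightarrow> 'a" where
  "int_poly_eval R f x =
     (\<Oplus>\<^bsub>R\<^esub>i\<in>{..Polynomial.degree f}. add_pow R (Polynomial.coeff f i) (x [^]\<^bsub>R\<^esub> i))"

definition roots_mod :: "int poly \<Rightarrow> nat \<Rightarrow> nat \<Rightarrow> padic_alg set set" where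
  "roots_mod f p r =
     {\<alpha> \<in> carrier (Zp_ur_mod p r). int_poly_eval (Zp_ur_mod p r) f \<alpha> = \<zero>\<^bsub>Zp_ur_mod p r\<^esub>}"

definition power_map :: "nat \<Rightarrow> nat \<Rightarrow> nat \<Rightarrow> padic_alg set \<Rightarrow> padic_alg set" where
  "power_map n p r \<alpha> = \<alpha> [^]\<^bsub>Zp_ur_mod p r\<^esub> n"

end

theory Submission
  imports Defs
begin

text \<open>For \<open>p\<^sup>r \<parallel> n\<close>, all that matters about the ring \<open>R\<close> of integers of the maximal unramified
  extension modulo \<open>p\<^sup>r\<close> is that it is local, that exactly the multiples of \<open>p\<^sup>r\<close> vanish in it,
  and that \<open>f\<close> has \<open>d\<close> roots in it. The roots then differ by units, so a monic divisor of
  \<open>f\<close> modulo \<open>p\<^sup>r\<close> is determined by its roots. The greatest common monic divisor of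
  \<open>x\<^bsup>n^i\<^esup> - x\<close> and \<open>f\<^bsub>i-1\<^esub>\<close> corresponds to the roots whose orbit under \<open>\<alpha> \<mapsto> \<alpha>\<^sup>n\<close> has length \<open>i\<close>:
  it is found modulo \<open>p\<close>, lifted to \<open>p\<^sup>r\<close> by Nakayama's lemma, and glued over the prime powers by the
  Chinese remainder theorem. The Frobenius step makes \<open>\<alpha> \<mapsto> \<alpha>\<^sup>n\<close> map the roots of \<open>F\<^sub>i\<close> to
  themselves, and \<open>(-1)\<^sup>S\<close> is the sign of the resulting permutation.

  That \<open>R\<close> has these properties rests on two facts. An integral element lies in a finite
  \<open>\<int>\<^sub>p\<close>-algebra \<open>B\<close>; as \<open>B\<close> is complete and \<open>B/pB\<close> is finite, some power of every element is
  idempotent modulo \<open>p\<close>, and lifting this idempotent shows that the element is a unit or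
  nilpotent modulo \<open>p\<close>; hence integral closures are local. If \<open>\<alpha>\<close> is a root of \<open>f\<close>, then
  \<open>f'(\<alpha>)\<close> is a unit, which forces \<open>\<alpha>\<^bsup>p^m\<^esup> \<equiv> \<alpha>\<close> modulo \<open>p\<close> for some \<open>m > 0\<close>; so
  \<open>y\<^bsup>p^m\<^esup> \<equiv> y\<close> on \<open>\<int>\<^sub>p[\<alpha>]\<close>, nilpotents modulo \<open>p\<close> vanish, and \<open>\<rat>\<^sub>p(\<alpha>)\<close> is unramified.\<close>


section \<open>Integer polynomials modulo an integer\<close>

text \<open>Elements of \<open>(Z/n)[x]\<close> are represented by integer polynomials up to
  congruence: one and the same polynomial can be read modulo \<open>n\<close>, modulo each
  \<open>p^r\<close> and modulo \<open>p\<close>, evaluated at roots in any ring, and divided by a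
  monic polynomial once and for all over the integers. The obstacle is that degree and monicity are
  not invariant under congruence; hence every gcd and every cofactor is chosen as a monic integer
  polynomial. Modulo \<open>p^r\<close> there are zero divisors and a gcmd may fail to exist. Its
  degree is found by counting: the roots bound the degrees of a gcd modulo \<open>p\<close> and of
  its cofactor from below, and the two bounds add up to the degree of their product. In the other
  direction counting shows that each \<open>F_i\<close> has as many roots as its degree. The roots
  are first found in an algebraic closure of \<open>Q_p\<close>, where \<open>f\<close> splits, and
  then placed in the maximal unramified extension, because each root generates an unramified field.
  Locality holds for the integers of every subfield of the closure, so all that the compositum has
  to supply is a field containing the roots.\<close>

abbreviation pdeg :: "'a::zero poly \<Rightarrow> nat" where "pdeg \<equiv> Polynomial.degree"
abbreviation pcoeff :: "'a::zero poly \<Rightarrow> nat \<Rightarrow> 'a" where "pcoeff \<equiv> Polynomial.coeff"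
abbreviation pmonom :: "'a::zero \<Rightarrow> nat \<Rightarrow> 'a poly" where "pmonom \<equiv> Polynomial.monom"

definition pcong :: "int \<Rightarrow> int poly \<Rightarrow> int poly \<Rightarrow> bool" where
  "pcong m a b \<longleftrightarrow> [:m:] dvd a - b"

lemma pcong_coeff: "pcong m a b \<longleftrightarrow> (\<forall>i. pcoeff a i mod m = pcoeff b i mod m)"
  by (simp add: pcong_def const_poly_dvd_iff mod_eq_dvd_iff)

lemma pcong_witness: "pcong m a b \<longleftrightarrow> (\<exists>c. a = b + smult m c)"
proof
  assume "pcong m a b"
  then obtain c where "a - b = [:m:] * c" unfolding pcong_def dvd_def by blast
  then have "a = b + smult m c" by (simp add: algebra_simps)
  then show "\<exists>c. a = b + smult m c" ..
next
  assume "\<exists>c. a = b + smult m c"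
  then show "pcong m a b" by (auto simp: pcong_def dvd_def)
qed

lemma pcong_refl [simp]: "pcong m a a"
  by (simp add: pcong_def)

lemma pcong_sym: "pcong m a b \<Longrightarrow> pcong m b a"
  by (simp add: pcong_coeff)

lemma pcong_trans [trans]: "pcong m a b \<Longrightarrow> pcong m b c \<Longrightarrow> pcong m a c"
  by (simp add: pcong_coeff)

lemma pcong_add: "pcong m a b \<Longrightarrow> pcong m c d \<Longrightarrow> pcong m (a + c) (b + d)"
  unfolding pcong_def using dvd_add[of "[:m:]" "a - b" "c - d"] by (simp add: algebra_simps)

lemma pcong_diff: "pcong m a b \<Longrightarrow> pcong m c d \<Longrightarrow> pcong m (a - c) (b - d)"
  unfolding pcong_def using dvd_diff[of "[:m:]" "a - b" "c - d"] by (simp add: algebra_simps)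

lemma pcong_mult:
  assumes "pcong m a b" "pcong m c d" shows "pcong m (a * c) (b * d)"
proof -
  have "a * c - b * d = (a - b) * c + b * (c - d)" by (simp add: algebra_simps)
  then show ?thesis using assms unfolding pcong_def by (metis dvd_add dvd_mult dvd_mult2)
qed

lemma pcong_power: "pcong m a b \<Longrightarrow> pcong m (a ^ k) (b ^ k)"
  by (induction k) (auto intro: pcong_mult)

lemma pcong_mono: "pcong m a b \<Longrightarrow> k dvd m \<Longrightarrow> pcong k a b"
  by (auto simp: pcong_def const_poly_dvd_iff intro: dvd_trans)

lemma pcong_smult_self [simp]: "pcong m (smult m c) 0" "pcong m (a + smult m c) a"
  by (auto simp: pcong_coeff)

text \<open>The reduction of \<open>a\<close> modulo \<open>m\<close> may have smaller degree than
  \<open>a\<close>; \<open>N\<close> is the degree of the reduction.\<close>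

lemma not_pcong_0_top_coeff:
  assumes "\<not> pcong m a 0"
  shows "\<exists>N\<le>pdeg a. \<not> m dvd pcoeff a N \<and> (\<forall>j>N. m dvd pcoeff a j)"
proof -
  let ?S = "{i. \<not> m dvd pcoeff a i}"
  have sub: "?S \<subseteq> {..pdeg a}" by (metis (mono_tags, lifting) atMost_iff dvd_0_right le_degree mem_Collect_eq subsetI)
  have fin: "finite ?S" using sub finite_subset by blast
  have ne: "?S \<noteq> {}" using assms by (auto simp: pcong_def const_poly_dvd_iff)
  have M: "Max ?S \<in> ?S" by (rule Max_in[OF fin ne])
  have "m dvd pcoeff a j" if "j > Max ?S" for j
  proof (rule ccontr)
    assume "\<not> m dvd pcoeff a j"
    then have "j \<le> Max ?S" using Max_ge[OF fin, of j] by simp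
    then show False using that by simp
  qed
  moreover have "\<not> m dvd pcoeff a (Max ?S)" using M by simp
  moreover have "Max ?S \<le> pdeg a" using M sub by (meson atMost_iff subsetD)
  ultimately show ?thesis by blast
qed

lemma pcong_smult_power: "k \<le> j \<Longrightarrow> pcong (m ^ k) (smult (m ^ j) c) 0"
  by (metis pcong_mono le_imp_power_dvd pcong_smult_self(1))

text \<open>Pseudo-division multiplies the dividend by a power of the leading coefficient of
  \<open>h\<close>; for monic \<open>h\<close> this factor is 1, which leaves true division over the
  integers.\<close>

lemma monic_division:
  fixes h y :: "int poly"
  assumes "monic h"
  obtains q s where "y = h * q + s" "s = 0 \<or> pdeg s < pdeg h"
proof -
  have h: "h \<noteq> 0" using assms by auto
  obtain q s where qs: "pseudo_divmod y h = (q, s)" by fastforce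
  from pseudo_divmod[OF h qs] assms that show ?thesis by simp
qed

lemma degree_monic_mult: "monic g \<Longrightarrow> monic h \<Longrightarrow> pdeg (g * h) = pdeg g + pdeg h"
  for g h :: "int poly"
  by (rule degree_mult_eq) auto

lemma monic_quotient:
  fixes g h q :: "int poly"
  assumes "monic (h * q)" "monic h" shows "monic q"
  using assms by (metis lead_coeff_mult mult_1)

text \<open>The remainder modulo a monic polynomial vanishes modulo \<open>m\<close> as soon as division is exact
  modulo \<open>m\<close>, so an exact quotient modulo \<open>m\<close> is the quotient over the integers.\<close>

lemma monic_dvd_remainder:
  fixes h y q s :: "int poly"
  assumes h: "monic h" and m: "m > 1"
    and y: "pcong m y (h * k)" and d: "y = h * q + s" "s = 0 \<or> pdeg s < pdeg h"
  shows "pcong m s 0" and "pcong m k q"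
proof -
  have *: "pcong m k q"
  proof (rule ccontr)
    assume n: "\<not> pcong m k q"
    let ?c = "k - q"
    have "\<not> pcong m ?c 0" using n by (simp add: pcong_def)
    then obtain N where N: "\<not> m dvd pcoeff ?c N" and N': "\<forall>j>N. m dvd pcoeff ?c j"
      using not_pcong_0_top_coeff by blast
    have "pcong m (h * ?c) s"
    proof -
      have "h * ?c - s = h * k - y" by (simp add: d(1) algebra_simps)
      then show ?thesis using pcong_sym[OF y] by (simp add: pcong_def)
    qed
    then have e: "m dvd pcoeff (h * ?c) (pdeg h + N) - pcoeff s (pdeg h + N)"
      by (simp add: pcong_coeff mod_eq_dvd_iff)
    have s0: "pcoeff s (pdeg h + N) = 0" 
    proof (cases "s = 0")
      case False then show ?thesis using d(2) by (intro coeff_eq_0) simp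
    qed simp
    \<comment> \<open>Since \<open>h\<close> is monic, the coefficient of \<open>h * ?c\<close> in
      degree \<open>pdeg h + N\<close> is, modulo \<open>m\<close>, the coefficient of
      \<open>?c\<close> in degree \<open>N\<close>. The remainder \<open>s\<close> has coefficient 0
      there, against the choice of \<open>N\<close>.\<close>
    have "pcoeff (h * ?c) (pdeg h + N) = (\<Sum>i\<le>pdeg h + N. pcoeff h i * pcoeff ?c (pdeg h + N - i))"
      by (rule coeff_mult)
    also have "\<dots> = pcoeff h (pdeg h) * pcoeff ?c N + (\<Sum>i\<in>{..pdeg h + N} - {pdeg h}. pcoeff h i * pcoeff ?c (pdeg h + N - i))"
      by (subst sum.remove[of _ "pdeg h"]) auto
    finally have eq: "pcoeff (h * ?c) (pdeg h + N) = pcoeff ?c N + (\<Sum>i\<in>{..pdeg h + N} - {pdeg h}. pcoeff h i * pcoeff ?c (pdeg h + N - i))"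
      using h by simp
    have "m dvd (\<Sum>i\<in>{..pdeg h + N} - {pdeg h}. pcoeff h i * pcoeff ?c (pdeg h + N - i))"
    proof (rule dvd_sum)
      fix i assume i: "i \<in> {..pdeg h + N} - {pdeg h}"
      show "m dvd pcoeff h i * pcoeff ?c (pdeg h + N - i)"
      proof (cases "i < pdeg h")
        case True then show ?thesis using N' i by (auto intro!: dvd_mult)
      next
        case False then show ?thesis using i by (simp add: coeff_eq_0)
      qed
    qed
    with eq e s0 have "m dvd pcoeff ?c N" by (simp add: dvd_add_left_iff)
    with N show False by simp
  qed
  then show "pcong m k q" .
  have "pcong m (h * k) (h * q)" using * by (auto intro: pcong_mult)
  with y have "pcong m y (h * q)" by (rule pcong_trans)
  then show "pcong m s 0" using d(1) by (simp add: pcong_def)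
qed

section \<open>Chinese remainder theorem for integer polynomials\<close>

lemma crt_poly:
  fixes m :: "'a \<Rightarrow> nat" and c :: "'a \<Rightarrow> int poly"
  assumes fin: "finite P" and pos: "\<And>p. p \<in> P \<Longrightarrow> m p > 0"
    and cop: "\<And>p q. p \<in> P \<Longrightarrow> q \<in> P \<Longrightarrow> p \<noteq> q \<Longrightarrow> coprime (m p) (m q)"
  shows "\<exists>q. (\<forall>p\<in>P. pcong (int (m p)) q (c p)) \<and> (\<forall>i. (\<forall>p\<in>P. pcoeff (c p) i = 0) \<longrightarrow> pcoeff q i = 0)"
proof -
  have "\<exists>x. (\<forall>p\<in>P. x mod int (m p) = pcoeff (c p) i mod int (m p)) \<and> ((\<forall>p\<in>P. pcoeff (c p) i = 0) \<longrightarrow> x = 0)" for i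
  \<comment> \<open>A coefficient that is 0 in all \<open>c p\<close> is solved by 0 itself and not
    by some other common residue; this bounds the degree of the glued polynomial.\<close>
  proof (cases "\<forall>p\<in>P. pcoeff (c p) i = 0")
    case True then show ?thesis by (intro exI[of _ 0]) auto
  next
    case False
    have "\<exists>x. \<forall>p\<in>P. [x = nat (pcoeff (c p) i mod int (m p))] (mod m p)"
      by (rule Cong.chinese_remainder_nat[OF fin]) (use cop in blast)
    then obtain x where x: "\<forall>p\<in>P. [x = nat (pcoeff (c p) i mod int (m p))] (mod m p)" by blast
    have "int x mod int (m p) = pcoeff (c p) i mod int (m p)" if "p \<in> P" for p
    proof -
      have "[int x = int (nat (pcoeff (c p) i mod int (m p)))] (mod int (m p))"
        unfolding cong_int_iff using x that by blast
      then show ?thesis using pos[OF that] by (simp add: Cong.cong_def)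
    qed
    then show ?thesis using False by blast
  qed
  then obtain x where x: "\<And>i p. p \<in> P \<Longrightarrow> x i mod int (m p) = pcoeff (c p) i mod int (m p)"
    and x0: "\<And>i. \<forall>p\<in>P. pcoeff (c p) i = 0 \<Longrightarrow> x i = 0" by metis
  define N where "N = Suc (\<Sum>p\<in>P. pdeg (c p))"
  have x0': "x i = 0" if "i \<ge> N" for i
  proof (rule x0, safe)
    fix p assume p: "p \<in> P"
    have "pdeg (c p) \<le> (\<Sum>p\<in>P. pdeg (c p))" by (rule member_le_sum) (use p fin in auto)
    then show "pcoeff (c p) i = 0" using that by (auto simp: N_def intro!: coeff_eq_0)
  qed
  have cq: "pcoeff (Poly (map x [0..<N])) i = x i" for i
    using x0'[of i] by (auto simp: nth_default_def)
  show ?thesis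
    by (rule exI[of _ "Poly (map x [0..<N])"]) (use x x0 cq in \<open>auto simp: pcong_coeff simp del: coeff_Poly_eq\<close>)
qed

lemma prime_powers_dvd_imp_dvd:
  fixes x :: int and n :: nat
  assumes n: "n > 0" and *: "\<And>p. p \<in> prime_factors n \<Longrightarrow> int (p ^ multiplicity p n) dvd x"
  shows "int n dvd x"
proof (cases "x = 0")
  case False
  have "n dvd nat \<bar>x\<bar>"
  proof (rule multiplicity_le_imp_dvd)
    show "n \<noteq> 0" using n by simp
    fix p :: nat assume p: "Factorial_Ring.prime p"
    show "multiplicity p n \<le> multiplicity p (nat \<bar>x\<bar>)"
    proof (cases "p dvd n")
      case True
      then have "p \<in> prime_factors n" using p n by (auto simp: in_prime_factors_iff)
      then have "p ^ multiplicity p n dvd nat \<bar>x\<bar>" using * by (metis int_dvd_int_iff dvd_abs_iff int_nat_eq abs_ge_zero)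
      then show ?thesis using False p by (intro multiplicity_geI) (auto simp: prime_gt_1_nat)
    next
      case False then show ?thesis by (simp add: not_dvd_imp_multiplicity_0)
    qed
  qed
  then show ?thesis by (metis int_dvd_int_iff dvd_abs_iff int_nat_eq abs_ge_zero)
qed simp

lemma pcong_of_prime_powers:
  assumes "n > 0" "\<And>p. p \<in> prime_factors n \<Longrightarrow> pcong (int (p ^ multiplicity p n)) a b"
  shows "pcong (int n) a b"
  using assms prime_powers_dvd_imp_dvd[of n] unfolding pcong_def const_poly_dvd_iff by blast

lemma prime_inverse_mod:
  fixes c :: int
  assumes "Factorial_Ring.prime p" "\<not> p dvd c"
  obtains c' where "p dvd c' * c - 1"
proof -
  have "coprime p c" using assms by (simp add: prime_imp_coprime)
  then have "coprime c p" by (simp add: coprime_commute)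
  then obtain x where "[c * x = 1] (mod p)" using cong_solve_coprime_int by blast
  then show ?thesis by (intro that[of x]) (simp add: cong_iff_dvd_diff mult.commute)
qed

text \<open>A monic polynomial of least degree in the ideal generated by \<open>Y\<close>, \<open>g\<close> and \<open>p\<close> is a greatest
  common divisor of \<open>Y\<close> and \<open>g\<close> modulo \<open>p\<close>.\<close>

lemma gcd_mod_prime:
  fixes Y g :: "int poly" and p :: int
  assumes p: "Factorial_Ring.prime p" and g: "monic g"
  obtains h a b u w where "monic h" "monic w" "pdeg g = pdeg h + pdeg w"
    "pcong p h (a * Y + b * g)" "pcong p Y (h * u)" "pcong p g (h * w)"
proof -
  define I where "I y \<longleftrightarrow> (\<exists>a b. pcong p y (a * Y + b * g))" for y
  have I_diff: "I (y - c * z)" if "I y" "I z" for y z c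
  proof -
    from that obtain a b a' b' where "pcong p y (a * Y + b * g)" "pcong p z (a' * Y + b' * g)" unfolding I_def by blast
    then have "pcong p (y - c * z) (a * Y + b * g - c * (a' * Y + b' * g))" by (intro pcong_diff pcong_mult pcong_refl)
    then have "pcong p (y - c * z) ((a - c * a') * Y + (b - c * b') * g)" by (simp add: algebra_simps)
    then show ?thesis unfolding I_def by blast
  qed
  have Ig: "I g" unfolding I_def by (intro exI[of _ 0] exI[of _ 1]) simp
  have IX: "I Y" unfolding I_def by (intro exI[of _ 1] exI[of _ 0]) simp
  have I0: "I 0" unfolding I_def by (intro exI[of _ 0]) simp
  define k where "k = (LEAST k. \<exists>h. monic h \<and> I h \<and> pdeg h = k)"
  have "\<exists>h. monic h \<and> I h \<and> pdeg h = k" unfolding k_def by (rule LeastI[of _ "pdeg g"]) (use g Ig in blast)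
  then obtain h where h: "monic h" "I h" "pdeg h = k" by blast
  have least: "k \<le> pdeg h'" if "monic h'" "I h'" for h' unfolding k_def by (rule Least_le) (use that in blast)
  have small: "pcong p s 0" if s: "I s" "s = 0 \<or> pdeg s < k" for s
  proof (rule ccontr)
    assume n: "\<not> pcong p s 0"
    from n obtain N where N: "\<not> p dvd pcoeff s N" "N \<le> pdeg s" and N': "\<forall>j>N. p dvd pcoeff s j"
      using not_pcong_0_top_coeff by blast
    have Nk: "N < k" using N s(2) by auto
    obtain c where c: "p dvd c * pcoeff s N - 1" using prime_inverse_mod[OF p N(1)] by blast
    \<comment> \<open>\<open>poly_cutoff\<close> removes the coefficients from degree
      \<open>N\<close> on, and the monomial restores a leading coefficient that equals 1 and is not
      merely congruent to it. So \<open>t\<close> is monic of degree \<open>N < k\<close> and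
      congruent to a multiple of \<open>s\<close>, against the minimality of
      \<open>k\<close>.\<close>
    define t where "t = poly_cutoff N (smult c s) + pmonom 1 N"
    have tc: "pcoeff t i = (if i < N then c * pcoeff s i else if i = N then 1 else 0)" for i
      by (simp add: t_def coeff_poly_cutoff)
    have dt: "pdeg t = N" by (rule antisym) (auto simp: tc intro!: degree_le le_degree)
    have mt: "monic t" by (simp add: dt tc)
    have "pcong p t (smult c s)" unfolding pcong_def const_poly_dvd_iff
    proof safe
      fix i show "p dvd pcoeff (t - smult c s) i"
        using c N' by (cases i N rule: linorder_cases) (auto simp: tc dvd_diff_commute intro!: dvd_mult)
    qed
    moreover have "I (smult c s)" using I_diff[OF I0 s(1), of "- [:c:]"] by simp
    ultimately have "I t" unfolding I_def by (meson pcong_trans)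
    with least[OF mt] dt Nk show False by simp
  qed
  have div: "\<exists>q s. y = h * q + s \<and> pcong p s 0 \<and> (s = 0 \<or> pdeg s < k)" if y: "I y" for y
  proof -
    obtain q s where qs: "y = h * q + s" "s = 0 \<or> pdeg s < pdeg h" using monic_division[OF h(1)] by blast
    have "s = y - q * h" using qs by (simp add: algebra_simps)
    then have "I s" using I_diff[OF y h(2)] by simp
    with small[of s] qs h(3) show ?thesis by blast
  qed
  obtain u s where us: "Y = h * u + s" "pcong p s 0" using div[OF IX] by blast
  obtain w t where wt: "g = h * w + t" "pcong p t 0" "t = 0 \<or> pdeg t < k" using div[OF Ig] by blast
  have "h \<noteq> 0" using h(1) by auto
  \<comment> \<open>With \<open>w = 0\<close> the monic \<open>g\<close> itself would be a remainder
    of degree below the minimum \<open>k\<close>.\<close>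
  have "w \<noteq> 0"
  proof
    assume "w = 0" then have "g = t" using wt by simp
    then show False using wt(3) least[OF g Ig] g by auto
  qed
  have dw: "pdeg (h * w) = pdeg h + pdeg w" using \<open>h \<noteq> 0\<close> \<open>w \<noteq> 0\<close> by (rule degree_mult_eq)
  have lt: "t = 0 \<or> pdeg t < pdeg (h * w)" using wt(3) h(3) dw by linarith
  have dg: "pdeg g = pdeg h + pdeg w" using lt dw wt(1) by (metis add.right_neutral degree_add_eq_left)
  have "pcoeff g (pdeg g) = pcoeff (h * w) (pdeg (h * w))"
    using lt dw dg wt(1) by (auto simp: coeff_eq_0)
  then have "monic w" using g h(1) by (metis lead_coeff_mult mult_1)
  obtain a b where "pcong p h (a * Y + b * g)" using h(2) unfolding I_def by blast
  moreover have "pcong p Y (h * u)" using us by (simp add: pcong_def)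
  moreover have "pcong p g (h * w)" using wt by (simp add: pcong_def)
  ultimately show ?thesis using that h(1) \<open>monic w\<close> dg by blast
qed

text \<open>Nakayama's lemma for the ideal generated by \<open>Y\<close> and \<open>g\<close> modulo \<open>p\<^bsup>r+1\<^esup>\<close>.\<close>

lemma monic_in_ideal_lift:
  fixes Y g h :: "int poly" and p :: int
  assumes h: "monic h" "pcong p h (a * Y + b * g)"
  shows "\<exists>h' a b. monic h' \<and> pdeg h' = pdeg h \<and> pcong (p ^ Suc r) h' (a * Y + b * g)"
proof (induction r)
  case 0 then show ?case using h by auto
next
  case (Suc r)
  then obtain h' a b where h': "monic h'" "pdeg h' = pdeg h" "pcong (p ^ Suc r) h' (a * Y + b * g)" by blast
  from h'(3) obtain w where w: "h' = a * Y + b * g + smult (p ^ Suc r) w" unfolding pcong_witness by blast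
  obtain q s where qs: "w = h' * q + s" "s = 0 \<or> pdeg s < pdeg h'" using monic_division[OF h'(1)] by blast
  \<comment> \<open>The error \<open>w\<close> is divided by \<open>h'\<close>. Its remainder has
    smaller degree and can be subtracted from \<open>h'\<close> without touching the leading term;
    the multiple of \<open>h'\<close> is absorbed into the factor \<open>e\<close> of the
    combination. The new error carries the square of \<open>p ^ Suc r\<close>.\<close>
  define t where "t = h' - smult (p ^ Suc r) s"
  define e where "e = 1 + smult (p ^ Suc r) q"
  have ct: "pcoeff t i = pcoeff h' i" if "i \<ge> pdeg h'" for i
    using qs(2) that unfolding t_def by (auto simp: coeff_eq_0)
  have dt: "pdeg t = pdeg h'"
  proof (rule antisym)
    show "pdeg t \<le> pdeg h'" by (rule degree_le) (use ct in \<open>auto simp: coeff_eq_0\<close>)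
    show "pdeg h' \<le> pdeg t" by (rule le_degree) (use ct h'(1) in auto)
  qed
  have mt: "monic t" using ct dt h'(1) by simp
  have "t = a * Y + b * g + smult (p ^ Suc r) (h' * q)"
    unfolding t_def using w qs(1) by (simp add: smult_add_right algebra_simps)
  also have "smult (p ^ Suc r) (h' * q) = smult (p ^ Suc r) ((a * Y + b * g) * q) + smult (p ^ (Suc r + Suc r)) (w * q)"
    using arg_cong[OF w, of "\<lambda>z. smult (p ^ Suc r) (z * q)"]
    by (simp only: distrib_right smult_add_right mult_smult_left smult_smult power_add)
  also have "a * Y + b * g + (smult (p ^ Suc r) ((a * Y + b * g) * q) + smult (p ^ (Suc r + Suc r)) (w * q))
     = (e * a) * Y + (e * b) * g + smult (p ^ (Suc r + Suc r)) (w * q)"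
    unfolding e_def by (simp add: algebra_simps smult_add_right)
  finally have tt: "t = (e * a) * Y + (e * b) * g + smult (p ^ (Suc r + Suc r)) (w * q)" .
  have "pcong (p ^ Suc (Suc r)) ((e * a) * Y + (e * b) * g + smult (p ^ (Suc r + Suc r)) (w * q)) ((e * a) * Y + (e * b) * g + 0)"
    by (intro pcong_add pcong_refl pcong_smult_power) simp
  then have "pcong (p ^ Suc (Suc r)) t ((e * a) * Y + (e * b) * g)" unfolding tt by simp
  then show ?case using mt dt h'(2) by metis
qed

section \<open>The Frobenius congruence for polynomials modulo a prime\<close>

lemma binomial_prime_pcong:
  fixes a b :: "int poly" and p :: nat
  assumes p: "Factorial_Ring.prime p"
  shows "pcong (int p) ((a + b) ^ p) (a ^ p + b ^ p)"
proof -
  have p0: "p > 0" using p prime_gt_0_nat by blast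
  have *: "[:int p:] dvd of_nat (p choose k) * a ^ k * b ^ (p - k)" if "0 < k" "k < p" for k
  proof -
    have "p dvd (p choose k)" using that p by (intro dvd_choose_prime) auto
    then obtain c where "p choose k = p * c" by (auto simp: dvd_def)
    then have "(of_nat (p choose k) :: int poly) = [:int p:] * of_nat c" by (simp add: of_nat_poly)
    then show ?thesis by (metis dvd_triv_left mult.assoc)
  qed
  have "(a + b) ^ p = (\<Sum>k\<le>p. of_nat (p choose k) * a ^ k * b ^ (p - k))" by (rule binomial_ring)
  also have "{..p} = insert 0 (insert p {0<..<p})" using p0 by auto
  also have "(\<Sum>k\<in>insert 0 (insert p {0<..<p}). of_nat (p choose k) * a ^ k * b ^ (p - k)) = b ^ p + (a ^ p + (\<Sum>k\<in>{0<..<p}. of_nat (p choose k) * a ^ k * b ^ (p - k)))"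
    using p0 by simp
  finally have "(a + b) ^ p - (a ^ p + b ^ p) = (\<Sum>k\<in>{0<..<p}. of_nat (p choose k) * a ^ k * b ^ (p - k))" by simp
  then show ?thesis unfolding pcong_def using * by (auto intro!: dvd_sum)
qed

lemma fermat_int:
  fixes p :: nat and c :: int
  assumes p: "Factorial_Ring.prime p" shows "int p dvd c ^ p - c"
proof -
  have n: "int p dvd int k ^ p - int k" for k :: nat
  proof (induction k)
    case 0 then show ?case using prime_gt_0_nat[OF p] by (simp add: zero_power)
  next
    case (Suc k)
    \<comment> \<open>The induction step is the binomial congruence for the constant polynomials
      \<open>[:k:]\<close> and 1, read off at the constant coefficient.\<close>
    from binomial_prime_pcong[OF p, of "[:int k:]" 1]
    have "int p dvd pcoeff (([:int k:] + 1) ^ p - ([:int k:] ^ p + 1 ^ p)) 0" unfolding pcong_def const_poly_dvd_iff by blast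
    then have "int p dvd (int k + 1) ^ p - (int k ^ p + 1)" by (simp add: coeff_0_power)
    then have "int p dvd ((int k + 1) ^ p - (int k ^ p + 1)) + (int k ^ p - int k)" using Suc by (rule dvd_add)
    then show ?case by (simp add: algebra_simps)
  qed
  define k where "k = nat (c mod int p)"
  have k: "int k = c mod int p" using prime_gt_0_nat[OF p] by (simp add: k_def)
  have "[int k = c] (mod int p)" by (simp add: k Cong.cong_def)
  then have "[int k ^ p - int k = c ^ p - c] (mod int p)" by (intro cong_diff cong_pow)
  then show ?thesis using n[of k] cong_dvd_iff by blast
qed

lemma power_prime_pcong:
  fixes g :: "int poly" and p :: nat
  assumes p: "Factorial_Ring.prime p"
  shows "pcong (int p) (g ^ p) (pcompose g (pmonom 1 p))"
proof (induction g)
  case 0 then show ?case using prime_gt_0_nat[OF p] by (simp add: zero_power)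
next
  case (pCons c g)
  have "pCons c g = [:c:] + pmonom 1 1 * g" by (simp add: monom_altdef)
  then have "pcong (int p) (pCons c g ^ p) ([:c:] ^ p + (pmonom 1 1 * g) ^ p)" using binomial_prime_pcong[OF p] by metis
  also have "pcong (int p) ([:c:] ^ p + (pmonom 1 1 * g) ^ p) ([:c:] + pmonom 1 p * pcompose g (pmonom 1 p))"
  proof (rule pcong_add)
    show "pcong (int p) ([:c:] ^ p) [:c:]" using fermat_int[OF p, of c]
      by (simp add: pcong_def poly_const_pow)
    have "(pmonom 1 1 * g) ^ p = pmonom 1 p * g ^ p" by (simp add: power_mult_distrib monom_power)
    then show "pcong (int p) ((pmonom 1 1 * g) ^ p) (pmonom 1 p * pcompose g (pmonom 1 p))" using pCons.IH by (simp add: pcong_mult)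
  qed
  finally show ?case by (simp add: pcompose_pCons)
qed

text \<open>The \<open>p^k\<close>-th power of a value moves the exponent onto the argument. Thus
  the Frobenius map modulo \<open>p\<close> is controlled on a whole ring generated by one element
  once it is known on the generator.\<close>

lemma power_prime_power_pcong:
  fixes g :: "int poly" and p k :: nat
  assumes p: "Factorial_Ring.prime p"
  shows "pcong (int p) (g ^ (p ^ k)) (pcompose g (pmonom 1 (p ^ k)))"
proof (induction k)
  case 0
  have "pcompose g (pmonom 1 1) = g" by (metis monom_altdef mult_1 pcompose_idR power_one_right smult_1_left)
  then show ?case by simp
next
  case (Suc k)
  have "g ^ (p ^ Suc k) = (g ^ (p ^ k)) ^ p" by (simp flip: power_mult add: mult.commute)
  also have "pcong (int p) \<dots> (pcompose g (pmonom 1 (p ^ k)) ^ p)" using Suc by (rule pcong_power)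
  also have "pcong (int p) \<dots> (pcompose (pcompose g (pmonom 1 (p ^ k))) (pmonom 1 p))" by (rule power_prime_pcong[OF p])
  also have "pcompose (pcompose g (pmonom 1 (p ^ k))) (pmonom 1 p) = pcompose g (pcompose (pmonom 1 (p ^ k)) (pmonom 1 p))"
    by (simp add: pcompose_assoc)
  also have "pcompose (pmonom 1 (p ^ k)) (pmonom 1 p) = (pmonom 1 (p ^ Suc k) :: int poly)"
    by (simp add: monom_altdef[of _ "p ^ k"] pcompose_hom.hom_power pcompose_pCons monom_power mult.commute)
  finally show ?case .
qed

text \<open>Row \<open>i\<close> of the Sylvester matrix, read as a polynomial, is a monomial times
  \<open>f\<close> or times \<open>g\<close>. The last row of the adjugate combines the rows to
  \<open>(0, ..., 0, Res)\<close>, so the same combination of the polynomials is the constant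
  \<open>Res\<close>.\<close>

lemma resultant_bezout:
  fixes f g :: "int poly"
  assumes d: "pdeg f > 0"
  shows "\<exists>u v. u * f + v * g = [:resultant f g:]"
proof -
  define m k where "m = pdeg f" and "k = pdeg g"
  define N where "N = m + k"
  define S where "S = sylvester_mat f g"
  define A where "A = adj_mat S"
  have S: "S \<in> carrier_mat N N" unfolding S_def N_def m_def k_def by (rule sylvester_carrier_mat)
  have A: "A \<in> carrier_mat N N" and AS: "A * S = Determinant.det S \<cdot>\<^sub>m 1\<^sub>m N" using adj_mat[OF S] by (auto simp: A_def)
  have N0: "N - 1 < N" using d by (simp add: N_def m_def)
  \<comment> \<open>Column \<open>j\<close> stands for the power \<open>N - 1 - j\<close>: the first
    \<open>k\<close> rows are the shifts of \<open>f\<close>, the remaining \<open>m\<close> rows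
    are those of \<open>g\<close>.\<close>
  have row: "(\<Sum>j<N. pmonom (S $$ (i, j)) (N - 1 - j)) = (if i < k then pmonom 1 (k - 1 - i) * f else pmonom 1 (N - 1 - i) * g)"
    if i: "i < N" for i
  proof (rule poly_eqI)
    fix t
    have "pcoeff (\<Sum>j<N. pmonom (S $$ (i, j)) (N - 1 - j)) t = (\<Sum>j<N. if N - 1 - j = t then S $$ (i, j) else 0)"
      by (simp add: coeff_sum)
    also have "\<dots> = (if t < N then S $$ (i, N - 1 - t) else 0)"
    proof (cases "t < N")
      case True
      have "(\<Sum>j<N. if N - 1 - j = t then S $$ (i, j) else 0) = (\<Sum>j<N. if j = N - 1 - t then S $$ (i, j) else 0)"
        using True by (intro sum.cong) auto
      then show ?thesis using True by (simp add: sum.delta)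
    next
      case False then show ?thesis by (auto intro!: sum.neutral)
    qed
    also have "\<dots> = pcoeff (if i < k then pmonom 1 (k - 1 - i) * f else pmonom 1 (N - 1 - i) * g) t"
    proof (cases "t < N")
      case True
      have "S $$ (i, N - 1 - t) = (if i < k then if i \<le> N - 1 - t \<and> N - 1 - t - i \<le> m then pcoeff f (m + i - (N - 1 - t)) else 0
         else if i - k \<le> N - 1 - t \<and> N - 1 - t \<le> i then pcoeff g (i - (N - 1 - t)) else 0)"
        unfolding S_def m_def k_def using i True by (intro sylvester_index_mat) (auto simp: N_def m_def k_def)
      also have "\<dots> = pcoeff (if i < k then pmonom 1 (k - 1 - i) * f else pmonom 1 (N - 1 - i) * g) t"
      proof (cases "i < k")
        case ik: True
        have 1: "m + i - (N - 1 - t) = t - (k - 1 - i)" if "k - 1 - i \<le> t" using that ik True by (simp add: N_def)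
        have 2: "N - 1 - t - i \<le> m \<longleftrightarrow> k - 1 - i \<le> t" using ik True by (auto simp: N_def)
        have 3: "pcoeff f (t - (k - 1 - i)) = 0" if "\<not> i \<le> N - 1 - t"
          by (rule coeff_eq_0) (use that ik True in \<open>simp add: N_def m_def\<close>)
        show ?thesis using ik 1 2 3 by (auto simp: coeff_monom_mult)
      next
        case ik: False
        have 1: "i - (N - 1 - t) = t - (N - 1 - i)" if "N - 1 - i \<le> t" using that True i by simp
        have 2: "N - 1 - t \<le> i \<longleftrightarrow> N - 1 - i \<le> t" using True i by auto
        have 3: "pcoeff g (t - (N - 1 - i)) = 0" if "\<not> i - k \<le> N - 1 - t"
          by (rule coeff_eq_0) (use that ik True i in \<open>simp add: N_def k_def\<close>)
        show ?thesis using ik 1 2 3 by (auto simp: coeff_monom_mult)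
      qed
      finally show ?thesis using True by simp
    next
      case False
      have "pcoeff f (t - (k - 1 - i)) = 0" if "i < k"
        by (rule coeff_eq_0) (use that False i in \<open>simp add: N_def m_def\<close>)
      moreover have "pcoeff g (t - (N - 1 - i)) = 0" if "\<not> i < k"
        by (rule coeff_eq_0) (use that False i in \<open>simp add: N_def k_def\<close>)
      ultimately show ?thesis using False by (auto simp: coeff_monom_mult)
    qed
    finally show "pcoeff (\<Sum>j<N. pmonom (S $$ (i, j)) (N - 1 - j)) t = \<dots>" .
  qed
  have ent: "(\<Sum>i<N. A $$ (N - 1, i) * S $$ (i, j)) = (if j = N - 1 then resultant f g else 0)" if j: "j < N" for j
  proof -
    have "(A * S) $$ (N - 1, j) = (\<Sum>i<N. A $$ (N - 1, i) * S $$ (i, j))"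
      using A S j N0 by (auto simp: scalar_prod_def lessThan_atLeast0 intro!: sum.cong)
    moreover have "(A * S) $$ (N - 1, j) = (if j = N - 1 then resultant f g else 0)"
      unfolding AS using j N0 by (auto simp: resultant_def S_def)
    ultimately show ?thesis by simp
  qed
  have "[:resultant f g:] = (\<Sum>j<N. if j = N - 1 then pmonom (resultant f g) (N - 1 - j) else 0)"
    using N0 by (simp add: sum.delta monom_0)
  also have "\<dots> = (\<Sum>j<N. pmonom (\<Sum>i<N. A $$ (N - 1, i) * S $$ (i, j)) (N - 1 - j))"
    by (rule sum.cong) (use ent in auto)
  also have "\<dots> = (\<Sum>j<N. \<Sum>i<N. smult (A $$ (N - 1, i)) (pmonom (S $$ (i, j)) (N - 1 - j)))"
    by (simp add: smult_monom monom_hom.hom_sum)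
  also have "\<dots> = (\<Sum>i<N. smult (A $$ (N - 1, i)) (\<Sum>j<N. pmonom (S $$ (i, j)) (N - 1 - j)))"
    by (subst sum.swap) (simp add: smult_sum2)
  also have "\<dots> = (\<Sum>i<N. (if i < k then smult (A $$ (N - 1, i)) (pmonom 1 (k - 1 - i)) else 0) * f
      + (if i < k then 0 else smult (A $$ (N - 1, i)) (pmonom 1 (N - 1 - i))) * g)"
  proof (rule sum.cong[OF refl])
    fix i assume "i \<in> {..<N}"
    then have "i < N" by simp
    show "smult (A $$ (N - 1, i)) (\<Sum>j<N. pmonom (S $$ (i, j)) (N - 1 - j))
      = (if i < k then smult (A $$ (N - 1, i)) (pmonom 1 (k - 1 - i)) else 0) * f
      + (if i < k then 0 else smult (A $$ (N - 1, i)) (pmonom 1 (N - 1 - i))) * g"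
      unfolding row[OF \<open>i < N\<close>] by simp
  qed
  finally have "[:resultant f g:] = (\<Sum>i<N. if i < k then smult (A $$ (N - 1, i)) (pmonom 1 (k - 1 - i)) else 0) * f
      + (\<Sum>i<N. if i < k then 0 else smult (A $$ (N - 1, i)) (pmonom 1 (N - 1 - i))) * g"
    by (simp only: sum.distrib sum_distrib_right)
  then show ?thesis by (intro exI) (rule sym)
qed

section \<open>Cycle types and signs\<close>

lemma funpow_add_apply: "(f ^^ a) ((f ^^ b) x) = (f ^^ (a + b)) x"
  by (simp add: funpow_add)

lemma card_orbit_eq_period:
  assumes "(f ^^ m) x = x" "m > 0" "\<And>j. 0 < j \<Longrightarrow> j < m \<Longrightarrow> (f ^^ j) x \<noteq> x"
  shows "card (orbit f x) = m"
proof -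
  have o: "orbit f x = (\<lambda>k. (f ^^ k) x) ` {..<m}"
    using orbit_altdef_bounded[OF assms(1,2)] by auto
  \<comment> \<open>A coincidence at \<open>a < b\<close> lets \<open>x\<close> return after
    \<open>m - b + a\<close> steps, which is positive and less than \<open>m\<close>.\<close>
  have *: False if ab: "a < b" "b < m" "(f ^^ a) x = (f ^^ b) x" for a b
  proof -
    have "(f ^^ (m - b + a)) x = (f ^^ (m - b)) ((f ^^ b) x)" using ab(3) by (simp add: funpow_add)
    also have "\<dots> = (f ^^ m) x" using ab(2) by (simp add: funpow_add_apply)
    finally have "(f ^^ (m - b + a)) x = x" using assms(1) by simp
    moreover have "0 < m - b + a" "m - b + a < m" using ab by auto
    ultimately show False using assms(3)[of "m - b + a"] by simp
  qed
  have "inj_on (\<lambda>k. (f ^^ k) x) {..<m}"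
  proof (rule inj_onI)
    fix a b assume ab: "a \<in> {..<m}" "b \<in> {..<m}" "(f ^^ a) x = (f ^^ b) x"
    show "a = b" using *[of a b] *[of b a] ab by (cases a b rule: linorder_cases) auto
  qed
  then show ?thesis unfolding o by (simp add: card_image)
qed

lemma funpow_in_set: "f ` A \<subseteq> A \<Longrightarrow> x \<in> A \<Longrightarrow> (f ^^ k) x \<in> A"
  by (induction k) auto

lemma funpow_in_orbitI: "k > 0 \<Longrightarrow> (f ^^ k) x \<in> orbit f x"
  by (auto simp: orbit_altdef)

lemma orbit_subset_invariant: "f ` A \<subseteq> A \<Longrightarrow> x \<in> A \<Longrightarrow> orbit f x \<subseteq> A"
  by (auto simp: orbit_altdef intro: funpow_in_set)

context
  fixes f :: "'a \<Rightarrow> 'a" and A :: "'a set"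
  assumes bij: "bij_betw f A A" and fin: "finite A"
begin

lemma funpow_inj_on: "inj_on (f ^^ k) A"
proof (induction k)
  case (Suc k)
  have "(f ^^ k) ` A \<subseteq> A" using bij funpow_in_set[of f A] by (auto simp: bij_betw_def)
  then have "inj_on f ((f ^^ k) ` A)" using bij by (meson bij_betw_def inj_on_subset)
  then show ?case using Suc using comp_inj_on by (simp only: funpow.simps)
qed auto

lemma image_subset: "f ` A \<subseteq> A"
  using bij by (auto simp: bij_betw_def)

lemma period_exists:
  assumes x: "x \<in> A" obtains m where "m > 0" "(f ^^ m) x = x"
proof -
  have "\<not> inj (\<lambda>k. (f ^^ k) x)"
  proof
    assume "inj (\<lambda>k. (f ^^ k) x)"
    moreover have "range (\<lambda>k. (f ^^ k) x) \<subseteq> A" using funpow_in_set[OF image_subset x] by blast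
    ultimately show False using fin by (meson finite_subset finite_imageD infinite_UNIV_nat)
  qed
  then obtain a b where ab: "a < b" "(f ^^ a) x = (f ^^ b) x"
    by (metis injI linorder_neqE_nat)
  have "(f ^^ a) ((f ^^ (b - a)) x) = (f ^^ a) x" using ab by (simp add: funpow_add_apply)
  then have "(f ^^ (b - a)) x = x"
    using funpow_inj_on[of a] x funpow_in_set[OF image_subset x] by (metis inj_onD)
  then show ?thesis using that ab by (metis zero_less_diff)
qed

lemma card_orbit_period:
  assumes x: "x \<in> A"
  shows "card (orbit f x) > 0" "(f ^^ card (orbit f x)) x = x"
    "\<And>j. 0 < j \<Longrightarrow> j < card (orbit f x) \<Longrightarrow> (f ^^ j) x \<noteq> x"
proof -
  define m where "m = (LEAST m. 0 < m \<and> (f ^^ m) x = x)"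
  have "\<exists>m. 0 < m \<and> (f ^^ m) x = x" using period_exists[OF x] by blast
  then have m: "0 < m \<and> (f ^^ m) x = x" unfolding m_def by (rule LeastI_ex)
  have l: "(f ^^ j) x \<noteq> x" if "0 < j" "j < m" for j
    using that not_less_Least[of j "\<lambda>m. 0 < m \<and> (f ^^ m) x = x"] unfolding m_def by blast
  have c: "card (orbit f x) = m" by (rule card_orbit_eq_period) (use m l in auto)
  show "card (orbit f x) > 0" "(f ^^ card (orbit f x)) x = x"
    "\<And>j. 0 < j \<Longrightarrow> j < card (orbit f x) \<Longrightarrow> (f ^^ j) x \<noteq> x" unfolding c using m l by auto
qed

lemma self_in_orbit: "x \<in> A \<Longrightarrow> x \<in> orbit f x"
  using card_orbit_period(1,2)[of x] funpow_in_orbitI[of "card (orbit f x)" f x] by simp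

lemma orbit_eq:
  assumes x: "x \<in> A" and y: "y \<in> orbit f x" shows "orbit f y = orbit f x"
proof -
  let ?m = "card (orbit f x)"
  have "y \<in> {(f ^^ k) x | k. k < ?m}"
    using orbit_altdef_bounded[OF card_orbit_period(2,1)[OF x]] y by simp
  then obtain k where k: "k < ?m" "y = (f ^^ k) x" by blast
  have "(f ^^ (?m - k)) y = (f ^^ ?m) x" using k by (simp add: funpow_add_apply)
  also have "\<dots> = x" by (rule card_orbit_period(2)[OF x])
  finally have "x \<in> orbit f y" using funpow_in_orbitI[of "?m - k" f y] k(1) by simp
  then show ?thesis using y by (auto intro: orbit_trans)
qed

lemma card_orbit_le: "x \<in> A \<Longrightarrow> card (orbit f x) \<le> card A"
  by (rule card_mono[OF fin orbit_subset_invariant[OF image_subset]])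

text \<open>The points on cycles of length \<open>i\<close> are what polynomials can count: their
  number becomes the degree of the factor \<open>F_i\<close>, and division by \<open>i\<close>
  recovers the number of cycles.\<close>

lemma card_points_orbit_size: "card {x \<in> A. card (orbit f x) = i} = i * cycle_type f A i"
proof -
  let ?C = "{C \<in> orbit f ` A. card C = i}"
  have U: "\<Union>?C = {x \<in> A. card (orbit f x) = i}"
  proof safe
    fix x y assume y: "y \<in> A" "x \<in> orbit f y" "i = card (orbit f y)"
    then show "x \<in> A" using orbit_subset_invariant[OF image_subset y(1)] by blast
    show "card (orbit f x) = card (orbit f y)" using orbit_eq[OF y(1,2)] by simp
  next
    fix x assume x: "x \<in> A" "i = card (orbit f x)"
    then show "x \<in> \<Union>{C \<in> orbit f ` A. card C = card (orbit f x)}" using self_in_orbit[OF x(1)] by blast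
  qed
  have "i * card ?C = card (\<Union>?C)"
  proof (rule card_partition)
    show "finite ?C" using fin by simp
    show "finite (\<Union>?C)" unfolding U using fin by simp
    show "\<And>c. c \<in> ?C \<Longrightarrow> card c = i" by simp
    fix c1 c2 assume c: "c1 \<in> ?C" "c2 \<in> ?C" "c1 \<noteq> c2"
    then obtain x1 x2 where x: "x1 \<in> A" "c1 = orbit f x1" "x2 \<in> A" "c2 = orbit f x2" by blast
    show "c1 \<inter> c2 = {}"
    proof (rule ccontr)
      assume "c1 \<inter> c2 \<noteq> {}"
      then obtain y where "y \<in> orbit f x1" "y \<in> orbit f x2" using x by blast
      then show False using orbit_eq[OF x(1), of y] orbit_eq[OF x(3), of y] c(3) x by simp
    qed
  qed
  then show ?thesis unfolding U by (simp add: cycle_type_def)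
qed

text \<open>Cycle types are functions on all natural numbers, while the factors \<open>F_i\<close>
  only reach the range from 1 to the number of points; this settles the remaining arguments.\<close>

lemma cycle_type_outside:
  assumes "i = 0 \<or> i > card A" shows "cycle_type f A i = 0"
proof -
  have "card (orbit f x) \<noteq> i" if "x \<in> A" for x
    using card_orbit_period(1)[OF that] card_orbit_le[OF that] assms by linarith
  then have "{C \<in> orbit f ` A. card C = i} = {}" by blast
  then show ?thesis by (simp only: cycle_type_def card.empty)
qed

lemma sum_cycle_type: "(\<Sum>i\<in>{1..card A}. i * cycle_type f A i) = card A"
proof -
  have "A = (\<Union>i\<in>{1..card A}. {x \<in> A. card (orbit f x) = i})"
    using card_orbit_period(1) card_orbit_le by (auto simp: Suc_le_eq)
  then have "card A = card (\<Union>i\<in>{1..card A}. {x \<in> A. card (orbit f x) = i})" by simp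
  also have "\<dots> = (\<Sum>i\<in>{1..card A}. card {x \<in> A. card (orbit f x) = i})"
    by (rule card_UN_disjoint) (use fin in auto)
  also have "\<dots> = (\<Sum>i\<in>{1..card A}. i * cycle_type f A i)" by (simp add: card_points_orbit_size)
  finally show ?thesis by simp
qed

lemma sum_even_cycle_type:
  "(\<Sum>i | i \<in> {1..card A} \<and> even i. cycle_type f A i) = card {C \<in> orbit f ` A. even (card C)}"
proof -
  have "{C \<in> orbit f ` A. even (card C)} = (\<Union>i\<in>{i \<in> {1..card A}. even i}. {C \<in> orbit f ` A. card C = i})"
    using card_orbit_period(1) card_orbit_le by (auto simp: Suc_le_eq)
  then have "card {C \<in> orbit f ` A. even (card C)} = card (\<Union>i\<in>{i \<in> {1..card A}. even i}. {C \<in> orbit f ` A. card C = i})" by simp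
  also have "\<dots> = (\<Sum>i\<in>{i \<in> {1..card A}. even i}. card {C \<in> orbit f ` A. card C = i})"
    by (rule card_UN_disjoint) (use fin in auto)
  finally show ?thesis by (simp add: cycle_type_def)
qed

end

lemma sign_cycle_of_list: "distinct cs \<Longrightarrow> sign (cycle_of_list cs) = (-1) ^ (length cs - 1)"
proof (induction cs rule: cycle_of_list.induct)
  case (1 i j cs)
  have "sign (cycle_of_list (i # j # cs)) = sign (Transposition.transpose i j) * sign (cycle_of_list (j # cs))"
    unfolding cycle_of_list.simps by (rule sign_compose[OF permutation_swap_id permutation_of_cycle])
  also have "sign (Transposition.transpose i j) = (-1 :: int)" using 1(2) by (simp add: sign_swap_id)
  also have "sign (cycle_of_list (j # cs)) = (-1) ^ (length (j # cs) - 1)" using 1 by simp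
  finally show ?case by simp
qed (simp_all add: sign_id)

lemma orbit_cycle_of_list:
  assumes cs: "distinct cs" and x: "x \<in> set cs"
  shows "orbit (cycle_of_list cs) x = set cs"
proof
  let ?f = "cycle_of_list cs"
  have p: "?f permutes set cs" by (rule cycle_permutes)
  show "orbit ?f x \<subseteq> set cs" by (rule orbit_subset_invariant[OF _ x]) (use p in \<open>auto simp: permutes_image\<close>)
  show "set cs \<subseteq> orbit ?f x"
  proof
    fix y assume "y \<in> set cs"
    then obtain j where j: "j < length cs" "y = cs ! j" by (metis in_set_conv_nth)
    obtain i where i: "i < length cs" "x = cs ! i" using x by (metis in_set_conv_nth)
    \<comment> \<open>Rotation by \<open>j - i\<close> places moves position \<open>i\<close> to
      position \<open>j\<close>. Adding the length keeps the number positive, which membership in an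
      orbit demands.\<close>
    let ?n = "j + (length cs - i)"
    have "(?f ^^ ?n) x = map (?f ^^ ?n) cs ! i" using i by simp
    also have "\<dots> = cs ! ((?n + i) mod length cs)" using i by (simp add: cyclic_rotation[OF cs] nth_rotate)
    also have "(?n + i) mod length cs = j" using i j by simp
    finally show "y \<in> orbit ?f x" unfolding orbit_altdef using j i by (auto intro!: exI[of _ ?n])
  qed
qed

lemma cycle_decomp_permutes: "cycle_decomp I p \<Longrightarrow> p permutes I \<and> finite I"
proof (induction rule: cycle_decomp.induct)
  case (comp I p cs)
  have "cycle_of_list cs permutes set cs \<union> I" by (rule permutes_subset[OF cycle_permutes]) simp
  moreover have "p permutes set cs \<union> I" by (rule permutes_subset[of p I]) (use comp in auto)
  ultimately show ?case using comp permutes_compose[of p "set cs \<union> I" "cycle_of_list cs"] by (simp add: comp_def)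
qed (auto simp: permutes_id)

text \<open>A cycle of length \<open>l\<close> has sign \<open>(-1)^(l-1)\<close>, so exactly the
  even cycles contribute -1. In the decomposition the new cycle and the old permutation move
  disjoint sets, and each orbit of the composite is an orbit of one of them.\<close>

lemma sign_eq_even_cycles:
  "cycle_decomp I p \<Longrightarrow> sign p = (-1) ^ card {C \<in> orbit p ` I. even (card C)}"
proof (induction rule: cycle_decomp.induct)
  case empty then show ?case by (simp add: sign_id)
next
  case (comp I p cs)
  let ?c = "cycle_of_list cs" let ?q = "?c \<circ> p"
  have p: "p permutes I" "finite I" using cycle_decomp_permutes[OF comp(1)] by auto
  have pp: "permutation p" using p permutation_permutes by blast
  have o1: "orbit ?q x = orbit p x" if x: "x \<in> I" for x
  proof (rule orbit_cong0[symmetric, of x I p])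
    show "x \<in> I" by (rule x)
    show "p \<in> I \<rightarrow> I" using p(1) by (auto simp: permutes_in_image)
    show "\<And>s. s \<in> I \<Longrightarrow> p s = ?q s" using p(1) comp(3) by (auto simp: permutes_in_image intro!: id_outside_supp[symmetric])
  qed
  have o2: "orbit ?q x = set cs" if x: "x \<in> set cs" for x
  proof -
    have "orbit ?c x = orbit ?q x"
    proof (rule orbit_cong0[OF x])
      show "?c \<in> set cs \<rightarrow> set cs" using cycle_permutes[of cs] by (auto simp: permutes_in_image)
      fix s assume "s \<in> set cs"
      then have "s \<notin> I" using comp(3) by blast
      then show "?c s = ?q s" using permutes_not_in[OF p(1)] by simp
    qed
    then show ?thesis using orbit_cycle_of_list[OF comp(2) x] by (rule trans[OF sym])
  qed
  have sg: "sign ?q = (-1) ^ (length cs - 1) * sign p"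
    using sign_compose[OF permutation_of_cycle pp] sign_cycle_of_list[OF comp(2)] by simp
  \<comment> \<open>The decomposition may contain the empty cycle. Its set is not an orbit, and for
    it \<open>length cs - 1\<close> is truncated to 0, so neither side changes.\<close>
  show ?case
  proof (cases "cs = []")
    case True then show ?thesis using comp by simp
  next
    case False
    have im: "orbit ?q ` (set cs \<union> I) = insert (set cs) (orbit p ` I)"
    proof -
      have "orbit ?q ` set cs = {set cs}" using o2 image_cong[of "set cs" "set cs" "orbit ?q" "\<lambda>_. set cs"] False by (simp add: image_constant_conv)
      moreover have "orbit ?q ` I = orbit p ` I" by (rule image_cong[OF refl o1])
      ultimately show ?thesis by (simp add: image_Un)
    qed
    have ni: "set cs \<notin> orbit p ` I"
    proof
      assume "set cs \<in> orbit p ` I"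
      then obtain x where "x \<in> I" "set cs = orbit p x" by blast
      then have "set cs \<subseteq> I" using orbit_subset_invariant[of p I x] p(1) by (auto simp: permutes_image)
      then show False using comp(3) False by (auto simp: neq_Nil_conv)
    qed
    have lc: "card (set cs) = length cs" using comp(2) by (simp add: distinct_card)
    have ev: "{C \<in> insert (set cs) (orbit p ` I). even (card C)} =
      (if even (length cs) then insert (set cs) {C \<in> orbit p ` I. even (card C)} else {C \<in> orbit p ` I. even (card C)})"
      using lc by auto
    have pw: "(-1 :: int) ^ (length cs - 1) = (if even (length cs) then -1 else 1)"
      using False by (cases cs) auto
    show ?thesis unfolding im ev sg comp(4) pw using ni p(2) by auto
  qed
qed

lemma sign_eq_cycle_type:
  assumes "\<sigma> permutes A" "finite A"
  shows "sign \<sigma> = (-1) ^ (\<Sum>i | i \<in> {1..card A} \<and> even i. cycle_type \<sigma> A i)"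
  unfolding sum_even_cycle_type[OF permutes_imp_bij[OF assms(1)] assms(2)]
  by (rule sign_eq_even_cycles[OF cycle_decomposition[OF assms]])

section \<open>Polynomials over residue rings of the integers\<close>

text \<open>A cofactor modulo \<open>m\<close> is determined only up to congruence, so its degree
  says nothing. The quotient of the division over the integers is congruent to it and monic, and for
  it the degrees add.\<close>

lemma monic_factor:
  fixes g h k :: "int poly"
  assumes g: "monic g" and h: "monic h" and m: "m > 1" and c: "pcong m g (h * k)"
  obtains q where "monic q" "pcong m k q" "pdeg g = pdeg h + pdeg q"
proof -
  obtain q s where qs: "g = h * q + s" "s = 0 \<or> pdeg s < pdeg h" using monic_division[OF h] by blast
  from monic_dvd_remainder[OF h m c qs] have s: "pcong m s 0" and k: "pcong m k q" by auto
  have n0: "\<not> pcong m g 0"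
  proof
    assume "pcong m g 0"
    then have "pcoeff g (pdeg g) mod m = 0 mod m" unfolding pcong_coeff by (metis coeff_0)
    then show False using g m by simp
  qed
  have "h \<noteq> 0" using h by auto
  have "q \<noteq> 0" using qs(1) s n0 by auto
  have dq: "pdeg (h * q) = pdeg h + pdeg q" using \<open>h \<noteq> 0\<close> \<open>q \<noteq> 0\<close> by (rule degree_mult_eq)
  have lt: "s = 0 \<or> pdeg s < pdeg (h * q)" using qs(2) dq by linarith
  have dg: "pdeg g = pdeg (h * q)"
  proof (cases "s = 0")
    case False then show ?thesis using lt unfolding qs(1) by (intro degree_add_eq_left) simp
  qed (simp add: qs(1))
  have "pcoeff s (pdeg (h * q)) = 0"
  proof (cases "s = 0")
    case False then show ?thesis using lt by (intro coeff_eq_0) simp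
  qed simp
  then have "pcoeff g (pdeg g) = pcoeff (h * q) (pdeg (h * q))" unfolding dg by (simp add: qs(1))
  then have "monic (h * q)" using g by simp
  then have "monic q" using h by (rule monic_quotient)
  then show ?thesis using that k dg dq by simp
qed

lemma monic_degree_0: "pdeg q = 0 \<Longrightarrow> monic q \<Longrightarrow> q = (1 :: int poly)"
  by (cases q) (auto simp: one_pCons split: if_splits)

text \<open>The equality of the ideals generated by \<open>G\<close>, \<open>g\<close> and by
  \<open>h\<close> modulo \<open>m\<close>, spelled out as congruences: \<open>h\<close> lies in the
  first ideal, and \<open>G\<close> and \<open>g\<close> are multiples of \<open>h\<close>. In this
  form it can be glued over the prime powers.\<close>

definition gcmd_rel :: "int \<Rightarrow> int poly \<Rightarrow> int poly \<Rightarrow> int poly \<Rightarrow> bool" where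
  "gcmd_rel m G g h \<longleftrightarrow> monic h \<and> (\<exists>a b. pcong m h (a * G + b * g)) \<and> (\<exists>u. pcong m G (h * u)) \<and> (\<exists>w. pcong m g (h * w))"

text \<open>The two degree equations force the monic cofactors to have degree 0, hence to be 1. This
  is the uniqueness that the definite description in \<open>gcmd\<close> demands.\<close>

lemma monic_associated_pcong:
  fixes h h' :: "int poly"
  assumes m: "m > 1" and h: "monic h" "monic h'" and c: "pcong m h (h' * k)" "pcong m h' (h * k')"
  shows "pcong m h h'"
proof -
  obtain q where q: "monic q" "pcong m k q" "pdeg h = pdeg h' + pdeg q" by (rule monic_factor[OF h m c(1)])
  obtain q' where q': "monic q'" "pcong m k' q'" "pdeg h' = pdeg h + pdeg q'" by (rule monic_factor[OF h(2,1) m c(2)])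
  have "pdeg q = 0" using q(3) q'(3) by simp
  then have "q = 1" using q(1) by (rule monic_degree_0)
  have "pcong m h (h' * q)" by (rule pcong_trans[OF c(1) pcong_mult[OF pcong_refl q(2)]])
  then show ?thesis using \<open>q = 1\<close> by simp
qed

text \<open>Both cofactors are congruent to the quotient of one division by \<open>h\<close>. The
  uniqueness of \<open>exact_quotient\<close> rests on this.\<close>

lemma monic_mult_cancel:
  fixes h k k' :: "int poly"
  assumes m: "m > 1" and h: "monic h" and c: "pcong m (h * k) (h * k')"
  shows "pcong m k k'"
proof -
  obtain q s where qs: "h * k = h * q + s" "s = 0 \<or> pdeg s < pdeg h" using monic_division[OF h] by blast
  from monic_dvd_remainder(2)[OF h m _ qs, of k] monic_dvd_remainder(2)[OF h m c qs]
  have "pcong m k q" "pcong m k' q" by auto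
  then show ?thesis by (meson pcong_sym pcong_trans)
qed

lemma carrier_UP: "carrier (UP R) = up R"
  by (simp add: UP_def)

lemma coeff_UP: "F \<in> carrier (UP R) \<Longrightarrow> up_ring.coeff (UP R) F = F"
  by (simp add: UP_def)

section \<open>Integer polynomials as representatives of polynomials over Z/n\<close>

locale zmod_poly =
  fixes n :: nat
  assumes n1: "n > 1"
begin

lemma int_n: "int n > 1" using n1 by simp

lemma residues_n: "residues (int n)"
  using n1 by (simp add: residues_def)

sublocale ZP: UP_cring "ZMod n" "UP (ZMod n)"
  by (simp add: UP_cring_def residues.cring[OF residues_n])

abbreviation pm :: "int poly \<Rightarrow> nat \<Rightarrow> int" where "pm \<equiv> poly_mod n"
abbreviation Zx where "Zx \<equiv> UP (ZMod n)"

lemma carrier_ZMod: "carrier (ZMod n) = {0..int n - 1}" by (simp add: residue_ring_def)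
lemma zero_ZMod: "\<zero>\<^bsub>ZMod n\<^esub> = 0" by (simp add: residue_ring_def)
lemma one_ZMod: "\<one>\<^bsub>ZMod n\<^esub> = 1" by (simp add: residue_ring_def)
lemma add_ZMod: "x \<oplus>\<^bsub>ZMod n\<^esub> y = (x + y) mod int n" by (simp add: residue_ring_def)
lemma mult_ZMod: "x \<otimes>\<^bsub>ZMod n\<^esub> y = (x * y) mod int n" by (simp add: residue_ring_def)

lemma mod_in_ZMod [simp]: "x mod int n \<in> carrier (ZMod n)"
  using n1 by (simp add: carrier_ZMod)

lemma finsum_ZMod:
  fixes x :: "nat \<Rightarrow> int" and k :: nat
  shows "(\<Oplus>\<^bsub>ZMod n\<^esub>i\<in>{..k}. x i mod int n) = (\<Sum>i\<le>k. x i) mod int n"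
proof (induction k)
  case 0 show ?case using ZP.R.finsum_0[of "\<lambda>i. x i mod int n"] by simp
next
  case (Suc k)
  have "(\<Oplus>\<^bsub>ZMod n\<^esub>i\<in>{..Suc k}. x i mod int n) = x (Suc k) mod int n \<oplus>\<^bsub>ZMod n\<^esub> (\<Oplus>\<^bsub>ZMod n\<^esub>i\<in>{..k}. x i mod int n)"
    by (rule ZP.R.finsum_Suc) simp
  also have "\<dots> = (\<Sum>i\<le>Suc k. x i) mod int n" unfolding Suc add_ZMod by (simp add: mod_simps add.commute)
  finally show ?case .
qed

lemma pm_closed [simp]: "pm a \<in> carrier Zx"
proof -
  have "bound 0 (pdeg a) (pm a)" by (rule bound.intro) (simp add: poly_mod_def coeff_eq_0)
  then have "pm a \<in> up (ZMod n)" by (intro mem_upI exI[of _ "pdeg a"]) (simp_all add: poly_mod_def zero_ZMod)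
  then show ?thesis unfolding carrier_UP .
qed

lemma coeff_Zx: "F \<in> carrier Zx \<Longrightarrow> up_ring.coeff Zx F = F"
  by (rule coeff_UP)

lemma coeff_pm [simp]: "up_ring.coeff Zx (pm a) i = pcoeff a i mod int n"
  unfolding coeff_Zx[OF pm_closed] by (simp add: poly_mod_def)

lemma pm_eq_iff: "pm a = pm b \<longleftrightarrow> pcong (int n) a b"
  by (simp add: poly_mod_def pcong_coeff fun_eq_iff)

text \<open>The representative has the very coefficients of \<open>F\<close>, so its degree and its
  leading coefficient are those of \<open>F\<close>; \<open>monic_UP_lift\<close> depends on
  this.\<close>

lemma pm_surj:
  assumes F: "F \<in> carrier Zx"
  obtains a where "pm a = F" "\<And>i. pcoeff a i = F i"
proof -
  have F': "F \<in> up (ZMod n)" using F by (simp only: carrier_UP)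
  then obtain N where N: "bound 0 N F" by (auto simp: up_def zero_ZMod)
  have cf: "pcoeff (Poly (map F [0..<Suc N])) i = F i" for i
  proof (cases "i < Suc N")
    case False then have "F i = 0" using N by (simp add: bound_def)
    then show ?thesis using False by (simp add: nth_default_def)
  qed (simp add: nth_default_def del: upt_Suc)
  have "F i \<in> {0..int n - 1}" for i using F' by (auto simp: up_def carrier_ZMod)
  then have "0 \<le> F i \<and> F i < int n" for i by (metis atLeastAtMost_iff zle_diff1_eq)
  then have "F i mod int n = F i" for i using mod_pos_pos_trivial[of "F i" "int n"] by auto
  then have "pm (Poly (map F [0..<Suc N])) = F" by (simp add: poly_mod_def cf fun_eq_iff del: coeff_Poly_eq upt_Suc)
  then show ?thesis using that cf by blast
qed

lemma pm_add: "pm (a + b) = pm a \<oplus>\<^bsub>Zx\<^esub> pm b"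
  by (rule ZP.up_eqI) (simp_all only: ZP.coeff_add pm_closed coeff_pm add_ZMod mod_add_eq coeff_add ZP.UP_a_closed)

lemma pm_mult: "pm (a * b) = pm a \<otimes>\<^bsub>Zx\<^esub> pm b"
proof (rule ZP.up_eqI)
  fix k
  have "up_ring.coeff Zx (pm a \<otimes>\<^bsub>Zx\<^esub> pm b) k = (\<Oplus>\<^bsub>ZMod n\<^esub>i\<in>{..k}. (pcoeff a i * pcoeff b (k - i)) mod int n)"
    by (simp only: ZP.coeff_mult pm_closed coeff_pm mult_ZMod mod_mult_eq)
  also have "\<dots> = pcoeff (a * b) k mod int n" by (simp only: finsum_ZMod coeff_mult)
  finally show "up_ring.coeff Zx (pm (a * b)) k = up_ring.coeff Zx (pm a \<otimes>\<^bsub>Zx\<^esub> pm b) k" by simp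
qed simp_all

lemma pm_1: "pm 1 = \<one>\<^bsub>Zx\<^esub>"
  using n1 by (intro ZP.up_eqI) (simp_all add: coeff_1 zero_ZMod one_ZMod)

lemma pm_monom: "pm (pmonom c k) = up_ring.monom Zx (c mod int n) k"
  by (rule ZP.up_eqI) (simp_all add: zero_ZMod)

lemma pm_xpow: "pm (pmonom 1 k) = xpow n k"
  using n1 by (simp add: xpow_def pm_monom one_ZMod)

lemma pm_diff: "pm (a - b) = pm a \<ominus>\<^bsub>Zx\<^esub> pm b"
proof -
  have "pm (a - b) \<oplus>\<^bsub>Zx\<^esub> pm b = pm a" unfolding pm_add[symmetric] by simp
  then show ?thesis using ZP.P.add.inv_solve_right[of "pm (a - b)" "pm a" "pm b"] by (simp add: a_minus_def)
qed

lemma deg_pm: "monic a \<Longrightarrow> deg (ZMod n) (pm a) = pdeg a"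
proof (intro le_antisym ZP.deg_aboveI ZP.deg_belowI)
  assume a: "monic a"
  show "\<And>m. pdeg a < m \<Longrightarrow> up_ring.coeff Zx (pm a) m = \<zero>\<^bsub>ZMod n\<^esub>" by (simp add: coeff_eq_0 zero_ZMod)
  show "up_ring.coeff Zx (pm a) (pdeg a) \<noteq> \<zero>\<^bsub>ZMod n\<^esub>" using a n1 by (simp add: zero_ZMod)
qed simp_all

lemma monic_UP_pm: "monic a \<Longrightarrow> monic_UP (ZMod n) (pm a)"
  using n1 by (simp add: monic_UP_def deg_pm one_ZMod)

lemma monic_UP_lift:
  assumes F: "monic_UP (ZMod n) F" obtains a where "pm a = F" "monic a"
proof -
  have Fc: "F \<in> carrier Zx" and l: "F (deg (ZMod n) F) = 1" using F coeff_Zx[of F] by (auto simp: monic_UP_def one_ZMod)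
  obtain a where a: "pm a = F" "\<And>i. pcoeff a i = F i" using pm_surj[OF Fc] by blast
  have "pdeg a \<le> deg (ZMod n) F"
  proof (rule degree_le, safe)
    fix i assume "i > deg (ZMod n) F"
    then show "pcoeff a i = 0" using ZP.deg_aboveD[OF _ Fc, of i] coeff_Zx[OF Fc] a(2) by (simp add: zero_ZMod)
  qed
  moreover have "deg (ZMod n) F \<le> pdeg a" by (rule le_degree) (simp add: a(2) l)
  ultimately have "monic a" using a(2) l by simp
  then show ?thesis using that a(1) by blast
qed

lemma in_PIdl_pm: "pm a \<in> PIdl\<^bsub>Zx\<^esub> (pm h) \<longleftrightarrow> (\<exists>k. pcong (int n) a (h * k))"
proof
  assume "pm a \<in> PIdl\<^bsub>Zx\<^esub> (pm h)"
  then obtain K where K: "K \<in> carrier Zx" "pm a = K \<otimes>\<^bsub>Zx\<^esub> pm h" by (auto simp: cgenideal_def)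
  obtain k where "pm k = K" using pm_surj[OF K(1)] by blast
  with K have "pm a = pm (k * h)" by (simp add: pm_mult)
  then show "\<exists>k. pcong (int n) a (h * k)" unfolding pm_eq_iff by (metis mult.commute)
next
  assume "\<exists>k. pcong (int n) a (h * k)"
  then obtain k where "pm a = pm k \<otimes>\<^bsub>Zx\<^esub> pm h" by (metis pm_eq_iff pm_mult mult.commute)
  then show "pm a \<in> PIdl\<^bsub>Zx\<^esub> (pm h)" by (auto simp: cgenideal_def)
qed

lemma Idl_pm: "Idl\<^bsub>Zx\<^esub> {pm h} = PIdl\<^bsub>Zx\<^esub> (pm h)"
  by (simp add: ZP.P.cgenideal_eq_genideal)

lemma is_gcmd_pm: "is_gcmd (ZMod n) (pm G) (pm g) (pm h) \<and> monic h \<longleftrightarrow> gcmd_rel (int n) G g h"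
proof
  assume *: "is_gcmd (ZMod n) (pm G) (pm g) (pm h) \<and> monic h"
  then have I: "Idl\<^bsub>Zx\<^esub> {pm G, pm g} = PIdl\<^bsub>Zx\<^esub> (pm h)" by (simp add: is_gcmd_def Idl_pm)
  have "pm G \<in> PIdl\<^bsub>Zx\<^esub> (pm h)" "pm g \<in> PIdl\<^bsub>Zx\<^esub> (pm h)"
    using ZP.P.genideal_self[of "{pm G, pm g}"] unfolding I by auto
  then have 1: "\<exists>u. pcong (int n) G (h * u)" "\<exists>w. pcong (int n) g (h * w)" by (simp_all add: in_PIdl_pm)
  \<comment> \<open>The generated ideal is an intersection of ideals, which exhibits no
    coefficients. It lies in the sum of the two principal ideals, and membership there provides the
    Bezout combination.\<close>
  let ?J = "PIdl\<^bsub>Zx\<^esub> (pm G) <+>\<^bsub>Zx\<^esub> PIdl\<^bsub>Zx\<^esub> (pm g)"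
  have J: "ideal ?J Zx" by (intro ZP.P.add_ideals ZP.P.cgenideal_ideal) simp_all
  have z: "\<zero>\<^bsub>Zx\<^esub> \<in> PIdl\<^bsub>Zx\<^esub> (pm a)" for a
    by (rule additive_subgroup.zero_closed[OF ideal.axioms(1)[OF ZP.P.cgenideal_ideal]]) simp
  have "pm G \<oplus>\<^bsub>Zx\<^esub> \<zero>\<^bsub>Zx\<^esub> \<in> ?J" "\<zero>\<^bsub>Zx\<^esub> \<oplus>\<^bsub>Zx\<^esub> pm g \<in> ?J"
    unfolding set_add_def' using z ZP.P.cgenideal_self[OF pm_closed] by blast+
  then have "pm G \<in> ?J" and "pm g \<in> ?J" by simp_all
  then have "PIdl\<^bsub>Zx\<^esub> (pm h) \<subseteq> ?J" unfolding I[symmetric] by (intro ZP.P.genideal_minimal[OF J]) simp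
  then have "pm h \<in> ?J" using ZP.P.cgenideal_self[of "pm h"] by auto
  then obtain A B where AB: "A \<in> carrier Zx" "B \<in> carrier Zx" "pm h = A \<otimes>\<^bsub>Zx\<^esub> pm G \<oplus>\<^bsub>Zx\<^esub> B \<otimes>\<^bsub>Zx\<^esub> pm g"
    by (auto simp: set_add_def' cgenideal_def)
  obtain a b where "pm a = A" "pm b = B" using pm_surj[OF AB(1)] pm_surj[OF AB(2)] by metis
  with AB(3) have "pm h = pm (a * G + b * g)" by (simp add: pm_mult pm_add)
  with 1 * show "gcmd_rel (int n) G g h" unfolding gcmd_rel_def pm_eq_iff by blast
next
  assume *: "gcmd_rel (int n) G g h"
  then have m: "monic h" by (simp add: gcmd_rel_def)
  have "pm G \<in> PIdl\<^bsub>Zx\<^esub> (pm h)" "pm g \<in> PIdl\<^bsub>Zx\<^esub> (pm h)" using * by (auto simp: in_PIdl_pm gcmd_rel_def)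
  then have 1: "Idl\<^bsub>Zx\<^esub> {pm G, pm g} \<subseteq> PIdl\<^bsub>Zx\<^esub> (pm h)"
    by (intro ZP.P.genideal_minimal ZP.P.cgenideal_ideal) simp_all
  from * obtain a b where "pm h = pm (a * G + b * g)" unfolding gcmd_rel_def pm_eq_iff by blast
  then have e: "pm h = pm a \<otimes>\<^bsub>Zx\<^esub> pm G \<oplus>\<^bsub>Zx\<^esub> pm b \<otimes>\<^bsub>Zx\<^esub> pm g" by (simp add: pm_mult pm_add)
  have I: "ideal (Idl\<^bsub>Zx\<^esub> {pm G, pm g}) Zx" by (rule ZP.P.genideal_ideal) simp
  have "{pm G, pm g} \<subseteq> Idl\<^bsub>Zx\<^esub> {pm G, pm g}" by (rule ZP.P.genideal_self) simp
  then have "pm h \<in> Idl\<^bsub>Zx\<^esub> {pm G, pm g}" unfolding e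
    by (intro additive_subgroup.a_closed[OF ideal.axioms(1)[OF I]] ideal.I_l_closed[OF I]) auto
  then have 2: "PIdl\<^bsub>Zx\<^esub> (pm h) \<subseteq> Idl\<^bsub>Zx\<^esub> {pm G, pm g}" by (rule ZP.P.cgenideal_minimal[OF I])
  from 1 2 m show "is_gcmd (ZMod n) (pm G) (pm g) (pm h) \<and> monic h"
    by (simp add: is_gcmd_def Idl_pm monic_UP_pm)
qed

lemma gcmd_pm:
  assumes "gcmd_rel (int n) G g h" shows "gcmd (ZMod n) (pm G) (pm g) = Some (pm h)"
proof -
  have h: "is_gcmd (ZMod n) (pm G) (pm g) (pm h)" "monic h" using assms is_gcmd_pm by blast+
  have u: "F = pm h" if F: "is_gcmd (ZMod n) (pm G) (pm g) F" for F
  proof -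
    obtain a where a: "pm a = F" "monic a" using F monic_UP_lift by (auto simp: is_gcmd_def)
    have "Idl\<^bsub>Zx\<^esub> {pm a} = Idl\<^bsub>Zx\<^esub> {pm h}" using F h by (simp add: is_gcmd_def a)
    then have "PIdl\<^bsub>Zx\<^esub> (pm a) = PIdl\<^bsub>Zx\<^esub> (pm h)" by (simp add: Idl_pm)
    then have "pm a \<in> PIdl\<^bsub>Zx\<^esub> (pm h)" "pm h \<in> PIdl\<^bsub>Zx\<^esub> (pm a)"
      using ZP.P.cgenideal_self[of "pm a"] ZP.P.cgenideal_self[of "pm h"] by auto
    then have "pcong (int n) a h" unfolding in_PIdl_pm using monic_associated_pcong[OF int_n a(2) h(2)] by blast
    then show ?thesis using a(1) by (simp flip: pm_eq_iff)
  qed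
  have "(THE F. is_gcmd (ZMod n) (pm G) (pm g) F) = pm h" using h(1) u by (rule the_equality)
  then show ?thesis using h(1) by (auto simp: gcmd_def)
qed

lemma gcmd_SomeE:
  assumes "gcmd (ZMod n) (pm G) (pm g) = Some F"
  obtains h where "F = pm h" "gcmd_rel (int n) G g h"
proof -
  have "\<exists>F. is_gcmd (ZMod n) (pm G) (pm g) F" using assms by (auto simp: gcmd_def split: if_splits)
  then obtain F' where F': "is_gcmd (ZMod n) (pm G) (pm g) F'" by blast
  then obtain h where h: "pm h = F'" "monic h" using monic_UP_lift by (auto simp: is_gcmd_def)
  then have r: "gcmd_rel (int n) G g h" using F' is_gcmd_pm by blast
  then have "F = pm h" using gcmd_pm[OF r] assms by simp
  then show ?thesis using that r by blast
qed

lemma exact_quotient_pm: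
  assumes "monic h" "pcong (int n) g (h * q)"
  shows "exact_quotient (ZMod n) (pm g) (pm h) = pm q"
  unfolding exact_quotient_def
proof (rule the_equality)
  show "pm q \<in> carrier Zx \<and> pm g = pm h \<otimes>\<^bsub>Zx\<^esub> pm q" using assms(2) by (simp add: pm_eq_iff flip: pm_mult)
  fix Q assume Q: "Q \<in> carrier Zx \<and> pm g = pm h \<otimes>\<^bsub>Zx\<^esub> Q"
  then obtain k where k: "pm k = Q" using pm_surj by blast
  then have "pm g = pm (h * k)" using Q by (simp add: pm_mult)
  then have "pcong (int n) g (h * k)" by (simp only: pm_eq_iff)
  then have "pcong (int n) (h * k) (h * q)" using assms(2) pcong_sym pcong_trans by blast
  then show "Q = pm q" using monic_mult_cancel[OF int_n assms(1)] k pm_eq_iff by blast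
qed

lemma finsum_pm:
  fixes k :: nat
  shows "(\<Oplus>\<^bsub>Zx\<^esub>i\<in>{..k}. pm (x i)) = pm (\<Sum>i\<le>k. x i)"
proof (induction k)
  case (Suc k)
  have "(\<Oplus>\<^bsub>Zx\<^esub>i\<in>{..Suc k}. pm (x i)) = pm (x (Suc k)) \<oplus>\<^bsub>Zx\<^esub> (\<Oplus>\<^bsub>Zx\<^esub>i\<in>{..k}. pm (x i))"
    by (rule ZP.P.finsum_Suc) simp
  also have "\<dots> = pm (\<Sum>i\<le>Suc k. x i)" unfolding Suc by (simp flip: pm_add add: add.commute)
  finally show ?case .
qed simp

lemma pm_pow: "pm (a ^ k) = pm a [^]\<^bsub>Zx\<^esub> k"
  by (induction k) (simp_all add: pm_1 pm_mult mult.commute[of _ a] ZP.P.m_comm)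

lemma subst_xpow_pm:
  assumes "monic h" shows "subst_xpow n (pm h) = pm (pcompose h (pmonom 1 n))"
proof -
  have "subst_xpow n (pm h) = (\<Oplus>\<^bsub>Zx\<^esub>i\<in>{..pdeg h}. up_ring.monom Zx (up_ring.coeff Zx (pm h) i) 0 \<otimes>\<^bsub>Zx\<^esub> xpow n n [^]\<^bsub>Zx\<^esub> i)"
    unfolding subst_xpow_def UnivPoly.eval_def by (simp add: deg_pm[OF assms])
  also have "\<dots> = (\<Oplus>\<^bsub>Zx\<^esub>i\<in>{..pdeg h}. pm ([:pcoeff h i:] * pmonom 1 n ^ i))"
    unfolding pm_mult pm_pow pm_xpow by (simp add: pm_monom flip: monom_0)
  also have "\<dots> = pm (\<Sum>i\<le>pdeg h. [:pcoeff h i:] * pmonom 1 n ^ i)" by (rule finsum_pm)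
  also have "(\<Sum>i\<le>pdeg h. [:pcoeff h i:] * pmonom 1 n ^ i) = pcompose h (pmonom 1 n)"
    by (simp add: pcompose_altdef poly_altdef degree_map_poly coeff_map_poly)
  finally show ?thesis .
qed

text \<open>A run of the Factorization step over \<open>k\<close> rounds with monic integer
  representatives: \<open>g i\<close> stands for \<open>f_i\<close>, and \<open>F (Suc i)\<close>
  for the factor split off in the next round. The value \<open>F 0\<close> is arbitrary.\<close>

definition frob_chain :: "int poly \<Rightarrow> nat \<Rightarrow> (nat \<Rightarrow> int poly) \<Rightarrow> (nat \<Rightarrow> int poly) \<Rightarrow> bool" where
  "frob_chain f k F g \<longleftrightarrow> g 0 = f \<and> (\<forall>i\<le>k. monic (g i)) \<and>
     (\<forall>i<k. gcmd_rel (int n) (pmonom 1 (n ^ Suc i) - pmonom 1 1) (g i) (F (Suc i)) \<and>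
            pcong (int n) (g i) (F (Suc i) * g (Suc i)))"

lemma frob_arg: "xpow n k \<ominus>\<^bsub>Zx\<^esub> xpow n 1 = pm (pmonom 1 k - pmonom 1 1)"
  by (simp add: pm_diff pm_xpow)

lemma frob_chain_rest:
  assumes "frob_chain f k F g" "i \<le> k" shows "frob_rest n f i = Some (pm (g i))"
  using assms(2)
proof (induction i)
  case 0 then show ?case using assms(1) by (simp add: frob_chain_def)
next
  case (Suc i)
  then have r: "frob_rest n f i = Some (pm (g i))" by simp
  have g: "gcmd_rel (int n) (pmonom 1 (n ^ Suc i) - pmonom 1 1) (g i) (F (Suc i))"
    and c: "pcong (int n) (g i) (F (Suc i) * g (Suc i))" using assms(1) Suc.prems by (auto simp: frob_chain_def)
  have "monic (F (Suc i))" using g by (simp add: gcmd_rel_def)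
  with r gcmd_pm[OF g] c show ?case unfolding frob_rest.simps frob_arg by (simp add: exact_quotient_pm)
qed

lemma frob_chain_factor:
  assumes "frob_chain f k F g" "i < k" shows "frob_factor n f (Suc i) = Some (pm (F (Suc i)))"
proof -
  have "gcmd_rel (int n) (pmonom 1 (n ^ Suc i) - pmonom 1 1) (g i) (F (Suc i))" using assms by (auto simp: frob_chain_def)
  from gcmd_pm[OF this] frob_chain_rest[OF assms(1), of i] assms(2) show ?thesis
    unfolding frob_factor_def frob_arg by simp
qed

lemma frob_chain_exists:
  assumes f: "monic f" and fac: "\<forall>i\<in>{1..k}. frob_factor n f i \<noteq> None"
  shows "\<exists>F g. frob_chain f k F g"
  using fac
proof (induction k)
  case 0 show ?case by (rule exI[of _ "\<lambda>_. 0"], rule exI[of _ "\<lambda>_. f"]) (simp add: frob_chain_def f)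
next
  case (Suc k)
  then obtain F g where c: "frob_chain f k F g" by auto
  have r: "frob_rest n f k = Some (pm (g k))" by (rule frob_chain_rest[OF c]) simp
  have "frob_factor n f (Suc k) \<noteq> None" using Suc.prems by simp
  then obtain H where "gcmd (ZMod n) (pm (pmonom 1 (n ^ Suc k) - pmonom 1 1)) (pm (g k)) = Some H"
    unfolding frob_factor_def frob_arg using r by auto
  then obtain h where h: "gcmd_rel (int n) (pmonom 1 (n ^ Suc k) - pmonom 1 1) (g k) h" by (rule gcmd_SomeE)
  then have mh: "monic h" by (simp add: gcmd_rel_def)
  obtain w where w: "pcong (int n) (g k) (h * w)" using h by (auto simp: gcmd_rel_def)
  have mg: "monic (g k)" using c by (simp add: frob_chain_def)
  \<comment> \<open>The cofactor from the gcmd is only known modulo \<open>n\<close>; the next round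
    needs a monic representative of it.\<close>
  obtain q where q: "monic q" "pcong (int n) w q" by (rule monic_factor[OF mg mh int_n w])
  have w': "pcong (int n) (g k) (h * q)" by (rule pcong_trans[OF w pcong_mult[OF pcong_refl q(2)]])
  have "frob_chain f (Suc k) (F(Suc k := h)) (g(Suc k := q))"
    using c h w' q(1) by (auto simp: frob_chain_def less_Suc_eq le_Suc_eq)
  then show ?case by blast
qed

lemma factorization_step_iff:
  assumes f: "monic f"
  shows "factorization_step n f \<longleftrightarrow> (\<exists>F g. frob_chain f (pdeg f) F g \<and> g (pdeg f) = 1)"
proof
  assume a: "factorization_step n f"
  then obtain F g where c: "frob_chain f (pdeg f) F g" using frob_chain_exists[OF f] unfolding factorization_step_def by blast
  have "Some (pm (g (pdeg f))) = Some \<one>\<^bsub>Zx\<^esub>"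
    using frob_chain_rest[OF c, of "pdeg f"] a by (simp add: factorization_step_def)
  then have p1: "pcong (int n) (g (pdeg f)) (1 * 1)" by (simp flip: pm_1 pm_eq_iff)
  have mg: "monic (g (pdeg f))" using c by (simp add: frob_chain_def)
  \<comment> \<open>Congruence to 1 does not yet make the representative equal to 1; but a monic
    divisor of 1 modulo \<open>n\<close> has degree 0.\<close>
  have "pcong (int n) 1 (g (pdeg f) * 1)" using pcong_sym[OF p1] by simp
  moreover have "monic (1 :: int poly)" by simp
  ultimately obtain q' where "monic q'" "pcong (int n) 1 q'" "pdeg (1 :: int poly) = pdeg (g (pdeg f)) + pdeg q'"
    using monic_factor[OF _ mg int_n] by blast
  then have "pdeg (g (pdeg f)) = 0" by simp
  then have "g (pdeg f) = 1" using mg by (rule monic_degree_0)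
  with c show "\<exists>F g. frob_chain f (pdeg f) F g \<and> g (pdeg f) = 1" by blast
next
  assume "\<exists>F g. frob_chain f (pdeg f) F g \<and> g (pdeg f) = 1"
  then obtain F g where c: "frob_chain f (pdeg f) F g" "g (pdeg f) = 1" by blast
  have "frob_factor n f i \<noteq> None" if "i \<in> {1..pdeg f}" for i
    using frob_chain_factor[OF c(1), of "i - 1"] that by auto
  moreover have "frob_rest n f (pdeg f) = Some \<one>\<^bsub>Zx\<^esub>"
    using frob_chain_rest[OF c(1), of "pdeg f"] c(2) by (simp add: pm_1)
  ultimately show "factorization_step n f" by (simp add: factorization_step_def)
qed

lemma frob_chain_monic: "frob_chain f k F g \<Longrightarrow> i < k \<Longrightarrow> monic (F (Suc i))"
  by (simp add: frob_chain_def gcmd_rel_def)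

lemma frob_chain_cycles:
  assumes "frob_chain f k F g" "1 \<le> i" "i \<le> k" shows "frob_cycles n f i = of_nat (pdeg (F i)) / of_nat i"
proof -
  obtain j where j: "i = Suc j" "j < k" using assms(2,3) by (cases i) auto
  show ?thesis unfolding frob_cycles_def j(1) frob_chain_factor[OF assms(1) j(2)]
    by (simp add: deg_pm[OF frob_chain_monic[OF assms(1) j(2)]])
qed

lemma frobenius_step_iff:
  assumes "frob_chain f (pdeg f) F g"
  shows "frobenius_step n f \<longleftrightarrow> (\<forall>i\<in>{2..pdeg f}. \<exists>k. pcong (int n) (pcompose (F i) (pmonom 1 n)) (F i * k))"
proof -
  have "subst_xpow n (the (frob_factor n f i)) \<in> Idl\<^bsub>UP (ZMod n)\<^esub> {the (frob_factor n f i)} \<longleftrightarrow>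
    (\<exists>k. pcong (int n) (pcompose (F i) (pmonom 1 n)) (F i * k))" if i: "i \<in> {2..pdeg f}" for i
  proof -
    obtain j where j: "i = Suc j" "j < pdeg f" using i by (cases i) auto
    show ?thesis unfolding j(1) frob_chain_factor[OF assms j(2)]
      by (simp add: subst_xpow_pm[OF frob_chain_monic[OF assms j(2)]] Idl_pm in_PIdl_pm)
  qed
  then show ?thesis unfolding frobenius_step_def by blast
qed

end

section \<open>Evaluation of integer polynomials in commutative rings\<close>

context cring
begin

definition iz :: "int \<Rightarrow> 'a" where "iz k = add_pow R k \<one>"

text \<open>This is by definition the evaluation that occurs in \<open>roots_mod\<close>, so its
  properties apply to the roots of the statement directly.\<close>

definition ev :: "int poly \<Rightarrow> 'a \<Rightarrow> 'a" where "ev = int_poly_eval R"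

lemma iz_closed [simp]: "iz k \<in> carrier R"
  by (simp add: iz_def)

lemma iz_0 [simp]: "iz 0 = \<zero>"
  unfolding iz_def by (simp add: add_pow_def)

lemma iz_1 [simp]: "iz 1 = \<one>"
  unfolding iz_def by (rule add.int_pow_1) simp

lemma iz_add: "iz (a + b) = iz a \<oplus> iz b"
  unfolding iz_def by (rule add.int_pow_mult) simp

lemma iz_mult: "iz (a * b) = iz a \<otimes> iz b"
proof -
  have "iz (a * b) = add_pow R a (iz b)"
    unfolding iz_def by (simp add: add.int_pow_pow mult.commute)
  also have "\<dots> = add_pow R a (\<one> \<otimes> iz b)" by simp
  also have "\<dots> = add_pow R a \<one> \<otimes> iz b" by (rule add_pow_ldistr_int[symmetric]) simp_all
  finally show ?thesis by (simp add: iz_def)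
qed

lemma iz_minus: "iz (- a) = \<ominus> iz a"
  unfolding iz_def by (rule add.int_pow_neg) simp

lemma iz_diff: "iz (a - b) = iz a \<ominus> iz b"
  using iz_add[of a "- b"] by (simp add: iz_minus a_minus_def)

lemma iz_power: "iz (a ^ k) = iz a [^] k"
  by (induction k) (simp_all add: iz_mult m_comm)

lemma add_pow_int_iz: "x \<in> carrier R \<Longrightarrow> add_pow R (k :: int) x = iz k \<otimes> x"
  unfolding iz_def using add_pow_ldistr_int[of \<one> x k] by simp

lemma add_pow_nat_iz: "x \<in> carrier R \<Longrightarrow> add_pow R (k :: nat) x = iz (int k) \<otimes> x"
  using add_pow_int_iz[of x "int k"] by (simp add: add_pow_int_ge)

lemma iz_of_nat: "iz (int k) = add_pow R k \<one>"
  by (simp add: add_pow_nat_iz)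

lemma ev_eq_finsum:
  assumes x: "x \<in> carrier R" and N: "pdeg f \<le> N"
  shows "ev f x = (\<Oplus>i\<in>{..N}. iz (pcoeff f i) \<otimes> x [^] i)"
proof -
  have "ev f x = (\<Oplus>i\<in>{..pdeg f}. iz (pcoeff f i) \<otimes> x [^] i)"
    unfolding ev_def int_poly_eval_def by (rule finsum_cong') (use x in \<open>auto simp: add_pow_int_iz\<close>)
  also have "\<dots> = (\<Oplus>i\<in>{..N}. iz (pcoeff f i) \<otimes> x [^] i)"
    by (rule add.finprod_mono_neutral_cong_left) (use x N in \<open>auto simp: coeff_eq_0\<close>)
  finally show ?thesis .
qed

lemma ev_0 [simp]: "x \<in> carrier R \<Longrightarrow> ev 0 x = \<zero>"
  by (subst ev_eq_finsum[of _ _ 0]) auto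

lemma ev_pCons:
  assumes x: "x \<in> carrier R" shows "ev (pCons a f) x = iz a \<oplus> x \<otimes> ev f x"
proof -
  define N where "N = pdeg f"
  have "ev (pCons a f) x = (\<Oplus>i\<in>{..Suc N}. iz (pcoeff (pCons a f) i) \<otimes> x [^] i)"
    by (rule ev_eq_finsum[OF x]) (simp add: N_def degree_pCons_le)
  also have "\<dots> = (\<Oplus>i\<in>{..N}. iz (pcoeff (pCons a f) (Suc i)) \<otimes> x [^] (Suc i)) \<oplus> iz (pcoeff (pCons a f) 0) \<otimes> x [^] (0::nat)"
    by (rule finsum_Suc2) (use x in auto)
  also have "(\<Oplus>i\<in>{..N}. iz (pcoeff (pCons a f) (Suc i)) \<otimes> x [^] (Suc i)) = (\<Oplus>i\<in>{..N}. x \<otimes> (iz (pcoeff f i) \<otimes> x [^] i))"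
    by (rule finsum_cong') (use x in \<open>auto simp: m_ac\<close>)
  also have "\<dots> = x \<otimes> ev f x" using x by (simp add: ev_eq_finsum[of x f N] N_def finsum_rdistr)
  finally show ?thesis using x by (simp add: ev_eq_finsum[OF x order_refl] a_comm)
qed

lemma ev_closed [simp]: "x \<in> carrier R \<Longrightarrow> ev f x \<in> carrier R"
  by (induction f) (simp_all add: ev_pCons)

lemma ev_const [simp]: "x \<in> carrier R \<Longrightarrow> ev [:c:] x = iz c"
  by (simp add: ev_pCons)

lemma ev_1 [simp]: "x \<in> carrier R \<Longrightarrow> ev 1 x = \<one>"
  by (simp add: one_pCons ev_pCons)

lemma ev_add:
  assumes x: "x \<in> carrier R" shows "ev (f + g) x = ev f x \<oplus> ev g x"
proof (induction f arbitrary: g)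
  case (pCons a f)
  obtain b g' where g: "g = pCons b g'" by (cases g)
  have c: "ev f x \<in> carrier R" "ev g' x \<in> carrier R" "iz a \<in> carrier R" "iz b \<in> carrier R" using x by auto
  have "ev (pCons a f + g) x = (iz a \<oplus> iz b) \<oplus> x \<otimes> (ev f x \<oplus> ev g' x)"
    using x by (simp add: g ev_pCons pCons.IH iz_add)
  also have "\<dots> = (iz a \<oplus> x \<otimes> ev f x) \<oplus> (iz b \<oplus> x \<otimes> ev g' x)" using c x by algebra
  finally show ?case using x by (simp add: g ev_pCons)
qed (simp add: x)

lemma ev_smult:
  assumes x: "x \<in> carrier R" shows "ev (smult c f) x = iz c \<otimes> ev f x"
proof (induction f)
  case (pCons a f)
  have c: "ev f x \<in> carrier R" "iz a \<in> carrier R" "iz c \<in> carrier R" using x by auto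
  have "ev (smult c (pCons a f)) x = iz c \<otimes> iz a \<oplus> x \<otimes> (iz c \<otimes> ev f x)"
    using x by (simp add: ev_pCons pCons.IH iz_mult)
  also have "\<dots> = iz c \<otimes> (iz a \<oplus> x \<otimes> ev f x)" using c x by algebra
  finally show ?case using x by (simp add: ev_pCons)
qed (simp add: x)

lemma ev_mult:
  assumes x: "x \<in> carrier R" shows "ev (f * g) x = ev f x \<otimes> ev g x"
proof (induction f)
  case (pCons a f)
  have c: "ev f x \<in> carrier R" "ev g x \<in> carrier R" "iz a \<in> carrier R" using x by auto
  have "ev (pCons a f * g) x = iz a \<otimes> ev g x \<oplus> x \<otimes> (ev f x \<otimes> ev g x)"
    using x by (simp add: mult_pCons_left ev_add ev_smult ev_pCons pCons.IH)
  also have "\<dots> = (iz a \<oplus> x \<otimes> ev f x) \<otimes> ev g x" using c x by algebra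
  finally show ?case using x by (simp add: ev_pCons)
qed (simp add: x)

lemma ev_uminus: "x \<in> carrier R \<Longrightarrow> ev (- f) x = \<ominus> ev f x"
  using ev_smult[of x "-1" f] by (simp add: iz_minus l_minus)

lemma ev_diff: "x \<in> carrier R \<Longrightarrow> ev (f - g) x = ev f x \<ominus> ev g x"
  using ev_add[of x f "- g"] by (simp add: ev_uminus a_minus_def)

lemma ev_power: "x \<in> carrier R \<Longrightarrow> ev (f ^ k) x = ev f x [^] k"
  by (induction k) (simp_all add: ev_mult m_comm)

lemma ev_monom: "x \<in> carrier R \<Longrightarrow> ev (pmonom c k) x = iz c \<otimes> x [^] k"
proof (induction k)
  case (Suc k)
  have "ev (pmonom c (Suc k)) x = x \<otimes> ev (pmonom c k) x" using Suc.prems by (simp add: monom_Suc ev_pCons)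
  also have "\<dots> = iz c \<otimes> x [^] Suc k" using Suc by (simp add: m_ac)
  finally show ?case .
qed (simp add: monom_0)

lemma ev_xpow: "x \<in> carrier R \<Longrightarrow> ev (pmonom 1 k) x = x [^] k"
  by (simp add: ev_monom)

lemma ev_pcompose: "x \<in> carrier R \<Longrightarrow> ev (pcompose f g) x = ev f (ev g x)"
  by (induction f) (simp_all add: pcompose_pCons ev_add ev_mult ev_pCons)

text \<open>The induction is that of Horner's scheme. The expansion serves as in Newton's method: to
  separate roots from each other, and to compare \<open>f\<close> at a root with \<open>f\<close> at
  a power of this root.\<close>

lemma ev_taylor:
  assumes x: "x \<in> carrier R" and d: "d \<in> carrier R"
  shows "\<exists>w\<in>carrier R. ev f (x \<oplus> d) = ev f x \<oplus> d \<otimes> ev (pderiv f) x \<oplus> d \<otimes> d \<otimes> w"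
proof (induction f)
  case 0 show ?case using x d by (intro bexI[of _ \<zero>]) auto
next
  case (pCons a f)
  then obtain w where w: "w \<in> carrier R" "ev f (x \<oplus> d) = ev f x \<oplus> d \<otimes> ev (pderiv f) x \<oplus> d \<otimes> d \<otimes> w" by blast
  define A B where "A = ev f x" and "B = ev (pderiv f) x"
  have c: "A \<in> carrier R" "B \<in> carrier R" "iz a \<in> carrier R" using x by (auto simp: A_def B_def)
  have "ev (pCons a f) (x \<oplus> d) = iz a \<oplus> (x \<oplus> d) \<otimes> (A \<oplus> d \<otimes> B \<oplus> d \<otimes> d \<otimes> w)"
    using x d by (simp add: ev_pCons w(2) A_def B_def)
  also have "\<dots> = (iz a \<oplus> x \<otimes> A) \<oplus> d \<otimes> (A \<oplus> x \<otimes> B) \<oplus> d \<otimes> d \<otimes> (B \<oplus> (x \<oplus> d) \<otimes> w)"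
    using c x d w(1) by algebra
  also have "iz a \<oplus> x \<otimes> A = ev (pCons a f) x" using x by (simp add: ev_pCons A_def)
  also have "A \<oplus> x \<otimes> B = ev (pderiv (pCons a f)) x"
    using x by (simp add: pderiv_pCons ev_add ev_pCons A_def B_def)
  finally show ?case using c x d w(1) by (intro bexI[of _ "B \<oplus> (x \<oplus> d) \<otimes> w"]) auto
qed

lemma ev_pcong:
  assumes x: "x \<in> carrier R" and c: "pcong m f g"
  shows "\<exists>w\<in>carrier R. ev f x = ev g x \<oplus> iz m \<otimes> w"
proof -
  obtain e where "f = g + smult m e" using c unfolding pcong_witness by blast
  then have "ev f x = ev g x \<oplus> iz m \<otimes> ev e x" using x by (simp add: ev_add ev_smult)
  then show ?thesis using x ev_closed by blast
qed

lemma ev_pcong_eq: "x \<in> carrier R \<Longrightarrow> pcong m f g \<Longrightarrow> iz m = \<zero> \<Longrightarrow> ev f x = ev g x"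
  using ev_pcong[of x m f g] by auto

section \<open>Horner's scheme and zeros with unit differences\<close>

primrec hor :: "'a list \<Rightarrow> 'a \<Rightarrow> 'a" where
  "hor [] x = \<zero>"
| "hor (a # p) x = a \<oplus> x \<otimes> hor p x"

lemma hor_closed [simp]: "set p \<subseteq> carrier R \<Longrightarrow> x \<in> carrier R \<Longrightarrow> hor p x \<in> carrier R"
  by (induction p) auto

text \<open>Synthetic division by \<open>X - x\<close>: the coefficients are the Horner values at
  \<open>x\<close> of the tails of \<open>p\<close>. The lists have entries in the ring, with the
  constant term first, because such a division leaves the integer coefficients.\<close>

primrec horner_quotient :: "'a list \<Rightarrow> 'a \<Rightarrow> 'a list" where
  "horner_quotient [] x = []"
| "horner_quotient (a # p) x = (if p = [] then [] else hor p x # horner_quotient p x)"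

lemma length_horner_quotient: "length (horner_quotient p x) = length p - 1"
  by (induction p) auto

lemma set_horner_quotient: "set p \<subseteq> carrier R \<Longrightarrow> x \<in> carrier R \<Longrightarrow> set (horner_quotient p x) \<subseteq> carrier R"
  by (induction p) auto

lemma hor_quotient:
  assumes "set p \<subseteq> carrier R" "x \<in> carrier R" "y \<in> carrier R"
  shows "hor p y = hor p x \<oplus> (y \<ominus> x) \<otimes> hor (horner_quotient p x) y"
  using assms(1)
proof (induction p)
  case Nil then show ?case using assms by simp
next
  case (Cons a p)
  show ?case
  proof (cases "p = []")
    case True then show ?thesis using Cons assms by simp
  next
    case False
    define A B C where "A = hor p x" and "B = hor (horner_quotient p x) y" and "C = hor p y"
    have c: "a \<in> carrier R" "A \<in> carrier R" "B \<in> carrier R" using Cons.prems assms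
      by (auto simp: A_def B_def set_horner_quotient)
    have C: "C = A \<oplus> (y \<ominus> x) \<otimes> B" using Cons by (simp add: A_def B_def C_def)
    have "a \<oplus> y \<otimes> (A \<oplus> (y \<ominus> x) \<otimes> B) = (a \<oplus> x \<otimes> A) \<oplus> (y \<ominus> x) \<otimes> (A \<oplus> y \<otimes> B)"
      using c assms by algebra
    then show ?thesis using False C by (simp add: A_def B_def C_def)
  qed
qed

lemma horner_quotient_zero:
  assumes "x \<in> carrier R"
  shows "set p \<subseteq> carrier R \<Longrightarrow> set (horner_quotient p x) \<subseteq> {\<zero>} \<Longrightarrow> hor p x = \<zero> \<Longrightarrow> set p \<subseteq> {\<zero>}"
proof (induction p)
  case (Cons a p)
  show ?case
  proof (cases "p = []")
    case True then show ?thesis using Cons assms by simp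
  next
    case False
    then have z: "hor p x = \<zero>" "set (horner_quotient p x) \<subseteq> {\<zero>}" using Cons.prems(2) by auto
    then have "set p \<subseteq> {\<zero>}" using Cons by simp
    moreover have "a = \<zero>" using Cons.prems z(1) assms by simp
    ultimately show ?thesis by simp
  qed
qed simp

text \<open>Divide by \<open>X - x\<close> for one zero \<open>x\<close>: at each other zero
  \<open>y\<close> the unit \<open>y - x\<close> cancels, so the quotient keeps the remaining zeros.
  Unit differences take the place of an integral domain.\<close>

lemma hor_zero:
  assumes "finite S" "S \<subseteq> carrier R" "set p \<subseteq> carrier R" "length p \<le> card S"
    "\<And>x y. x \<in> S \<Longrightarrow> y \<in> S \<Longrightarrow> x \<noteq> y \<Longrightarrow> y \<ominus> x \<in> Units R"
    "\<And>x. x \<in> S \<Longrightarrow> hor p x = \<zero>"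
  shows "set p \<subseteq> {\<zero>}"
  using assms
proof (induction S arbitrary: p rule: finite_induct)
  case (insert x S)
  have x: "x \<in> carrier R" using insert by simp
  let ?q = "horner_quotient p x"
  have q: "set ?q \<subseteq> carrier R" using insert.prems x by (simp add: set_horner_quotient)
  have "set ?q \<subseteq> {\<zero>}"
  proof (rule insert.IH)
    show "S \<subseteq> carrier R" "set ?q \<subseteq> carrier R" using insert q by auto
    show "length ?q \<le> card S" using insert by (simp add: length_horner_quotient)
    show "y \<ominus> z \<in> Units R" if "z \<in> S" "y \<in> S" "z \<noteq> y" for z y using insert.prems(4)[of z y] that by simp
    fix y assume y: "y \<in> S"
    have yc: "y \<in> carrier R" using y insert by auto
    have u: "y \<ominus> x \<in> Units R" using insert.prems(4)[of x y] y insert.hyps by auto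
    have "hor p y = hor p x \<oplus> (y \<ominus> x) \<otimes> hor ?q y" by (rule hor_quotient) (use insert.prems x yc in auto)
    then have "(y \<ominus> x) \<otimes> hor ?q y = \<zero>" using insert.prems(5) y x yc q by simp
    then have "(y \<ominus> x) \<otimes> hor ?q y = (y \<ominus> x) \<otimes> \<zero>" using x yc by simp
    then show "hor ?q y = \<zero>" using Units_l_cancel[OF u, of "hor ?q y" \<zero>] q yc by simp
  qed
  then show ?case using horner_quotient_zero[OF x] insert.prems by simp
qed simp

lemma ev_hor: "x \<in> carrier R \<Longrightarrow> ev f x = hor (map iz (coeffs f)) x"
proof (induction f)
  case (pCons a f)
  then show ?case by (cases "f = 0 \<and> a = 0") (auto simp: ev_pCons cCons_def)
qed simp

lemma iz_coeff_eq_0: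
  assumes S: "finite S" "S \<subseteq> carrier R"
    "\<And>x y. x \<in> S \<Longrightarrow> y \<in> S \<Longrightarrow> x \<noteq> y \<Longrightarrow> y \<ominus> x \<in> Units R"
    and z: "\<And>x. x \<in> S \<Longrightarrow> ev g x = \<zero>" and d: "\<And>i. i \<ge> card S \<Longrightarrow> pcoeff g i = 0"
  shows "iz (pcoeff g i) = \<zero>"
proof (cases "g = 0")
  case False
  have "pdeg g < card S" using d[of "pdeg g"] False by (metis leading_coeff_0_iff not_le)
  then have l: "length (coeffs g) \<le> card S" using False by (simp add: length_coeffs_degree)
  have "set (map iz (coeffs g)) \<subseteq> {\<zero>}"
  proof (rule hor_zero[OF S(1,2)])
    show "set (map iz (coeffs g)) \<subseteq> carrier R" by auto
    show "length (map iz (coeffs g)) \<le> card S" using l by simp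
    show "\<And>x y. x \<in> S \<Longrightarrow> y \<in> S \<Longrightarrow> x \<noteq> y \<Longrightarrow> y \<ominus> x \<in> Units R" by (rule S(3))
    fix x assume "x \<in> S"
    then show "hor (map iz (coeffs g)) x = \<zero>" using z S(2) ev_hor[of x g] by auto
  qed
  then have z: "iz c = \<zero>" if "c \<in> set (coeffs g)" for c using that by auto
  show ?thesis
  proof (cases "i < length (coeffs g)")
    case True
    then have "pcoeff g i = coeffs g ! i" by (metis nth_default_coeffs_eq nth_default_nth)
    then show ?thesis using True by (simp add: z)
  next
    case False
    then have "pcoeff g i = 0" by (metis nth_default_coeffs_eq nth_default_beyond not_less)
    then show ?thesis by simp
  qed
qed simp

lemma ring_hom_iz:
  assumes "cring S" "h \<in> Ring.ring_hom R S" shows "h (iz k) = cring.iz S k"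
proof -
  interpret S: cring S by (rule assms(1))
  interpret h: RingHom.ring_hom_ring R S h using assms(2) by (intro ring_hom_ringI2 ring_axioms S.ring_axioms)
  have n: "h (iz (int k)) = S.iz (int k)" for k :: nat
    by (induction k) (simp_all add: iz_add S.iz_add add.commute[of 1])
  show ?thesis
  proof (cases "k \<ge> 0")
    case True then show ?thesis using n[of "nat k"] by simp
  next
    case False
    then have "h (iz (- int (nat (- k)))) = S.iz (- int (nat (- k)))"
      unfolding iz_minus S.iz_minus using n[of "nat (- k)"] by simp
    then show ?thesis using False by simp
  qed
qed

lemma ring_hom_ev:
  assumes "cring S" "h \<in> Ring.ring_hom R S" "x \<in> carrier R" shows "h (ev f x) = cring.ev S f (h x)"
proof -
  interpret S: cring S by (rule assms(1))
  interpret h: RingHom.ring_hom_ring R S h using assms(2) by (intro ring_hom_ringI2 ring_axioms S.ring_axioms)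
  show ?thesis using assms(3)
    by (induction f) (simp_all add: ev_pCons S.ev_pCons ring_hom_iz[OF assms(1,2)])
qed

end

section \<open>Roots in local rings\<close>

lemma pcong_pderiv: "pcong m a b \<Longrightarrow> pcong m (pderiv a) (pderiv b)"
  unfolding pcong_witness by (auto simp: pderiv_add pderiv_smult)

lemma pcong_monic_degree:
  assumes m: "m > 1" and c: "pcong m a b" and a: "monic a" and b: "monic b"
  shows "pdeg a = pdeg b"
proof (rule ccontr)
  assume "pdeg a \<noteq> pdeg b"
  moreover have False if "pdeg x < pdeg y" "pcong m x y" "monic y" for x y
  proof -
    have "pcoeff x (pdeg y) = 0" using that(1) by (rule coeff_eq_0)
    then have "0 mod m = 1 mod m" using that(2,3) unfolding pcong_coeff by metis
    then show False using m by simp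
  qed
  ultimately show False using c pcong_sym[OF c] a b by (meson linorder_neqE_nat)
qed

text \<open>Locality is stated through \<open>x\<close> and \<open>1 - x\<close>;
  \<open>unit_sumD\<close> and \<open>unit_addI\<close> turn this into the usual closure of the
  non-units under addition.\<close>

locale local_cring = cring +
  assumes one_not_zero [simp]: "\<one> \<noteq> \<zero>"
    and local: "x \<in> carrier R \<Longrightarrow> x \<in> Units R \<or> \<one> \<ominus> x \<in> Units R"
begin

lemma unit_factorD: "x \<otimes> y \<in> Units R \<Longrightarrow> x \<in> carrier R \<Longrightarrow> y \<in> carrier R \<Longrightarrow> x \<in> Units R \<and> y \<in> Units R"
  using unit_factor[of x y] unit_factor[of y x] m_comm by auto

lemma zero_not_unit [simp]: "\<zero> \<notin> Units R"
proof
  assume "\<zero> \<in> Units R"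
  then have "inv \<zero> \<otimes> \<zero> = \<one>" by (rule Units_l_inv)
  then show False using \<open>\<zero> \<in> Units R\<close> one_not_zero by (simp add: eq_commute[of \<zero>])
qed

text \<open>After division by the sum the two terms add up to 1, which is the situation of the
  axiom.\<close>

lemma unit_sumD:
  assumes x: "x \<in> carrier R" and y: "y \<in> carrier R" and u: "x \<oplus> y \<in> Units R"
  shows "x \<in> Units R \<or> y \<in> Units R"
proof -
  define v where "v = inv (x \<oplus> y)"
  have v: "v \<in> carrier R" "v \<otimes> (x \<oplus> y) = \<one>" using u by (auto simp: v_def)
  have "\<one> \<ominus> v \<otimes> x = v \<otimes> (x \<oplus> y) \<ominus> v \<otimes> x" by (simp add: v(2))
  also have "\<dots> = v \<otimes> y" using v(1) x y by algebra
  finally have "v \<otimes> x \<in> Units R \<or> v \<otimes> y \<in> Units R" using local[of "v \<otimes> x"] v x by simp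
  then show ?thesis using unit_factorD v x y by blast
qed

lemma unit_addI: "u \<in> Units R \<Longrightarrow> x \<in> carrier R \<Longrightarrow> x \<notin> Units R \<Longrightarrow> u \<oplus> x \<in> Units R"
proof (rule ccontr)
  assume u: "u \<in> Units R" and x: "x \<in> carrier R" "x \<notin> Units R" and n: "u \<oplus> x \<notin> Units R"
  have uc: "u \<in> carrier R" using u by (rule Units_closed)
  have "(u \<oplus> x) \<oplus> \<ominus> x = u" using uc x by algebra
  then have "\<ominus> x \<in> Units R" using unit_sumD[of "u \<oplus> x" "\<ominus> x"] n u uc x by auto
  then have "\<ominus> \<one> \<otimes> \<ominus> x \<in> Units R" by (rule Units_m_closed[OF Units_minus_one_closed])
  moreover have "\<ominus> \<one> \<otimes> \<ominus> x = x" using x by algebra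
  ultimately show False using x by simp
qed

lemma unit_mult_eq_zero: "u \<in> Units R \<Longrightarrow> x \<in> carrier R \<Longrightarrow> u \<otimes> x = \<zero> \<Longrightarrow> x = \<zero>"
  using Units_l_cancel[of u x \<zero>] Units_closed[of u] by simp

lemma prime_nondvd_unit:
  assumes p: "Factorial_Ring.prime p" "iz (int p) \<notin> Units R" and c: "\<not> int p dvd c"
  shows "iz c \<in> Units R"
proof -
  obtain c' where "int p dvd c' * c - 1" using prime_inverse_mod[of "int p" c] p(1) c by auto
  then obtain k where "c' * c = 1 + int p * k" by (metis add_diff_cancel_left' diff_add_cancel dvd_def add.commute)
  then have "iz c' \<otimes> iz c = \<one> \<oplus> iz (int p) \<otimes> iz k" by (metis iz_1 iz_add iz_mult)
  moreover have "iz (int p) \<otimes> iz k \<notin> Units R" using unit_factorD[of "iz (int p)" "iz k"] p(2) by auto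
  then have "\<one> \<oplus> iz (int p) \<otimes> iz k \<in> Units R" by (intro unit_addI) simp_all
  ultimately show ?thesis using unit_factorD[of "iz c'" "iz c"] by simp
qed

text \<open>At a root the Bezout relation becomes \<open>Res = v(a) f'(a)\<close>. For monic
  \<open>f\<close> the discriminant is the resultant up to sign, so \<open>Res\<close> is prime to
  \<open>p\<close> and hence a unit.\<close>

lemma separable_root_pderiv_unit:
  assumes p: "Factorial_Ring.prime p" "iz (int p) \<notin> Units R"
    and f: "monic f" "pdeg f \<ge> 1" "\<not> int p dvd discriminant f"
    and a: "a \<in> carrier R" "ev f a = \<zero>"
  shows "ev (pderiv f) a \<in> Units R"
proof -
  obtain u v where uv: "u * f + v * pderiv f = [:resultant f (pderiv f):]"
    using resultant_bezout[of f "pderiv f"] f by auto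
  have "\<not> int p dvd resultant f (pderiv f)"
    using f by (auto simp: discriminant_def)
  then have "iz (resultant f (pderiv f)) \<in> Units R" by (rule prime_nondvd_unit[OF p])
  moreover have "iz (resultant f (pderiv f)) = ev v a \<otimes> ev (pderiv f) a"
    using arg_cong[OF uv, of "\<lambda>g. ev g a"] a by (simp add: ev_add ev_mult)
  ultimately show ?thesis using unit_factorD[of "ev v a" "ev (pderiv f) a"] a by simp
qed

text \<open>With \<open>d = b - a\<close>, Taylor's formula reads
  \<open>0 = d (f'(a) + d w)\<close>. If \<open>d\<close> were not a unit, the bracket would be one,
  and \<open>d\<close> would vanish.\<close>

lemma root_diff_unit:
  assumes a: "a \<in> carrier R" "ev f a = \<zero>" "ev (pderiv f) a \<in> Units R"
    and b: "b \<in> carrier R" "ev f b = \<zero>" and ne: "a \<noteq> b"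
  shows "b \<ominus> a \<in> Units R"
proof (rule ccontr)
  assume n: "b \<ominus> a \<notin> Units R"
  define d where "d = b \<ominus> a"
  have d: "d \<in> carrier R" using a b by (simp add: d_def)
  have ad: "a \<oplus> d = b" unfolding d_def using a(1) b(1) by algebra
  obtain w where w: "w \<in> carrier R" "ev f (a \<oplus> d) = ev f a \<oplus> d \<otimes> ev (pderiv f) a \<oplus> d \<otimes> d \<otimes> w"
    using ev_taylor[OF a(1) d] by blast
  define e where "e = ev (pderiv f) a"
  have e: "e \<in> Units R" "e \<in> carrier R" using a by (auto simp: e_def)
  have "\<zero> = d \<otimes> e \<oplus> d \<otimes> d \<otimes> w" using w(2) a b ad d w(1) e by (simp add: e_def)
  also have "\<dots> = (e \<oplus> d \<otimes> w) \<otimes> d" using d e w(1) by algebra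
  finally have z: "(e \<oplus> d \<otimes> w) \<otimes> d = \<zero>" by simp
  have "d \<otimes> w \<notin> Units R" using n unit_factorD[of d w] d w(1) by (auto simp: d_def)
  then have "e \<oplus> d \<otimes> w \<in> Units R" using e d w(1) by (intro unit_addI) auto
  then have "d = \<zero>" using d z by (rule unit_mult_eq_zero)
  then show False using ne ad a by simp
qed

end

text \<open>The interface between the two halves: the pseudoprime argument uses these properties
  alone, and the p-adic half has to establish them for \<open>Zp_ur_mod\<close>. Through
  \<open>iz_eq_0_iff\<close> a vanishing coefficient becomes a congruence modulo
  \<open>p^r\<close>.\<close>

locale root_model = local_cring R for R (structure) +
  fixes p r :: nat and f :: "int poly"
  assumes prime_p: "Factorial_Ring.prime p" and r1: "r \<ge> 1"
    and iz_eq_0_iff: "iz k = \<zero> \<longleftrightarrow> int p ^ r dvd k"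
    and monic_f: "monic f" and deg_f: "pdeg f \<ge> 1" and disc: "\<not> int p dvd discriminant f"
    and card_T: "card {x \<in> carrier R. ev f x = \<zero>} = pdeg f"
begin

definition T :: "'a set" where "T = {x \<in> carrier R. ev f x = \<zero>}"

lemma card_T': "card T = pdeg f" using card_T by (simp add: T_def)

lemma finite_T: "finite T"
  using card_T' deg_f by (metis card.infinite not_one_le_zero)

lemma T_carrier: "x \<in> T \<Longrightarrow> x \<in> carrier R" and T_root: "x \<in> T \<Longrightarrow> ev f x = \<zero>"
  by (auto simp: T_def)

abbreviation q where "q \<equiv> int p ^ r"

lemma iz_q: "iz q = \<zero>" by (simp add: iz_eq_0_iff)

lemma iz_p_not_unit: "iz (int p) \<notin> Units R"
proof
  assume "iz (int p) \<in> Units R"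
  then have "iz (int p) [^] r \<in> Units R" by (rule Units_pow_closed)
  moreover have "iz (int p) [^] r = \<zero>" using iz_q by (simp only: iz_power)
  ultimately show False using zero_not_unit by simp
qed

lemmas iz_unit = prime_nondvd_unit[OF prime_p iz_p_not_unit]

lemma iz_p_mult_not_unit: "w \<in> carrier R \<Longrightarrow> iz (int p) \<otimes> w \<notin> Units R"
  using unit_factorD[OF _ iz_closed, of "int p" w] iz_p_not_unit by blast

lemma ev_pderiv_unit: "a \<in> T \<Longrightarrow> ev (pderiv f) a \<in> Units R"
  by (rule separable_root_pderiv_unit[OF prime_p iz_p_not_unit monic_f deg_f disc T_carrier T_root])

lemma diff_unit: "a \<in> T \<Longrightarrow> b \<in> T \<Longrightarrow> a \<noteq> b \<Longrightarrow> b \<ominus> a \<in> Units R"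
  by (rule root_diff_unit[OF T_carrier T_root ev_pderiv_unit T_carrier T_root])

lemma vanish:
  assumes "S \<subseteq> T" "\<And>x. x \<in> S \<Longrightarrow> ev g x = \<zero>" "\<And>i. i \<ge> card S \<Longrightarrow> pcoeff g i = 0"
  shows "pcong q g 0"
proof -
  have "iz (pcoeff g i) = \<zero>" for i
  proof (rule iz_coeff_eq_0)
    show "finite S" "S \<subseteq> carrier R" using assms(1) finite_T T_carrier finite_subset by auto
    show "y \<ominus> x \<in> Units R" if "x \<in> S" "y \<in> S" "x \<noteq> y" for x y using diff_unit that assms(1) by blast
  qed (use assms in auto)
  then show ?thesis by (simp add: pcong_def const_poly_dvd_iff iz_eq_0_iff)
qed

text \<open>Multiplication by \<open>p^(r-1)\<close> turns vanishing modulo \<open>p\<close> into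
  vanishing in the ring, whose characteristic is \<open>p^r\<close>; afterwards the factor is
  cancelled from the congruence.\<close>

lemma vanish_mod_p:
  assumes S: "S \<subseteq> T" and z: "\<And>x. x \<in> S \<Longrightarrow> \<exists>w\<in>carrier R. ev g x = iz (int p) \<otimes> w" and d: "\<And>i. i \<ge> card S \<Longrightarrow> pcoeff g i = 0"
  shows "pcong (int p) g 0"
proof -
  let ?g = "smult (int p ^ (r - 1)) g"
  have qq: "int p ^ (r - 1) * int p = q" using r1 by (simp flip: power_Suc2)
  have "pcong q ?g 0"
  proof (rule vanish[OF S])
    fix x assume x: "x \<in> S"
    then obtain w where w: "w \<in> carrier R" "ev g x = iz (int p) \<otimes> w" using z by blast
    have xc: "x \<in> carrier R" using x S T_carrier by auto
    have "ev ?g x = iz (int p ^ (r - 1)) \<otimes> (iz (int p) \<otimes> w)" using xc w by (simp add: ev_smult)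
    also have "\<dots> = iz (int p ^ (r - 1) * int p) \<otimes> w" using w by (simp add: iz_mult m_assoc)
    also have "\<dots> = \<zero>" unfolding qq iz_q using w by simp
    finally show "ev ?g x = \<zero>" .
  qed (use d in simp)
  then have "int p ^ (r - 1) * int p dvd int p ^ (r - 1) * pcoeff g i" for i
    unfolding qq by (simp add: pcong_def const_poly_dvd_iff)
  then have "int p dvd pcoeff g i" for i using prime_p by (metis dvd_times_left_cancel_iff not_prime_0 of_nat_eq_0_iff power_not_zero)
  then show ?thesis by (simp add: pcong_def const_poly_dvd_iff)
qed

lemma monic_not_pcong_0: "monic h \<Longrightarrow> m > 1 \<Longrightarrow> \<not> pcong m h 0"
  unfolding pcong_coeff by (metis coeff_0 mod_0 mod_pos_pos_trivial one_less_numeral_iff zero_le_one zero_neq_one)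

text \<open>With fewer coefficients than needed a monic polynomial would vanish modulo
  \<open>p\<close>. This lower bound is what pins down the degree of a gcd modulo \<open>p\<close>
  in \<open>local_gcmd\<close>.\<close>

lemma card_le_degree_mod_p:
  assumes S: "S \<subseteq> T" and h: "monic h" and z: "\<And>x. x \<in> S \<Longrightarrow> \<exists>w\<in>carrier R. ev h x = iz (int p) \<otimes> w"
  shows "card S \<le> pdeg h"
proof (rule ccontr)
  assume "\<not> card S \<le> pdeg h"
  then have "pcong (int p) h 0" by (intro vanish_mod_p[OF S z]) (auto intro: coeff_eq_0)
  moreover have "int p > 1" using prime_gt_1_nat[OF prime_p] by simp
  ultimately show False using monic_not_pcong_0[OF h] by blast
qed

lemma card_le_degree:
  assumes S: "S \<subseteq> T" and h: "monic h" and z: "\<And>x. x \<in> S \<Longrightarrow> ev h x = \<zero>"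
  shows "card S \<le> pdeg h"
proof (rule card_le_degree_mod_p[OF S h])
  fix x assume "x \<in> S" then show "\<exists>w\<in>carrier R. ev h x = iz (int p) \<otimes> w" using z by (intro bexI[of _ \<zero>]) auto
qed

text \<open>The remainder on division by \<open>h\<close> also vanishes on \<open>S\<close>, and its
  degree is too small for that many zeros.\<close>

lemma vanish_imp_dvd:
  assumes S: "S \<subseteq> T" and h: "monic h" "pdeg h = card S" "\<And>x. x \<in> S \<Longrightarrow> ev h x = \<zero>"
    and y: "\<And>x. x \<in> S \<Longrightarrow> ev y x = \<zero>"
  shows "\<exists>k. pcong q y (h * k)"
proof -
  obtain k s where ks: "y = h * k + s" "s = 0 \<or> pdeg s < pdeg h" using monic_division[OF h(1)] by blast
  have "pcong q s 0"
  proof (rule vanish[OF S])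
    fix x assume x: "x \<in> S"
    then have xc: "x \<in> carrier R" using S T_carrier by auto
    have "s = y - h * k" using ks by simp
    then show "ev s x = \<zero>" using xc x y h(3) by (simp add: ev_diff ev_mult a_minus_def)
  next
    fix i assume "i \<ge> card S"
    then show "pcoeff s i = 0" using ks(2) h(2) by (cases "s = 0") (auto intro: coeff_eq_0)
  qed
  then show ?thesis using ks(1) by (intro exI[of _ k]) (simp add: pcong_def)
qed

text \<open>By the product rule the unit \<open>f'(a)\<close> is a combination of the values of
  \<open>F\<close> and \<open>G\<close> at \<open>a\<close>. This keeps factors split off in
  different rounds from sharing a root.\<close>

lemma no_double_root:
  assumes a: "a \<in> T" and m: "iz m = \<zero>" and c: "pcong m f (A * (F * G))"
  shows "ev F a \<in> Units R \<or> ev G a \<in> Units R"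
proof (rule ccontr)
  assume n: "\<not> ?thesis"
  have ac: "a \<in> carrier R" by (rule T_carrier[OF a])
  let ?A = "ev A a" let ?F = "ev F a" let ?G = "ev G a"
  let ?A' = "ev (pderiv A) a" let ?F' = "ev (pderiv F) a" let ?G' = "ev (pderiv G) a"
  have "pcong m (pderiv f) (pderiv (A * (F * G)))" using c by (rule pcong_pderiv)
  then have "ev (pderiv f) a = ev (pderiv (A * (F * G))) a" using ac m by (intro ev_pcong_eq)
  also have "\<dots> = ?A \<otimes> (?F \<otimes> ?G' \<oplus> ?G \<otimes> ?F') \<oplus> ?F \<otimes> ?G \<otimes> ?A'"
    using ac by (simp add: pderiv_mult ev_add ev_mult)
  also have "\<dots> = ?F \<otimes> (?A \<otimes> ?G' \<oplus> ?G \<otimes> ?A') \<oplus> ?G \<otimes> (?A \<otimes> ?F')"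
    using ev_closed[OF ac] by algebra
  finally have "?F \<otimes> (?A \<otimes> ?G' \<oplus> ?G \<otimes> ?A') \<oplus> ?G \<otimes> (?A \<otimes> ?F') \<in> Units R"
    using ev_pderiv_unit[OF a] by simp
  then have "?F \<otimes> (?A \<otimes> ?G' \<oplus> ?G \<otimes> ?A') \<in> Units R \<or> ?G \<otimes> (?A \<otimes> ?F') \<in> Units R"
    using ac by (intro unit_sumD) auto
  then show False using n ac unit_factorD[of ?F "?A \<otimes> ?G' \<oplus> ?G \<otimes> ?A'"] unit_factorD[of ?G "?A \<otimes> ?F'"] by auto
qed

section \<open>The power map on the roots and the factors of f\<close>

definition \<phi> :: "nat \<Rightarrow> 'a \<Rightarrow> 'a" where "\<phi> n x = x [^] n"

lemma funpow_\<phi>: "x \<in> carrier R \<Longrightarrow> (\<phi> n ^^ i) x = x [^] (n ^ i)"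
  by (induction i) (simp_all add: \<phi>_def nat_pow_pow mult.commute)

lemma ev_frob_poly: "x \<in> carrier R \<Longrightarrow> ev (pmonom 1 (n ^ i) - pmonom 1 1) x = (\<phi> n ^^ i) x \<ominus> x"
  by (simp add: ev_diff ev_xpow funpow_\<phi>)

text \<open>Every root is a zero of exactly one \<open>F i\<close>, and \<open>F i\<close> has at
  most \<open>pdeg (F i)\<close> of them as zeros; as the degrees add up to the number of roots,
  equality holds for each \<open>i\<close>. Since \<open>F i\<close> divides
  \<open>x^(n^i) - x\<close>, its zeros have period \<open>i\<close>, and the Bezout part of the
  gcmd excludes shorter periods.\<close>

lemma orbit_split_by_factors:
  assumes n: "n > 1" "q dvd int n"
    and chain: "zmod_poly.frob_chain n f (pdeg f) F g" and last: "g (pdeg f) = 1"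
    and frob: "\<forall>i\<in>{2..pdeg f}. \<exists>k. pcong (int n) (pcompose (F i) (pmonom 1 n)) (F i * k)"
  shows "bij_betw (\<phi> n) T T" "\<And>i. 1 \<le> i \<Longrightarrow> i \<le> pdeg f \<Longrightarrow> i * cycle_type (\<phi> n) T i = pdeg (F i)"
proof -
  interpret zmod_poly n by (rule zmod_poly.intro[OF n(1)])
  define d where "d = pdeg f"
  have izn: "iz (int n) = \<zero>" using n(2) by (simp add: iz_eq_0_iff)
  have g0: "g 0 = f" and mg: "\<And>i. i \<le> d \<Longrightarrow> monic (g i)"
    and rel: "\<And>i. i < d \<Longrightarrow> gcmd_rel (int n) (pmonom 1 (n ^ Suc i) - pmonom 1 1) (g i) (F (Suc i))"
    and fac: "\<And>i. i < d \<Longrightarrow> pcong (int n) (g i) (F (Suc i) * g (Suc i))"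
    using chain by (auto simp: frob_chain_def d_def)
  have mF: "monic (F (Suc i))" if "i < d" for i using rel[OF that] by (simp add: gcmd_rel_def)
  have evc: "ev a x = ev b x" if "pcong (int n) a b" "x \<in> carrier R" for a b x
    using ev_pcong_eq[OF that(2,1) izn] .
  have gF: "ev (g i) x = ev (F (Suc i)) x \<otimes> ev (g (Suc i)) x" if "i < d" "x \<in> carrier R" for i x
    using evc[OF fac[OF that(1)] that(2)] that(2) by (simp add: ev_mult)
  \<comment> \<open>\<open>no_double_root\<close> concerns factors of \<open>f\<close> itself, so
    each \<open>g i\<close> is first exhibited as a divisor of \<open>f\<close> modulo
    \<open>n\<close>.\<close>
  have cof: "\<exists>A. pcong (int n) f (A * g i)" if "i \<le> d" for i using that
  proof (induction i)
    case 0 show ?case by (rule exI[of _ 1]) (simp add: g0)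
  next
    case (Suc i)
    then obtain A where A: "pcong (int n) f (A * g i)" by auto
    have "pcong (int n) (A * g i) (A * (F (Suc i) * g (Suc i)))" using Suc.prems by (intro pcong_mult pcong_refl fac) simp
    then have "pcong (int n) f ((A * F (Suc i)) * g (Suc i))" using A by (metis mult.assoc pcong_trans)
    then show ?case by blast
  qed
  have nd: "ev (F (Suc i)) a \<in> Units R \<or> ev (g (Suc i)) a \<in> Units R" if i: "i < d" and a: "a \<in> T" for i a
  proof -
    obtain A where A: "pcong (int n) f (A * g i)" using cof[of i] i by auto
    have "pcong (int n) (A * g i) (A * (F (Suc i) * g (Suc i)))" by (intro pcong_mult pcong_refl fac i)
    then have "pcong (int n) f (A * (F (Suc i) * g (Suc i)))" using A pcong_trans by blast
    then show ?thesis by (rule no_double_root[OF a izn])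
  qed
  have up: "ev (g j) a = \<zero>" if "ev (g i) a = \<zero>" "j \<le> i" "i \<le> d" "a \<in> carrier R" for i j a
    using that(2,1,3)
  proof (induction rule: dec_induct)
    case (step k)
    have "ev (g k) a = \<zero>" using gF[of k a] step that(4) by simp
    then show ?case using step by simp
  qed auto
  define Tp where "Tp i = {a \<in> T. ev (F i) a = \<zero>}" for i
  have Fg: "ev (g i) a = \<zero>" if "i < d" "a \<in> Tp (Suc i)" for i a
    using that gF[of i a] T_carrier[of a] by (simp add: Tp_def)
  have uniq0: False if ij: "i < j" "j < d" and a: "a \<in> Tp (Suc i)" "a \<in> Tp (Suc j)" for i j a
  proof -
    have aT: "a \<in> T" using a by (simp add: Tp_def)
    have "ev (g j) a = \<zero>" by (rule Fg[OF ij(2) a(2)])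
    then have "ev (g (Suc i)) a = \<zero>" using up[of j a "Suc i"] ij T_carrier[OF aT] by simp
    then show False using nd[of i a] ij aT a(1) by (simp add: Tp_def)
  qed
  have ex: "\<exists>i<d. a \<in> Tp (Suc i)" if a: "a \<in> T" for a
  proof -
    have ac: "a \<in> carrier R" by (rule T_carrier[OF a])
    \<comment> \<open>\<open>k\<close> is the first stage at which \<open>a\<close> is no longer a
      zero; it exists because the last \<open>g\<close> is 1. There the values of \<open>F k\<close>
      and \<open>g k\<close> have product 0 and one of them is a unit. It cannot be that of
      \<open>F k\<close>, so \<open>g k\<close> is a unit at \<open>a\<close> and \<open>F k\<close>
      vanishes.\<close>
    define k where "k = (LEAST k. ev (g k) a \<noteq> \<zero>)"
    have gd: "ev (g d) a \<noteq> \<zero>" using last ac by (simp add: d_def)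
    then have k: "ev (g k) a \<noteq> \<zero>" unfolding k_def by (rule LeastI)
    have kd: "k \<le> d" unfolding k_def using gd by (rule Least_le)
    have "k \<noteq> 0" using k g0 T_root[OF a] by metis
    then obtain i where i: "k = Suc i" by (cases k) auto
    have "ev (g i) a = \<zero>" using not_less_Least[of i "\<lambda>k. ev (g k) a \<noteq> \<zero>"] i by (simp add: k_def)
    then have z: "ev (F (Suc i)) a \<otimes> ev (g (Suc i)) a = \<zero>" using gF[of i a] i kd ac by simp
    have "ev (F (Suc i)) a \<notin> Units R"
      using unit_mult_eq_zero[OF _ _ z] k i ac by auto
    then have "ev (g (Suc i)) a \<in> Units R" using nd[of i a] i kd a by auto
    moreover have "ev (g (Suc i)) a \<otimes> ev (F (Suc i)) a = \<zero>" using z m_comm[OF ev_closed[OF ac] ev_closed[OF ac]] by metis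
    ultimately have "ev (F (Suc i)) a = \<zero>" using ev_closed[OF ac] unit_mult_eq_zero by blast
    then have "a \<in> Tp (Suc i)" "i < d" using a i kd by (auto simp: Tp_def)
    then show ?thesis by blast
  qed
  have Tsub: "Tp i \<subseteq> T" for i unfolding Tp_def by blast
  have TU: "T = (\<Union>i\<in>{..<d}. Tp (Suc i))"
  proof (rule equalityI; rule subsetI)
    fix a assume "a \<in> T" then show "a \<in> (\<Union>i\<in>{..<d}. Tp (Suc i))" using ex by blast
  next
    fix a assume "a \<in> (\<Union>i\<in>{..<d}. Tp (Suc i))" then show "a \<in> T" using Tsub by blast
  qed
  have cle: "card (Tp (Suc i)) \<le> pdeg (F (Suc i))" if "i < d" for i
    by (rule card_le_degree[OF Tsub mF[OF that]]) (simp add: Tp_def)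
  have cT: "card T = (\<Sum>i<d. card (Tp (Suc i)))"
  proof -
    have "card (\<Union>i\<in>{..<d}. Tp (Suc i)) = (\<Sum>i\<in>{..<d}. card (Tp (Suc i)))"
    proof (rule card_UN_disjoint)
      show "\<forall>i\<in>{..<d}. finite (Tp (Suc i))" by (intro ballI finite_subset[OF Tsub finite_T])
      show "\<forall>i\<in>{..<d}. \<forall>j\<in>{..<d}. i \<noteq> j \<longrightarrow> Tp (Suc i) \<inter> Tp (Suc j) = {}"
      proof (intro ballI impI equals0I)
        fix i j x assume "i \<in> {..<d}" "j \<in> {..<d}" "i \<noteq> j" "x \<in> Tp (Suc i) \<inter> Tp (Suc j)"
        then show False using uniq0[of i j x] uniq0[of j i x] by (cases i j rule: linorder_cases) auto
      qed
    qed simp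
    then show ?thesis using TU by simp
  qed
  have degs: "pdeg (g 0) = (\<Sum>i<k. pdeg (F (Suc i))) + pdeg (g k)" if "k \<le> d" for k using that
  proof (induction k)
    case (Suc k)
    have m: "monic (F (Suc k))" "monic (g (Suc k))" using Suc.prems mF mg by auto
    have "monic (F (Suc k) * g (Suc k))" using m by (rule monic_mult)
    then have "pdeg (g k) = pdeg (F (Suc k) * g (Suc k))"
      using pcong_monic_degree[OF int_n fac[of k]] mg[of k] Suc.prems by simp
    then show ?case using Suc degree_monic_mult[OF m] by simp
  qed simp
  have sumd: "(\<Sum>i<d. pdeg (F (Suc i))) = d" using degs[of d] last g0 by (simp add: d_def)
  \<comment> \<open>A single strict inequality would make the total number of roots smaller than
    \<open>d\<close>.\<close>
  have ceq: "card (Tp (Suc i)) = pdeg (F (Suc i))" if "i < d" for i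
  proof (rule ccontr)
    assume "card (Tp (Suc i)) \<noteq> pdeg (F (Suc i))"
    then have "card (Tp (Suc i)) < pdeg (F (Suc i))" using cle[OF that] by simp
    then have "(\<Sum>i<d. card (Tp (Suc i))) < (\<Sum>i<d. pdeg (F (Suc i)))" using that cle by (intro sum_strict_mono_ex1) auto
    then show False using cT card_T' sumd by (simp add: d_def)
  qed
  have per: "(\<phi> n ^^ Suc i) a = a" if i: "i < d" and a: "a \<in> Tp (Suc i)" for i a
  proof -
    have ac: "a \<in> carrier R" using a T_carrier by (simp add: Tp_def)
    obtain u where "pcong (int n) (pmonom 1 (n ^ Suc i) - pmonom 1 1) (F (Suc i) * u)" using rel[OF i] by (auto simp: gcmd_rel_def)
    from evc[OF this ac] have "(\<phi> n ^^ Suc i) a \<ominus> a = \<zero>" using a ac unfolding ev_frob_poly[OF ac] by (simp add: ev_mult Tp_def)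
    moreover have "(\<phi> n ^^ Suc i) a \<in> carrier R" using ac by (simp only: funpow_\<phi> nat_pow_closed)
    ultimately show ?thesis using ac by (metis minus_equality r_neg minus_eq add.inv_closed a_comm local.minus_minus)
  qed
  \<comment> \<open>The Frobenius step starts at 2; for \<open>F 1\<close>, the case
    \<open>i = 0\<close>, invariance holds because the zeros are fixed points.\<close>
  have inv: "\<phi> n a \<in> Tp (Suc i)" if i: "i < d" and a: "a \<in> Tp (Suc i)" for i a
  proof (cases "i = 0")
    case True then show ?thesis using per[OF i a] a by simp
  next
    case False
    have ac: "a \<in> carrier R" using a T_carrier by (simp add: Tp_def)
    then have pc: "\<phi> n a \<in> carrier R" by (simp add: \<phi>_def)
    have si: "Suc i \<in> {2..pdeg f}" using i False by (simp add: d_def)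
    obtain k where k: "pcong (int n) (pcompose (F (Suc i)) (pmonom 1 n)) (F (Suc i) * k)" using frob si by blast
    from evc[OF k ac] have z: "ev (F (Suc i)) (\<phi> n a) = \<zero>" using a ac by (simp add: ev_pcompose ev_xpow ev_mult \<phi>_def Tp_def)
    then have "ev (g i) (\<phi> n a) = \<zero>" using gF[OF i pc] pc by simp
    then have "ev (g 0) (\<phi> n a) = \<zero>" using up[of i "\<phi> n a" 0] i pc by simp
    then show ?thesis using z pc by (simp add: Tp_def T_def g0)
  qed
  have im: "\<phi> n ` T = T"
  proof
    show "\<phi> n ` T \<subseteq> T"
    proof (rule image_subsetI)
      fix a assume "a \<in> T"
      then obtain i where "i < d" "a \<in> Tp (Suc i)" using ex by blast
      then show "\<phi> n a \<in> T" using inv[of i a] Tsub by blast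
    qed
    show "T \<subseteq> \<phi> n ` T"
    proof
      fix a assume "a \<in> T"
      then obtain i where i: "i < d" "a \<in> Tp (Suc i)" using ex by blast
      have "\<phi> n ` Tp (Suc i) \<subseteq> Tp (Suc i)" by (rule image_subsetI) (rule inv[OF i(1)])
      then have "(\<phi> n ^^ i) a \<in> Tp (Suc i)" using i(2) by (rule funpow_in_set)
      then have "(\<phi> n ^^ i) a \<in> T" using Tsub by blast
      moreover have "a = \<phi> n ((\<phi> n ^^ i) a)" using per[OF i] by simp
      ultimately show "a \<in> \<phi> n ` T" by (rule rev_image_eqI)
    qed
  qed
  then show bij: "bij_betw (\<phi> n) T T" by (simp add: bij_betw_def eq_card_imp_inj_on[OF finite_T])
  have orb: "card (orbit (\<phi> n) a) = Suc i" if i: "i < d" and a: "a \<in> Tp (Suc i)" for i a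
  proof (rule card_orbit_eq_period[OF per[OF i a]])
    have aT: "a \<in> T" and ac: "a \<in> carrier R" using a T_carrier by (auto simp: Tp_def)
    fix j assume j: "0 < j" "j < Suc i"
    then obtain k where k: "j = Suc k" by (cases j) auto
    have kd: "k < d" using k j i by simp
    \<comment> \<open>If the smaller \<open>j\<close> were a period, \<open>a\<close> would be a
      zero of \<open>x^(n^j) - x\<close> and of \<open>g (j - 1)\<close>, hence of their combination
      \<open>F j\<close>; but it is already a zero of the later factor
      \<open>F (Suc i)\<close>.\<close>
    show "(\<phi> n ^^ j) a \<noteq> a"
    proof
      assume "(\<phi> n ^^ j) a = a"
      then have z: "ev (pmonom 1 (n ^ Suc k) - pmonom 1 1) a = \<zero>" unfolding ev_frob_poly[OF ac] k using ac by (simp add: a_minus_def r_neg)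
      have "ev (g k) a = \<zero>" using up[OF Fg[OF i a], of k] k j i ac by simp
      moreover obtain u v where "pcong (int n) (F (Suc k)) (u * (pmonom 1 (n ^ Suc k) - pmonom 1 1) + v * g k)"
        using rel[OF kd] by (auto simp: gcmd_rel_def)
      ultimately have "ev (F (Suc k)) a = \<zero>" using evc[of "F (Suc k)", OF _ ac] z ac by (simp add: ev_add ev_mult)
      then have "a \<in> Tp (Suc k)" using aT by (simp add: Tp_def)
      then show False using uniq0[of k i a] k j i a by simp
    qed
  qed simp
  fix i assume "1 \<le> i" "i \<le> pdeg f"
  then obtain k where k: "i = Suc k" "k < d" by (cases i) (auto simp: d_def)
  have "{x \<in> T. card (orbit (\<phi> n) x) = i} = Tp i"
  proof safe
    fix x assume x: "x \<in> T" "i = card (orbit (\<phi> n) x)"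
    then obtain j where "j < d" "x \<in> Tp (Suc j)" using ex by blast
    then show "x \<in> Tp (card (orbit (\<phi> n) x))" using orb by simp
  next
    fix x assume "x \<in> Tp i"
    then show "x \<in> T" "card (orbit (\<phi> n) x) = i" using orb[OF k(2)] k(1) Tsub by auto
  qed
  then show "i * cycle_type (\<phi> n) T i = pdeg (F i)"
    using card_points_orbit_size[OF bij finite_T, of i] ceq[OF k(2)] k(1) by simp
qed

text \<open>The degree of a gcd \<open>h0\<close> modulo \<open>p\<close> is found by counting:
  modulo \<open>p\<close> it vanishes on \<open>S1\<close>, and its cofactor \<open>w\<close> on the
  rest of \<open>S\<close>. The two lower bounds add up to \<open>card S\<close>, the degree of
  \<open>g\<close>, so both are attained.\<close>

lemma local_gcmd:
  fixes n i :: nat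
  assumes bij: "bij_betw (\<phi> n) T T" and i: "i > 0"
    and g: "monic g" "pdeg g = card {a \<in> T. card (orbit (\<phi> n) a) \<ge> i}"
    and gz: "\<And>a. a \<in> T \<Longrightarrow> card (orbit (\<phi> n) a) \<ge> i \<Longrightarrow> ev g a = \<zero>"
  shows "\<exists>h. pdeg h = card {a \<in> T. card (orbit (\<phi> n) a) = i} \<and> gcmd_rel q (pmonom 1 (n ^ i) - pmonom 1 1) g h"
proof -
  let ?K = "pmonom 1 (n ^ i) - pmonom 1 1 :: int poly"
  define S where "S = {a \<in> T. card (orbit (\<phi> n) a) \<ge> i}"
  define S1 where "S1 = {a \<in> T. card (orbit (\<phi> n) a) = i}"
  have sub: "S1 \<subseteq> S" "S \<subseteq> T" "S1 \<subseteq> T" "S - S1 \<subseteq> T" by (auto simp: S_def S1_def)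
  have fin: "finite S" "finite S1" by (rule finite_subset[OF sub(2) finite_T], rule finite_subset[OF sub(3) finite_T])
  have K0: "ev ?K a = \<zero>" if "a \<in> S1" for a
  proof -
    have a: "a \<in> T" "card (orbit (\<phi> n) a) = i" using that by (auto simp: S1_def)
    then have "(\<phi> n ^^ i) a = a" using card_orbit_period(2)[OF bij finite_T a(1)] by simp
    then show ?thesis unfolding ev_frob_poly[OF T_carrier[OF a(1)]] using T_carrier[OF a(1)] by (simp add: a_minus_def r_neg)
  qed
  \<comment> \<open>The orbit is longer than \<open>i\<close>, so the value is a difference of two
    distinct roots.\<close>
  have Ku: "ev ?K a \<in> Units R" if "a \<in> S - S1" for a
  proof -
    have a: "a \<in> T" "i < card (orbit (\<phi> n) a)" using that by (auto simp: S_def S1_def)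
    have ne: "(\<phi> n ^^ i) a \<noteq> a" by (rule card_orbit_period(3)[OF bij finite_T a(1) i a(2)])
    have "(\<phi> n ^^ i) a \<in> T" by (rule funpow_in_set) (use bij a(1) in \<open>auto simp: bij_betw_def\<close>)
    then show ?thesis unfolding ev_frob_poly[OF T_carrier[OF a(1)]] using diff_unit[OF a(1)] ne by auto
  qed
  have pp: "Factorial_Ring.prime (int p)" using prime_p by simp
  obtain h0 a b u w where h0: "monic h0" "monic w" "pdeg g = pdeg h0 + pdeg w"
    "pcong (int p) h0 (a * ?K + b * g)" "pcong (int p) ?K (h0 * u)" "pcong (int p) g (h0 * w)"
    by (rule gcd_mod_prime[OF pp g(1), of ?K])
  have "card S1 \<le> pdeg h0"
  proof (rule card_le_degree_mod_p[OF sub(3) h0(1)])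
    fix x assume x: "x \<in> S1"
    then have xc: "x \<in> carrier R" using sub T_carrier by blast
    have "ev g x = \<zero>" using x gz by (auto simp: S1_def)
    then have "ev (a * ?K + b * g) x = \<zero>" using xc K0[OF x] by (simp add: ev_add ev_mult)
    then show "\<exists>w\<in>carrier R. ev h0 x = iz (int p) \<otimes> w" using ev_pcong[OF xc h0(4)] by auto
  qed
  moreover have "card (S - S1) \<le> pdeg w"
  proof (rule card_le_degree_mod_p[OF sub(4) h0(2)])
    fix x assume x: "x \<in> S - S1"
    then have xc: "x \<in> carrier R" using sub T_carrier by blast
    obtain e where e: "e \<in> carrier R" "ev ?K x = ev h0 x \<otimes> ev u x \<oplus> iz (int p) \<otimes> e"
      using ev_pcong[OF xc h0(5)] xc by (auto simp: ev_mult)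
    \<comment> \<open>Modulo the non-unit \<open>p\<close>, the value of \<open>h0\<close> divides
      the unit value of \<open>?K\<close>, so it is a unit. As \<open>g\<close> vanishes at
      \<open>x\<close> and is \<open>h0 * w\<close> modulo \<open>p\<close>, the value of
      \<open>w\<close> is a multiple of \<open>p\<close>.\<close>
    have "ev h0 x \<otimes> ev u x \<in> Units R"
      using unit_sumD[of "ev h0 x \<otimes> ev u x" "iz (int p) \<otimes> e"] Ku[OF x] e iz_p_mult_not_unit xc by auto
    then have hu: "ev h0 x \<in> Units R" using unit_factorD[of "ev h0 x" "ev u x"] xc by simp
    obtain e' where e': "e' \<in> carrier R" "ev g x = ev h0 x \<otimes> ev w x \<oplus> iz (int p) \<otimes> e'"
      using ev_pcong[OF xc h0(6)] xc by (auto simp: ev_mult)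
    have gx: "ev g x = \<zero>" using x gz by (auto simp: S_def)
    define v where "v = inv (ev h0 x)"
    have v: "v \<in> carrier R" "v \<otimes> ev h0 x = \<one>" using hu by (auto simp: v_def)
    have "ev w x = (v \<otimes> ev h0 x) \<otimes> ev w x" using v xc by simp
    also have "\<dots> = v \<otimes> (ev h0 x \<otimes> ev w x \<oplus> iz (int p) \<otimes> e') \<oplus> iz (int p) \<otimes> (\<ominus> (v \<otimes> e'))"
      using v(1) e'(1) ev_closed[OF xc] iz_closed[of "int p"] by algebra
    also have "\<dots> = iz (int p) \<otimes> (\<ominus> (v \<otimes> e'))" unfolding e'(2)[symmetric] gx using v(1) e'(1) by simp
    finally show "\<exists>w'\<in>carrier R. ev w x = iz (int p) \<otimes> w'" using v(1) e'(1) by blast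
  qed
  moreover have "card S = card S1 + card (S - S1)" using sub(1) fin by (simp add: card_Diff_subset card_mono)
  ultimately have dh0: "pdeg h0 = card S1" using h0(3) g(2) by (simp add: S_def)
  \<comment> \<open>The lifting lemma counts from exponent 1, hence \<open>r - 1\<close>. On
    \<open>S1\<close> the lifted \<open>h\<close> vanishes in the ring itself and no longer only
    modulo \<open>p\<close>, so it divides \<open>?K\<close> and \<open>g\<close> modulo
    \<open>p^r\<close>.\<close>
  obtain h a' b' where h: "monic h" "pdeg h = card S1" "pcong (int p ^ Suc (r - 1)) h (a' * ?K + b' * g)"
    using monic_in_ideal_lift[OF h0(1,4), of "r - 1"] dh0 by auto
  have h3: "pcong q h (a' * ?K + b' * g)" using h(3) r1 by simp
  have hz: "ev h x = \<zero>" if x: "x \<in> S1" for x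
  proof -
    have xc: "x \<in> carrier R" using x sub T_carrier by blast
    have "ev g x = \<zero>" using x gz by (auto simp: S1_def)
    then show ?thesis using ev_pcong_eq[OF xc h3 iz_q] K0[OF x] xc by (simp add: ev_add ev_mult)
  qed
  have "\<exists>k. pcong q ?K (h * k)" by (rule vanish_imp_dvd[OF sub(3) h(1,2) hz K0])
  moreover have "\<exists>k. pcong q g (h * k)" by (rule vanish_imp_dvd[OF sub(3) h(1,2) hz]) (auto simp: S1_def gz)
  ultimately show ?thesis using h(1,2) h3 unfolding gcmd_rel_def S1_def by blast
qed

end

section \<open>Frobenius pseudoprimes and roots in local rings\<close>

lemma card_points_orbit_gt:
  assumes bij: "bij_betw f A A" and fin: "finite A"
  shows "card {x \<in> A. card (orbit f x) > k} = (\<Sum>i\<in>{k<..card A}. i * cycle_type f A i)"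
proof -
  have "{x \<in> A. card (orbit f x) > k} = (\<Union>i\<in>{k<..card A}. {x \<in> A. card (orbit f x) = i})"
    using card_orbit_le[OF bij fin] by auto
  then have "card {x \<in> A. card (orbit f x) > k} = card (\<Union>i\<in>{k<..card A}. {x \<in> A. card (orbit f x) = i})" by simp
  also have "\<dots> = (\<Sum>i\<in>{k<..card A}. card {x \<in> A. card (orbit f x) = i})"
    by (rule card_UN_disjoint) (use fin in auto)
  also have "\<dots> = (\<Sum>i\<in>{k<..card A}. i * cycle_type f A i)"
    by (rule sum.cong[OF refl]) (rule card_points_orbit_size[OF bij fin])
  finally show ?thesis .
qed

lemma prime_factor_power_coprime:
  fixes n :: nat
  assumes "p \<in> prime_factors n" "p' \<in> prime_factors n" "p \<noteq> p'"
  shows "coprime (p ^ multiplicity p n) (p' ^ multiplicity p' n)"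
  using assms by (auto intro!: coprime_power_left_iff[THEN iffD2] primes_coprime simp: in_prime_factors_iff)

text \<open>One division by \<open>h\<close> over the integers serves all prime powers: its
  remainder vanishes modulo each of them.\<close>

lemma dvd_mod_crt:
  fixes n :: nat
  assumes n: "n > 1" and h: "monic h"
    and loc: "\<And>p. p \<in> prime_factors n \<Longrightarrow> \<exists>k. pcong (int (p ^ multiplicity p n)) y (h * k)"
  shows "\<exists>k. pcong (int n) y (h * k)"
proof -
  obtain k s where ks: "y = h * k + s" "s = 0 \<or> pdeg s < pdeg h" using monic_division[OF h] by blast
  have "pcong (int n) s 0"
  proof (rule pcong_of_prime_powers)
    fix p assume p: "p \<in> prime_factors n"
    then obtain k' where k': "pcong (int (p ^ multiplicity p n)) y (h * k')" using loc by blast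
    have "multiplicity p n > 0" using p by (simp add: prime_factors_multiplicity)
    moreover have "p > 1" using p prime_gt_1_nat by auto
    ultimately have "p ^ multiplicity p n > 1" by (metis one_less_power)
    then have m: "int (p ^ multiplicity p n) > 1" by linarith
    show "pcong (int (p ^ multiplicity p n)) s 0" by (rule monic_dvd_remainder(1)[OF h m k' ks])
  qed (use n in simp)
  then show ?thesis using ks(1) by (intro exI[of _ k]) (simp add: pcong_def)
qed

lemma gcmd_rel_crt:
  fixes n :: nat
  assumes n: "n > 1"
    and loc: "\<And>p. p \<in> prime_factors n \<Longrightarrow> \<exists>h. pdeg h = k \<and> gcmd_rel (int (p ^ multiplicity p n)) K g h"
  shows "\<exists>h. pdeg h = k \<and> gcmd_rel (int n) K g h"
proof -
  let ?m = "\<lambda>p. p ^ multiplicity p n"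
  have "\<forall>p\<in>prime_factors n. \<exists>h a b. pdeg h = k \<and> monic h \<and> pcong (int (?m p)) h (a * K + b * g)
     \<and> (\<exists>u. pcong (int (?m p)) K (h * u)) \<and> (\<exists>w. pcong (int (?m p)) g (h * w))"
    using loc unfolding gcmd_rel_def by blast
  then obtain H A B where H: "\<And>p. p \<in> prime_factors n \<Longrightarrow> pdeg (H p) = k \<and> monic (H p) \<and> pcong (int (?m p)) (H p) (A p * K + B p * g)
     \<and> (\<exists>u. pcong (int (?m p)) K (H p * u)) \<and> (\<exists>w. pcong (int (?m p)) g (H p * w))"
    by metis
  have fin: "finite (prime_factors n)" by simp
  have pos: "\<And>p. p \<in> prime_factors n \<Longrightarrow> ?m p > 0" using prime_gt_0_nat by auto
  note cop = prime_factor_power_coprime[where n = n]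
  note ex = crt_poly[of "prime_factors n" ?m, OF fin pos cop]
  \<comment> \<open>The monomial of degree \<open>k\<close> is subtracted before gluing and restored
    afterwards. What is glued has zero coefficients from \<open>k\<close> on, so \<open>h\<close> is
    monic of degree exactly \<open>k\<close>. This is why the local gcmds must have a common
    degree.\<close>
  obtain h0 where h0: "\<forall>p\<in>prime_factors n. pcong (int (?m p)) h0 (H p - pmonom 1 k)"
    "\<forall>i. (\<forall>p\<in>prime_factors n. pcoeff (H p - pmonom 1 k) i = 0) \<longrightarrow> pcoeff h0 i = 0"
    using ex[of "\<lambda>p. H p - pmonom 1 k"] by blast
  obtain a where a: "\<forall>p\<in>prime_factors n. pcong (int (?m p)) a (A p)"
    using ex[of A] by blast
  obtain b where b: "\<forall>p\<in>prime_factors n. pcong (int (?m p)) b (B p)"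
    using ex[of B] by blast
  define h where "h = h0 + pmonom 1 k"
  have c0: "pcoeff h0 i = 0" if "i \<ge> k" for i
  proof (rule h0(2)[rule_format])
    fix p assume "p \<in> prime_factors n"
    then have "pdeg (H p) = k" "monic (H p)" using H by auto
    then show "pcoeff (H p - pmonom 1 k) i = 0" using that by (cases "i = k") (auto simp: coeff_eq_0)
  qed
  have dh: "pdeg h = k"
  proof (rule antisym)
    show "pdeg h \<le> k" by (rule degree_le) (simp add: h_def c0)
    show "k \<le> pdeg h" by (rule le_degree) (simp add: h_def c0)
  qed
  have mh: "monic h" unfolding dh by (simp add: h_def c0)
  have hH: "pcong (int (?m p)) h (H p)" if "p \<in> prime_factors n" for p
    using pcong_add[OF h0(1)[rule_format, OF that] pcong_refl[of _ "pmonom 1 k"]] by (simp add: h_def)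
  have "pcong (int n) h (a * K + b * g)"
  proof (rule pcong_of_prime_powers)
    fix p assume p: "p \<in> prime_factors n"
    have "pcong (int (?m p)) (a * K + b * g) (A p * K + B p * g)" by (intro pcong_add pcong_mult pcong_refl a[rule_format] b[rule_format] p)
    moreover have "pcong (int (?m p)) h (A p * K + B p * g)" using hH[OF p] H[OF p] by (meson pcong_trans)
    ultimately show "pcong (int (?m p)) h (a * K + b * g)" by (meson pcong_trans pcong_sym)
  qed (use n in simp)
  moreover have "\<exists>u. pcong (int n) K (h * u)"
  proof (rule dvd_mod_crt[OF n mh])
    fix p assume p: "p \<in> prime_factors n"
    then obtain u where u: "pcong (int (?m p)) K (H p * u)" using H by blast
    have "pcong (int (?m p)) (H p * u) (h * u)" by (rule pcong_mult[OF pcong_sym[OF hH[OF p]] pcong_refl])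
    then show "\<exists>u. pcong (int (?m p)) K (h * u)" using u pcong_trans by blast
  qed
  moreover have "\<exists>u. pcong (int n) g (h * u)"
  proof (rule dvd_mod_crt[OF n mh])
    fix p assume p: "p \<in> prime_factors n"
    then obtain u where u: "pcong (int (?m p)) g (H p * u)" using H by blast
    have "pcong (int (?m p)) (H p * u) (h * u)" by (rule pcong_mult[OF pcong_sym[OF hH[OF p]] pcong_refl])
    then show "\<exists>u. pcong (int (?m p)) g (h * u)" using u pcong_trans by blast
  qed
  ultimately have "gcmd_rel (int n) K g h" using mh unfolding gcmd_rel_def by blast
  then show ?thesis using dh by blast
qed

context zmod_poly
begin

context
  fixes f :: "int poly" and c :: "nat \<Rightarrow> nat" and Rr :: "nat \<Rightarrow> ('a, 'b) ring_scheme"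
  assumes monic_f: "monic f" and deg_f: "pdeg f \<ge> 1"
    and model: "\<And>p. p \<in> prime_factors n \<Longrightarrow> root_model (Rr p) p (multiplicity p n) f"
    and bij: "\<And>p. p \<in> prime_factors n \<Longrightarrow> bij_betw (root_model.\<phi> (Rr p) n) (root_model.T (Rr p) f) (root_model.T (Rr p) f)"
    and cyc: "\<And>p i. p \<in> prime_factors n \<Longrightarrow> 1 \<le> i \<Longrightarrow> i \<le> pdeg f \<Longrightarrow>
       cycle_type (root_model.\<phi> (Rr p) n) (root_model.T (Rr p) f) i = c i"
    and sum_c: "(\<Sum>i\<in>{1..pdeg f}. i * c i) = pdeg f"
begin

text \<open>The degree and the zeros of \<open>g k\<close> are what \<open>local_gcmd\<close> asks
  for in the next round; the zeros of the \<open>F i\<close> are recorded for the Frobenius step.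
  The numbers of points on cycles depend on \<open>c\<close> alone, so the local gcmds have the same
  degree for all \<open>p\<close>, as gluing requires.\<close>

lemma frob_chain_build:
  "k \<le> pdeg f \<Longrightarrow> \<exists>F g. frob_chain f k F g \<and>
    (\<forall>i\<in>{1..k}. pdeg (F i) = i * c i \<and>
      (\<forall>p\<in>prime_factors n. \<forall>a\<in>root_model.T (Rr p) f.
         card (orbit (root_model.\<phi> (Rr p) n) a) = i \<longrightarrow> cring.ev (Rr p) (F i) a = \<zero>\<^bsub>Rr p\<^esub>)) \<and>
    pdeg (g k) = (\<Sum>i\<in>{k<..pdeg f}. i * c i) \<and>
    (\<forall>p\<in>prime_factors n. \<forall>a\<in>root_model.T (Rr p) f.
       card (orbit (root_model.\<phi> (Rr p) n) a) > k \<longrightarrow> cring.ev (Rr p) (g k) a = \<zero>\<^bsub>Rr p\<^esub>)"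
proof (induction k)
  case 0
  have "frob_chain f 0 (\<lambda>_. 0) (\<lambda>_. f)" by (simp add: frob_chain_def monic_f)
  moreover have "pdeg f = (\<Sum>i\<in>{0<..pdeg f}. i * c i)"
  proof -
    have "{0<..pdeg f} = {1..pdeg f}" by auto
    then show ?thesis using sum_c by simp
  qed
  moreover have "cring.ev (Rr p) f a = \<zero>\<^bsub>Rr p\<^esub>" if "p \<in> prime_factors n" "a \<in> root_model.T (Rr p) f" for p a
    by (rule root_model.T_root[OF model[OF that(1)] that(2)])
  ultimately show ?case by (intro exI[of _ "\<lambda>_. 0"] exI[of _ "\<lambda>_. f"]) simp
next
  case (Suc k)
  then have kd: "k < pdeg f" by simp
  obtain F g where ch: "frob_chain f k F g"
    and Fi: "\<And>i. i \<in> {1..k} \<Longrightarrow> pdeg (F i) = i * c i"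
    and Fz: "\<And>i p a. i \<in> {1..k} \<Longrightarrow> p \<in> prime_factors n \<Longrightarrow> a \<in> root_model.T (Rr p) f \<Longrightarrow>
         card (orbit (root_model.\<phi> (Rr p) n) a) = i \<Longrightarrow> cring.ev (Rr p) (F i) a = \<zero>\<^bsub>Rr p\<^esub>"
    and dg: "pdeg (g k) = (\<Sum>i\<in>{k<..pdeg f}. i * c i)"
    and gz: "\<And>p a. p \<in> prime_factors n \<Longrightarrow> a \<in> root_model.T (Rr p) f \<Longrightarrow>
       card (orbit (root_model.\<phi> (Rr p) n) a) > k \<Longrightarrow> cring.ev (Rr p) (g k) a = \<zero>\<^bsub>Rr p\<^esub>"
    using Suc.IH kd by (auto simp del: One_nat_def)
  have mg: "monic (g k)" using ch by (simp add: frob_chain_def)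
  let ?K = "pmonom 1 (n ^ Suc k) - pmonom 1 1 :: int poly"
  have "\<exists>h. pdeg h = Suc k * c (Suc k) \<and> gcmd_rel (int n) ?K (g k) h"
  proof (rule gcmd_rel_crt[OF n1])
    fix p assume p: "p \<in> prime_factors n"
    interpret R: root_model "Rr p" p "multiplicity p n" f by (rule model[OF p])
    note b = bij[OF p]
    have 1: "pdeg (g k) = card {a \<in> R.T. card (orbit (R.\<phi> n) a) \<ge> Suc k}"
    proof -
      have "card {a \<in> R.T. card (orbit (R.\<phi> n) a) > k} = (\<Sum>i\<in>{k<..card R.T}. i * cycle_type (R.\<phi> n) R.T i)"
        by (rule card_points_orbit_gt[OF b R.finite_T])
      also have "\<dots> = (\<Sum>i\<in>{k<..pdeg f}. i * c i)"
        unfolding R.card_T' by (rule sum.cong[OF refl]) (use cyc[OF p] in auto)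
      finally show ?thesis unfolding dg by (simp only: Suc_le_eq)
    qed
    have "\<exists>h. pdeg h = card {a \<in> R.T. card (orbit (R.\<phi> n) a) = Suc k} \<and> gcmd_rel R.q ?K (g k) h"
      by (rule R.local_gcmd[OF b _ mg 1]) (use gz[OF p] in \<open>auto simp: Suc_le_eq\<close>)
    moreover have "card {a \<in> R.T. card (orbit (R.\<phi> n) a) = Suc k} = Suc k * c (Suc k)"
      using card_points_orbit_size[OF b R.finite_T, of "Suc k"] cyc[OF p, of "Suc k"] kd by simp
    ultimately show "\<exists>h. pdeg h = Suc k * c (Suc k) \<and> gcmd_rel (int (p ^ multiplicity p n)) ?K (g k) h" by simp
  qed
  then obtain h where dh: "pdeg h = Suc k * c (Suc k)" and h: "gcmd_rel (int n) ?K (g k) h" by blast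
  have mh: "monic h" using h by (simp add: gcmd_rel_def)
  obtain w where w: "pcong (int n) (g k) (h * w)" using h by (auto simp: gcmd_rel_def)
  obtain q where q: "monic q" "pcong (int n) w q" "pdeg (g k) = pdeg h + pdeg q" by (rule monic_factor[OF mg mh int_n w])
  have w': "pcong (int n) (g k) (h * q)" by (rule pcong_trans[OF w pcong_mult[OF pcong_refl q(2)]])
  define F' g' where "F' = F(Suc k := h)" and "g' = g(Suc k := q)"
  have ch': "frob_chain f (Suc k) F' g'"
    using ch h w' q(1) by (auto simp: frob_chain_def less_Suc_eq le_Suc_eq F'_def g'_def)
  have Fi': "pdeg (F' i) = i * c i" if "i \<in> {1..Suc k}" for i
    using that Fi[of i] dh by (cases "i = Suc k") (auto simp: F'_def)
  have ev_h: "cring.ev (Rr p) h a = \<zero>\<^bsub>Rr p\<^esub>" if p: "p \<in> prime_factors n" and a: "a \<in> root_model.T (Rr p) f"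
    and o: "card (orbit (root_model.\<phi> (Rr p) n) a) = Suc k" for p a
  proof -
    interpret R: root_model "Rr p" p "multiplicity p n" f by (rule model[OF p])
    have ac: "a \<in> carrier (Rr p)" by (rule R.T_carrier[OF a])
    have "R.iz (int n) = \<zero>\<^bsub>Rr p\<^esub>" unfolding R.iz_eq_0_iff by (metis multiplicity_dvd of_nat_dvd_iff of_nat_power)
    moreover obtain x y where "pcong (int n) h (x * ?K + y * g k)" using h by (auto simp: gcmd_rel_def)
    ultimately have "R.ev h a = R.ev (x * ?K + y * g k) a" using ac by (intro R.ev_pcong_eq)
    also have "\<dots> = R.ev x a \<otimes>\<^bsub>Rr p\<^esub> R.ev ?K a \<oplus>\<^bsub>Rr p\<^esub> R.ev y a \<otimes>\<^bsub>Rr p\<^esub> R.ev (g k) a"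
      using ac by (simp add: R.ev_add R.ev_mult)
    also have "R.ev (g k) a = \<zero>\<^bsub>Rr p\<^esub>" using gz[OF p a] o by simp
    also have "R.ev ?K a = \<zero>\<^bsub>Rr p\<^esub>"
      unfolding R.ev_frob_poly[OF ac] using card_orbit_period(2)[OF bij[OF p] R.finite_T a] o ac by (simp add: a_minus_def R.r_neg)
    finally show ?thesis using ac by simp
  qed
  have Fz': "cring.ev (Rr p) (F' i) a = \<zero>\<^bsub>Rr p\<^esub>" if "i \<in> {1..Suc k}" and p: "p \<in> prime_factors n" and a: "a \<in> root_model.T (Rr p) f"
    and o: "card (orbit (root_model.\<phi> (Rr p) n) a) = i" for i p a
    using ev_h[OF p a] Fz[OF _ p a, of i] that(1) o by (cases "i = Suc k") (auto simp: F'_def)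
  have dg': "pdeg (g' (Suc k)) = (\<Sum>i\<in>{Suc k<..pdeg f}. i * c i)"
  proof -
    have "{k<..pdeg f} = insert (Suc k) {Suc k<..pdeg f}" using kd by auto
    then have "pdeg (g k) = Suc k * c (Suc k) + (\<Sum>i\<in>{Suc k<..pdeg f}. i * c i)" unfolding dg by simp
    then show ?thesis using q(3) dh by (simp add: g'_def)
  qed
  have gz': "cring.ev (Rr p) (g' (Suc k)) a = \<zero>\<^bsub>Rr p\<^esub>" if p: "p \<in> prime_factors n" and a: "a \<in> root_model.T (Rr p) f"
    and o: "card (orbit (root_model.\<phi> (Rr p) n) a) > Suc k" for p a
  proof -
    interpret R: root_model "Rr p" p "multiplicity p n" f by (rule model[OF p])
    have ac: "a \<in> carrier (Rr p)" by (rule R.T_carrier[OF a])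
    have izn: "R.iz (int n) = \<zero>\<^bsub>Rr p\<^esub>" unfolding R.iz_eq_0_iff by (metis multiplicity_dvd of_nat_dvd_iff of_nat_power)
    have ne: "(R.\<phi> n ^^ Suc k) a \<noteq> a" by (rule card_orbit_period(3)[OF bij[OF p] R.finite_T a _ o]) simp
    have "(R.\<phi> n ^^ Suc k) a \<in> R.T" by (rule funpow_in_set[OF _ a]) (use bij[OF p] in \<open>auto simp: bij_betw_def\<close>)
    \<comment> \<open>On orbits longer than \<open>Suc k\<close> the value of \<open>?K\<close> is a
      unit, and so is that of its divisor \<open>h\<close>. Hence a zero of \<open>g k\<close> on
      such an orbit passes to the quotient \<open>q\<close>.\<close>
    then have Ku: "R.ev ?K a \<in> Units (Rr p)" unfolding R.ev_frob_poly[OF ac] using ne by (intro R.diff_unit a) auto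
    obtain u where u: "pcong (int n) ?K (h * u)" using h by (auto simp: gcmd_rel_def)
    have "R.ev ?K a = R.ev h a \<otimes>\<^bsub>Rr p\<^esub> R.ev u a" using R.ev_pcong_eq[OF ac u izn] ac by (simp add: R.ev_mult)
    then have hu: "R.ev h a \<in> Units (Rr p)" using Ku R.unit_factorD[of "R.ev h a" "R.ev u a"] ac by simp
    have "R.ev h a \<otimes>\<^bsub>Rr p\<^esub> R.ev q a = R.ev (g k) a" using R.ev_pcong_eq[OF ac w' izn] ac by (simp add: R.ev_mult)
    also have "\<dots> = \<zero>\<^bsub>Rr p\<^esub>" using gz[OF p a] o by simp
    finally have "R.ev q a = \<zero>\<^bsub>Rr p\<^esub>" by (rule R.unit_mult_eq_zero[OF hu R.ev_closed[OF ac]])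
    then show ?thesis by (simp add: g'_def)
  qed
  show ?case using ch' Fi' Fz' dg' gz' by blast
qed

text \<open>The power map preserves orbit lengths, so the composition of \<open>F i\<close> with
  \<open>x^n\<close> vanishes at all zeros of \<open>F i\<close>. This is the Frobenius step modulo
  each prime power.\<close>

lemma frob_chain_of_permutation:
  "\<exists>F g. frob_chain f (pdeg f) F g \<and> g (pdeg f) = 1 \<and> (\<forall>i\<in>{1..pdeg f}. pdeg (F i) = i * c i) \<and>
     (\<forall>i\<in>{2..pdeg f}. \<exists>k. pcong (int n) (pcompose (F i) (pmonom 1 n)) (F i * k))"
proof -
  obtain F g where ch: "frob_chain f (pdeg f) F g"
    and Fi: "\<And>i. i \<in> {1..pdeg f} \<Longrightarrow> pdeg (F i) = i * c i"
    and Fz: "\<And>i p a. i \<in> {1..pdeg f} \<Longrightarrow> p \<in> prime_factors n \<Longrightarrow> a \<in> root_model.T (Rr p) f \<Longrightarrow>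
         card (orbit (root_model.\<phi> (Rr p) n) a) = i \<Longrightarrow> cring.ev (Rr p) (F i) a = \<zero>\<^bsub>Rr p\<^esub>"
    and dg: "pdeg (g (pdeg f)) = 0"
    using frob_chain_build[of "pdeg f"] by auto
  have "monic (g (pdeg f))" using ch by (simp add: frob_chain_def)
  then have g1: "g (pdeg f) = 1" using dg by (intro monic_degree_0)
  have "\<exists>k. pcong (int n) (pcompose (F i) (pmonom 1 n)) (F i * k)" if i: "i \<in> {2..pdeg f}" for i
  proof -
    obtain j where j: "i = Suc j" "j < pdeg f" using i by (cases i) auto
    have mF: "monic (F i)" using frob_chain_monic[OF ch j(2)] j(1) by simp
    show ?thesis
    proof (rule dvd_mod_crt[OF n1 mF])
      fix p assume p: "p \<in> prime_factors n"
      interpret R: root_model "Rr p" p "multiplicity p n" f by (rule model[OF p])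
      note b = bij[OF p]
      let ?S = "{a \<in> R.T. card (orbit (R.\<phi> n) a) = i}"
      have z: "R.ev (F i) a = \<zero>\<^bsub>Rr p\<^esub>" if "a \<in> ?S" for a using Fz[OF _ p, of i a] that i by auto
      have "\<exists>k. pcong R.q (pcompose (F i) (pmonom 1 n)) (F i * k)"
      proof (rule R.vanish_imp_dvd[of ?S, OF _ mF])
        show "pdeg (F i) = card ?S"
          using card_points_orbit_size[OF b R.finite_T, of i] cyc[OF p, of i] Fi[of i] i by simp
        fix a assume a: "a \<in> ?S"
        then show "R.ev (F i) a = \<zero>\<^bsub>Rr p\<^esub>" by (rule z)
        have aT: "a \<in> R.T" using a by simp
        have "R.\<phi> n a \<in> orbit (R.\<phi> n) a" by (rule orbit.base)
        then have "orbit (R.\<phi> n) (R.\<phi> n a) = orbit (R.\<phi> n) a" by (rule orbit_eq[OF b R.finite_T aT])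
        moreover have "R.\<phi> n a \<in> R.T" using b aT by (auto simp: bij_betw_def)
        ultimately have "R.\<phi> n a \<in> ?S" using a by simp
        then show "R.ev (pcompose (F i) (pmonom 1 n)) a = \<zero>\<^bsub>Rr p\<^esub>"
          using z R.T_carrier[OF aT] by (simp add: R.ev_pcompose R.ev_xpow R.\<phi>_def)
      qed auto
      then show "\<exists>k. pcong (int (p ^ multiplicity p n)) (pcompose (F i) (pmonom 1 n)) (F i * k)" by simp
    qed
  qed
  then show ?thesis using ch g1 Fi by blast
qed

end

end

text \<open>Both sides are compared through a chain with degrees \<open>i * c i\<close>: cycle
  counts determine the degrees and conversely. Once they agree, the Jacobi step and the sign
  condition are the same equation.\<close>

theorem pseudoprime_iff_root_models:
  fixes n :: nat and \<sigma> :: "nat \<Rightarrow> nat" and Rr :: "nat \<Rightarrow> ('a, 'b) ring_scheme"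
  assumes n: "n > 1" and f: "monic f" "pdeg f \<ge> 1" and \<sigma>: "\<sigma> permutes {1..pdeg f}"
    and model: "\<And>p. p \<in> prime_factors n \<Longrightarrow> root_model (Rr p) p (multiplicity p n) f"
  shows "(frobenius_pseudoprime f n \<and> has_cycle_structure f n \<sigma>) \<longleftrightarrow>
    (\<forall>p\<in>prime_factors n. bij_betw (root_model.\<phi> (Rr p) n) (root_model.T (Rr p) f) (root_model.T (Rr p) f) \<and>
       cycle_type (root_model.\<phi> (Rr p) n) (root_model.T (Rr p) f) = cycle_type \<sigma> {1..pdeg f}) \<and>
    Jacobi (discriminant f) n = sign \<sigma>"
proof -
  interpret zmod_poly n by (rule zmod_poly.intro[OF n])
  define d where "d = pdeg f"
  define c where "c = cycle_type \<sigma> {1..d}"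
  have bs: "bij_betw \<sigma> {1..d} {1..d}" using permutes_imp_bij[OF \<sigma>] by (simp add: d_def)
  have sgn: "sign \<sigma> = (-1) ^ (\<Sum>i | i \<in> {1..d} \<and> even i. c i)"
    using sign_eq_cycle_type[OF \<sigma>] by (simp add: c_def d_def)
  have sumc: "(\<Sum>i\<in>{1..d}. i * c i) = d" using sum_cycle_type[OF bs] by (simp add: c_def)
  have c_out: "c i = 0" if "i = 0 \<or> i > d" for i using cycle_type_outside[OF bs, of i] that by (simp add: c_def)
  have cyc_chain: "frob_cycles n f i = of_nat (c i) \<longleftrightarrow> pdeg (F i) = i * c i"
    if "frob_chain f d F g" "i \<in> {1..d}" for F g i
  proof -
    have "frob_cycles n f i = of_nat (pdeg (F i)) / of_nat i" using frob_chain_cycles[OF that(1)] that(2) by simp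
    moreover have "(of_nat i :: rat) \<noteq> 0" using that(2) by simp
    ultimately have "frob_cycles n f i = of_nat (c i) \<longleftrightarrow> (of_nat (pdeg (F i)) :: rat) = of_nat i * of_nat (c i)"
      by (simp add: nonzero_divide_eq_eq mult.commute)
    also have "\<dots> \<longleftrightarrow> pdeg (F i) = i * c i" by (simp only: of_nat_mult[symmetric] of_nat_eq_iff)
    finally show ?thesis .
  qed
  \<comment> \<open>\<open>S\<close> is determined by its rational value, which under the given
    cycle structure is the number of even cycles of \<sigma>.\<close>
  have jac: "jacobi_step n f \<longleftrightarrow> Jacobi (discriminant f) n = sign \<sigma>" if hc: "has_cycle_structure f n \<sigma>"
  proof -
    have "(\<Sum>i | i \<in> {1..pdeg f} \<and> even i. frob_cycles n f i) = (\<Sum>i | i \<in> {1..d} \<and> even i. of_nat (c i))"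
      by (rule sum.cong) (use hc in \<open>auto simp: has_cycle_structure_def c_def d_def\<close>)
    also have "\<dots> = of_nat (\<Sum>i | i \<in> {1..d} \<and> even i. c i)" by simp
    finally have "jacobi_step n f \<longleftrightarrow> (-1) ^ (\<Sum>i | i \<in> {1..d} \<and> even i. c i) = Jacobi (discriminant f) n"
      unfolding jacobi_step_def by (simp only: of_nat_eq_iff) simp
    then show ?thesis unfolding sgn by (simp only: eq_commute)
  qed
  show ?thesis
  proof
    assume L: "frobenius_pseudoprime f n \<and> has_cycle_structure f n \<sigma>"
    then have fs: "factorization_step n f" "frobenius_step n f" "jacobi_step n f" by (auto simp: frobenius_pseudoprime_def)
    obtain F g where ch: "frob_chain f d F g" "g d = 1" using fs(1) factorization_step_iff[OF f(1)] by (auto simp: d_def)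
    have fr: "\<forall>i\<in>{2..d}. \<exists>k. pcong (int n) (pcompose (F i) (pmonom 1 n)) (F i * k)"
      using fs(2) frobenius_step_iff ch(1) by (simp add: d_def)
    have Fc: "pdeg (F i) = i * c i" if "i \<in> {1..d}" for i
      using L cyc_chain[OF ch(1) that] that by (simp add: has_cycle_structure_def c_def d_def)
    have "bij_betw (root_model.\<phi> (Rr p) n) (root_model.T (Rr p) f) (root_model.T (Rr p) f) \<and>
       cycle_type (root_model.\<phi> (Rr p) n) (root_model.T (Rr p) f) = c" if p: "p \<in> prime_factors n" for p
    proof -
      interpret R: root_model "Rr p" p "multiplicity p n" f by (rule model[OF p])
      have qn: "R.q dvd int n" by (metis multiplicity_dvd of_nat_dvd_iff of_nat_power)
      note os = R.orbit_split_by_factors[OF n qn ch(1)[unfolded d_def] ch(2)[unfolded d_def] fr[unfolded d_def]]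
      \<comment> \<open>Outside \<open>1..d\<close> both numbers are 0; inside, both become the
        degree of \<open>F i\<close> after multiplication by \<open>i\<close>.\<close>
      have "cycle_type (R.\<phi> n) R.T i = c i" for i
      proof (cases "i = 0 \<or> i > d")
        case True
        then show ?thesis using cycle_type_outside[OF os(1) R.finite_T, of i] c_out[OF True] by (simp add: R.card_T' d_def)
      next
        case False
        then have "i * cycle_type (R.\<phi> n) R.T i = i * c i" using os(2)[of i] Fc[of i] by (simp add: d_def)
        then show ?thesis using False by simp
      qed
      then show ?thesis using os(1) by blast
    qed
    then show "(\<forall>p\<in>prime_factors n. bij_betw (root_model.\<phi> (Rr p) n) (root_model.T (Rr p) f) (root_model.T (Rr p) f) \<and>
       cycle_type (root_model.\<phi> (Rr p) n) (root_model.T (Rr p) f) = cycle_type \<sigma> {1..pdeg f}) \<and>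
       Jacobi (discriminant f) n = sign \<sigma>" using jac L fs(3) unfolding c_def d_def by blast
  next
    assume Rt: "(\<forall>p\<in>prime_factors n. bij_betw (root_model.\<phi> (Rr p) n) (root_model.T (Rr p) f) (root_model.T (Rr p) f) \<and>
       cycle_type (root_model.\<phi> (Rr p) n) (root_model.T (Rr p) f) = cycle_type \<sigma> {1..pdeg f}) \<and>
       Jacobi (discriminant f) n = sign \<sigma>"
    have "\<exists>F g. frob_chain f (pdeg f) F g \<and> g (pdeg f) = 1 \<and> (\<forall>i\<in>{1..pdeg f}. pdeg (F i) = i * c i) \<and>
       (\<forall>i\<in>{2..pdeg f}. \<exists>k. pcong (int n) (pcompose (F i) (pmonom 1 n)) (F i * k))"
      by (rule frob_chain_of_permutation[OF f model]) (use Rt sumc in \<open>auto simp: c_def d_def\<close>)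
    then obtain F g where ch: "frob_chain f d F g" "g d = 1" "\<forall>i\<in>{1..d}. pdeg (F i) = i * c i"
      "\<forall>i\<in>{2..pdeg f}. \<exists>k. pcong (int n) (pcompose (F i) (pmonom 1 n)) (F i * k)" unfolding d_def by blast
    have 1: "factorization_step n f" unfolding factorization_step_iff[OF f(1)] using ch(1,2) unfolding d_def by blast
    have 2: "frobenius_step n f" using frobenius_step_iff[of f F g] ch(1,4) by (simp add: d_def)
    have 3: "has_cycle_structure f n \<sigma>" using cyc_chain[OF ch(1)] ch(3) by (simp add: has_cycle_structure_def c_def d_def)
    show "frobenius_pseudoprime f n \<and> has_cycle_structure f n \<sigma>"
      using 1 2 3 jac[OF 3] Rt by (simp add: frobenius_pseudoprime_def)
  qed
qed

section \<open>The \<open>p\<close>-adic numbers\<close>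

locale padic =
  fixes p :: nat
  assumes prime_p: "Factorial_Ring.prime p"
begin

abbreviation "vabs \<equiv> padic_abs p"

lemma p_gt_1: "real p > 1" and p_pos: "real p > 0"
  using prime_gt_1_nat[OF prime_p] by auto

lemma prime_int_p: "Factorial_Ring.prime_elem (int p)"
  using prime_p by auto

lemma vabs_0 [simp]: "vabs 0 = 0"
  by (simp add: padic_abs_def)

text \<open>The definition uses lowest terms. By cross-multiplication, any other fraction of the
  same value has the same difference of multiplicities; later proofs can therefore use arbitrary
  fractions, such as those over a common denominator.\<close>

lemma vabs_frac:
  fixes a b :: int
  assumes a: "a \<noteq> 0" and b: "b \<noteq> 0"
  shows "vabs (of_int a / of_int b) = real p powi (int (multiplicity (int p) b) - int (multiplicity (int p) a))"
proof -
  let ?x = "of_int a / of_int b :: rat"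
  obtain c d where cd: "quotient_of ?x = (c, d)" by fastforce
  have d: "d > 0" using quotient_of_denom_pos[OF cd] .
  have x: "?x = of_int c / of_int d" by (rule quotient_of_div[OF cd])
  have x0: "?x \<noteq> 0" using a b by simp
  then have c: "c \<noteq> 0" using x by auto
  have "of_int (a * d) = (of_int (c * b) :: rat)" using x b d by (simp add: field_simps)
  then have e: "a * d = c * b" by (simp only: of_int_eq_iff)
  have "multiplicity (int p) a + multiplicity (int p) d = multiplicity (int p) c + multiplicity (int p) b"
    using arg_cong[OF e, of "multiplicity (int p)"] a b c d prime_int_p
    by (simp add: prime_elem_multiplicity_mult_distrib)
  then have "int (multiplicity (int p) d) - int (multiplicity (int p) c) = int (multiplicity (int p) b) - int (multiplicity (int p) a)"
    by linarith
  then show ?thesis using x0 cd by (simp add: padic_abs_def)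
qed

lemma rat_fracE: obtains a b :: int where "x = of_int a / (of_int b :: rat)" "b \<noteq> 0"
proof -
  obtain c d where cd: "quotient_of x = (c, d)" by fastforce
  show ?thesis by (rule that[OF quotient_of_div[OF cd]]) (use quotient_of_denom_pos[OF cd] in simp)
qed

lemma vabs_nonzero: "x \<noteq> 0 \<Longrightarrow> \<exists>k. vabs x = real p powi k"
  by (auto simp: padic_abs_def)

lemma vabs_pos: "x \<noteq> 0 \<Longrightarrow> vabs x > 0"
  using vabs_nonzero[of x] p_pos by (auto intro: zero_less_power_int)

lemma vabs_nonneg: "vabs x \<ge> 0"
  using vabs_pos[of x] by (cases "x = 0") auto

lemma vabs_mult: "vabs (x * y) = vabs x * vabs y"
proof (cases "x = 0 \<or> y = 0")
  case False
  obtain a b where x: "x = of_int a / of_int b" "b \<noteq> 0" by (rule rat_fracE)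
  obtain c d where y: "y = of_int c / of_int d" "d \<noteq> 0" by (rule rat_fracE)
  have ac: "a \<noteq> 0" "c \<noteq> 0" using False x y by auto
  have "x * y = of_int (a * c) / of_int (b * d)" using x y by simp
  then have "vabs (x * y) = real p powi (int (multiplicity (int p) (b * d)) - int (multiplicity (int p) (a * c)))"
    using vabs_frac[of "a * c" "b * d"] ac x(2) y(2) by (simp del: of_int_mult)
  also have "int (multiplicity (int p) (b * d)) - int (multiplicity (int p) (a * c))
     = (int (multiplicity (int p) b) - int (multiplicity (int p) a)) + (int (multiplicity (int p) d) - int (multiplicity (int p) c))"
    using ac x(2) y(2) prime_int_p by (simp add: prime_elem_multiplicity_mult_distrib)
  also have "real p powi \<dots> = vabs x * vabs y"
    using vabs_frac[OF ac(1) x(2)] vabs_frac[OF ac(2) y(2)] x(1) y(1) p_pos by (simp add: power_int_add)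
  finally show ?thesis .
qed auto

lemma vabs_int_le: "k \<noteq> 0 \<Longrightarrow> int p ^ e dvd k \<Longrightarrow> vabs (of_int k) \<le> real p powi (- int e)"
proof -
  assume k: "k \<noteq> 0" and d: "int p ^ e dvd k"
  have "e \<le> multiplicity (int p) k" using d k prime_int_p by (intro multiplicity_geI) auto
  moreover have "vabs (of_int k) = real p powi (- int (multiplicity (int p) k))" using vabs_frac[of k 1] k by simp
  ultimately show ?thesis using p_gt_1 by (simp add: power_int_increasing)
qed

lemma vabs_int_le_1: "vabs (of_int k) \<le> 1"
  using vabs_int_le[of k 0] by (cases "k = 0") auto

lemma vabs_int_dvd: "vabs (of_int k) \<le> real p powi (- int e) \<Longrightarrow> int p ^ e dvd k"
proof (cases "k = 0")
  case False
  assume l: "vabs (of_int k) \<le> real p powi (- int e)"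
  have "vabs (of_int k) = real p powi (- int (multiplicity (int p) k))" using vabs_frac[of k 1] False by simp
  then have "- int (multiplicity (int p) k) \<le> - int e" using l p_gt_1 by (metis not_le power_int_strict_increasing)
  then show ?thesis by (intro multiplicity_dvd') simp
qed simp

lemma vabs_1 [simp]: "vabs 1 = 1"
  using vabs_frac[of 1 1] by simp

lemma vabs_p: "vabs (of_nat p) = 1 / real p"
proof -
  have "vabs (of_int (int p) / of_int 1) = real p powi (int (multiplicity (int p) 1) - int (multiplicity (int p) (int p)))"
    using prime_p prime_gt_0_nat by (intro vabs_frac) auto
  also have "\<dots> = 1 / real p" using prime_int_p by (simp add: power_int_minus inverse_eq_divide multiplicity_same_power prime_elem_def)
  finally show ?thesis by simp
qed

lemma vabs_minus [simp]: "vabs (- x) = vabs x"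
proof -
  have "vabs (- 1) * vabs (- 1) = 1" by (simp flip: vabs_mult)
  then have "vabs (- 1) = 1" using vabs_nonneg[of "- 1"] by (metis abs_of_nonneg power2_eq_1_iff power2_eq_square abs_1 abs_minus_cancel)
  then show ?thesis using vabs_mult[of "- 1" x] by simp
qed

lemma vabs_diff_commute: "vabs (x - y) = vabs (y - x)"
  using vabs_minus[of "x - y"] by simp

lemma vabs_inverse: "vabs (inverse x) = inverse (vabs x)"
proof (cases "x = 0")
  case False
  then have "vabs x * vabs (inverse x) = 1" by (simp flip: vabs_mult)
  then show ?thesis using vabs_pos[OF False] by (simp add: field_simps)
qed simp

lemma vabs_power: "vabs (x ^ k) = vabs x ^ k"
  by (induction k) (auto simp: vabs_mult)

lemma vabs_inverse_p_power: "vabs (inverse (of_nat p ^ k)) = real p ^ k"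
  unfolding vabs_inverse vabs_power vabs_p using p_pos by (simp add: power_divide)

text \<open>Over a common denominator this is a fact on multiplicities: the smaller of two powers of
  \<open>p\<close> divides the sum of the numerators.\<close>

lemma vabs_add: "vabs (x + y) \<le> max (vabs x) (vabs y)"
proof (cases "x = 0 \<or> y = 0 \<or> x + y = 0")
  case True then show ?thesis using vabs_nonneg[of x] vabs_nonneg[of y] by (auto simp: max_def)
next
  case False
  obtain a b where x: "x = of_int a / of_int b" "b \<noteq> 0" by (rule rat_fracE)
  obtain c d where y: "y = of_int c / of_int d" "d \<noteq> 0" by (rule rat_fracE)
  define A C D where "A = a * d" and "C = c * b" and "D = b * d"
  have D: "D \<noteq> 0" using x y by (simp add: D_def)
  have xA: "x = of_int A / of_int D" and yC: "y = of_int C / of_int D" using x y by (auto simp: A_def C_def D_def)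
  have xy: "x + y = of_int (A + C) / of_int D" unfolding xA yC by (simp add: add_divide_distrib)
  have nz: "A \<noteq> 0" "C \<noteq> 0" "A + C \<noteq> 0" using False xA yC xy by auto
  define m where "m = min (multiplicity (int p) A) (multiplicity (int p) C)"
  have "int p ^ m dvd A" "int p ^ m dvd C" by (auto simp: m_def intro: multiplicity_dvd')
  then have "int p ^ m dvd A + C" by simp
  then have "m \<le> multiplicity (int p) (A + C)" using nz prime_int_p by (intro multiplicity_geI) auto
  then have "vabs (x + y) \<le> real p powi (int (multiplicity (int p) D) - int m)"
    unfolding xy vabs_frac[OF nz(3) D] using p_gt_1 by (intro power_int_increasing) auto
  also have "\<dots> \<le> max (vabs x) (vabs y)"
    unfolding xA yC vabs_frac[OF nz(1) D] vabs_frac[OF nz(2) D] m_def by (auto simp: min_def)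
  finally show ?thesis .
qed

lemma vabs_add_le: "vabs x \<le> e \<Longrightarrow> vabs y \<le> e \<Longrightarrow> vabs (x + y) \<le> e"
  using vabs_add[of x y] by linarith

lemma vabs_add_less: "vabs x < e \<Longrightarrow> vabs y < e \<Longrightarrow> vabs (x + y) < e"
  using vabs_add[of x y] by linarith

lemma vabs_diff_less: "vabs x < e \<Longrightarrow> vabs y < e \<Longrightarrow> vabs (x - y) < e"
  using vabs_add_less[of x e "- y"] by simp

lemma vabs_close_eq: "vabs (x - y) < vabs y \<Longrightarrow> vabs x = vabs y"
proof -
  assume l: "vabs (x - y) < vabs y"
  have "vabs x \<le> vabs y" using vabs_add[of "x - y" y] l by simp
  moreover have "vabs y \<le> max (vabs (x - y)) (vabs x)" using vabs_add[of "- (x - y)" x] by (simp add: max.commute vabs_diff_commute)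
  ultimately show ?thesis using l by linarith
qed

text \<open>Non-zero values are integral powers of \<open>p\<close>, so none lies strictly between
  \<open>1 / p\<close> and 1; a bound below 1 already means divisibility by
  \<open>p\<close>.\<close>

lemma vabs_less_1: "vabs x < 1 \<Longrightarrow> vabs x \<le> 1 / real p"
proof (cases "x = 0")
  case False
  assume l: "vabs x < 1"
  obtain k where k: "vabs x = real p powi k" using vabs_nonzero[OF False] by blast
  have "k < 0" using l k p_gt_1 by (metis not_le one_le_power_int order_less_imp_le)
  then have "real p powi k \<le> real p powi (-1)" using p_gt_1 by (intro power_int_increasing) auto
  then show ?thesis using k by (simp add: power_int_minus inverse_eq_divide)
qed simp

section \<open>Cauchy sequences and the maximal ideal of null sequences\<close>

abbreviation "Ca \<equiv> padic_cauchy p"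
abbreviation "CR \<equiv> padic_cauchy_ring p"
abbreviation "Nu \<equiv> padic_null p"

lemma CaD: "s \<in> Ca \<Longrightarrow> e > 0 \<Longrightarrow> \<exists>N. \<forall>i\<ge>N. \<forall>j\<ge>N. vabs (s i - s j) < e"
  by (simp add: padic_cauchy_def)

lemma NuD: "s \<in> Nu \<Longrightarrow> e > 0 \<Longrightarrow> \<exists>N. \<forall>i\<ge>N. vabs (s i) < e"
  using LIMSEQ_D[of "\<lambda>i. vabs (s i)" 0 e] vabs_nonneg by (auto simp: padic_null_def)

lemma NuI: "(\<And>e. e > 0 \<Longrightarrow> \<exists>N. \<forall>i\<ge>N. vabs (s i) < e) \<Longrightarrow> s \<in> Nu"
  unfolding padic_null_def by (auto intro!: LIMSEQ_I simp: vabs_nonneg)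

lemma Nu_eventually_0: "(\<And>i. i \<ge> N \<Longrightarrow> s i = 0) \<Longrightarrow> s \<in> Nu"
  by (rule NuI) (auto intro!: exI[of _ N])

lemma Ca_const [simp]: "(\<lambda>_. c) \<in> Ca"
  by (simp add: padic_cauchy_def)

lemma Ca_add: "s \<in> Ca \<Longrightarrow> t \<in> Ca \<Longrightarrow> (\<lambda>i. s i + t i) \<in> Ca"
proof -
  assume s: "s \<in> Ca" and t: "t \<in> Ca"
  show ?thesis unfolding padic_cauchy_def
  proof safe
    fix e :: real assume e: "e > 0"
    obtain N where N: "\<forall>i\<ge>N. \<forall>j\<ge>N. vabs (s i - s j) < e" using CaD[OF s e] by blast
    obtain M where M: "\<forall>i\<ge>M. \<forall>j\<ge>M. vabs (t i - t j) < e" using CaD[OF t e] by blast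
    have "vabs (s i + t i - (s j + t j)) < e" if "i \<ge> max N M" "j \<ge> max N M" for i j
      using vabs_add_less[of "s i - s j" e "t i - t j"] N M that by (simp add: algebra_simps)
    then show "\<exists>N. \<forall>i\<ge>N. \<forall>j\<ge>N. vabs (s i + t i - (s j + t j)) < e" by blast
  qed
qed

lemma Ca_uminus: "s \<in> Ca \<Longrightarrow> (\<lambda>i. - s i) \<in> Ca"
proof -
  have "vabs (- a - - b) = vabs (a - b)" for a b using vabs_minus[of "a - b"] by simp
  then show "s \<in> Ca \<Longrightarrow> (\<lambda>i. - s i) \<in> Ca" unfolding padic_cauchy_def mem_Collect_eq by (simp only:)
qed

lemma Ca_bounded: "s \<in> Ca \<Longrightarrow> \<exists>B>0. \<forall>i. vabs (s i) \<le> B"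
proof -
  assume s: "s \<in> Ca"
  obtain N where N: "\<forall>i\<ge>N. \<forall>j\<ge>N. vabs (s i - s j) < 1" using CaD[OF s, of 1] by auto
  define B where "B = 1 + (\<Sum>i\<le>N. vabs (s i))"
  have le: "vabs (s i) \<le> (\<Sum>i\<le>N. vabs (s i))" if "i \<le> N" for i
    by (rule member_le_sum) (use that vabs_nonneg in auto)
  have S: "(\<Sum>i\<le>N. vabs (s i)) \<ge> 0" by (intro sum_nonneg vabs_nonneg)
  have "vabs (s i) \<le> B" for i
  proof (cases "i \<le> N")
    case True then show ?thesis using le[OF True] by (simp add: B_def)
  next
    case False
    have "vabs (s i - s N) \<le> B" using N[rule_format, of i N] False S by (simp add: B_def)
    moreover have "vabs (s N) \<le> B" using le[of N] by (simp add: B_def)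
    ultimately show ?thesis using vabs_add_le[of "s i - s N" B "s N"] by simp
  qed
  moreover have "B > 0" using S by (simp add: B_def)
  ultimately show ?thesis by blast
qed

lemma Ca_mult: "s \<in> Ca \<Longrightarrow> t \<in> Ca \<Longrightarrow> (\<lambda>i. s i * t i) \<in> Ca"
proof -
  assume s: "s \<in> Ca" and t: "t \<in> Ca"
  obtain B where B: "B > 0" "\<And>i. vabs (s i) \<le> B" using Ca_bounded[OF s] by blast
  obtain C where C: "C > 0" "\<And>i. vabs (t i) \<le> C" using Ca_bounded[OF t] by blast
  show ?thesis unfolding padic_cauchy_def
  proof safe
    fix e :: real assume e: "e > 0"
    obtain N where N: "\<forall>i\<ge>N. \<forall>j\<ge>N. vabs (s i - s j) < e / C" using CaD[OF s] e C by (meson divide_pos_pos)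
    obtain M where M: "\<forall>i\<ge>M. \<forall>j\<ge>M. vabs (t i - t j) < e / B" using CaD[OF t] e B by (meson divide_pos_pos)
    have "vabs (s i * t i - s j * t j) < e" if ij: "i \<ge> max N M" "j \<ge> max N M" for i j
    proof -
      have "vabs (s i) * vabs (t i - t j) \<le> B * vabs (t i - t j)" using B vabs_nonneg by (intro mult_right_mono) auto
      also have "\<dots> < B * (e / B)" using M ij B by (intro mult_strict_left_mono) auto
      finally have 1: "vabs (s i * (t i - t j)) < e" using B by (simp add: vabs_mult)
      have "vabs (s i - s j) * vabs (t j) \<le> vabs (s i - s j) * C" using C vabs_nonneg by (intro mult_left_mono) auto
      also have "\<dots> < (e / C) * C" using N ij C by (intro mult_strict_right_mono) auto
      finally have 2: "vabs ((s i - s j) * t j) < e" using C by (simp add: vabs_mult)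
      show ?thesis using vabs_add_less[OF 1 2] by (simp add: algebra_simps)
    qed
    then show "\<exists>N. \<forall>i\<ge>N. \<forall>j\<ge>N. vabs (s i * t i - s j * t j) < e" by blast
  qed
qed

lemma Nu_Ca: "s \<in> Nu \<Longrightarrow> s \<in> Ca"
proof -
  assume s: "s \<in> Nu"
  show ?thesis unfolding padic_cauchy_def
  proof safe
    fix e :: real assume "e > 0"
    then obtain N where "\<forall>i\<ge>N. vabs (s i) < e" using NuD[OF s] by blast
    then show "\<exists>N. \<forall>i\<ge>N. \<forall>j\<ge>N. vabs (s i - s j) < e" by (intro exI[of _ N] allI impI vabs_diff_less) simp_all
  qed
qed

lemma CR_simps: "carrier CR = Ca" "\<zero>\<^bsub>CR\<^esub> = (\<lambda>_. 0)" "\<one>\<^bsub>CR\<^esub> = (\<lambda>_. 1)"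
  "s \<otimes>\<^bsub>CR\<^esub> t = (\<lambda>i. s i * t i)" "s \<oplus>\<^bsub>CR\<^esub> t = (\<lambda>i. s i + t i)"
  by (simp_all add: padic_cauchy_ring_def)

sublocale C: cring CR
proof (rule cringI)
  show "abelian_group CR"
  proof (rule abelian_groupI)
    fix x assume "x \<in> carrier CR"
    then show "\<exists>y\<in>carrier CR. y \<oplus>\<^bsub>CR\<^esub> x = \<zero>\<^bsub>CR\<^esub>"
      by (intro bexI[of _ "\<lambda>i. - x i"]) (auto simp: CR_simps Ca_uminus)
  qed (auto simp: CR_simps Ca_add algebra_simps)
  show "comm_monoid CR"
    by (rule comm_monoidI) (auto simp: CR_simps Ca_mult)
qed (auto simp: CR_simps algebra_simps)

lemma CR_uminus: "s \<in> Ca \<Longrightarrow> \<ominus>\<^bsub>CR\<^esub> s = (\<lambda>i. - s i)"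
  by (rule C.minus_equality) (auto simp: CR_simps Ca_uminus)

lemma CR_diff: "s \<in> Ca \<Longrightarrow> t \<in> Ca \<Longrightarrow> s \<ominus>\<^bsub>CR\<^esub> t = (\<lambda>i. s i - t i)"
  by (simp add: a_minus_def CR_uminus CR_simps)

lemma Nu_ideal: "ideal Nu CR"
proof (rule idealI)
  show "ring CR" by (rule C.ring_axioms)
  show "subgroup Nu (add_monoid CR)"
  proof
    show "Nu \<subseteq> carrier (add_monoid CR)" using Nu_Ca by (auto simp: CR_simps)
    fix x y assume xy: "x \<in> Nu" "y \<in> Nu"
    show "x \<otimes>\<^bsub>add_monoid CR\<^esub> y \<in> Nu"
    proof (simp add: CR_simps, rule NuI)
      fix e :: real assume e: "e > 0"
      obtain N M where "\<forall>i\<ge>N. vabs (x i) < e" "\<forall>i\<ge>M. vabs (y i) < e" using NuD[OF xy(1) e] NuD[OF xy(2) e] by blast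
      then show "\<exists>N. \<forall>i\<ge>N. vabs (x i + y i) < e" by (intro exI[of _ "max N M"]) (auto intro: vabs_add_less)
    qed
  next
    show "\<one>\<^bsub>add_monoid CR\<^esub> \<in> Nu" by (simp add: CR_simps Nu_eventually_0)
  next
    fix x assume x: "x \<in> Nu"
    have "inv\<^bsub>add_monoid CR\<^esub> x = (\<lambda>i. - x i)" using CR_uminus[OF Nu_Ca[OF x]] by (simp add: a_inv_def)
    then show "inv\<^bsub>add_monoid CR\<^esub> x \<in> Nu" using x by (simp add: padic_null_def)
  qed
  fix a x assume a: "a \<in> Nu" and x: "x \<in> carrier CR"
  obtain B where B: "B > 0" "\<And>i. vabs (x i) \<le> B" using Ca_bounded x by (auto simp: CR_simps)
  have "(\<lambda>i. x i * a i) \<in> Nu"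
  proof (rule NuI)
    fix e :: real assume e: "e > 0"
    obtain N where N: "\<forall>i\<ge>N. vabs (a i) < e / B" using NuD[OF a] e B by (meson divide_pos_pos)
    have "vabs (x i * a i) < e" if "i \<ge> N" for i
    proof -
      have "vabs (x i) * vabs (a i) \<le> B * vabs (a i)" using B vabs_nonneg by (intro mult_right_mono) auto
      also have "\<dots> < B * (e / B)" using N that B by (intro mult_strict_left_mono) auto
      finally show ?thesis using B by (simp add: vabs_mult)
    qed
    then show "\<exists>N. \<forall>i\<ge>N. vabs (x i * a i) < e" by blast
  qed
  then show "x \<otimes>\<^bsub>CR\<^esub> a \<in> Nu" "a \<otimes>\<^bsub>CR\<^esub> x \<in> Nu" by (simp_all add: CR_simps mult.commute)
qed

text \<open>Infinitely many terms stay away from 0. From some index on the terms are closer to each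
  other than that size, and then the ultrametric inequality makes their absolute values
  equal.\<close>

lemma nonnull_eventually_const:
  assumes s: "s \<in> Ca" and n: "s \<notin> Nu"
  obtains N where "\<And>i. i \<ge> N \<Longrightarrow> vabs (s i) = vabs (s N)" "s N \<noteq> 0"
proof -
  obtain e where e: "e > 0" "\<And>N. \<exists>i\<ge>N. vabs (s i) \<ge> e" using n NuI[of s] by (metis not_le)
  obtain N where N: "\<forall>i\<ge>N. \<forall>j\<ge>N. vabs (s i - s j) < e" using CaD[OF s e(1)] by blast
  obtain k where k: "k \<ge> N" "vabs (s k) \<ge> e" using e(2) by blast
  have "vabs (s i) = vabs (s k)" if "i \<ge> k" for i
    using N that k by (intro vabs_close_eq) (meson le_trans less_le_trans)
  moreover have "s k \<noteq> 0" using k(2) e(1) by auto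
  ultimately show ?thesis using that by blast
qed

lemma Ca_inverse:
  assumes s: "s \<in> Ca" and n: "s \<notin> Nu" shows "(\<lambda>i. inverse (s i)) \<in> Ca"
proof -
  obtain N where N: "\<And>i. i \<ge> N \<Longrightarrow> vabs (s i) = vabs (s N)" "s N \<noteq> 0" using nonnull_eventually_const[OF s n] by blast
  define c where "c = vabs (s N)"
  have c: "c > 0" using vabs_pos[OF N(2)] by (simp add: c_def)
  \<comment> \<open>Early terms may be 0, where \<open>inverse\<close> yields 0. The Cauchy
    condition only sees the tail, on which the absolute value is the constant
    \<open>c > 0\<close>.\<close>
  have nz: "s i \<noteq> 0" if "i \<ge> N" for i using N(1)[OF that] c c_def by auto
  show ?thesis unfolding padic_cauchy_def
  proof safe
    fix e :: real assume e: "e > 0"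
    have "e * c * c > 0" using e c by simp
    then obtain M where M: "\<forall>i\<ge>M. \<forall>j\<ge>M. vabs (s i - s j) < e * c * c" using CaD[OF s] by blast
    have "vabs (inverse (s i) - inverse (s j)) < e" if ij: "i \<ge> max N M" "j \<ge> max N M" for i j
    proof -
      have "inverse (s i) - inverse (s j) = (s j - s i) * (inverse (s i) * inverse (s j))"
        using nz[of i] nz[of j] ij by (simp add: field_simps)
      then have "vabs (inverse (s i) - inverse (s j)) = vabs (s j - s i) * (inverse c * inverse c)"
        using N(1)[of i] N(1)[of j] ij by (simp add: vabs_mult vabs_inverse c_def)
      also have "\<dots> < e * c * c * (inverse c * inverse c)" using M ij c by (intro mult_strict_right_mono) auto
      also have "\<dots> = e" using c by (simp add: field_simps)
      finally show ?thesis .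
    qed
    then show "\<exists>N. \<forall>i\<ge>N. \<forall>j\<ge>N. vabs (inverse (s i) - inverse (s j)) < e" by blast
  qed
qed

lemma Nu_maximal: "maximalideal Nu CR"
proof (rule maximalidealI[OF Nu_ideal])
  show "carrier CR \<noteq> Nu"
  proof
    assume c: "carrier CR = Nu"
    have "(\<lambda>_. 1) \<in> carrier CR" by (simp add: CR_simps)
    then have "(\<lambda>_. 1) \<in> Nu" unfolding c .
    then show False using NuD[of "\<lambda>_. 1" 1] by auto
  qed
  fix J assume J: "ideal J CR" "Nu \<subseteq> J" "J \<subseteq> carrier CR"
  show "J = Nu \<or> J = carrier CR"
  proof (rule disjCI)
    assume "J \<noteq> carrier CR"
    show "J = Nu"
    proof (rule ccontr)
      assume "J \<noteq> Nu"
      then obtain s where s: "s \<in> J" "s \<notin> Nu" using J(2) by blast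
      have "s \<in> carrier CR" using s(1) J(3) by blast
      then have sC: "s \<in> Ca" by (simp add: CR_simps)
      define t where "t = (\<lambda>i. inverse (s i))"
      have t: "t \<in> Ca" unfolding t_def by (rule Ca_inverse[OF sC s(2)])
      obtain N where N: "\<And>i. i \<ge> N \<Longrightarrow> vabs (s i) = vabs (s N)" "s N \<noteq> 0" using nonnull_eventually_const[OF sC s(2)] by blast
      have nz: "s i \<noteq> 0" if "i \<ge> N" for i using N(1)[OF that] vabs_pos[OF N(2)] by auto
      \<comment> \<open>\<open>t\<close> inverts \<open>s\<close> from index \<open>N\<close> on, so
        \<open>1 - s t\<close> is eventually 0 and lies in the null ideal; adding \<open>s t\<close>
        puts 1 into \<open>J\<close>.\<close>
      have "(\<lambda>i. 1 - s i * t i) \<in> Nu" by (rule Nu_eventually_0[of N]) (simp add: t_def nz)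
      then have 1: "(\<lambda>i. 1 - s i * t i) \<in> J" using J by blast
      have 2: "(\<lambda>i. s i * t i) \<in> J" using ideal.I_r_closed[OF J(1) s(1), of t] t by (simp add: CR_simps)
      have "(\<lambda>i. 1 - s i * t i) \<oplus>\<^bsub>CR\<^esub> (\<lambda>i. s i * t i) \<in> J"
        by (rule additive_subgroup.a_closed[OF ideal.axioms(1)[OF J(1)] 1 2])
      then have "\<one>\<^bsub>CR\<^esub> \<in> J" by (simp add: CR_simps)
      then show False using ideal.one_imp_carrier[OF J(1)] \<open>J \<noteq> carrier CR\<close> by blast
    qed
  qed
qed

lemma Qp_field: "field (Qp p)"
  unfolding Qp_def by (rule maximalideal.quotient_is_field[OF Nu_maximal C.is_cring])

sublocale Q: field "Qp p" by (rule Qp_field)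

section \<open>The field of p-adic numbers and its integers\<close>

definition cls :: "(nat \<Rightarrow> rat) \<Rightarrow> (nat \<Rightarrow> rat) set" where "cls s = Nu +>\<^bsub>CR\<^esub> s"

lemma cls_hom: "cls \<in> Ring.ring_hom CR (Qp p)"
  using ideal.rcos_ring_hom[OF Nu_ideal] unfolding Qp_def cls_def[abs_def] .

lemma cls_closed [simp]: "s \<in> Ca \<Longrightarrow> cls s \<in> carrier (Qp p)"
  by (rule ring_hom_closed[OF cls_hom, of s, unfolded CR_simps])

lemma cls_mult: "s \<in> Ca \<Longrightarrow> t \<in> Ca \<Longrightarrow> cls (\<lambda>i. s i * t i) = cls s \<otimes>\<^bsub>Qp p\<^esub> cls t"
  by (rule ring_hom_mult[OF cls_hom, of s t, unfolded CR_simps])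

lemma cls_add: "s \<in> Ca \<Longrightarrow> t \<in> Ca \<Longrightarrow> cls (\<lambda>i. s i + t i) = cls s \<oplus>\<^bsub>Qp p\<^esub> cls t"
  by (rule ring_hom_add[OF cls_hom, of s t, unfolded CR_simps])

lemma cls_1: "cls (\<lambda>_. 1) = \<one>\<^bsub>Qp p\<^esub>"
  by (rule ring_hom_one[OF cls_hom, unfolded CR_simps])

lemma cls_0: "cls (\<lambda>_. 0) = \<zero>\<^bsub>Qp p\<^esub>"
  by (rule ring_hom_zero[OF cls_hom C.ring_axioms Q.ring_axioms, unfolded CR_simps])

lemma cls_surj: "z \<in> carrier (Qp p) \<Longrightarrow> \<exists>s\<in>Ca. z = cls s"
proof -
  assume "z \<in> carrier (Qp p)"
  then have "z \<in> a_rcosets\<^bsub>CR\<^esub> Nu" by (simp add: Qp_def FactRing_def)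
  then show ?thesis unfolding A_RCOSETS_def' cls_def CR_simps by blast
qed

lemma cls_eq_iff:
  assumes s: "s \<in> Ca" and t: "t \<in> Ca" shows "cls s = cls t \<longleftrightarrow> (\<lambda>i. s i - t i) \<in> Nu"
proof -
  have "s \<ominus>\<^bsub>CR\<^esub> t \<in> Nu \<longleftrightarrow> Nu +>\<^bsub>CR\<^esub> s = Nu +>\<^bsub>CR\<^esub> t"
    by (rule C.quotient_eq_iff_same_a_r_cos[OF Nu_ideal]) (simp_all only: CR_simps s t)
  then show ?thesis unfolding cls_def CR_diff[OF s t] by blast
qed

lemma cls_eq_0_iff: "s \<in> Ca \<Longrightarrow> cls s = \<zero>\<^bsub>Qp p\<^esub> \<longleftrightarrow> s \<in> Nu"
  using cls_eq_iff[of s "\<lambda>_. 0"] by (simp add: cls_0)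

lemma cls_diff: "s \<in> Ca \<Longrightarrow> t \<in> Ca \<Longrightarrow> cls (\<lambda>i. s i - t i) = cls s \<ominus>\<^bsub>Qp p\<^esub> cls t"
proof -
  assume s: "s \<in> Ca" and t: "t \<in> Ca"
  have d: "(\<lambda>i. s i - t i) \<in> Ca" using Ca_add[OF s Ca_uminus[OF t]] by simp
  have "cls (\<lambda>i. s i - t i) \<oplus>\<^bsub>Qp p\<^esub> cls t = cls s" using cls_add[OF d t] by simp
  then show ?thesis using Q.add.inv_solve_right[of "cls (\<lambda>i. s i - t i)" "cls s" "cls t"] d s t by (simp add: a_minus_def)
qed

lemma cls_iz: "cls (\<lambda>_. of_int k) = Q.iz k"
proof -
  have "cls (C.iz k) = Q.iz k" by (rule C.ring_hom_iz[OF Q.is_cring cls_hom])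
  moreover have "C.iz k = (\<lambda>_. of_int k)"
  proof -
    have n: "C.iz (int j) = (\<lambda>_. of_nat j)" for j
      by (induction j) (simp_all add: C.iz_add CR_simps)
    show ?thesis
    proof (cases "k \<ge> 0")
      case True then show ?thesis using n[of "nat k"] by simp
    next
      case False
      have "C.iz k = C.iz (- int (nat (- k)))" using False by simp
      also have "\<dots> = (\<lambda>_. - of_nat (nat (- k)))" unfolding C.iz_minus n by (simp add: CR_uminus)
      finally show ?thesis using False by simp
    qed
  qed
  ultimately show ?thesis by simp
qed

lemma Zp_iff: "z \<in> Zp p \<longleftrightarrow> (\<exists>s\<in>Ca. z = cls s \<and> (\<forall>i. vabs (s i) \<le> 1))"
  by (auto simp: Zp_def cls_def)

text \<open>\<open>Zp\<close> asks for a representative all of whose terms are integral; replacing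
  an initial segment by 0 changes the sequence only by a null sequence.\<close>

lemma cls_in_Zp:
  assumes s: "s \<in> Ca" and le: "\<And>i. i \<ge> N \<Longrightarrow> vabs (s i) \<le> 1" shows "cls s \<in> Zp p"
proof -
  define t where "t = (\<lambda>i. if i \<ge> N then s i else 0)"
  have d: "(\<lambda>i. t i - s i) \<in> Nu" by (rule Nu_eventually_0[of N]) (simp add: t_def)
  have t: "t \<in> Ca" using Ca_add[OF Nu_Ca[OF d] s] by simp
  have "cls t = cls s" using cls_eq_iff[OF t s] d by simp
  moreover have "vabs (t i) \<le> 1" for i using le by (simp add: t_def)
  ultimately show ?thesis using t Zp_iff by metis
qed

lemma Zp_carrier: "z \<in> Zp p \<Longrightarrow> z \<in> carrier (Qp p)"
  by (auto simp: Zp_iff)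

lemma Zp_subring: "subring (Zp p) (Qp p)"
proof (rule Q.subringI)
  show "Zp p \<subseteq> carrier (Qp p)" using Zp_carrier by blast
  show "\<one>\<^bsub>Qp p\<^esub> \<in> Zp p" unfolding cls_1[symmetric] by (rule cls_in_Zp) auto
  fix x assume "x \<in> Zp p"
  then obtain s where s: "s \<in> Ca" "x = cls s" "\<And>i. vabs (s i) \<le> 1" by (auto simp: Zp_iff)
  have "\<ominus>\<^bsub>Qp p\<^esub> x = cls (\<lambda>i. 0 - s i)" using cls_diff[of "\<lambda>_. 0" s] s by (simp add: cls_0 a_minus_def)
  also have "\<dots> \<in> Zp p" by (rule cls_in_Zp) (use Ca_uminus[OF s(1)] s(3) in auto)
  finally show "\<ominus>\<^bsub>Qp p\<^esub> x \<in> Zp p" .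
  fix y assume "y \<in> Zp p"
  then obtain t where t: "t \<in> Ca" "y = cls t" "\<And>i. vabs (t i) \<le> 1" by (auto simp: Zp_iff)
  show "x \<otimes>\<^bsub>Qp p\<^esub> y \<in> Zp p" unfolding s(2) t(2) cls_mult[OF s(1) t(1), symmetric]
    by (rule cls_in_Zp[OF Ca_mult[OF s(1) t(1)]]) (use s(3) t(3) vabs_nonneg in \<open>simp add: vabs_mult mult_le_one\<close>)
  show "x \<oplus>\<^bsub>Qp p\<^esub> y \<in> Zp p" unfolding s(2) t(2) cls_add[OF s(1) t(1), symmetric]
    by (rule cls_in_Zp[OF Ca_add[OF s(1) t(1)]]) (use s(3) t(3) vabs_add_le in blast)
qed

abbreviation "ppi \<equiv> Q.iz (int p)"

lemma ppi_cls: "ppi = cls (\<lambda>_. of_nat p)"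
  using cls_iz[of "int p"] by simp

lemma ppi_pow_cls: "ppi [^]\<^bsub>Qp p\<^esub> k = cls (\<lambda>_. of_nat p ^ k)"
  using cls_iz[of "int p ^ k"] by (simp add: Q.iz_power)

lemma Zp_divide_p_power:
  assumes s: "s \<in> Ca" and le: "\<And>i. i \<ge> N \<Longrightarrow> vabs (s i) \<le> real p powi (- int k)"
  shows "\<exists>w\<in>Zp p. cls s = ppi [^]\<^bsub>Qp p\<^esub> k \<otimes>\<^bsub>Qp p\<^esub> w"
proof -
  define c where "c = inverse (of_nat p ^ k :: rat)"
  have pk: "(of_nat p ^ k :: rat) \<noteq> 0" using prime_p prime_gt_0_nat by auto
  have t: "(\<lambda>i. c * s i) \<in> Ca" by (rule Ca_mult[OF Ca_const s])
  have vc: "vabs c = real p ^ k" unfolding c_def by (rule vabs_inverse_p_power)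
  have "vabs (c * s i) \<le> 1" if "i \<ge> N" for i
  proof -
    have "vabs (c * s i) \<le> real p ^ k * real p powi (- int k)"
      unfolding vabs_mult vc using le[OF that] by (intro mult_left_mono) auto
    also have "\<dots> = 1" using p_pos by (simp add: power_int_minus)
    finally show ?thesis .
  qed
  then have "cls (\<lambda>i. c * s i) \<in> Zp p" by (rule cls_in_Zp[OF t])
  moreover have "cls s = ppi [^]\<^bsub>Qp p\<^esub> k \<otimes>\<^bsub>Qp p\<^esub> cls (\<lambda>i. c * s i)"
  proof -
    have "of_nat p ^ k * (c * s i) = s i" for i unfolding c_def mult.assoc[symmetric] right_inverse[OF pk] by (rule mult_1)
    then have e: "(\<lambda>i. of_nat p ^ k * (c * s i)) = s" by (rule ext)
    show ?thesis unfolding ppi_pow_cls cls_mult[OF Ca_const t, symmetric] e ..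
  qed
  ultimately show ?thesis by blast
qed

text \<open>Together with \<open>Zp_divide_p_power\<close> this reads divisibility by
  \<open>p^k\<close> off the tail of any representative: two representatives differ by a null
  sequence, whose terms eventually fall below the bound.\<close>

lemma ppi_pow_mult_bound:
  assumes s: "s \<in> Ca" and w: "w \<in> Zp p" and e: "cls s = ppi [^]\<^bsub>Qp p\<^esub> k \<otimes>\<^bsub>Qp p\<^esub> w"
  shows "\<exists>N. \<forall>i\<ge>N. vabs (s i) \<le> real p powi (- int k)"
proof -
  obtain t where t: "t \<in> Ca" "w = cls t" "\<And>i. vabs (t i) \<le> 1" using w by (auto simp: Zp_iff)
  have pt: "(\<lambda>i. of_nat p ^ k * t i) \<in> Ca" by (rule Ca_mult[OF Ca_const t(1)])
  have "cls s = cls (\<lambda>i. of_nat p ^ k * t i)" using e cls_mult[OF Ca_const t(1), of "of_nat p ^ k"] by (simp add: t(2) ppi_pow_cls)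
  then have n: "(\<lambda>i. s i - of_nat p ^ k * t i) \<in> Nu" using cls_eq_iff[OF s pt] by simp
  have pos: "real p powi (- int k) > 0" using p_pos by (rule zero_less_power_int)
  obtain N where N: "\<forall>i\<ge>N. vabs (s i - of_nat p ^ k * t i) < real p powi (- int k)" using NuD[OF n pos] by blast
  have "vabs (s i) \<le> real p powi (- int k)" if "i \<ge> N" for i
  proof -
    have "vabs (of_nat p ^ k * t i) \<le> real p powi (- int k)"
      using t(3)[of i] p_pos by (simp add: vabs_mult vabs_power vabs_p power_int_minus power_divide field_simps)
    then show ?thesis using vabs_add_le[of "s i - of_nat p ^ k * t i" _ "of_nat p ^ k * t i"] N that by force
  qed
  then show ?thesis by blast
qed

lemma ppi_not_zero: "ppi \<noteq> \<zero>\<^bsub>Qp p\<^esub>"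
proof
  assume "ppi = \<zero>\<^bsub>Qp p\<^esub>"
  then have "(\<lambda>_. of_nat p) \<in> Nu" unfolding ppi_cls by (simp add: cls_eq_0_iff)
  then show False using NuD[of "\<lambda>_. of_nat p" "1 / real p"] p_pos by (auto simp: vabs_p)
qed

lemma ppi_inv_not_Zp: "w \<in> Zp p \<Longrightarrow> ppi \<otimes>\<^bsub>Qp p\<^esub> w \<noteq> \<one>\<^bsub>Qp p\<^esub>"
proof
  assume w: "w \<in> Zp p" and "ppi \<otimes>\<^bsub>Qp p\<^esub> w = \<one>\<^bsub>Qp p\<^esub>"
  then have "cls (\<lambda>_. 1) = ppi [^]\<^bsub>Qp p\<^esub> (1::nat) \<otimes>\<^bsub>Qp p\<^esub> w" by (simp add: cls_1)
  then obtain N :: nat where "\<forall>i\<ge>N. vabs 1 \<le> real p powi (- int 1)" using ppi_pow_mult_bound[OF Ca_const w] by blast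
  from this[rule_format, OF order_refl] have "vabs 1 \<le> real p powi (- int 1)" .
  then have "1 \<le> 1 / real p" by (simp add: power_int_minus inverse_eq_divide)
  then show False using p_gt_1 by simp
qed

text \<open>The absolute value of a non-null sequence is eventually a fixed power of
  \<open>p\<close>, and rescaling by this power yields a unit. The two alternatives stand for the
  two signs of the exponent.\<close>

lemma Zp_unit_decomp:
  assumes z: "z \<in> carrier (Qp p)" "z \<noteq> \<zero>\<^bsub>Qp p\<^esub>"
  shows "\<exists>k::nat. \<exists>u\<in>Zp p. inv\<^bsub>Qp p\<^esub> u \<in> Zp p \<and> u \<noteq> \<zero>\<^bsub>Qp p\<^esub> \<and> (z = ppi [^]\<^bsub>Qp p\<^esub> k \<otimes>\<^bsub>Qp p\<^esub> u \<or> z \<otimes>\<^bsub>Qp p\<^esub> ppi [^]\<^bsub>Qp p\<^esub> k = u)"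
proof -
  obtain s where s: "s \<in> Ca" "z = cls s" using cls_surj[OF z(1)] by blast
  have n: "s \<notin> Nu" using z s cls_eq_0_iff by simp
  obtain N where N: "\<And>i. i \<ge> N \<Longrightarrow> vabs (s i) = vabs (s N)" "s N \<noteq> 0" using nonnull_eventually_const[OF s(1) n] by blast
  obtain k where k: "vabs (s N) = real p powi k" using vabs_nonzero[OF N(2)] by blast
  have unit: "cls t \<in> Zp p \<and> inv\<^bsub>Qp p\<^esub> (cls t) \<in> Zp p \<and> cls t \<noteq> \<zero>\<^bsub>Qp p\<^esub>"
    if t: "t \<in> Ca" and v: "\<And>i. i \<ge> N \<Longrightarrow> vabs (t i) = 1" for t
  proof -
    have tn: "t \<notin> Nu"
    proof
      assume "t \<in> Nu"
      then obtain M where "\<forall>i\<ge>M. vabs (t i) < 1" using NuD[of t 1] by auto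
      then show False using v[of "max N M"] by (metis less_irrefl max.cobounded1 max.cobounded2)
    qed
    have nz: "t i \<noteq> 0" if "i \<ge> N" for i using v[OF that] by auto
    have ti: "(\<lambda>i. inverse (t i)) \<in> Ca" by (rule Ca_inverse[OF t tn])
    have "cls t \<otimes>\<^bsub>Qp p\<^esub> cls (\<lambda>i. inverse (t i)) = cls (\<lambda>i. t i * inverse (t i))" by (rule cls_mult[OF t ti, symmetric])
    also have "\<dots> = cls (\<lambda>_. 1)"
      by (subst cls_eq_iff[OF Ca_mult[OF t ti] Ca_const], rule Nu_eventually_0[of N]) (simp add: nz)
    finally have "inv\<^bsub>Qp p\<^esub> (cls t) = cls (\<lambda>i. inverse (t i))" using Q.comm_inv_char t ti cls_1 by simp
    moreover have "cls (\<lambda>i. inverse (t i)) \<in> Zp p" by (rule cls_in_Zp[OF ti, of N]) (simp add: vabs_inverse v)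
    moreover have "cls t \<in> Zp p" by (rule cls_in_Zp[OF t, of N]) (simp add: v)
    ultimately show ?thesis using cls_eq_0_iff[OF t] tn by simp
  qed
  have pk: "(of_nat p ^ j :: rat) \<noteq> 0" for j using prime_p prime_gt_0_nat by auto
  show ?thesis
  proof (cases "k \<ge> 0")
    case True
    define j where "j = nat k"
    define t where "t = (\<lambda>i. s i * of_nat p ^ j)"
    have t: "t \<in> Ca" unfolding t_def by (rule Ca_mult[OF s(1) Ca_const])
    have "vabs (t i) = 1" if "i \<ge> N" for i
      using N(1)[OF that] k True p_pos by (simp add: t_def vabs_mult vabs_power vabs_p j_def power_int_def power_divide)
    then have "cls t \<in> Zp p \<and> inv\<^bsub>Qp p\<^esub> (cls t) \<in> Zp p \<and> cls t \<noteq> \<zero>\<^bsub>Qp p\<^esub>" by (rule unit[OF t])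
    moreover have "z \<otimes>\<^bsub>Qp p\<^esub> ppi [^]\<^bsub>Qp p\<^esub> j = cls t" unfolding s(2) ppi_pow_cls t_def by (rule cls_mult[OF s(1) Ca_const, symmetric])
    ultimately show ?thesis by blast
  next
    case False
    define j where "j = nat (- k)"
    define t where "t = (\<lambda>i. inverse (of_nat p ^ j) * s i)"
    have t: "t \<in> Ca" unfolding t_def by (rule Ca_mult[OF Ca_const s(1)])
    have "vabs (t i) = 1" if "i \<ge> N" for i
    proof -
      have kj: "k = - int j" using False by (simp add: j_def)
      have "vabs (t i) = real p ^ j * real p powi k" unfolding t_def vabs_mult vabs_inverse_p_power N(1)[OF that] k ..
      also have "\<dots> = 1" unfolding kj using p_pos by (simp add: power_int_minus)
      finally show ?thesis .
    qed
    then have "cls t \<in> Zp p \<and> inv\<^bsub>Qp p\<^esub> (cls t) \<in> Zp p \<and> cls t \<noteq> \<zero>\<^bsub>Qp p\<^esub>" by (rule unit[OF t])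
    moreover have "z = ppi [^]\<^bsub>Qp p\<^esub> j \<otimes>\<^bsub>Qp p\<^esub> cls t"
    proof -
      have "of_nat p ^ j * t i = s i" for i unfolding t_def mult.assoc[symmetric] right_inverse[OF pk] by (rule mult_1)
      then have e: "(\<lambda>i. of_nat p ^ j * t i) = s" by (rule ext)
      show ?thesis unfolding s(2) ppi_pow_cls cls_mult[OF Ca_const t, symmetric] e ..
    qed
    ultimately show ?thesis by blast
  qed
qed

lemma Zp_residue: "z \<in> Zp p \<Longrightarrow> \<exists>m. \<exists>w\<in>Zp p. z \<ominus>\<^bsub>Qp p\<^esub> Q.iz m = ppi \<otimes>\<^bsub>Qp p\<^esub> w"
proof -
  assume "z \<in> Zp p"
  then obtain s where s: "s \<in> Ca" "z = cls s" "\<And>i. vabs (s i) \<le> 1" by (auto simp: Zp_iff)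
  obtain N where N: "\<forall>i\<ge>N. \<forall>j\<ge>N. vabs (s i - s j) < 1" using CaD[OF s(1), of 1] by auto
  have "\<exists>m. vabs (s N - of_int m) < 1"
  proof (cases "vabs (s N) < 1")
    case True then show ?thesis by (intro exI[of _ 0]) simp
  next
    case False
    then have v1: "vabs (s N) = 1" using s(3)[of N] by simp
    obtain a b where ab: "quotient_of (s N) = (a, b)" by fastforce
    have sN: "s N = of_int a / of_int b" and b0: "b \<noteq> 0" and cop: "coprime a b"
      using quotient_of_div[OF ab] quotient_of_denom_pos[OF ab] quotient_of_coprime[OF ab] by auto
    have a0: "a \<noteq> 0" using v1 sN by auto
    have "int (multiplicity (int p) b) - int (multiplicity (int p) a) = 0"
    proof (rule ccontr)
      assume ne: "int (multiplicity (int p) b) - int (multiplicity (int p) a) \<noteq> 0"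
      have "real p powi (int (multiplicity (int p) b) - int (multiplicity (int p) a)) = 1" using vabs_frac[OF a0 b0] v1 sN by simp
      then show False using ne p_gt_1 power_int_strict_increasing[of 0 "int (multiplicity (int p) b) - int (multiplicity (int p) a)" "real p"]
          power_int_strict_increasing[of "int (multiplicity (int p) b) - int (multiplicity (int p) a)" 0 "real p"] by (cases rule: linorder_cases) auto
    qed
    then have eqm: "multiplicity (int p) b = multiplicity (int p) a" by simp
    have npb: "\<not> int p dvd b"
    proof
      assume "int p dvd b"
      then have "multiplicity (int p) b > 0" using b0 prime_int_p by (simp add: prime_multiplicity_gt_zero_iff)
      then have "int p dvd a" using eqm by (metis dvd_power multiplicity_dvd dvd_trans)
      then have "is_unit (int p)" using cop \<open>int p dvd b\<close> by (meson coprime_common_divisor)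
      then show False using prime_int_p by (simp add: prime_elem_def)
    qed
    have ip: "Factorial_Ring.prime (int p)" using prime_p by simp
    \<comment> \<open>With \<open>c\<close> inverse to the denominator \<open>b\<close> modulo
      \<open>p\<close>, the integer \<open>a * c\<close> approximates \<open>a / b\<close>: the
      difference is \<open>a / b\<close> times the multiple \<open>1 - c b\<close> of
      \<open>p\<close>.\<close>
    obtain c where c: "int p dvd c * b - 1" using prime_inverse_mod[OF ip npb] by blast
    have "s N - of_int (a * c) = - (s N * of_int (c * b - 1))"
      using b0 sN by (simp add: field_simps)
    then have "vabs (s N - of_int (a * c)) = vabs (s N) * vabs (of_int (c * b - 1))"
      by (simp only: vabs_minus vabs_mult)
    also have "\<dots> \<le> 1 / real p"
    proof (cases "c * b - 1 = 0")
      case False then show ?thesis using vabs_int_le[of "c * b - 1" 1] c v1 by (simp add: power_int_minus inverse_eq_divide del: of_int_mult of_int_diff)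
    qed (use p_pos in \<open>simp del: of_int_mult of_int_diff\<close>)
    also have "\<dots> < 1" using p_gt_1 by simp
    finally show ?thesis by blast
  qed
  then obtain m where m: "vabs (s N - of_int m) < 1" by blast
  have d: "(\<lambda>i. s i - of_int m) \<in> Ca" using Ca_add[OF s(1) Ca_const[of "- of_int m"]] by simp
  have "vabs (s i - of_int m) \<le> real p powi (- int 1)" if "i \<ge> N" for i
  proof -
    have "vabs (s i - s N) < 1" using N that by simp
    then have "vabs (s i - of_int m) < 1" using vabs_add_less[of "s i - s N" 1 "s N - of_int m"] m by simp
    then show ?thesis using vabs_less_1 by (simp add: power_int_minus inverse_eq_divide)
  qed
  then obtain w where "w \<in> Zp p" "cls (\<lambda>i. s i - of_int m) = ppi [^]\<^bsub>Qp p\<^esub> (1::nat) \<otimes>\<^bsub>Qp p\<^esub> w"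
    using Zp_divide_p_power[OF d] by blast
  moreover have "cls (\<lambda>i. s i - of_int m) = z \<ominus>\<^bsub>Qp p\<^esub> Q.iz m" using cls_diff[OF s(1) Ca_const, of "of_int m"] by (simp add: s(2) cls_iz)
  ultimately show ?thesis by auto
qed

lemma iz_dvd_of_ppi_pow:
  assumes "w \<in> Zp p" "Q.iz m = ppi [^]\<^bsub>Qp p\<^esub> k \<otimes>\<^bsub>Qp p\<^esub> w" shows "int p ^ k dvd m"
  using ppi_pow_mult_bound[OF Ca_const assms(1), of "of_int m" k] assms(2) by (auto simp: cls_iz intro: vabs_int_dvd)

text \<open>A coherent sequence of integers is itself Cauchy and represents its own limit.
  Completeness is passed on in this form; \<open>A_has_limits\<close> extends it to series with
  p-adic coefficients.\<close>

lemma int_seq_limit: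
  fixes t :: "nat \<Rightarrow> int"
  assumes t: "\<And>k. int p ^ k dvd t (Suc k) - t k"
  shows "\<exists>s\<in>Zp p. \<forall>k. \<exists>w\<in>Zp p. s \<ominus>\<^bsub>Qp p\<^esub> Q.iz (t k) = ppi [^]\<^bsub>Qp p\<^esub> k \<otimes>\<^bsub>Qp p\<^esub> w"
proof -
  have dv: "int p ^ k dvd t i - t k" if "k \<le> i" for i k using that
  proof (induction rule: dec_induct)
    case (step j)
    have "int p ^ k dvd t (Suc j) - t j" using t[of j] step(1) by (meson dvd_trans le_imp_power_dvd)
    then show ?case using dvd_add[OF _ step.IH] by force
  qed simp
  have vk: "vabs (of_int (t i) - of_int (t k)) \<le> real p powi (- int k)" if "k \<le> i" for i k
  proof (cases "t i = t k")
    case True then show ?thesis using p_pos by simp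
  next
    case False then show ?thesis using vabs_int_le[of "t i - t k" k] dv[OF that] by simp
  qed
  define s where "s = (\<lambda>i. of_int (t i) :: rat)"
  have s: "s \<in> Ca" unfolding padic_cauchy_def
  proof safe
    fix e :: real assume e: "e > 0"
    obtain k where k: "(1 / real p) ^ k < e" using real_arch_pow_inv[OF e, of "1 / real p"] p_gt_1 by auto
    then have k': "real p powi (- int k) < e" by (simp add: power_int_minus power_divide inverse_eq_divide)
    have "vabs (s i - s j) < e" if "i \<ge> k" "j \<ge> k" for i j
      using vabs_diff_less[of "s i - s k" e "s j - s k"] vk[OF that(1)] vk[OF that(2)] k' by (simp add: s_def)
    then show "\<exists>N. \<forall>i\<ge>N. \<forall>j\<ge>N. vabs (s i - s j) < e" by blast
  qed
  have "cls s \<in> Zp p" by (rule cls_in_Zp[OF s, of 0]) (simp add: s_def vabs_int_le_1)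
  moreover have "\<exists>w\<in>Zp p. cls s \<ominus>\<^bsub>Qp p\<^esub> Q.iz (t k) = ppi [^]\<^bsub>Qp p\<^esub> k \<otimes>\<^bsub>Qp p\<^esub> w" for k
  proof -
    have d: "(\<lambda>i. s i - of_int (t k)) \<in> Ca" using Ca_add[OF s Ca_const[of "- of_int (t k)"]] by simp
    have "\<exists>w\<in>Zp p. cls (\<lambda>i. s i - of_int (t k)) = ppi [^]\<^bsub>Qp p\<^esub> k \<otimes>\<^bsub>Qp p\<^esub> w"
      by (rule Zp_divide_p_power[OF d, of k]) (use vk in \<open>simp add: s_def\<close>)
    then show ?thesis using cls_diff[OF s Ca_const, of "of_int (t k)"] by (simp add: cls_iz)
  qed
  ultimately show ?thesis by blast
qed

end

section \<open>Finite modules over the \<open>p\<close>-adic integers\<close>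

context cring
begin

text \<open>Scalars, generators and elements all live in one ring, so that the same notion serves
  for spans over the p-adic integers, over the p-adic numbers and over a finite algebra.\<close>

primrec spn :: "'a set \<Rightarrow> 'a list \<Rightarrow> 'a set" where
  "spn A [] = {\<zero>}"
| "spn A (u # us) = {a \<otimes> u \<oplus> v | a v. a \<in> A \<and> v \<in> spn A us}"

lemma spnI: "a \<in> A \<Longrightarrow> v \<in> spn A us \<Longrightarrow> a \<otimes> u \<oplus> v \<in> spn A (u # us)"
  by auto

definition submod :: "'a set \<Rightarrow> 'a set \<Rightarrow> bool" where
  "submod A N \<longleftrightarrow> N \<subseteq> carrier R \<and> \<zero> \<in> N \<and> (\<forall>x\<in>N. \<forall>y\<in>N. x \<oplus> y \<in> N) \<and> (\<forall>a\<in>A. \<forall>x\<in>N. a \<otimes> x \<in> N)"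

lemma submodI:
  "N \<subseteq> carrier R \<Longrightarrow> \<zero> \<in> N \<Longrightarrow> (\<And>x y. x \<in> N \<Longrightarrow> y \<in> N \<Longrightarrow> x \<oplus> y \<in> N) \<Longrightarrow> (\<And>a x. a \<in> A \<Longrightarrow> x \<in> N \<Longrightarrow> a \<otimes> x \<in> N) \<Longrightarrow> submod A N"
  by (simp add: submod_def)

lemma submodD:
  assumes "submod A N"
  shows "N \<subseteq> carrier R" "\<zero> \<in> N" "\<And>x y. x \<in> N \<Longrightarrow> y \<in> N \<Longrightarrow> x \<oplus> y \<in> N" "\<And>a x. a \<in> A \<Longrightarrow> x \<in> N \<Longrightarrow> a \<otimes> x \<in> N"
  using assms by (auto simp: submod_def)

lemma submod_diff:
  assumes A: "subring A R" and N: "submod A N" and x: "x \<in> N" and y: "y \<in> N" shows "x \<ominus> y \<in> N"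
proof -
  have c: "x \<in> carrier R" "y \<in> carrier R" using submodD(1)[OF N] x y by auto
  have "\<ominus> \<one> \<in> A" using subringE(3,5)[OF A] by blast
  then have "x \<oplus> \<ominus> \<one> \<otimes> y \<in> N" using submodD(3,4)[OF N] x y by blast
  then show ?thesis using c by (simp add: a_minus_def l_minus)
qed

lemma submod_inter: "submod A M \<Longrightarrow> submod A N \<Longrightarrow> submod A (M \<inter> N)"
  by (auto simp: submod_def)

text \<open>The means to extend a property to a span: the elements having it form a submodule, and
  the generators have it.\<close>

lemma spn_minimal:
  assumes "submod A N" "set us \<subseteq> N" shows "spn A us \<subseteq> N"
  using assms(2)
proof (induction us)
  case (Cons u us) then show ?case using submodD[OF assms(1)] by auto
qed (use submodD[OF assms(1)] in auto)

context
  fixes A assumes A: "subring A R"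
begin

lemma A_carrier: "a \<in> A \<Longrightarrow> a \<in> carrier R"
  using subringE(1)[OF A] by blast

lemma spn_submod: "set us \<subseteq> carrier R \<Longrightarrow> submod A (spn A us)"
proof (induction us)
  case Nil show ?case by (rule submodI) (auto simp: A_carrier)
next
  case (Cons u us)
  then have IH: "submod A (spn A us)" and u: "u \<in> carrier R" by auto
  note N = submodD[OF IH]
  show ?case
  proof (rule submodI)
    show "spn A (u # us) \<subseteq> carrier R" using N(1) u A_carrier by auto
    show "\<zero> \<in> spn A (u # us)" using u N(2) subringE(2)[OF A] by (force intro: exI[of _ \<zero>])
  next
    fix x y assume "x \<in> spn A (u # us)" "y \<in> spn A (u # us)"
    then obtain a v b w where *: "x = a \<otimes> u \<oplus> v" "y = b \<otimes> u \<oplus> w" "a \<in> A" "b \<in> A" "v \<in> spn A us" "w \<in> spn A us" by auto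
    then have c: "a \<in> carrier R" "b \<in> carrier R" "v \<in> carrier R" "w \<in> carrier R" using N(1) A_carrier by auto
    have "x \<oplus> y = (a \<oplus> b) \<otimes> u \<oplus> (v \<oplus> w)" unfolding * using c u by algebra
    then show "x \<oplus> y \<in> spn A (u # us)" using spnI[OF subringE(7)[OF A *(3,4)] N(3)[OF *(5,6)]] by (simp only:)
  next
    fix a x assume a: "a \<in> A" and "x \<in> spn A (u # us)"
    then obtain b w where *: "x = b \<otimes> u \<oplus> w" "b \<in> A" "w \<in> spn A us" by auto
    then have c: "a \<in> carrier R" "b \<in> carrier R" "w \<in> carrier R" using N(1) A_carrier a by auto
    have "a \<otimes> x = (a \<otimes> b) \<otimes> u \<oplus> a \<otimes> w" unfolding * using c u by algebra
    then show "a \<otimes> x \<in> spn A (u # us)" using spnI[OF subringE(6)[OF A a *(2)] N(4)[OF a *(3)]] by (simp only:)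
  qed
qed

lemma spn_carrier: "set us \<subseteq> carrier R \<Longrightarrow> spn A us \<subseteq> carrier R"
  using submodD(1)[OF spn_submod] .

lemma spn_mem: "set us \<subseteq> carrier R \<Longrightarrow> u \<in> set us \<Longrightarrow> u \<in> spn A us"
proof (induction us)
  case (Cons v us)
  have vc: "v \<in> carrier R" and usc: "set us \<subseteq> carrier R" using Cons.prems by auto
  show ?case
  proof (cases "u = v")
    case True
    have "v = \<one> \<otimes> v \<oplus> \<zero>" using vc by simp
    then show ?thesis using True submodD(2)[OF spn_submod[OF usc]] subringE(3)[OF A] by auto
  next
    case False
    then have "u \<in> spn A us" using Cons by auto
    moreover have "u = \<zero> \<otimes> v \<oplus> u" using vc Cons.prems by auto
    ultimately show ?thesis using subringE(2)[OF A] by auto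
  qed
qed simp

lemma spn_append:
  "set us \<subseteq> carrier R \<Longrightarrow> set vs \<subseteq> carrier R \<Longrightarrow> spn A (us @ vs) = {x \<oplus> y | x y. x \<in> spn A us \<and> y \<in> spn A vs}"
proof (induction us)
  case Nil
  then show ?case using spn_carrier[OF Nil(2)] by (auto simp: subset_iff) (metis l_zero)
next
  case (Cons u us)
  have c: "u \<in> carrier R" "spn A us \<subseteq> carrier R" "spn A vs \<subseteq> carrier R" using Cons.prems spn_carrier by auto
  have IH: "spn A (us @ vs) = {x \<oplus> y | x y. x \<in> spn A us \<and> y \<in> spn A vs}" using Cons by simp
  show ?case
  proof safe
    fix z assume "z \<in> spn A ((u # us) @ vs)"
    then obtain a x y where *: "z = a \<otimes> u \<oplus> (x \<oplus> y)" "a \<in> A" "x \<in> spn A us" "y \<in> spn A vs" using IH by auto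
    have "x \<in> carrier R" "y \<in> carrier R" "a \<in> carrier R" using * c A_carrier by auto
    then have "z = (a \<otimes> u \<oplus> x) \<oplus> y" using *(1) c(1) by (simp add: a_assoc)
    then show "\<exists>x y. z = x \<oplus> y \<and> x \<in> spn A (u # us) \<and> y \<in> spn A vs" using * by auto
  next
    fix x y assume "x \<in> spn A (u # us)" and y: "y \<in> spn A vs"
    then obtain a x' where *: "x = a \<otimes> u \<oplus> x'" "a \<in> A" "x' \<in> spn A us" by auto
    have "x' \<in> carrier R" "y \<in> carrier R" "a \<in> carrier R" using * c y A_carrier by auto
    then have "x \<oplus> y = a \<otimes> u \<oplus> (x' \<oplus> y)" using *(1) c(1) by (simp add: a_assoc)
    then show "x \<oplus> y \<in> spn A ((u # us) @ vs)" using * y IH by auto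
  qed
qed

lemma spn_map_mult:
  "set us \<subseteq> carrier R \<Longrightarrow> w \<in> carrier R \<Longrightarrow> spn A (map (\<lambda>u. u \<otimes> w) us) = {b \<otimes> w | b. b \<in> spn A us}"
proof (induction us)
  case (Cons u us)
  have c: "u \<in> carrier R" "spn A us \<subseteq> carrier R" using Cons.prems spn_carrier by auto
  have IH: "spn A (map (\<lambda>u. u \<otimes> w) us) = {b \<otimes> w | b. b \<in> spn A us}" using Cons by simp
  have e: "(a \<otimes> u \<oplus> x) \<otimes> w = a \<otimes> (u \<otimes> w) \<oplus> x \<otimes> w" if "a \<in> A" "x \<in> spn A us" for a x
  proof -
    have "a \<in> carrier R" "x \<in> carrier R" using that A_carrier c by auto
    then show ?thesis using c(1) Cons.prems(2) by algebra
  qed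
  show ?case
  proof safe
    fix z assume "z \<in> spn A (map (\<lambda>u. u \<otimes> w) (u # us))"
    then obtain a x where "a \<in> A" "x \<in> spn A us" "z = a \<otimes> (u \<otimes> w) \<oplus> x \<otimes> w" using IH by auto
    then show "\<exists>b. z = b \<otimes> w \<and> b \<in> spn A (u # us)" using e[of a x] spnI[of a A x us u] by (intro exI[of _ "a \<otimes> u \<oplus> x"]) simp
  next
    fix b assume "b \<in> spn A (u # us)"
    then obtain a x where *: "a \<in> A" "x \<in> spn A us" "b = a \<otimes> u \<oplus> x" by auto
    have "x \<otimes> w \<in> spn A (map (\<lambda>u. u \<otimes> w) us)" using IH *(2) by blast
    then have "a \<otimes> (u \<otimes> w) \<oplus> x \<otimes> w \<in> spn A ((u \<otimes> w) # map (\<lambda>u. u \<otimes> w) us)" by (rule spnI[OF *(1)])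
    then show "b \<otimes> w \<in> spn A (map (\<lambda>u. u \<otimes> w) (u # us))" using e[OF *(1,2)] *(3) by simp
  qed
qed auto

text \<open>As in a tower of extensions, the products of a generator from each list
  generate.\<close>

lemma spn_trans:
  assumes us: "set us \<subseteq> carrier R" and ws: "set ws \<subseteq> carrier R"
  shows "\<exists>us'. set us' \<subseteq> carrier R \<and> spn (spn A us) ws = spn A us'"
  using ws
proof (induction ws)
  case Nil show ?case by (rule exI[of _ "[]"]) simp
next
  case (Cons w ws)
  then obtain us' where us': "set us' \<subseteq> carrier R" "spn (spn A us) ws = spn A us'" by auto
  have w: "w \<in> carrier R" using Cons by simp
  let ?m = "map (\<lambda>u. u \<otimes> w) us"
  have m: "set ?m \<subseteq> carrier R" using us w by auto
  have "spn A (?m @ us') = {x \<oplus> y | x y. x \<in> spn A ?m \<and> y \<in> spn A us'}" by (rule spn_append[OF m us'(1)])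
  also have "\<dots> = spn (spn A us) (w # ws)" unfolding spn_map_mult[OF us w] spn.simps us'(2) by blast
  finally show ?case using m us'(1) by (intro exI[of _ "?m @ us'"]) auto
qed

end

text \<open>The powers come in descending order, so that combinations of \<open>pw x m\<close> match
  the evaluation of coefficient lists starting with the leading term.\<close>

primrec pw :: "'a \<Rightarrow> nat \<Rightarrow> 'a list" where
  "pw x 0 = []"
| "pw x (Suc m) = x [^] m # pw x m"

lemma set_pw: "set (pw x m) = {x [^] i | i. i < m}"
  by (induction m) (auto simp: less_Suc_eq)

lemma pw_carrier: "x \<in> carrier R \<Longrightarrow> set (pw x m) \<subseteq> carrier R"
  by (auto simp: set_pw)

lemma pw_in_spn: "subring A R \<Longrightarrow> x \<in> carrier R \<Longrightarrow> i < m \<Longrightarrow> x [^] i \<in> spn A (pw x m)"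
  by (rule spn_mem[OF _ pw_carrier]) (auto simp: set_pw)

lemma spn_pw_mono: "subring A R \<Longrightarrow> x \<in> carrier R \<Longrightarrow> m \<le> k \<Longrightarrow> spn A (pw x m) \<subseteq> spn A (pw x k)"
  by (rule spn_minimal[OF spn_submod[OF _ pw_carrier]]) (auto simp: set_pw intro!: pw_in_spn)

definition fin_alg :: "'a set \<Rightarrow> 'a set \<Rightarrow> bool" where
  "fin_alg A B \<longleftrightarrow> subring B R \<and> A \<subseteq> B \<and> (\<exists>us. set us \<subseteq> carrier R \<and> B = spn A us)"

text \<open>The last power of \<open>x\<close> being a combination of the lower ones is a monic equation for \<open>x\<close>
  over \<open>A\<close>.\<close>

definition intg :: "'a set \<Rightarrow> 'a \<Rightarrow> bool" where
  "intg A x \<longleftrightarrow> x \<in> carrier R \<and> (\<exists>m. x [^] m \<in> spn A (pw x m))"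

lemma fin_alg_self: "subring A R \<Longrightarrow> fin_alg A A"
proof -
  assume A: "subring A R"
  have "spn A [\<one>] = A" using A_carrier[OF A] by (auto, (force intro: exI[of _ \<zero>])?)
  then show ?thesis using A by (auto simp: fin_alg_def intro!: exI[of _ "[\<one>]"])
qed

text \<open>Closure of the span under products is reached in stages: multiplication by
  \<open>y\<close>, where only the top power has to be reduced by the equation, then by powers of
  \<open>y\<close>, then by arbitrary elements through linearity.\<close>

lemma fin_alg_adjoin_pw:
  assumes A: "subring A R" and B: "fin_alg A B" and nz: "\<one> \<noteq> \<zero>"
    and yc: "y \<in> carrier R" and m: "y [^] m \<in> spn A (pw y m)"
  shows "fin_alg A (spn B (pw y m)) \<and> B \<subseteq> spn B (pw y m) \<and> y \<in> spn B (pw y m)"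
proof -
  have Bs: "subring B R" and AB: "A \<subseteq> B" using B by (auto simp: fin_alg_def)
  obtain us where us: "set us \<subseteq> carrier R" "B = spn A us" using B by (auto simp: fin_alg_def)
  \<comment> \<open>For \<open>m = 0\<close> the assumed relation would put 1 into the span of the
    empty list, which is zero.\<close>
  have m0: "m > 0" using m nz by (cases m) auto
  define C where "C = spn B (pw y m)"
  have C: "submod B C" unfolding C_def by (rule spn_submod[OF Bs pw_carrier[OF yc]])
  note CD = submodD[OF C]
  have Cp: "y [^] i \<in> C" if "i < m" for i unfolding C_def by (rule pw_in_spn[OF Bs yc that])
  have "spn A (pw y m) \<subseteq> C"
  proof (rule spn_minimal)
    show "submod A C" using C AB by (auto simp: submod_def)
    show "set (pw y m) \<subseteq> C" using Cp by (auto simp: set_pw)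
  qed
  then have ym: "y [^] m \<in> C" using m by blast
  have yC: "y \<otimes> v \<in> C" if "v \<in> C" for v
  proof -
    have "C \<subseteq> {v \<in> carrier R. y \<otimes> v \<in> C}" unfolding C_def
    proof (rule spn_minimal, fold C_def)
      show "submod B {v \<in> carrier R. y \<otimes> v \<in> C}"
      proof (rule submodI)
        fix a x assume "a \<in> B" "x \<in> {v \<in> carrier R. y \<otimes> v \<in> C}"
        then have a: "a \<in> B" "a \<in> carrier R" and x: "x \<in> carrier R" "y \<otimes> x \<in> C" using A_carrier[OF Bs] by auto
        have "y \<otimes> (a \<otimes> x) = a \<otimes> (y \<otimes> x)" using a x yc by (simp add: m_lcomm)
        then show "a \<otimes> x \<in> {v \<in> carrier R. y \<otimes> v \<in> C}" using a x CD(4) by auto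
      qed (use yc CD(2,3) in \<open>auto simp: r_distr\<close>)
      show "set (pw y m) \<subseteq> {v \<in> carrier R. y \<otimes> v \<in> C}"
      proof
        fix v assume "v \<in> set (pw y m)"
        then obtain i where i: "i < m" "v = y [^] i" by (auto simp: set_pw)
        have "y \<otimes> y [^] i = y [^] Suc i" using yc by (simp add: m_comm)
        moreover have "y [^] Suc i \<in> C" using i Cp[of "Suc i"] ym by (cases "Suc i = m") auto
        ultimately show "v \<in> {v \<in> carrier R. y \<otimes> v \<in> C}" using i yc by simp
      qed
    qed
    then show ?thesis using that by blast
  qed
  have ypC: "y [^] i \<otimes> v \<in> C" if "v \<in> C" for i :: nat and v using that
  proof (induction i)
    case 0 then show ?case using CD(1) by auto
  next
    case (Suc i)
    have vc: "v \<in> carrier R" using Suc CD(1) by auto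
    have "y [^] Suc i \<otimes> v = y \<otimes> (y [^] i \<otimes> v)" using vc yc by (simp add: m_ac)
    then show ?case using Suc yC by simp
  qed
  have mC: "v \<otimes> w \<in> C" if v: "v \<in> C" and w: "w \<in> C" for v w
  proof -
    have wc: "w \<in> carrier R" using w CD(1) by auto
    have "C \<subseteq> {v \<in> carrier R. v \<otimes> w \<in> C}" unfolding C_def
    proof (rule spn_minimal, fold C_def)
      show "submod B {v \<in> carrier R. v \<otimes> w \<in> C}"
      proof (rule submodI)
        fix a x assume "a \<in> B" "x \<in> {v \<in> carrier R. v \<otimes> w \<in> C}"
        then have a: "a \<in> B" "a \<in> carrier R" and x: "x \<in> carrier R" "x \<otimes> w \<in> C" using A_carrier[OF Bs] by auto
        have "(a \<otimes> x) \<otimes> w = a \<otimes> (x \<otimes> w)" using a x wc by (simp add: m_assoc)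
        then show "a \<otimes> x \<in> {v \<in> carrier R. v \<otimes> w \<in> C}" using a x CD(4) by auto
      qed (use wc CD(2,3) in \<open>auto simp: l_distr\<close>)
      show "set (pw y m) \<subseteq> {v \<in> carrier R. v \<otimes> w \<in> C}" using ypC[OF w] yc by (auto simp: set_pw)
    qed
    then show ?thesis using v by blast
  qed
  have one: "\<one> \<in> C" using Cp[OF m0] by simp
  have BC: "B \<subseteq> C"
  proof
    fix b assume b: "b \<in> B"
    then have "b \<otimes> \<one> \<in> C" using CD(4) one by blast
    then show "b \<in> C" using A_carrier[OF Bs b] by simp
  qed
  have Cs: "subring C R"
  proof (rule subringI[OF CD(1) one])
    fix h assume h: "h \<in> C"
    have "\<zero> \<ominus> h \<in> C" by (rule submod_diff[OF Bs C CD(2) h])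
    then show "\<ominus> h \<in> C" using h CD(1) by (auto simp: a_minus_def)
  qed (use mC CD(3) in auto)
  obtain us' where "set us' \<subseteq> carrier R" "C = spn A us'" using spn_trans[OF A us(1) pw_carrier[OF yc]] unfolding C_def us(2) by blast
  then have "fin_alg A C" using Cs BC AB by (auto simp: fin_alg_def)
  moreover have "y \<in> C" using yC[OF one] yc by simp
  ultimately show ?thesis using BC by (simp add: C_def)
qed

lemma fin_alg_adjoin:
  assumes A: "subring A R" and B: "fin_alg A B" and y: "intg A y" and nz: "\<one> \<noteq> \<zero>"
  shows "\<exists>B'. fin_alg A B' \<and> B \<subseteq> B' \<and> y \<in> B'"
proof -
  obtain m where "y \<in> carrier R" "y [^] m \<in> spn A (pw y m)" using y by (auto simp: intg_def)
  then show ?thesis using fin_alg_adjoin_pw[OF A B nz] by blast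
qed

end

text \<open>\<open>A \<subseteq> K \<subseteq> L\<close> are the \<open>p\<close>-adic integers, the \<open>p\<close>-adic numbers and their algebraic
  closure; completeness of \<open>A\<close> is only assumed for sequences of integers.\<close>

locale padic_ext = field L for L (structure) +
  fixes p :: nat and A K :: "'a set"
  assumes prime_p: "Factorial_Ring.prime p"
    and subring_A: "subring A L" and subfield_K: "subfield K L" and A_sub_K: "A \<subseteq> K"
    and pi_inv: "w \<in> A \<Longrightarrow> iz (int p) \<otimes> w \<noteq> \<one>"
    and decomp: "z \<in> K \<Longrightarrow> z \<noteq> \<zero> \<Longrightarrow> \<exists>k::nat. \<exists>u\<in>A. inv u \<in> A \<and> u \<noteq> \<zero> \<and>
       (z = iz (int p) [^] k \<otimes> u \<or> z \<otimes> iz (int p) [^] k = u)"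
    and residue: "z \<in> A \<Longrightarrow> \<exists>m. \<exists>w\<in>A. z \<ominus> iz m = iz (int p) \<otimes> w"
    and iz_dvd: "w \<in> A \<Longrightarrow> iz m = iz (int p) [^] k \<otimes> w \<Longrightarrow> int p ^ k dvd m"
    and int_limit: "(\<And>k. int p ^ k dvd t (Suc k) - t k) \<Longrightarrow> \<exists>s\<in>A. \<forall>k. \<exists>w\<in>A. s \<ominus> iz (t k) = iz (int p) [^] k \<otimes> w"
    and pi_nz: "iz (int p) \<noteq> \<zero>"
    and algebraic_L: "x \<in> carrier L \<Longrightarrow> (algebraic over K) x"
begin

abbreviation \<pi> where "\<pi> \<equiv> iz (int p)"

lemma A_car: "a \<in> A \<Longrightarrow> a \<in> carrier L" by (rule A_carrier[OF subring_A])

lemma iz_in_subring: "subring B L \<Longrightarrow> iz m \<in> B"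
proof -
  assume B: "subring B L"
  have n: "iz (int k) \<in> B" for k
    by (induction k) (use subringE(2,3,7)[OF B] in \<open>auto simp: iz_add\<close>)
  show ?thesis
  proof (cases "m \<ge> 0")
    case True then show ?thesis using n[of "nat m"] by simp
  next
    case False
    then have e: "iz m = \<ominus> iz (int (nat (- m)))" by (simp flip: iz_minus)
    show ?thesis unfolding e by (rule subringE(5)[OF B n])
  qed
qed

lemma pow_in_subring: "subring B L \<Longrightarrow> x \<in> B \<Longrightarrow> x [^] (k::nat) \<in> B"
proof (induction k)
  case (Suc k) then show ?case using subringE(6)[of B L "x [^] k" x] by simp
qed (simp add: subringE(3))

lemma pi_A: "\<pi> \<in> A" by (rule iz_in_subring[OF subring_A])
lemma pi_pow_A: "\<pi> [^] (k::nat) \<in> A" by (rule pow_in_subring[OF subring_A pi_A])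

lemma pi_pow_nz: "\<pi> [^] (k::nat) \<noteq> \<zero>"
  using pi_nz by (induction k) (auto simp: integral_iff)

text \<open>In the second alternative with positive \<open>k\<close>, an element of \<open>A\<close>
  would be an inverse of \<open>p\<close>.\<close>

lemma A_decomp:
  assumes a: "a \<in> A" "a \<noteq> \<zero>"
  shows "\<exists>k::nat. \<exists>u\<in>A. inv u \<in> A \<and> u \<noteq> \<zero> \<and> a = \<pi> [^] k \<otimes> u"
proof -
  obtain k u where u: "u \<in> A" "inv u \<in> A" "u \<noteq> \<zero>" and *: "a = \<pi> [^] k \<otimes> u \<or> a \<otimes> \<pi> [^] (k::nat) = u"
    using decomp[of a] a A_sub_K by blast
  show ?thesis
  proof (cases "a = \<pi> [^] k \<otimes> u")
    case True then show ?thesis using u by blast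
  next
    case False
    then have e: "a \<otimes> \<pi> [^] k = u" using * by blast
    show ?thesis
    proof (cases k)
      case 0 then show ?thesis using e u A_car a by (intro exI[of _ 0] bexI[of _ u]) auto
    next
      case (Suc j)
      have c: "a \<in> carrier L" "u \<in> carrier L" "inv u \<in> carrier L" using a u A_car by auto
      have "u \<otimes> inv u = \<one>" using u(3) c(2) field_Units by auto
      then have "\<pi> \<otimes> (a \<otimes> \<pi> [^] j \<otimes> inv u) = \<one>" using e[symmetric] c by (simp add: Suc m_ac)
      moreover have "a \<otimes> \<pi> [^] j \<otimes> inv u \<in> A" using a u pi_pow_A subringE(6)[OF subring_A] by auto
      ultimately show ?thesis using pi_inv by blast
    qed
  qed
qed

text \<open>\<open>A\<close> is a discrete valuation ring. By induction on the generators: the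
  coefficients of \<open>u\<close> in elements of \<open>N\<close> form an ideal generated by a
  power of \<open>p\<close>, or zero. An element attaining this power, together with generators of
  the part of \<open>N\<close> in \<open>spn A us\<close>, generates \<open>N\<close>.\<close>

lemma submod_finite:
  "set us \<subseteq> carrier L \<Longrightarrow> submod A N \<Longrightarrow> N \<subseteq> spn A us \<Longrightarrow> \<exists>vs. set vs \<subseteq> N \<and> N = spn A vs"
proof (induction us arbitrary: N)
  case Nil
  then have "N = {\<zero>}" using submodD(2) by fastforce
  then show ?case by (intro exI[of _ "[]"]) simp
next
  case (Cons u us)
  have uc: "u \<in> carrier L" and usc: "set us \<subseteq> carrier L" using Cons.prems by auto
  note N = submodD[OF Cons.prems(2)]
  have S: "submod A (spn A us)" by (rule spn_submod[OF subring_A usc])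
  note SD = submodD[OF S]
  define J where "J a \<longleftrightarrow> a \<in> A \<and> (\<exists>v\<in>spn A us. a \<otimes> u \<oplus> v \<in> N)" for a
  obtain vs where vs: "set vs \<subseteq> N \<inter> spn A us" "N \<inter> spn A us = spn A vs"
    using Cons.IH[OF usc submod_inter[OF Cons.prems(2) S]] by blast
  show ?case
  proof (cases "\<exists>a. J a \<and> a \<noteq> \<zero>")
    case False
    have "N \<subseteq> spn A us"
    proof
      fix x assume x: "x \<in> N"
      then obtain a v where av: "x = a \<otimes> u \<oplus> v" "a \<in> A" "v \<in> spn A us" using Cons.prems(3) by auto
      then have "a = \<zero>" using False x unfolding J_def by blast
      then show "x \<in> spn A us" using av uc SD(1) by auto
    qed
    then have "N \<inter> spn A us = N" by blast
    then show ?thesis using vs by auto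
  next
    case True
    have mulJ: "J (c \<otimes> a)" if aJ: "J a" and cA: "c \<in> A" for a c
    proof -
      obtain v where v: "v \<in> spn A us" "a \<otimes> u \<oplus> v \<in> N" "a \<in> A" using aJ unfolding J_def by blast
      have cc: "c \<in> carrier L" "a \<in> carrier L" "v \<in> carrier L" using cA v A_car SD(1) by auto
      have "c \<otimes> (a \<otimes> u \<oplus> v) = (c \<otimes> a) \<otimes> u \<oplus> c \<otimes> v" using cc uc by algebra
      moreover have "c \<otimes> (a \<otimes> u \<oplus> v) \<in> N" using N(4) v cA by blast
      ultimately show ?thesis using SD(4)[OF cA v(1)] subringE(6)[OF subring_A cA v(3)] unfolding J_def by auto
    qed
    have Jpi: "\<exists>k::nat. J (\<pi> [^] k) \<and> (\<exists>w\<in>A. a = w \<otimes> \<pi> [^] k)" if a: "J a" "a \<noteq> \<zero>" for a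
    proof -
      have aA: "a \<in> A" using a by (simp add: J_def)
      obtain k u where u: "u \<in> A" "inv u \<in> A" "u \<noteq> \<zero>" "a = \<pi> [^] (k::nat) \<otimes> u" using A_decomp[OF aA a(2)] by blast
      have c: "u \<in> carrier L" "inv u \<in> carrier L" "inv u \<otimes> u = \<one>" using u A_car field_Units by auto
      have "inv u \<otimes> a = (inv u \<otimes> u) \<otimes> \<pi> [^] k" unfolding u(4) using c(1,2) by (simp add: m_assoc m_comm[of "\<pi> [^] k" u])
      then have "inv u \<otimes> a = \<pi> [^] k" using c by simp
      then have "J (\<pi> [^] k)" using mulJ[OF a(1) u(2)] by simp
      moreover have "a = u \<otimes> \<pi> [^] k" using u(4) c by (simp add: m_comm)
      ultimately show ?thesis using u(1) by blast
    qed
    define k where "k = (LEAST k. J (\<pi> [^] (k::nat)))"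
    have ex: "\<exists>k::nat. J (\<pi> [^] k)" using True Jpi by blast
    then have k: "J (\<pi> [^] k)" unfolding k_def by (rule LeastI_ex)
    have least: "k \<le> j" if "J (\<pi> [^] (j::nat))" for j unfolding k_def using that by (rule Least_le)
    have mult: "\<exists>w\<in>A. a = w \<otimes> \<pi> [^] k" if a: "J a" for a
    proof (cases "a = \<zero>")
      case True then show ?thesis using subringE(2)[OF subring_A] by (intro bexI[of _ \<zero>]) auto
    next
      case False
      then obtain j w where j: "J (\<pi> [^] (j::nat))" "w \<in> A" "a = w \<otimes> \<pi> [^] j" using Jpi[OF a] by blast
      have "\<pi> [^] j = \<pi> [^] (j - k) \<otimes> \<pi> [^] k" using least[OF j(1)] by (simp add: nat_pow_mult)
      then have "a = (w \<otimes> \<pi> [^] (j - k)) \<otimes> \<pi> [^] k" using j A_car by (simp add: m_assoc)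
      then show ?thesis using subringE(6)[OF subring_A j(2) pi_pow_A] by blast
    qed
    obtain v0 where v0: "v0 \<in> spn A us" "\<pi> [^] k \<otimes> u \<oplus> v0 \<in> N" using k by (auto simp: J_def)
    define n0 where "n0 = \<pi> [^] k \<otimes> u \<oplus> v0"
    have v0c: "v0 \<in> carrier L" using v0 SD(1) by auto
    have "N = spn A (n0 # vs)"
    proof (rule equalityI)
      show "spn A (n0 # vs) \<subseteq> N" by (rule spn_minimal[OF Cons.prems(2)]) (use vs v0 in \<open>auto simp: n0_def\<close>)
      show "N \<subseteq> spn A (n0 # vs)"
      proof
        fix x assume x: "x \<in> N"
        then obtain a v where av: "x = a \<otimes> u \<oplus> v" "a \<in> A" "v \<in> spn A us" using Cons.prems(3) by auto
        then have "J a" using x by (auto simp: J_def)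
        then obtain w where w: "w \<in> A" "a = w \<otimes> \<pi> [^] k" using mult by blast
        have c: "w \<in> carrier L" "v \<in> carrier L" "\<pi> [^] k \<in> carrier L" using w av A_car SD(1) by auto
        have eq: "x = w \<otimes> n0 \<oplus> (v \<ominus> w \<otimes> v0)" unfolding av(1) w(2) n0_def using c uc v0c by algebra
        have "v \<ominus> w \<otimes> v0 \<in> spn A us" by (rule submod_diff[OF subring_A S av(3) SD(4)[OF w(1) v0(1)]])
        moreover have "v \<ominus> w \<otimes> v0 \<in> N"
        proof -
          have n0N: "n0 \<in> N" using v0 by (simp add: n0_def)
          have "x \<ominus> w \<otimes> n0 \<in> N" by (rule submod_diff[OF subring_A Cons.prems(2) x N(4)[OF w(1) n0N]])
          moreover have "x \<ominus> w \<otimes> n0 = v \<ominus> w \<otimes> v0" unfolding av(1) w(2) n0_def using c uc v0c by algebra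
          ultimately show ?thesis by simp
        qed
        ultimately have "v \<ominus> w \<otimes> v0 \<in> spn A vs" using vs(2) by blast
        then show "x \<in> spn A (n0 # vs)" using eq w(1) by auto
      qed
    qed
    moreover have "set (n0 # vs) \<subseteq> N" using vs(1) v0(2) by (auto simp: n0_def)
    ultimately show ?thesis by blast
  qed
qed

text \<open>The spans of the first \<open>m\<close> powers of \<open>x\<close> increase with
  \<open>m\<close>, and their union is a submodule of \<open>B\<close>, hence finitely generated. So
  it is reached at some \<open>M\<close>, and \<open>x^M\<close> is a combination of lower
  powers.\<close>

lemma fin_alg_intg:
  assumes B: "fin_alg A B" and x: "x \<in> B" shows "intg A x"
proof -
  have Bs: "subring B L" "A \<subseteq> B" using B by (auto simp: fin_alg_def)
  obtain us where us: "set us \<subseteq> carrier L" "B = spn A us" using B by (auto simp: fin_alg_def)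
  have xc: "x \<in> carrier L" using A_carrier[OF Bs(1) x] .
  define N where "N = (\<Union>m. spn A (pw x m))"
  have mono: "spn A (pw x m) \<subseteq> spn A (pw x k)" if "m \<le> k" for m k by (rule spn_pw_mono[OF subring_A xc that])
  have sm: "submod A (spn A (pw x m))" for m by (rule spn_submod[OF subring_A pw_carrier[OF xc]])
  have N: "submod A N"
  proof (rule submodI)
    show "N \<subseteq> carrier L" unfolding N_def using submodD(1)[OF sm] by blast
    show "\<zero> \<in> N" unfolding N_def using submodD(2)[OF sm] by blast
    fix a y z assume "y \<in> N"
    then obtain i where i: "y \<in> spn A (pw x i)" unfolding N_def by blast
    show "a \<in> A \<Longrightarrow> a \<otimes> y \<in> N" unfolding N_def using submodD(4)[OF sm _ i] by blast
    assume "z \<in> N"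
    then obtain j where j: "z \<in> spn A (pw x j)" unfolding N_def by blast
    have "y \<in> spn A (pw x (max i j))" "z \<in> spn A (pw x (max i j))"
      using i j mono[of i "max i j"] mono[of j "max i j"] by auto
    then show "y \<oplus> z \<in> N" unfolding N_def using submodD(3)[OF sm] by blast
  qed
  have BM: "submod A B" unfolding us(2) by (rule spn_submod[OF subring_A us(1)])
  have "N \<subseteq> B" unfolding N_def
  proof (rule UN_least, rule spn_minimal[OF BM])
    show "set (pw x m) \<subseteq> B" for m using pow_in_subring[OF Bs(1) x] by (auto simp: set_pw)
  qed
  then obtain vs where vs: "set vs \<subseteq> N" "N = spn A vs" using submod_finite[OF us(1) N] us(2) by blast
  have "\<exists>M. set ws \<subseteq> spn A (pw x M)" if "set ws \<subseteq> N" for ws using that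
  proof (induction ws)
    case (Cons w ws)
    then obtain M where M: "set ws \<subseteq> spn A (pw x M)" by auto
    obtain i where i: "w \<in> spn A (pw x i)" using Cons.prems unfolding N_def by auto
    have "set (w # ws) \<subseteq> spn A (pw x (max M i))" using M i mono[of M "max M i"] mono[of i "max M i"] by auto
    then show ?case by blast
  qed simp
  then obtain M where M: "set vs \<subseteq> spn A (pw x M)" using vs(1) by blast
  have "N \<subseteq> spn A (pw x M)" unfolding vs(2) by (rule spn_minimal[OF sm M])
  moreover have "x [^] M \<in> N" unfolding N_def using pw_in_spn[OF subring_A xc, of M "Suc M"] by blast
  ultimately have "x [^] M \<in> spn A (pw x M)" by blast
  then show ?thesis using xc by (auto simp: intg_def)
qed

text \<open>The integral closure of \<open>A\<close> in \<open>L\<close>.\<close>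

definition IL :: "'a set" where "IL = {x. intg A x}"

lemma IL_carrier: "x \<in> IL \<Longrightarrow> x \<in> carrier L" by (simp add: IL_def intg_def)

text \<open>Adjoining two integral elements in turn gives a finite algebra; their sum and product
  are integral because they lie in it.\<close>

lemma IL_fin_alg:
  assumes "x \<in> IL" "y \<in> IL" obtains B where "fin_alg A B" "x \<in> B" "y \<in> B"
proof -
  have i: "intg A x" "intg A y" using assms by (auto simp: IL_def)
  obtain B1 where B1: "fin_alg A B1" "x \<in> B1" using fin_alg_adjoin[OF subring_A fin_alg_self[OF subring_A] i(1) one_not_zero] by blast
  obtain B2 where B2: "fin_alg A B2" "B1 \<subseteq> B2" "y \<in> B2" using fin_alg_adjoin[OF subring_A B1(1) i(2) one_not_zero] by blast
  show ?thesis by (rule that[OF B2(1) _ B2(3)]) (use B1(2) B2(2) in blast)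
qed

lemma fin_alg_IL: "fin_alg A B \<Longrightarrow> B \<subseteq> IL"
  using fin_alg_intg by (auto simp: IL_def)

lemma A_IL: "A \<subseteq> IL" by (rule fin_alg_IL[OF fin_alg_self[OF subring_A]])

lemma IL_subring: "subring IL L"
proof (rule subringI)
  show "IL \<subseteq> carrier L" using IL_carrier by blast
  show "\<one> \<in> IL" using A_IL subringE(3)[OF subring_A] by blast
  fix x assume x: "x \<in> IL"
  show "\<ominus> x \<in> IL"
  proof -
    obtain B where B: "fin_alg A B" "x \<in> B" by (rule IL_fin_alg[OF x x])
    then have "\<ominus> x \<in> B" using subringE(5) by (auto simp: fin_alg_def)
    then show ?thesis using fin_alg_IL[OF B(1)] by blast
  qed
  fix y assume y: "y \<in> IL"
  obtain B where B: "fin_alg A B" "x \<in> B" "y \<in> B" by (rule IL_fin_alg[OF x y])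
  then have "x \<otimes> y \<in> B" "x \<oplus> y \<in> B" using subringE(6,7) by (auto simp: fin_alg_def)
  then show "x \<otimes> y \<in> IL" "x \<oplus> y \<in> IL" using fin_alg_IL[OF B(1)] by auto
qed

text \<open>An integral inverse \<open>w\<close> of \<open>p\<close> satisfies a monic equation of
  some degree \<open>m\<close>; multiplied by \<open>p^m\<close>, it equates 1 with a multiple of
  \<open>p\<close> in \<open>A\<close>.\<close>

lemma pi_not_unit_IL: "w \<in> IL \<Longrightarrow> \<pi> \<otimes> w \<noteq> \<one>"
proof
  assume w: "w \<in> IL" and e: "\<pi> \<otimes> w = \<one>"
  obtain m where wc: "w \<in> carrier L" and m: "w [^] m \<in> spn A (pw w m)" using w by (auto simp: IL_def intg_def)
  have pow1: "\<pi> [^] i \<otimes> w [^] i = \<one>" for i :: nat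
    using e wc by (simp flip: nat_pow_distrib)
  \<comment> \<open>The elements that \<open>p^m\<close> carries into \<open>p A\<close>. Each
    \<open>w^i\<close> with \<open>i < m\<close> is one, since at least one factor \<open>p\<close>
    is left over.\<close>
  let ?N = "{v \<in> carrier L. \<exists>a\<in>A. \<pi> [^] m \<otimes> v = \<pi> \<otimes> a}"
  have "spn A (pw w m) \<subseteq> ?N"
  proof (rule spn_minimal)
    show "submod A ?N"
    proof (rule submodI)
      show "\<zero> \<in> ?N" using subringE(2)[OF subring_A] by (auto intro!: bexI[of _ \<zero>])
      fix x y assume "x \<in> ?N" "y \<in> ?N"
      then obtain a b where *: "x \<in> carrier L" "y \<in> carrier L" "a \<in> A" "b \<in> A" "\<pi> [^] m \<otimes> x = \<pi> \<otimes> a" "\<pi> [^] m \<otimes> y = \<pi> \<otimes> b" by blast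
      then have "\<pi> [^] m \<otimes> (x \<oplus> y) = \<pi> \<otimes> (a \<oplus> b)" using A_car by (simp add: r_distr)
      then show "x \<oplus> y \<in> ?N" using * subringE(7)[OF subring_A] by blast
    next
      fix c x assume c: "c \<in> A" and "x \<in> ?N"
      then obtain a where *: "x \<in> carrier L" "a \<in> A" "\<pi> [^] m \<otimes> x = \<pi> \<otimes> a" by blast
      have cc: "c \<in> carrier L" "a \<in> carrier L" using c * A_car by auto
      have "\<pi> [^] m \<otimes> (c \<otimes> x) = c \<otimes> (\<pi> [^] m \<otimes> x)" using cc * by (simp add: m_lcomm)
      also have "\<dots> = \<pi> \<otimes> (c \<otimes> a)" unfolding *(3) using cc by (simp add: m_lcomm)
      finally show "c \<otimes> x \<in> ?N" using * c cc subringE(6)[OF subring_A] by blast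
    qed blast
    show "set (pw w m) \<subseteq> ?N"
    proof
      fix v assume "v \<in> set (pw w m)"
      then obtain i where i: "i < m" "v = w [^] i" by (auto simp: set_pw)
      then obtain j where j: "m = Suc (j + i)" using less_iff_Suc_add[of i m] by (auto simp: add.commute)
      have "\<pi> [^] m = \<pi> \<otimes> \<pi> [^] j \<otimes> \<pi> [^] i" unfolding j by (simp add: m_ac flip: nat_pow_mult)
      then have "\<pi> [^] m \<otimes> v = \<pi> \<otimes> \<pi> [^] j \<otimes> (\<pi> [^] i \<otimes> w [^] i)" using i(2) wc by (simp add: m_assoc)
      also have "\<dots> = \<pi> \<otimes> \<pi> [^] j" unfolding pow1 by simp
      finally show "v \<in> ?N" using pi_pow_A i(2) wc by blast
    qed
  qed
  then obtain a where "a \<in> A" "\<pi> [^] m \<otimes> w [^] m = \<pi> \<otimes> a" using m by blast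
  then show False using pow1 pi_inv by metis
qed

end

section \<open>Local integral closures\<close>

context padic_ext
begin

lemma pi_car [simp]: "\<pi> \<in> carrier L" by simp

lemma pi_pow_add: "\<pi> [^] (i + j) = \<pi> [^] i \<otimes> \<pi> [^] (j::nat)"
  by (simp add: nat_pow_mult)

lemma K_car: "z \<in> K \<Longrightarrow> z \<in> carrier L"
  using subfieldE(3)[OF subfield_K] by blast

text \<open>Stated for all large exponents, so that one \<open>k\<close> can clear finitely many
  denominators.\<close>

lemma K_denominator: "z \<in> K \<Longrightarrow> \<exists>k0. \<forall>k\<ge>k0. \<pi> [^] (k::nat) \<otimes> z \<in> A"
proof (cases "z = \<zero>")
  case True then show ?thesis using subringE(2)[OF subring_A] by simp
next
  case False
  assume z: "z \<in> K"
  obtain k0 u where u: "u \<in> A" and *: "z = \<pi> [^] (k0::nat) \<otimes> u \<or> z \<otimes> \<pi> [^] k0 = u" using decomp[OF z False] by blast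
  have "\<pi> [^] k \<otimes> z \<in> A" if k: "k \<ge> k0" for k
    using *
  proof
    assume "z = \<pi> [^] k0 \<otimes> u"
    then show ?thesis using u pi_pow_A subringE(6)[OF subring_A] by blast
  next
    assume e: "z \<otimes> \<pi> [^] k0 = u"
    have "\<pi> [^] k = \<pi> [^] (k - k0) \<otimes> \<pi> [^] k0" using k by (simp flip: pi_pow_add)
    then have "\<pi> [^] k \<otimes> z = \<pi> [^] (k - k0) \<otimes> (z \<otimes> \<pi> [^] k0)" using K_car[OF z] by (simp add: m_ac)
    then show ?thesis unfolding e using u pi_pow_A subringE(6)[OF subring_A] by simp
  qed
  then show ?thesis by blast
qed

text \<open>Rewriting a relation of degree \<open>M\<close> for \<open>x\<close> as one for
  \<open>p^k x\<close> multiplies the coefficient of \<open>x^i\<close> by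
  \<open>p^(k (M - i))\<close>, which clears its denominator when \<open>k\<close> is large.\<close>

lemma span_K_denominator:
  assumes x: "x \<in> carrier L"
  shows "m \<le> M \<Longrightarrow> v \<in> spn K (pw x m) \<Longrightarrow> \<exists>k0. \<forall>k\<ge>k0. \<pi> [^] (k * M) \<otimes> v \<in> spn A (pw (\<pi> [^] (k::nat) \<otimes> x) m)"
proof (induction m arbitrary: v)
  case 0 then show ?case by simp
next
  case (Suc m)
  then obtain c v' where v: "v = c \<otimes> x [^] m \<oplus> v'" "c \<in> K" "v' \<in> spn K (pw x m)" by auto
  have Ks: "subring K L" by (rule subfieldE(1)[OF subfield_K])
  obtain k1 where k1: "\<forall>k\<ge>k1. \<pi> [^] (k * M) \<otimes> v' \<in> spn A (pw (\<pi> [^] (k::nat) \<otimes> x) m)" using Suc v(3) by auto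
  obtain k2 where k2: "\<forall>k\<ge>k2. \<pi> [^] (k::nat) \<otimes> c \<in> A" using K_denominator[OF v(2)] by blast
  have cc: "c \<in> carrier L" "v' \<in> carrier L" using v K_car spn_carrier[OF Ks pw_carrier[OF x]] by auto
  have "\<pi> [^] (k * M) \<otimes> v \<in> spn A (pw (\<pi> [^] k \<otimes> x) (Suc m))" if k: "k \<ge> max k1 k2" for k
  proof -
    \<comment> \<open>\<open>M - m\<close> is at least 1 here, so every coefficient gains at least
      \<open>p^k\<close>.\<close>
    have "k \<le> k * (M - m)" using Suc.prems(1) by (metis Suc_le_eq mult.right_neutral mult_le_mono2 One_nat_def zero_less_diff less_eq_Suc_le)
    then have "k2 \<le> k * (M - m)" using k by linarith
    then have a: "\<pi> [^] (k * (M - m)) \<otimes> c \<in> A" using k2 by blast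
    have "k * M = k * (M - m) + k * m" using Suc.prems(1) by (simp flip: add_mult_distrib2)
    then have "\<pi> [^] (k * M) = \<pi> [^] (k * (M - m)) \<otimes> (\<pi> [^] k) [^] m" by (simp add: pi_pow_add nat_pow_pow)
    moreover have "(\<pi> [^] k \<otimes> x) [^] m = (\<pi> [^] k) [^] m \<otimes> x [^] m" using x by (simp add: nat_pow_distrib)
    moreover define Q1 Q2 Q3 xm where "Q1 = \<pi> [^] (k * (M - m))" and "Q2 = (\<pi> [^] k) [^] m" and "Q3 = \<pi> [^] (k * M)" and "xm = x [^] m"
    moreover have "Q1 \<in> carrier L" "Q2 \<in> carrier L" "Q3 \<in> carrier L" "xm \<in> carrier L" using x by (auto simp: Q1_def Q2_def Q3_def xm_def)
    moreover have "(Q1 \<otimes> Q2) \<otimes> (c \<otimes> xm \<oplus> v') = (Q1 \<otimes> c) \<otimes> (Q2 \<otimes> xm) \<oplus> (Q1 \<otimes> Q2) \<otimes> v'" using calculation(7-) cc by algebra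
    ultimately have "\<pi> [^] (k * M) \<otimes> v = (\<pi> [^] (k * (M - m)) \<otimes> c) \<otimes> (\<pi> [^] k \<otimes> x) [^] m \<oplus> \<pi> [^] (k * M) \<otimes> v'"
      unfolding v(1) by simp
    moreover have "\<pi> [^] (k * M) \<otimes> v' \<in> spn A (pw (\<pi> [^] k \<otimes> x) m)" using k1 k by simp
    ultimately show ?thesis using spnI[OF a] by simp
  qed
  then show ?case by blast
qed

lemma spn_eval_iff:
  assumes A: "subring B L" and x: "x \<in> carrier L"
  shows "v \<in> spn B (pw x m) \<longleftrightarrow> (\<exists>cs. set cs \<subseteq> B \<and> length cs = m \<and> v = eval cs x)"
proof (induction m arbitrary: v)
  case (Suc m)
  show ?case
  proof
    assume "v \<in> spn B (pw x (Suc m))"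
    then obtain a w where *: "a \<in> B" "w \<in> spn B (pw x m)" "v = a \<otimes> x [^] m \<oplus> w" by auto
    then obtain cs where "set cs \<subseteq> B" "length cs = m" "w = eval cs x" using Suc by blast
    then show "\<exists>cs. set cs \<subseteq> B \<and> length cs = Suc m \<and> v = eval cs x" using * by (intro exI[of _ "a # cs"]) simp
  next
    assume "\<exists>cs. set cs \<subseteq> B \<and> length cs = Suc m \<and> v = eval cs x"
    then obtain cs where cs: "set cs \<subseteq> B" "length cs = Suc m" "v = eval cs x" by blast
    then obtain a cs' where c: "cs = a # cs'" by (cases cs) auto
    have "eval cs' x \<in> spn B (pw x m)" using Suc cs c by auto
    then show "v \<in> spn B (pw x (Suc m))" using spnI[of a B _ "pw x m" "x [^] m"] cs c by simp
  qed
qed auto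

lemma algebraic_imp_IL_multiple:
  assumes x: "x \<in> carrier L" shows "\<exists>k::nat. \<pi> [^] k \<otimes> x \<in> IL"
proof -
  have Ks: "subring K L" by (rule subfieldE(1)[OF subfield_K])
  obtain P where P: "P \<in> carrier (K[X])" "P \<noteq> []" "eval P x = \<zero>" using algebraicE[OF Ks x algebraic_L[OF x]] by blast
  then obtain a q where aq: "P = a # q" by (cases P) auto
  have "polynomial K P" using P(1) by (simp add: univ_poly_carrier)
  then have a: "a \<in> K" "a \<noteq> \<zero>" "set q \<subseteq> K" using aq by (auto simp: polynomial_def)
  have ac: "a \<in> carrier L" and qc: "set q \<subseteq> carrier L" using a K_car by auto
  define m where "m = length q"
  have ai: "inv a \<in> K" using subfield_m_inv(1)[OF subfield_K, of a] a by blast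
  have aic: "inv a \<in> carrier L" "inv a \<otimes> a = \<one>" using ai K_car a(2) ac field_Units by auto
  have e: "a \<otimes> x [^] m \<oplus> eval q x = \<zero>" using P(3) aq by (simp add: m_def)
  have ev: "eval q x \<in> carrier L" using eval_in_carrier[OF qc x] .
  have xm: "x [^] m \<in> carrier L" using x by simp
  define ia where "ia = inv a"
  have iac: "ia \<in> carrier L" "ia \<otimes> a = \<one>" using aic by (auto simp: ia_def)
  have "x [^] m = (ia \<otimes> a) \<otimes> x [^] m" using iac xm by simp
  also have "\<dots> = ia \<otimes> (a \<otimes> x [^] m \<oplus> eval q x) \<oplus> (\<ominus> ia) \<otimes> eval q x" using iac(1) ac xm ev by algebra
  also have "\<dots> = (\<ominus> ia) \<otimes> eval q x" unfolding e using iac(1) ev by simp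
  finally have xe: "x [^] m = (\<ominus> ia) \<otimes> eval q x" .
  have "eval q x \<in> spn K (pw x m)" using spn_eval_iff[OF Ks x] a(3) m_def by blast
  moreover have "\<ominus> ia \<in> K" using ai subringE(5)[OF Ks] by (simp add: ia_def)
  ultimately have "x [^] m \<in> spn K (pw x m)"
    unfolding xe using submodD(4)[OF spn_submod[OF Ks pw_carrier[OF x]]] by blast
  then obtain k where k: "\<pi> [^] (k * m) \<otimes> x [^] m \<in> spn A (pw (\<pi> [^] (k::nat) \<otimes> x) m)"
    using span_K_denominator[OF x order_refl] by blast
  have "(\<pi> [^] k \<otimes> x) [^] m = \<pi> [^] (k * m) \<otimes> x [^] m" using x by (simp add: nat_pow_distrib nat_pow_pow)
  then have "intg A (\<pi> [^] k \<otimes> x)" unfolding intg_def using k x by (intro conjI exI[of _ m]) simp_all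
  then show ?thesis by (auto simp: IL_def)
qed

text \<open>For non-zero \<open>y\<close> some \<open>p^j\<close> makes the inverse of
  \<open>y\<close> integral. If \<open>y\<close> were divisible by \<open>p^(j+1)\<close>, the
  product of the two would exhibit an integral inverse of \<open>p\<close>.\<close>

lemma IL_separated:
  assumes y: "y \<in> carrier L" and all: "\<And>k::nat. \<exists>w\<in>IL. y = \<pi> [^] k \<otimes> w"
  shows "y = \<zero>"
proof (rule ccontr)
  assume n: "y \<noteq> \<zero>"
  define z where "z = inv y"
  have z: "z \<in> carrier L" "z \<otimes> y = \<one>" using n y field_Units by (auto simp: z_def)
  obtain j where j: "\<pi> [^] (j::nat) \<otimes> z \<in> IL" using algebraic_imp_IL_multiple[OF z(1)] by blast
  obtain w where w: "w \<in> IL" "y = \<pi> [^] (Suc j) \<otimes> w" using all by blast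
  have wc: "w \<in> carrier L" using w IL_carrier by blast
  have "\<pi> \<otimes> ((\<pi> [^] j \<otimes> z) \<otimes> w) = z \<otimes> (\<pi> [^] Suc j \<otimes> w)" using z(1) wc by (simp add: m_ac)
  also have "\<dots> = \<one>" using w(2) z(2) by simp
  finally have "\<pi> \<otimes> ((\<pi> [^] j \<otimes> z) \<otimes> w) = \<one>" .
  moreover have "(\<pi> [^] j \<otimes> z) \<otimes> w \<in> IL" using j w(1) subringE(6)[OF IL_subring] by blast
  ultimately show False using pi_not_unit_IL by blast
qed

primrec psum :: "(nat \<Rightarrow> 'a) \<Rightarrow> nat \<Rightarrow> 'a" where
  "psum c 0 = \<zero>"
| "psum c (Suc k) = psum c k \<oplus> \<pi> [^] k \<otimes> c k"

text \<open>Completeness in algebraic form: a power series in \<open>p\<close> with coefficients in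
  \<open>M\<close> has a limit in \<open>M\<close>, with an error in \<open>p^k M\<close> after
  \<open>k\<close> terms. No absolute value on the extension has to be constructed.\<close>

definition has_limits :: "'a set \<Rightarrow> bool" where
  "has_limits M \<longleftrightarrow> (\<forall>c. (\<forall>i. c i \<in> M) \<longrightarrow> (\<exists>s\<in>M. \<forall>k. \<exists>w\<in>M. s \<ominus> psum c k = \<pi> [^] k \<otimes> w))"

lemma psum_closed: "subring B L \<Longrightarrow> \<pi> \<in> B \<Longrightarrow> (\<And>i. c i \<in> B) \<Longrightarrow> psum c k \<in> B"
  by (induction k) (auto simp: subringE(2,6,7) pow_in_subring)

lemma psum_carrier: "(\<And>i. c i \<in> carrier L) \<Longrightarrow> psum c k \<in> carrier L"
  by (induction k) auto

lemma residue_power: "z \<in> A \<Longrightarrow> \<exists>m. \<exists>w\<in>A. z \<ominus> iz m = \<pi> [^] (k::nat) \<otimes> w"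
proof (induction k arbitrary: z)
  case 0
  then show ?case using A_car by (intro exI[of _ 0] bexI[of _ z]) (auto simp: a_minus_def)
next
  case (Suc k)
  obtain m w where w: "w \<in> A" "z \<ominus> iz m = \<pi> \<otimes> w" using residue[OF Suc.prems] by blast
  obtain m' w' where w': "w' \<in> A" "w \<ominus> iz m' = \<pi> [^] k \<otimes> w'" using Suc.IH[OF w(1)] by blast
  have c: "z \<in> carrier L" "w \<in> carrier L" "w' \<in> carrier L" using Suc.prems w w' A_car by auto
  have "z \<ominus> iz (m + int p * m') = (z \<ominus> iz m) \<ominus> \<pi> \<otimes> iz m'" unfolding iz_add iz_mult using c iz_closed[of m] iz_closed[of m'] pi_car by algebra
  also have "\<dots> = \<pi> \<otimes> (w \<ominus> iz m')" unfolding w(2) using c iz_closed[of m'] pi_car by algebra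
  also have "\<dots> = \<pi> [^] Suc k \<otimes> w'" unfolding w'(2) using c by (simp add: m_ac)
  finally show ?case using w'(1) by blast
qed

text \<open>The \<open>k\<close>-th partial sum is replaced by an integer congruent to it modulo
  \<open>p^k\<close>. Consecutive integers are then congruent modulo \<open>p^k\<close>, which is
  the hypothesis of \<open>int_limit\<close>.\<close>

lemma A_has_limits: "has_limits A"
  unfolding has_limits_def
proof (intro allI impI)
  fix c :: "nat \<Rightarrow> 'a" assume c: "\<forall>i. c i \<in> A"
  have S: "psum c k \<in> A" for k by (rule psum_closed[OF subring_A pi_A]) (use c in auto)
  have "\<exists>m. \<exists>w\<in>A. psum c k \<ominus> iz m = \<pi> [^] k \<otimes> w" for k by (rule residue_power[OF S])
  then obtain t w where t: "\<And>k. w k \<in> A" "\<And>k. psum c k \<ominus> iz (t k) = \<pi> [^] k \<otimes> w k" by metis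
  have dv: "int p ^ k dvd t (Suc k) - t k" for k
  proof -
    define a b S0 P0 where "a = iz (t (Suc k))" and "b = iz (t k)" and "S0 = psum c k" and "P0 = \<pi> [^] k"
    have cc: "a \<in> carrier L" "b \<in> carrier L" "S0 \<in> carrier L" "P0 \<in> carrier L" "c k \<in> carrier L" "w k \<in> carrier L" "w (Suc k) \<in> carrier L"
      using S A_car t(1) c by (auto simp: a_def b_def S0_def P0_def)
    have 1: "S0 \<oplus> P0 \<otimes> c k \<ominus> a = P0 \<otimes> \<pi> \<otimes> w (Suc k)" using t(2)[of "Suc k"] by (simp add: S0_def P0_def a_def)
    have 2: "S0 \<ominus> b = P0 \<otimes> w k" using t(2)[of k] by (simp add: S0_def P0_def b_def)
    have "iz (t (Suc k) - t k) = a \<ominus> b" by (simp add: iz_diff a_def b_def)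
    also have "\<dots> = (S0 \<ominus> b) \<oplus> P0 \<otimes> c k \<ominus> (S0 \<oplus> P0 \<otimes> c k \<ominus> a)" using cc by algebra
    also have "\<dots> = P0 \<otimes> (w k \<oplus> c k \<ominus> \<pi> \<otimes> w (Suc k))" unfolding 1 2 using cc pi_car by algebra
    finally have e: "iz (t (Suc k) - t k) = \<pi> [^] k \<otimes> (w k \<oplus> c k \<ominus> \<pi> \<otimes> w (Suc k))" by (simp add: P0_def)
    have "w k \<oplus> c k \<ominus> \<pi> \<otimes> w (Suc k) \<in> A" unfolding a_minus_def
      using t(1) c pi_A subringE(5,6,7)[OF subring_A] by simp
    then show ?thesis using e by (rule iz_dvd)
  qed
  obtain s where s: "s \<in> A" "\<And>k. \<exists>w\<in>A. s \<ominus> iz (t k) = \<pi> [^] k \<otimes> w" using int_limit[of t, OF dv] by blast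
  have "\<exists>w\<in>A. s \<ominus> psum c k = \<pi> [^] k \<otimes> w" for k
  proof -
    obtain v where v: "v \<in> A" "s \<ominus> iz (t k) = \<pi> [^] k \<otimes> v" using s(2) by blast
    define P0 where "P0 = \<pi> [^] k"
    have cc: "s \<in> carrier L" "v \<in> carrier L" "w k \<in> carrier L" "psum c k \<in> carrier L" "P0 \<in> carrier L" using s v t(1) S A_car by (auto simp: P0_def)
    have "s \<ominus> psum c k = (s \<ominus> iz (t k)) \<ominus> (psum c k \<ominus> iz (t k))" using cc iz_closed[of "t k"] by algebra
    also have "\<dots> = P0 \<otimes> (v \<ominus> w k)" unfolding v(2) t(2) P0_def[symmetric] using cc by algebra
    finally have "s \<ominus> psum c k = \<pi> [^] k \<otimes> (v \<ominus> w k)" by (simp add: P0_def)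
    moreover have "v \<ominus> w k \<in> A" unfolding a_minus_def using v t(1) subringE(5,7)[OF subring_A] by simp
    ultimately show ?thesis by blast
  qed
  then show "\<exists>s\<in>A. \<forall>k. \<exists>w\<in>A. s \<ominus> psum c k = \<pi> [^] k \<otimes> w" using s(1) by blast
qed

text \<open>Limits are taken coordinatewise. The generators may be dependent, so coordinates are
  chosen for each coefficient of the series.\<close>

lemma spn_has_limits: "set us \<subseteq> carrier L \<Longrightarrow> has_limits (spn A us)"
proof (induction us)
  case Nil
  have "psum c k = \<zero>" if "\<forall>i. c i \<in> {\<zero>}" for c k using that by (induction k) auto
  then show ?case by (auto simp: has_limits_def a_minus_def)
next
  case (Cons u us)
  then have IH: "has_limits (spn A us)" and u: "u \<in> carrier L" and us: "set us \<subseteq> carrier L" by auto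
  note SC = spn_carrier[OF subring_A us]
  show ?case unfolding has_limits_def
  proof (intro allI impI)
    fix c :: "nat \<Rightarrow> 'a" assume "\<forall>i. c i \<in> spn A (u # us)"
    then have "\<forall>i. \<exists>a v. c i = a \<otimes> u \<oplus> v \<and> a \<in> A \<and> v \<in> spn A us" by auto
    then obtain a v where av: "\<And>i. c i = a i \<otimes> u \<oplus> v i" "\<And>i. a i \<in> A" "\<And>i. v i \<in> spn A us" by metis
    obtain s1 where s1: "s1 \<in> A" "\<And>k. \<exists>w\<in>A. s1 \<ominus> psum a k = \<pi> [^] k \<otimes> w" using A_has_limits av(2) unfolding has_limits_def by blast
    obtain s2 where s2: "s2 \<in> spn A us" "\<And>k. \<exists>w\<in>spn A us. s2 \<ominus> psum v k = \<pi> [^] k \<otimes> w" using IH av(3) unfolding has_limits_def by blast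
    have avc: "a i \<in> carrier L" "v i \<in> carrier L" for i using av A_car SC by auto
    have ps: "psum a k \<in> carrier L" "psum v k \<in> carrier L" for k by (rule psum_carrier, rule avc)+
    have pc: "psum c k = psum a k \<otimes> u \<oplus> psum v k" for k
    proof (induction k)
      case (Suc k)
      define P0 where "P0 = \<pi> [^] k"
      have "P0 \<in> carrier L" by (simp add: P0_def)
      then have "psum a k \<otimes> u \<oplus> psum v k \<oplus> P0 \<otimes> (a k \<otimes> u \<oplus> v k) = (psum a k \<oplus> P0 \<otimes> a k) \<otimes> u \<oplus> (psum v k \<oplus> P0 \<otimes> v k)"
        using ps[of k] avc[of k] u by algebra
      then show ?case unfolding psum.simps Suc av(1)[of k] P0_def[symmetric] .
    qed (use u in simp)
    have "\<exists>w\<in>spn A (u # us). (s1 \<otimes> u \<oplus> s2) \<ominus> psum c k = \<pi> [^] k \<otimes> w" for k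
    proof -
      obtain w1 w2 where w: "w1 \<in> A" "s1 \<ominus> psum a k = \<pi> [^] k \<otimes> w1" "w2 \<in> spn A us" "s2 \<ominus> psum v k = \<pi> [^] k \<otimes> w2"
        using s1(2) s2(2) by blast
      define P0 where "P0 = \<pi> [^] k"
      have cc: "s1 \<in> carrier L" "s2 \<in> carrier L" "w1 \<in> carrier L" "w2 \<in> carrier L" "P0 \<in> carrier L"
        using s1 s2 w A_car SC by (auto simp: P0_def)
      have "(s1 \<otimes> u \<oplus> s2) \<ominus> psum c k = (s1 \<ominus> psum a k) \<otimes> u \<oplus> (s2 \<ominus> psum v k)" unfolding pc using cc ps[of k] u by algebra
      also have "\<dots> = P0 \<otimes> (w1 \<otimes> u \<oplus> w2)" unfolding w(2,4) P0_def[symmetric] using cc u by algebra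
      finally show ?thesis using spnI[OF w(1,3), of u] by (auto simp: P0_def)
    qed
    then show "\<exists>s\<in>spn A (u # us). \<forall>k. \<exists>w\<in>spn A (u # us). s \<ominus> psum c k = \<pi> [^] k \<otimes> w"
      using spnI[OF s1(1) s2(1), of u] by blast
  qed
qed

definition mod_pi :: "'a set \<Rightarrow> 'a \<Rightarrow> 'a \<Rightarrow> bool" where
  "mod_pi B x y \<longleftrightarrow> (\<exists>w\<in>B. x \<ominus> y = \<pi> \<otimes> w)"

lemma spn_finite_mod_pi:
  "set us \<subseteq> carrier L \<Longrightarrow> \<exists>F. finite F \<and> F \<subseteq> spn A us \<and> (\<forall>y\<in>spn A us. \<exists>x\<in>F. mod_pi (spn A us) y x)"
proof (induction us)
  case Nil show ?case by (intro exI[of _ "{\<zero>}"]) (auto simp: mod_pi_def a_minus_def)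
next
  case (Cons u us)
  then obtain F where F: "finite F" "F \<subseteq> spn A us" "\<And>y. y \<in> spn A us \<Longrightarrow> \<exists>x\<in>F. mod_pi (spn A us) y x" by auto
  have u: "u \<in> carrier L" and us: "set us \<subseteq> carrier L" using Cons.prems by auto
  note SC = spn_carrier[OF subring_A us]
  \<comment> \<open>Reduced coordinates: modulo \<open>p\<close> every element of \<open>A\<close>
    is an integer, and this integer may be taken between 0 and \<open>p - 1\<close>.\<close>
  define G where "G = (\<lambda>(m, x). iz m \<otimes> u \<oplus> x) ` ({0..<int p} \<times> F)"
  have "\<exists>x\<in>G. mod_pi (spn A (u # us)) y x" if "y \<in> spn A (u # us)" for y
  proof -
    obtain a v where av: "y = a \<otimes> u \<oplus> v" "a \<in> A" "v \<in> spn A us" using \<open>y \<in> spn A (u # us)\<close> by auto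
    obtain m w where w: "w \<in> A" "a \<ominus> iz m = \<pi> \<otimes> w" using residue[OF av(2)] by blast
    define m' q where "m' = m mod int p" and "q = m div int p"
    have m': "m' \<in> {0..<int p}" using prime_gt_0_nat[OF prime_p] by (simp add: m'_def)
    have mm: "m = int p * q + m'" by (simp add: m'_def q_def)
    obtain x where x: "x \<in> F" "mod_pi (spn A us) v x" using F(3)[OF av(3)] by blast
    then obtain w2 where w2: "w2 \<in> spn A us" "v \<ominus> x = \<pi> \<otimes> w2" by (auto simp: mod_pi_def)
    define n q' where "n = iz m'" and "q' = iz q"
    have cc: "a \<in> carrier L" "w \<in> carrier L" "v \<in> carrier L" "x \<in> carrier L" "w2 \<in> carrier L" "n \<in> carrier L" "q' \<in> carrier L"
      using av w x w2 A_car SC F(2) by (auto simp: n_def q'_def)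
    have izm: "iz m = \<pi> \<otimes> q' \<oplus> n" unfolding mm iz_add iz_mult n_def q'_def ..
    have "y \<ominus> (n \<otimes> u \<oplus> x) = (a \<ominus> (\<pi> \<otimes> q' \<oplus> n)) \<otimes> u \<oplus> (v \<ominus> x) \<oplus> \<pi> \<otimes> (q' \<otimes> u)" unfolding av(1) using cc u pi_car by algebra
    also have "\<dots> = \<pi> \<otimes> ((w \<oplus> q') \<otimes> u \<oplus> w2)" unfolding izm[symmetric] w(2) w2(2) using cc u pi_car by algebra
    finally have "y \<ominus> (n \<otimes> u \<oplus> x) = \<pi> \<otimes> ((w \<oplus> q') \<otimes> u \<oplus> w2)" .
    moreover have "w \<oplus> q' \<in> A" using w(1) iz_in_subring[OF subring_A] subringE(7)[OF subring_A] by (simp add: q'_def)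
    ultimately have "mod_pi (spn A (u # us)) y (n \<otimes> u \<oplus> x)" unfolding mod_pi_def using spnI[OF _ w2(1)] by blast
    moreover have "n \<otimes> u \<oplus> x \<in> G" unfolding G_def n_def using m' x(1) by force
    ultimately show ?thesis by blast
  qed
  moreover have "finite G" unfolding G_def using F(1) by simp
  moreover have "G \<subseteq> spn A (u # us)" unfolding G_def using F(2) iz_in_subring[OF subring_A] by auto
  ultimately show ?case by blast
qed

section \<open>Finite algebras over the p-adic integers: units, idempotents, locality\<close>

context
  fixes B assumes B: "fin_alg A B"
begin

lemma B_subring: "subring B L" and A_sub_B: "A \<subseteq> B"
  using B by (auto simp: fin_alg_def)

lemma B_car: "b \<in> B \<Longrightarrow> b \<in> carrier L" by (rule A_carrier[OF B_subring])
lemma pi_B: "\<pi> \<in> B" using pi_A A_sub_B by blast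
lemma pi_pow_B: "\<pi> [^] (k::nat) \<in> B" by (rule pow_in_subring[OF B_subring pi_B])
lemma B_IL: "b \<in> B \<Longrightarrow> b \<in> IL" using fin_alg_IL[OF B] by blast
lemma B_minus: "a \<in> B \<Longrightarrow> b \<in> B \<Longrightarrow> a \<ominus> b \<in> B"
  unfolding a_minus_def using subringE(5,7)[OF B_subring] by simp
lemmas B_closed = subringE(2,3,5,6,7)[OF B_subring] B_minus

lemma B_limits:
  assumes c: "\<And>i. c i \<in> B" shows "\<exists>s\<in>B. \<forall>k. \<exists>w\<in>B. s \<ominus> psum c k = \<pi> [^] k \<otimes> w"
proof -
  have "has_limits B" using B spn_has_limits by (auto simp: fin_alg_def)
  then show ?thesis unfolding has_limits_def using c by blast
qed

lemma B_separated:
  assumes y: "y \<in> carrier L" and w: "\<And>k::nat. \<exists>w\<in>B. y = \<pi> [^] k \<otimes> w" shows "y = \<zero>"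
  by (rule IL_separated[OF y]) (use w B_IL in blast)

text \<open>The inverse is the geometric series with terms \<open>p^i b^i\<close>, summed by
  \<open>B_limits\<close>. The product is exactly 1 because its difference from 1 is divisible by
  every \<open>p^k\<close>.\<close>

lemma one_minus_pi_unit:
  assumes b: "b \<in> B" shows "\<exists>s\<in>B. (\<one> \<ominus> \<pi> \<otimes> b) \<otimes> s = \<one>"
proof -
  define c where "c i = b [^] (i::nat)" for i
  have c: "c i \<in> B" for i unfolding c_def by (rule pow_in_subring[OF B_subring b])
  obtain s where s: "s \<in> B" "\<And>k. \<exists>w\<in>B. s \<ominus> psum c k = \<pi> [^] k \<otimes> w" using B_limits[of c, OF c] by blast
  have bc: "b \<in> carrier L" and sc: "s \<in> carrier L" using b s B_car by auto
  define t where "t = \<one> \<ominus> \<pi> \<otimes> b"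
  have tB: "t \<in> B" unfolding t_def using b pi_B B_closed by simp
  then have tc: "t \<in> carrier L" by (rule B_car)
  have psc: "psum c k \<in> carrier L" for k by (rule psum_carrier) (use c B_car in blast)
  have geo: "t \<otimes> psum c k = \<one> \<ominus> \<pi> [^] k \<otimes> c k" for k
  proof (induction k)
    case 0 show ?case using tc by (simp add: c_def a_minus_def r_neg)
  next
    case (Suc k)
    define P0 where "P0 = \<pi> [^] k"
    have cc: "P0 \<in> carrier L" "c k \<in> carrier L" using c B_car by (auto simp: P0_def)
    have "t \<otimes> psum c (Suc k) = t \<otimes> psum c k \<oplus> t \<otimes> (P0 \<otimes> c k)" using tc psc cc by (simp add: r_distr P0_def)
    also have "\<dots> = (\<one> \<ominus> P0 \<otimes> c k) \<oplus> (\<one> \<ominus> \<pi> \<otimes> b) \<otimes> (P0 \<otimes> c k)" unfolding Suc P0_def[symmetric] unfolding t_def ..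
    also have "\<dots> = \<one> \<ominus> (P0 \<otimes> \<pi>) \<otimes> (c k \<otimes> b)" using cc bc pi_car by algebra
    also have "\<dots> = \<one> \<ominus> \<pi> [^] Suc k \<otimes> c (Suc k)" by (simp add: P0_def c_def)
    finally show ?case .
  qed
  have "t \<otimes> s \<ominus> \<one> = \<zero>"
  proof (rule B_separated)
    show "t \<otimes> s \<ominus> \<one> \<in> carrier L" using tc sc by simp
    fix k :: nat
    obtain w where w: "w \<in> B" "s \<ominus> psum c k = \<pi> [^] k \<otimes> w" using s(2) by blast
    define P0 where "P0 = \<pi> [^] k"
    have cc: "P0 \<in> carrier L" "c k \<in> carrier L" "w \<in> carrier L" using c w B_car by (auto simp: P0_def)
    have "t \<otimes> s \<ominus> \<one> = t \<otimes> (s \<ominus> psum c k) \<oplus> (t \<otimes> psum c k \<ominus> \<one>)" using tc sc psc[of k] by algebra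
    also have "\<dots> = t \<otimes> (P0 \<otimes> w) \<oplus> ((\<one> \<ominus> P0 \<otimes> c k) \<ominus> \<one>)" unfolding w(2) geo P0_def[symmetric] ..
    also have "\<dots> = P0 \<otimes> (t \<otimes> w \<ominus> c k)" using cc tc by algebra
    finally show "\<exists>w\<in>B. t \<otimes> s \<ominus> \<one> = \<pi> [^] k \<otimes> w" using tB w(1) c B_closed by (auto simp: P0_def)
  qed
  then have "t \<otimes> s = \<one>" using tc sc by (simp add: r_right_minus_eq)
  then show ?thesis using s(1) by (auto simp: t_def)
qed

lemma one_plus_pi_unit: "b \<in> B \<Longrightarrow> \<exists>s\<in>B. (\<one> \<oplus> \<pi> \<otimes> b) \<otimes> s = \<one>"
proof -
  assume b: "b \<in> B"
  have bc: "b \<in> carrier L" using b by (rule B_car)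
  have "\<one> \<ominus> \<pi> \<otimes> (\<ominus> b) = \<one> \<oplus> \<pi> \<otimes> b" using bc pi_car by algebra
  then show ?thesis using one_minus_pi_unit[of "\<ominus> b"] b B_closed(3) by simp
qed

lemma mod_pi_refl: "x \<in> B \<Longrightarrow> mod_pi B x x"
  unfolding mod_pi_def using B_car B_closed(1) by (intro bexI[of _ \<zero>]) (auto simp: a_minus_def r_neg)

lemma mod_pi_sym: assumes "x \<in> B" "y \<in> B" "mod_pi B x y" shows "mod_pi B y x"
proof -
  obtain w where w: "w \<in> B" "x \<ominus> y = \<pi> \<otimes> w" using assms by (auto simp: mod_pi_def)
  have c: "x \<in> carrier L" "y \<in> carrier L" "w \<in> carrier L" using assms w B_car by auto
  have "y \<ominus> x = \<ominus> (x \<ominus> y)" using c by algebra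
  also have "\<dots> = \<pi> \<otimes> (\<ominus> w)" unfolding w(2) using c pi_car by algebra
  finally show ?thesis unfolding mod_pi_def using w B_closed(3) by blast
qed

lemma mod_pi_trans: assumes "x \<in> B" "y \<in> B" "z \<in> B" "mod_pi B x y" "mod_pi B y z" shows "mod_pi B x z"
proof -
  obtain w v where w: "w \<in> B" "x \<ominus> y = \<pi> \<otimes> w" "v \<in> B" "y \<ominus> z = \<pi> \<otimes> v" using assms by (auto simp: mod_pi_def)
  have c: "x \<in> carrier L" "y \<in> carrier L" "z \<in> carrier L" "w \<in> carrier L" "v \<in> carrier L" using assms w B_car by auto
  have "x \<ominus> z = (x \<ominus> y) \<oplus> (y \<ominus> z)" using c by algebra
  also have "\<dots> = \<pi> \<otimes> (w \<oplus> v)" unfolding w(2,4) using c pi_car by algebra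
  finally show ?thesis unfolding mod_pi_def using w B_closed(5) by blast
qed

lemma mod_pi_mult: assumes "x \<in> B" "y \<in> B" "z \<in> B" "mod_pi B x y" shows "mod_pi B (x \<otimes> z) (y \<otimes> z)"
proof -
  obtain w where w: "w \<in> B" "x \<ominus> y = \<pi> \<otimes> w" using assms by (auto simp: mod_pi_def)
  have c: "x \<in> carrier L" "y \<in> carrier L" "z \<in> carrier L" "w \<in> carrier L" using assms w B_car by auto
  have "x \<otimes> z \<ominus> y \<otimes> z = (x \<ominus> y) \<otimes> z" using c by algebra
  also have "\<dots> = \<pi> \<otimes> (w \<otimes> z)" unfolding w(2) using c pi_car by algebra
  finally show ?thesis unfolding mod_pi_def using w assms B_closed(4) by blast
qed

lemma pow_B: "y \<in> B \<Longrightarrow> y [^] (k::nat) \<in> B" by (rule pow_in_subring[OF B_subring])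

lemma mod_pi_pow: assumes "x \<in> B" "y \<in> B" "mod_pi B x y" shows "mod_pi B (x [^] (k::nat)) (y [^] k)"
proof (induction k)
  case 0 show ?case using mod_pi_refl[OF B_closed(2)] by simp
next
  case (Suc k)
  have 1: "mod_pi B (x [^] k \<otimes> x) (y [^] k \<otimes> x)" by (rule mod_pi_mult[OF pow_B pow_B _ Suc]) (use assms in auto)
  have "mod_pi B (x \<otimes> y [^] k) (y \<otimes> y [^] k)" by (rule mod_pi_mult[OF assms(1,2) pow_B assms(3)]) (use assms in auto)
  then have 2: "mod_pi B (y [^] k \<otimes> x) (y [^] k \<otimes> y)" using assms B_car by (simp add: m_comm)
  show ?case using mod_pi_trans[OF _ _ _ 1 2] pow_B assms B_closed(4) by simp
qed

lemma sequence_repeats_mod_pi: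
  fixes g :: "nat \<Rightarrow> 'a"
  assumes g: "\<And>k. g k \<in> B" shows "\<exists>a b. a < b \<and> mod_pi B (g b) (g a)"
proof -
  obtain us where us: "set us \<subseteq> carrier L" "B = spn A us" using B by (auto simp: fin_alg_def)
  obtain F where F: "finite F" "F \<subseteq> B" "\<forall>z\<in>B. \<exists>x\<in>F. mod_pi B z x"
    using spn_finite_mod_pi[OF us(1)] unfolding us(2)[symmetric] by blast
  have "\<exists>x. x \<in> F \<and> mod_pi B (g k) x" for k using F(3) g by blast
  then obtain \<rho> where \<rho>: "\<And>k. \<rho> k \<in> F" "\<And>k. mod_pi B (g k) (\<rho> k)" by metis
  have "\<not> inj \<rho>"
  proof
    assume "inj \<rho>"
    moreover have "range \<rho> \<subseteq> F" using \<rho>(1) by blast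
    ultimately show False using F(1) by (meson finite_imageD finite_subset infinite_UNIV_nat)
  qed
  then obtain i j where "i \<noteq> j" "\<rho> i = \<rho> j" by (auto simp: inj_def)
  then obtain a b where ab: "a < b" "\<rho> a = \<rho> b" by (cases i j rule: linorder_cases) metis+
  have "mod_pi B (\<rho> a) (g a)" using mod_pi_sym[OF g _ \<rho>(2)] \<rho>(1) F(2) by blast
  then have "mod_pi B (g b) (g a)"
    using mod_pi_trans[OF g _ g, of "\<rho> b" b a] \<rho> F(2) ab(2) by auto
  then show ?thesis using ab(1) by blast
qed

lemma power_cycle_mod_pi:
  assumes y: "y \<in> B" shows "\<exists>a c::nat. c > 0 \<and> mod_pi B (y [^] (a + c)) (y [^] a)"
proof -
  obtain a b :: nat where "a < b" "mod_pi B (y [^] b) (y [^] a)"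
    using sequence_repeats_mod_pi[of "\<lambda>k. y [^] k"] pow_B[OF y] by blast
  then show ?thesis by (intro exI[of _ a] exI[of _ "b - a"]) simp
qed

lemma idempotent_power_mod_pi:
  assumes y: "y \<in> B" shows "\<exists>N>0. mod_pi B (y [^] N \<otimes> y [^] N) (y [^] (N::nat))"
proof -
  obtain a c :: nat where c: "c > 0" and ac: "mod_pi B (y [^] (a + c)) (y [^] a)" using power_cycle_mod_pi[OF y] by blast
  have yc: "y \<in> carrier L" using y by (rule B_car)
  have s: "mod_pi B (y [^] (s + c)) (y [^] s)" if "s \<ge> a" for s
  proof -
    have "mod_pi B (y [^] (a + c) \<otimes> y [^] (s - a)) (y [^] a \<otimes> y [^] (s - a))" by (rule mod_pi_mult[OF pow_B pow_B pow_B ac]) (rule y)+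
    moreover have "a + c + (s - a) = s + c" "a + (s - a) = s" using that by simp_all
    ultimately show ?thesis using yc by (simp only: nat_pow_mult)
  qed
  have j: "mod_pi B (y [^] (s + j * c)) (y [^] s)" if "s \<ge> a" for s j
  proof (induction j)
    case 0 show ?case using mod_pi_refl[OF pow_B[OF y]] by simp
  next
    case (Suc j)
    have "mod_pi B (y [^] (s + j * c + c)) (y [^] (s + j * c))" using that by (intro s) simp
    then have "mod_pi B (y [^] (s + j * c + c)) (y [^] s)" using mod_pi_trans[OF pow_B pow_B pow_B _ Suc] y by blast
    then show ?case by (simp add: add_ac)
  qed
  \<comment> \<open>A multiple of the period \<open>c\<close> that is at least \<open>a\<close>:
    from there on, adding multiples of \<open>c\<close> to the exponent changes nothing modulo
    \<open>p\<close>, and doubling \<open>N\<close> is such a change.\<close>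
  define N where "N = Suc a * c"
  have "N \<ge> Suc a * 1" unfolding N_def using c by (intro mult_le_mono2) simp
  then have "N \<ge> a" by simp
  then have "mod_pi B (y [^] (N + N)) (y [^] N)" using j[of N "Suc a"] by (simp add: N_def)
  moreover have "N > 0" using c by (simp add: N_def)
  ultimately show ?thesis using yc by (auto simp: nat_pow_mult)
qed

text \<open>The iteration \<open>e \<mapsto> 3e\<^sup>2 - 2e\<^sup>3\<close>, which squares the defect \<open>e\<^sup>2 - e\<close>
  up to a factor.\<close>

primrec idem_seq :: "'a \<Rightarrow> nat \<Rightarrow> 'a" where
  "idem_seq e 0 = e"
| "idem_seq e (Suc k) = idem_seq e k \<oplus> (idem_seq e k \<otimes> idem_seq e k \<ominus> idem_seq e k) \<otimes> (\<one> \<ominus> (idem_seq e k \<oplus> idem_seq e k))"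

text \<open>The limit of \<open>idem_seq\<close> is an idempotent of \<open>B\<close> congruent to
  \<open>e\<close>, and the ambient field has no idempotents besides 0 and 1.\<close>

lemma idempotent_lift:
  assumes e: "e \<in> B" and w: "mod_pi B (e \<otimes> e) e"
  shows "mod_pi B e \<zero> \<or> mod_pi B e \<one>"
proof -
  let ?e = "idem_seq e"
  have eB: "?e k \<in> B" for k by (induction k) (use e B_closed in auto)
  have ec: "?e k \<in> carrier L" for k using eB B_car by blast
  have id: "\<exists>w\<in>B. ?e k \<otimes> ?e k \<ominus> ?e k = \<pi> [^] Suc k \<otimes> w" for k
  proof (induction k)
    case 0 then show ?case using w by (simp add: mod_pi_def)
  next
    case (Suc k)
    then obtain w where w: "w \<in> B" "?e k \<otimes> ?e k \<ominus> ?e k = \<pi> [^] Suc k \<otimes> w" by blast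
    define t x P0 where "t = ?e k \<otimes> ?e k \<ominus> ?e k" and "x = ?e k" and "P0 = \<pi> [^] k"
    have tB: "t \<in> B" using eB[of k] B_closed(4,6) by (simp only: t_def)
    have xc: "x \<in> carrier L" and tc: "t \<in> carrier L" and wc: "w \<in> carrier L" and Pc: "P0 \<in> carrier L" and PB: "P0 \<in> B"
      using ec w(1) tB B_car pi_pow_B by (auto simp: x_def P0_def)
    have tx: "x \<otimes> x = t \<oplus> x" unfolding t_def x_def using ec[of k] by algebra
    have tw: "t = P0 \<otimes> \<pi> \<otimes> w" using w(2) by (simp add: t_def P0_def)
    define z where "z = t \<oplus> t \<oplus> t \<oplus> t"
    define y where "y = x \<oplus> t \<otimes> (\<one> \<ominus> (x \<oplus> x))"
    have y: "?e (Suc k) = y" by (simp add: y_def x_def t_def)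
    \<comment> \<open>\<open>s = 1 - 2 x\<close> satisfies \<open>s s = 1 + 4 t\<close>; for
      \<open>y = x + t s\<close> this gives \<open>y y - y = t t (4 t - 3)\<close>. As
      \<open>t\<close> is divisible by \<open>p^(k+1)\<close>, its square is divisible by
      \<open>p^(k+2)\<close>.\<close>
    define s where "s = \<one> \<ominus> (x \<oplus> x)"
    have sc: "s \<in> carrier L" using xc by (simp add: s_def)
    have zc: "z \<in> carrier L" using tc by (simp add: z_def)
    have ms: "(x \<oplus> x) \<ominus> \<one> = \<ominus> s" unfolding s_def using xc by algebra
    have "s \<otimes> s = \<one> \<oplus> (x \<otimes> x \<ominus> x) \<oplus> (x \<otimes> x \<ominus> x) \<oplus> (x \<otimes> x \<ominus> x) \<oplus> (x \<otimes> x \<ominus> x)" unfolding s_def using xc by algebra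
    also have "x \<otimes> x \<ominus> x = t" by (simp add: x_def t_def)
    also have "\<one> \<oplus> t \<oplus> t \<oplus> t \<oplus> t = \<one> \<oplus> z" unfolding z_def using tc by algebra
    finally have ss: "s \<otimes> s = \<one> \<oplus> z" .
    have "y \<otimes> y \<ominus> y = (x \<otimes> x \<ominus> x) \<oplus> t \<otimes> s \<otimes> ((x \<oplus> x) \<ominus> \<one>) \<oplus> t \<otimes> t \<otimes> (s \<otimes> s)"
      unfolding y_def s_def[symmetric] using xc tc sc by algebra
    also have "\<dots> = t \<oplus> t \<otimes> s \<otimes> (\<ominus> s) \<oplus> t \<otimes> t \<otimes> (s \<otimes> s)" unfolding ms by (simp add: x_def t_def)
    also have "\<dots> = t \<ominus> t \<otimes> (s \<otimes> s) \<oplus> t \<otimes> t \<otimes> (s \<otimes> s)" using sc tc by algebra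
    also have "\<dots> = t \<otimes> (t \<otimes> (\<one> \<oplus> z) \<ominus> z)" unfolding ss using zc tc by algebra
    also have "\<dots> = t \<otimes> t \<otimes> (\<one> \<oplus> z \<ominus> (\<one> \<oplus> \<one> \<oplus> \<one> \<oplus> \<one>))" unfolding z_def using tc by algebra
    also have "\<dots> = \<pi> [^] Suc (Suc k) \<otimes> (P0 \<otimes> w \<otimes> w \<otimes> (\<one> \<oplus> z \<ominus> (\<one> \<oplus> \<one> \<oplus> \<one> \<oplus> \<one>)))"
    proof -
      define s where "s = \<one> \<oplus> z \<ominus> (\<one> \<oplus> \<one> \<oplus> \<one> \<oplus> \<one>)"
      have "s \<in> carrier L" using tc by (simp add: s_def z_def)
      then have "P0 \<otimes> \<pi> \<otimes> w \<otimes> (P0 \<otimes> \<pi> \<otimes> w) \<otimes> s = P0 \<otimes> \<pi> \<otimes> \<pi> \<otimes> (P0 \<otimes> w \<otimes> w \<otimes> s)" using Pc wc pi_car by algebra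
      then show ?thesis unfolding tw s_def[symmetric] by (simp add: P0_def)
    qed
    finally have "?e (Suc k) \<otimes> ?e (Suc k) \<ominus> ?e (Suc k) = \<pi> [^] Suc (Suc k) \<otimes> (P0 \<otimes> w \<otimes> w \<otimes> (\<one> \<oplus> z \<ominus> (\<one> \<oplus> \<one> \<oplus> \<one> \<oplus> \<one>)))"
      unfolding y .
    moreover have "P0 \<otimes> w \<otimes> w \<otimes> (\<one> \<oplus> z \<ominus> (\<one> \<oplus> \<one> \<oplus> \<one> \<oplus> \<one>)) \<in> B" unfolding z_def using PB w(1) tB B_closed by simp
    ultimately show ?case by blast
  qed
  then obtain w where w: "\<And>k. w k \<in> B" "\<And>k. ?e k \<otimes> ?e k \<ominus> ?e k = \<pi> [^] Suc k \<otimes> w k" by metis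
  \<comment> \<open>The corrections are \<open>p^(k+1)\<close> times \<open>d k\<close>, so the
    iterates are \<open>e\<close> plus \<open>p\<close> times the partial sums of a series with
    coefficients in \<open>B\<close>.\<close>
  define d where "d k = w k \<otimes> (\<one> \<ominus> (?e k \<oplus> ?e k))" for k
  have dB: "d k \<in> B" for k unfolding d_def using w(1) eB B_closed by simp
  have dc: "d k \<in> carrier L" for k using dB B_car by blast
  have wc: "w k \<in> carrier L" for k using w(1) B_car by blast
  have pc: "psum d k \<in> carrier L" for k by (rule psum_carrier) (rule dc)
  have ek: "?e k = e \<oplus> \<pi> \<otimes> psum d k" for k
  proof (induction k)
    case 0 show ?case using ec[of 0] by simp
  next
    case (Suc k)
    define P0 where "P0 = \<pi> [^] k"
    have Pc: "P0 \<in> carrier L" by (simp add: P0_def)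
    have "?e (Suc k) = ?e k \<oplus> P0 \<otimes> \<pi> \<otimes> w k \<otimes> (\<one> \<ominus> (?e k \<oplus> ?e k))" using w(2)[of k] by (simp add: P0_def)
    also have "\<dots> = ?e k \<oplus> \<pi> \<otimes> (P0 \<otimes> (w k \<otimes> (\<one> \<ominus> (?e k \<oplus> ?e k))))" using Pc wc[of k] ec[of k] pi_car by algebra
    also have "\<dots> = e \<oplus> \<pi> \<otimes> psum d k \<oplus> \<pi> \<otimes> (P0 \<otimes> d k)" unfolding d_def[of k, symmetric] unfolding Suc ..
    also have "\<dots> = e \<oplus> \<pi> \<otimes> (psum d k \<oplus> P0 \<otimes> d k)" using Pc dc[of k] pc[of k] ec[of 0] pi_car by (simp add: r_distr a_assoc)
    finally show ?case by (simp add: P0_def)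
  qed
  obtain s where s: "s \<in> B" "\<And>k. \<exists>v\<in>B. s \<ominus> psum d k = \<pi> [^] k \<otimes> v" using B_limits[of d, OF dB] by blast
  have sc: "s \<in> carrier L" using s B_car by blast
  define \<epsilon> where "\<epsilon> = e \<oplus> \<pi> \<otimes> s"
  have \<epsilon>B: "\<epsilon> \<in> B" unfolding \<epsilon>_def using e s pi_B B_closed by simp
  then have \<epsilon>c: "\<epsilon> \<in> carrier L" by (rule B_car)
  have "\<epsilon> \<otimes> \<epsilon> \<ominus> \<epsilon> = \<zero>"
  proof (rule B_separated)
    show "\<epsilon> \<otimes> \<epsilon> \<ominus> \<epsilon> \<in> carrier L" using \<epsilon>c by simp
    fix k :: nat
    obtain v where v: "v \<in> B" "s \<ominus> psum d k = \<pi> [^] k \<otimes> v" using s(2) by blast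
    define P0 x where "P0 = \<pi> [^] k" and "x = ?e k"
    have cc: "P0 \<in> carrier L" "x \<in> carrier L" "v \<in> carrier L" using ec v B_car by (auto simp: P0_def x_def)
    have ecar: "e \<in> carrier L" using ec[of 0] by simp
    have "\<epsilon> \<ominus> x = \<pi> \<otimes> (s \<ominus> psum d k)" unfolding \<epsilon>_def x_def ek using ecar sc pc[of k] pi_car by algebra
    then have d1: "\<epsilon> \<ominus> x = P0 \<otimes> (\<pi> \<otimes> v)" unfolding v(2) P0_def using cc by (simp add: m_ac)
    have d2: "x \<otimes> x \<ominus> x = P0 \<otimes> (\<pi> \<otimes> w k)" unfolding x_def w(2) P0_def using wc by (simp add: m_assoc)
    have "\<epsilon> \<otimes> \<epsilon> \<ominus> \<epsilon> = (x \<otimes> x \<ominus> x) \<oplus> (\<epsilon> \<ominus> x) \<otimes> (\<epsilon> \<oplus> x \<ominus> \<one>)" using \<epsilon>c cc by algebra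
    also have "\<dots> = P0 \<otimes> (\<pi> \<otimes> w k \<oplus> \<pi> \<otimes> v \<otimes> (\<epsilon> \<oplus> x \<ominus> \<one>))" unfolding d1 d2 using \<epsilon>c cc wc[of k] pi_car by algebra
    finally have "\<epsilon> \<otimes> \<epsilon> \<ominus> \<epsilon> = \<pi> [^] k \<otimes> (\<pi> \<otimes> w k \<oplus> \<pi> \<otimes> v \<otimes> (\<epsilon> \<oplus> x \<ominus> \<one>))" by (simp add: P0_def)
    moreover have "\<pi> \<otimes> w k \<oplus> \<pi> \<otimes> v \<otimes> (\<epsilon> \<oplus> x \<ominus> \<one>) \<in> B" using pi_B w(1) v(1) \<epsilon>B eB B_closed by (simp add: x_def)
    ultimately show "\<exists>w\<in>B. \<epsilon> \<otimes> \<epsilon> \<ominus> \<epsilon> = \<pi> [^] k \<otimes> w" by blast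
  qed
  moreover have "\<epsilon> \<otimes> \<epsilon> \<ominus> \<epsilon> = \<epsilon> \<otimes> (\<epsilon> \<ominus> \<one>)" using \<epsilon>c by algebra
  ultimately have "\<epsilon> = \<zero> \<or> \<epsilon> \<ominus> \<one> = \<zero>" using \<epsilon>c integral[of \<epsilon> "\<epsilon> \<ominus> \<one>"] by simp
  then have "\<epsilon> = \<zero> \<or> \<epsilon> = \<one>" using \<epsilon>c by (simp add: r_right_minus_eq)
  moreover have "e \<ominus> \<epsilon> = \<pi> \<otimes> (\<ominus> s)" unfolding \<epsilon>_def using sc ec[of 0] pi_car by (simp, algebra)
  ultimately show ?thesis unfolding mod_pi_def using s(1) B_closed(3) by metis
qed

lemma unit_or_nilpotent_mod_pi:
  assumes y: "y \<in> B"
  shows "(\<exists>N::nat. N > 0 \<and> (\<exists>w\<in>B. y [^] N = \<pi> \<otimes> w)) \<or> (\<exists>s\<in>B. y \<otimes> s = \<one>)"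
proof -
  obtain N where N: "N > 0" "mod_pi B (y [^] N \<otimes> y [^] N) (y [^] (N::nat))" using idempotent_power_mod_pi[OF y] by blast
  have yc: "y \<in> carrier L" using y by (rule B_car)
  from idempotent_lift[OF pow_B[OF y] N(2)] show ?thesis
  proof
    assume "mod_pi B (y [^] N) \<zero>"
    then obtain w where "w \<in> B" "y [^] N \<ominus> \<zero> = \<pi> \<otimes> w" by (auto simp: mod_pi_def)
    then show ?thesis using N(1) yc by (auto simp: a_minus_def)
  next
    assume "mod_pi B (y [^] N) \<one>"
    then obtain w where w: "w \<in> B" "y [^] N \<ominus> \<one> = \<pi> \<otimes> w" by (auto simp: mod_pi_def)
    have wc: "w \<in> carrier L" using w B_car by blast
    have "y [^] N = \<one> \<oplus> (y [^] N \<ominus> \<one>)" using nat_pow_closed[OF yc, of N] by algebra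
    then have e: "y [^] N = \<one> \<oplus> \<pi> \<otimes> w" using w(2) by simp
    obtain s where s: "s \<in> B" "y [^] N \<otimes> s = \<one>" unfolding e using one_plus_pi_unit[OF w(1)] by blast
    obtain M where M: "N = Suc M" using N(1) by (cases N) auto
    have "y \<otimes> (y [^] M \<otimes> s) = \<one>" using s B_car yc unfolding M by (simp add: m_ac)
    then show ?thesis using pow_B[OF y] s(1) B_closed(4) by blast
  qed
qed

text \<open>If \<open>y\<close> is not a unit, then some \<open>y^N\<close> equals
  \<open>p w\<close>, and \<open>1 - y\<close> divides \<open>1 - y^N\<close>, which is a unit by
  the geometric series.\<close>

lemma B_local: assumes y: "y \<in> B" shows "(\<exists>s\<in>B. y \<otimes> s = \<one>) \<or> (\<exists>s\<in>B. (\<one> \<ominus> y) \<otimes> s = \<one>)"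
proof (rule disjCI)
  assume "\<not> (\<exists>s\<in>B. (\<one> \<ominus> y) \<otimes> s = \<one>)"
  have yc: "y \<in> carrier L" using y by (rule B_car)
  have geo: "\<exists>g\<in>B. (\<one> \<ominus> y) \<otimes> g = \<one> \<ominus> y [^] (N::nat)" for N
  proof (induction N)
    case 0 show ?case using yc B_closed(1) by (intro bexI[of _ \<zero>]) (auto simp: a_minus_def r_neg)
  next
    case (Suc N)
    then obtain g where g: "g \<in> B" "(\<one> \<ominus> y) \<otimes> g = \<one> \<ominus> y [^] N" by blast
    define z where "z = y [^] N"
    have c: "g \<in> carrier L" "z \<in> carrier L" using g B_car yc by (auto simp: z_def)
    have "(\<one> \<ominus> y) \<otimes> (g \<oplus> z) = (\<one> \<ominus> y) \<otimes> g \<oplus> (\<one> \<ominus> y) \<otimes> z" using c yc by algebra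
    also have "\<dots> = \<one> \<ominus> z \<otimes> y" unfolding g(2) z_def[symmetric] using c yc by algebra
    finally show ?case using g(1) pow_B[OF y] B_closed(5) by (auto simp: z_def)
  qed
  show "\<exists>s\<in>B. y \<otimes> s = \<one>"
  proof (rule ccontr)
    assume "\<not> (\<exists>s\<in>B. y \<otimes> s = \<one>)"
    then obtain N w where w: "w \<in> B" "y [^] (N::nat) = \<pi> \<otimes> w" using unit_or_nilpotent_mod_pi[OF y] by blast
    obtain g where g: "g \<in> B" "(\<one> \<ominus> y) \<otimes> g = \<one> \<ominus> \<pi> \<otimes> w" using geo[of N] w(2) by auto
    obtain s where s: "s \<in> B" "(\<one> \<ominus> \<pi> \<otimes> w) \<otimes> s = \<one>" using one_minus_pi_unit[OF w(1)] by blast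
    have "(\<one> \<ominus> y) \<otimes> (g \<otimes> s) = \<one>" using s(2) g B_car s(1) yc by (simp flip: m_assoc)
    then show False using \<open>\<not> (\<exists>s\<in>B. (\<one> \<ominus> y) \<otimes> s = \<one>)\<close> g(1) s(1) B_closed(4) by blast
  qed
qed

end

lemma IL_local: "y \<in> IL \<Longrightarrow> (\<exists>s\<in>IL. y \<otimes> s = \<one>) \<or> (\<exists>s\<in>IL. (\<one> \<ominus> y) \<otimes> s = \<one>)"
proof -
  assume y: "y \<in> IL"
  obtain B where B: "fin_alg A B" "y \<in> B" by (rule IL_fin_alg[OF y y])
  show ?thesis using B_local[OF B] fin_alg_IL[OF B(1)] by blast
qed

end

section \<open>Unramified extensions\<close>

context padic_ext
begin

lemma sub_cring: "subring B L \<Longrightarrow> cring (L\<lparr>carrier := B\<rparr>)"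
  using subcring_iff[OF subringE(1)] subcringI' by blast

lemma ev_sub:
  assumes B: "subring B L" and x: "x \<in> B" shows "cring.ev (L\<lparr>carrier := B\<rparr>) f x = ev f x"
proof -
  interpret S: cring "L\<lparr>carrier := B\<rparr>" by (rule sub_cring[OF B])
  have "(\<lambda>x. x) \<in> Ring.ring_hom (L\<lparr>carrier := B\<rparr>) L"
    using subringE(1)[OF B] by (intro Ring.ring_hom_memI) auto
  then show ?thesis using S.ring_hom_ev[OF is_cring, of "\<lambda>x. x" x f] x by simp
qed

lemma iz_sub:
  assumes B: "subring B L" shows "cring.iz (L\<lparr>carrier := B\<rparr>) m = iz m"
proof -
  interpret S: cring "L\<lparr>carrier := B\<rparr>" by (rule sub_cring[OF B])
  have "(\<lambda>x. x) \<in> Ring.ring_hom (L\<lparr>carrier := B\<rparr>) L"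
    using subringE(1)[OF B] by (intro Ring.ring_hom_memI) auto
  then show ?thesis using S.ring_hom_iz[OF is_cring, of "\<lambda>x. x" m] by simp
qed

lemma ev_in_subring:
  assumes B: "subring B L" and x: "x \<in> B" shows "ev f x \<in> B"
proof -
  interpret S: cring "L\<lparr>carrier := B\<rparr>" by (rule sub_cring[OF B])
  have "S.ev f x \<in> B" using S.ev_closed[of x f] x by simp
  then show ?thesis by (simp add: ev_sub[OF B x])
qed

text \<open>Applying the expansion in the ring \<open>B\<close> puts the remainder into
  \<open>B\<close>, so that it can be read modulo \<open>p B\<close>.\<close>

lemma taylor_in_subring:
  assumes B: "subring B L" and x: "x \<in> B" and d: "d \<in> B"
  shows "\<exists>w\<in>B. ev f (x \<oplus> d) = ev f x \<oplus> d \<otimes> ev (pderiv f) x \<oplus> d \<otimes> d \<otimes> w"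
proof -
  interpret S: cring "L\<lparr>carrier := B\<rparr>" by (rule sub_cring[OF B])
  have "x \<oplus> d \<in> B" using x d subringE(7)[OF B] by blast
  then show ?thesis using S.ev_taylor[of x d f] x d by (simp add: ev_sub[OF B])
qed

lemma pcong_in_subring:
  assumes B: "subring B L" and x: "x \<in> B" and c: "pcong m f g"
  shows "\<exists>w\<in>B. ev f x = ev g x \<oplus> iz m \<otimes> w"
proof -
  interpret S: cring "L\<lparr>carrier := B\<rparr>" by (rule sub_cring[OF B])
  show ?thesis using S.ev_pcong[of x m f g] x c by (simp add: ev_sub[OF B] iz_sub[OF B])
qed

lemma finsum_poly_in_spn:
  assumes x: "x \<in> carrier L" shows "(\<Oplus>i\<in>{..<m}. iz (c i) \<otimes> x [^] (i::nat)) \<in> spn A (pw x m)"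
proof (induction m)
  case (Suc m)
  have "(\<Oplus>i\<in>{..<Suc m}. iz (c i) \<otimes> x [^] i) = iz (c m) \<otimes> x [^] m \<oplus> (\<Oplus>i\<in>{..<m}. iz (c i) \<otimes> x [^] i)"
    unfolding lessThan_Suc by (subst finsum_insert) (use x in auto)
  then show ?case using spnI[OF iz_in_subring[OF subring_A] Suc, of "c m" "x [^] m"] by simp
qed simp

lemma monic_root_power:
  assumes x: "x \<in> carrier L" and f: "monic f" and r: "ev f x = \<zero>"
  shows "x [^] pdeg f \<in> spn A (pw x (pdeg f))"
proof -
  let ?d = "pdeg f"
  define S where "S = (\<Oplus>i\<in>{..<?d}. iz (pcoeff f i) \<otimes> x [^] i)"
  have S: "S \<in> spn A (pw x ?d)" unfolding S_def by (rule finsum_poly_in_spn[OF x])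
  have M: "submod A (spn A (pw x ?d))" by (rule spn_submod[OF subring_A pw_carrier[OF x]])
  have Sc: "S \<in> carrier L" using S submodD(1)[OF M] by blast
  have i: "{..?d} = insert ?d {..<?d}" by auto
  have "ev f x = iz (pcoeff f ?d) \<otimes> x [^] ?d \<oplus> S"
    unfolding ev_eq_finsum[OF x order_refl] S_def i by (subst finsum_insert) (use x in auto)
  then have "x [^] ?d \<oplus> S = \<zero>" using f r x by simp
  then have "x [^] ?d = \<zero> \<ominus> S" using x Sc by (simp add: a_minus_def minus_equality)
  then show ?thesis using submod_diff[OF subring_A M submodD(2)[OF M] S] by simp
qed

lemma monic_root_IL: "x \<in> carrier L \<Longrightarrow> monic f \<Longrightarrow> ev f x = \<zero> \<Longrightarrow> x \<in> IL"
  using monic_root_power[of x f] by (auto simp: IL_def intg_def)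

lemma iz_unit_A:
  assumes c: "\<not> int p dvd c" shows "\<exists>s\<in>A. iz c \<otimes> s = \<one>"
proof -
  obtain x where "int p dvd x * c - 1" using prime_inverse_mod[of "int p" c] prime_p c by auto
  then obtain k where k: "c * x = 1 + int p * k" by (metis add_diff_cancel_left' diff_add_cancel dvd_def add.commute mult.commute)
  have kA: "iz k \<in> A" and xA: "iz x \<in> A" by (rule iz_in_subring[OF subring_A])+
  obtain s where s: "s \<in> A" "(\<one> \<oplus> \<pi> \<otimes> iz k) \<otimes> s = \<one>" using one_plus_pi_unit[OF fin_alg_self[OF subring_A] kA] by blast
  have "iz c \<otimes> iz x = \<one> \<oplus> \<pi> \<otimes> iz k" using arg_cong[OF k, of iz] by (simp add: iz_add iz_mult)
  then have "iz c \<otimes> (iz x \<otimes> s) = \<one>" using s A_car by (simp flip: m_assoc)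
  then show ?thesis using subringE(6)[OF subring_A xA s(1)] by blast
qed

lemma ev_pderiv_unit_subring:
  assumes B: "subring B L" "A \<subseteq> B" and a: "a \<in> B" "ev f a = \<zero>"
    and f: "monic f" "pdeg f \<ge> 1" "\<not> int p dvd discriminant f"
  shows "\<exists>s\<in>B. ev (pderiv f) a \<otimes> s = \<one>"
proof -
  obtain u v where uv: "u * f + v * pderiv f = [:resultant f (pderiv f):]"
    using resultant_bezout[of f "pderiv f"] f by auto
  have "\<not> int p dvd resultant f (pderiv f)"
    using f by (auto simp: discriminant_def)
  then obtain s where s: "s \<in> A" "iz (resultant f (pderiv f)) \<otimes> s = \<one>" using iz_unit_A by blast
  have ac: "a \<in> carrier L" by (rule A_carrier[OF B(1) a(1)])
  have sc: "s \<in> carrier L" using s A_car by blast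
  have "iz (resultant f (pderiv f)) = ev v a \<otimes> ev (pderiv f) a"
    using arg_cong[OF uv, of "\<lambda>g. ev g a"] ac a(2) by (simp add: ev_add ev_mult)
  then have "ev (pderiv f) a \<otimes> (ev v a \<otimes> s) = \<one>" using s(2) ac sc ev_closed[of a v] ev_closed[of a "pderiv f"] by (simp add: m_ac)
  moreover have "ev v a \<otimes> s \<in> B" using s B(2) ev_in_subring[OF B(1) a(1)] subringE(6)[OF B(1)] by blast
  ultimately show ?thesis by blast
qed

lemma mod_pi_ev:
  assumes B: "fin_alg A B" and x: "x \<in> B" and y: "y \<in> B" and c: "mod_pi B x y"
  shows "mod_pi B (ev g x) (ev g y)"
proof -
  note S = B_subring[OF B]
  obtain w where w: "w \<in> B" "x \<ominus> y = \<pi> \<otimes> w" using c by (auto simp: mod_pi_def)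
  have dB: "x \<ominus> y \<in> B" using B_minus[OF B x y] .
  obtain v where v: "v \<in> B" "ev g (y \<oplus> (x \<ominus> y)) = ev g y \<oplus> (x \<ominus> y) \<otimes> ev (pderiv g) y \<oplus> (x \<ominus> y) \<otimes> (x \<ominus> y) \<otimes> v"
    using taylor_in_subring[OF S y dB] by blast
  define e where "e = ev (pderiv g) y"
  define d where "d = x \<ominus> y"
  have eB: "e \<in> B" unfolding e_def by (rule ev_in_subring[OF S y])
  have cc: "x \<in> carrier L" "y \<in> carrier L" "w \<in> carrier L" "v \<in> carrier L" "e \<in> carrier L" "d \<in> carrier L" "ev g y \<in> carrier L"
    using B_car[OF B] x y w v eB dB by (auto simp: d_def)
  have "y \<oplus> d = x" unfolding d_def using cc by algebra
  then have "ev g x = ev g y \<oplus> d \<otimes> e \<oplus> d \<otimes> d \<otimes> v" using v(2) by (simp add: e_def d_def)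
  then have "ev g x \<ominus> ev g y = d \<otimes> (e \<oplus> d \<otimes> v)" using cc by (simp, algebra)
  also have "\<dots> = \<pi> \<otimes> (w \<otimes> (e \<oplus> d \<otimes> v))" unfolding d_def w(2) using cc pi_car by algebra
  finally have "ev g x \<ominus> ev g y = \<pi> \<otimes> (w \<otimes> (e \<oplus> d \<otimes> v))" .
  moreover have "w \<otimes> (e \<oplus> d \<otimes> v) \<in> B" using w(1) eB v(1) dB B_closed[OF B] by (simp add: d_def)
  ultimately show ?thesis unfolding mod_pi_def by blast
qed

lemma pcong_mod_pi: "fin_alg A B \<Longrightarrow> x \<in> B \<Longrightarrow> pcong (int p) f g \<Longrightarrow> mod_pi B (ev f x) (ev g x)"
proof -
  assume B: "fin_alg A B" and x: "x \<in> B" and c: "pcong (int p) f g"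
  obtain w where w: "w \<in> B" "ev f x = ev g x \<oplus> \<pi> \<otimes> w" using pcong_in_subring[OF B_subring[OF B] x c] by blast
  have "ev g x \<in> carrier L" "w \<in> carrier L" using B_car[OF B] x w(1) by auto
  then have "ev f x \<ominus> ev g x = \<pi> \<otimes> w" unfolding w(2) using pi_car by algebra
  then show ?thesis unfolding mod_pi_def using w(1) by blast
qed

lemma ev_frobenius_mod_pi:
  assumes B: "fin_alg A B" and x: "x \<in> B"
  shows "mod_pi B (ev g x [^] (p ^ k)) (ev g (x [^] (p ^ k)))"
  using pcong_mod_pi[OF B x power_prime_power_pcong[OF prime_p, of g k]] B_car[OF B x]
  by (simp add: ev_power ev_pcompose ev_xpow)

lemma mod_pi_zero_iff: "fin_alg A B \<Longrightarrow> x \<in> B \<Longrightarrow> mod_pi B x \<zero> \<longleftrightarrow> (\<exists>w\<in>B. x = \<pi> \<otimes> w)"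
  using B_car[of B x] by (simp add: mod_pi_def a_minus_def)

text \<open>Modulo \<open>p\<close> every coefficient from \<open>A\<close> can be replaced by an
  integer. Thus the Frobenius congruence for integer polynomials applies to all of
  \<open>A[x]\<close>.\<close>

lemma residue_poly:
  assumes B: "fin_alg A B" and x: "x \<in> B"
  shows "y \<in> spn A (pw x m) \<Longrightarrow> \<exists>g. mod_pi B y (ev g x)"
proof (induction m arbitrary: y)
  case 0
  have "mod_pi B \<zero> \<zero>" by (rule mod_pi_refl[OF B B_closed(1)[OF B]])
  then show ?case using 0 B_car[OF B x] by (intro exI[of _ 0]) simp
next
  case (Suc m)
  then obtain a v where v: "y = a \<otimes> x [^] m \<oplus> v" "a \<in> A" "v \<in> spn A (pw x m)" by auto
  obtain c w where w: "w \<in> A" "a \<ominus> iz c = \<pi> \<otimes> w" using residue[OF v(2)] by blast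
  obtain g w2 where g: "w2 \<in> B" "v \<ominus> ev g x = \<pi> \<otimes> w2" using Suc.IH[OF v(3)] by (auto simp: mod_pi_def)
  have xc: "x \<in> carrier L" by (rule B_car[OF B x])
  define P0 n e where "P0 = x [^] m" and "n = iz c" and "e = ev g x"
  have vc: "v \<in> carrier L" using v(3) spn_carrier[OF subring_A pw_carrier[OF xc]] by blast
  have PB: "P0 \<in> B" unfolding P0_def by (rule pow_B[OF B x])
  have cc: "P0 \<in> carrier L" "n \<in> carrier L" "e \<in> carrier L" "a \<in> carrier L" "w \<in> carrier L" "w2 \<in> carrier L"
    using xc v(2) w(1) A_car g(1) B_car[OF B] by (auto simp: P0_def n_def e_def)
  have "y \<ominus> (n \<otimes> P0 \<oplus> e) = (a \<ominus> n) \<otimes> P0 \<oplus> (v \<ominus> e)" unfolding v(1) P0_def[symmetric] using cc vc by algebra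
  also have "\<dots> = \<pi> \<otimes> (w \<otimes> P0 \<oplus> w2)" unfolding n_def e_def w(2) g(2) using cc pi_car by algebra
  finally have "y \<ominus> ev (pmonom c m + g) x = \<pi> \<otimes> (w \<otimes> P0 \<oplus> w2)" using xc by (simp add: ev_add ev_monom n_def P0_def e_def)
  moreover have "w \<otimes> P0 \<oplus> w2 \<in> B" using w(1) A_sub_B[OF B] PB g(1) B_closed(4,5)[OF B] by blast
  ultimately show ?case unfolding mod_pi_def by blast
qed

lemma unit_not_nilpotent_mod_pi:
  assumes B: "fin_alg A B" and y: "y \<in> B" "s \<in> B" "y \<otimes> s = \<one>" and n: "w \<in> B" "y [^] (N::nat) = \<pi> \<otimes> w"
  shows False
proof -
  have c: "y \<in> carrier L" "s \<in> carrier L" "w \<in> carrier L" using y n B_car[OF B] by auto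
  have "\<one> = (y \<otimes> s) [^] N" using y(3) by simp
  also have "\<dots> = y [^] N \<otimes> s [^] N" using c by (simp add: nat_pow_distrib)
  also have "\<dots> = \<pi> \<otimes> (w \<otimes> s [^] N)" unfolding n(2) using c by (simp add: m_assoc)
  finally have "\<pi> \<otimes> (w \<otimes> s [^] N) = \<one>" by simp
  moreover have "w \<otimes> s [^] N \<in> IL" using n(1) y(2) pow_B[OF B] B_closed(4)[OF B] B_IL[OF B] by blast
  ultimately show False using pi_not_unit_IL by blast
qed

section \<open>The ring and the field generated by a root of f\<close>

context
  fixes f :: "int poly" and \<alpha> :: 'a
  assumes f: "monic f" "pdeg f \<ge> 1" "\<not> int p dvd discriminant f"
    and \<alpha>: "\<alpha> \<in> carrier L" "ev f \<alpha> = \<zero>"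
begin

definition "R\<alpha> = spn A (pw \<alpha> (pdeg f))"

lemma fin_alg_R\<alpha>: "fin_alg A R\<alpha>" and \<alpha>_R\<alpha>: "\<alpha> \<in> R\<alpha>"
  using fin_alg_adjoin_pw[OF subring_A fin_alg_self[OF subring_A] one_not_zero \<alpha>(1) monic_root_power[OF \<alpha>(1) f(1) \<alpha>(2)]]
  by (auto simp: R\<alpha>_def)

text \<open>By the pigeonhole principle two iterated Frobenius powers of \<alpha> agree modulo
  \<open>p\<close>, which makes the defect \<open>d\<close> nilpotent there. As \<open>f\<close>
  vanishes modulo \<open>p\<close> at both \<alpha> and \<open>\<alpha> + d\<close>, Taylor's
  formula shows \<open>d (F + d v)\<close> to be 0 modulo \<open>p\<close>, and the bracket is a
  unit.\<close>

lemma root_frobenius_fixed: "\<exists>m>0. mod_pi R\<alpha> (\<alpha> [^] (p ^ m)) \<alpha>"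
proof -
  note B = fin_alg_R\<alpha> and a = \<alpha>_R\<alpha>
  note S = B_subring[OF B]
  obtain i j where ij: "i < j" "mod_pi R\<alpha> (\<alpha> [^] (p ^ j)) (\<alpha> [^] (p ^ i))"
    using sequence_repeats_mod_pi[OF B, of "\<lambda>k. \<alpha> [^] (p ^ k)"] pow_B[OF B a] by blast
  define m where "m = j - i"
  have m: "m > 0" "j = i + m" using ij by (auto simp: m_def)
  define d where "d = \<alpha> [^] (p ^ m) \<ominus> \<alpha>"
  have dB: "d \<in> R\<alpha>" unfolding d_def by (rule B_minus[OF B pow_B[OF B a] a])
  have dc: "d \<in> carrier L" by (rule B_car[OF B dB])
  \<comment> \<open>The \<open>p^i\<close>-th power of \<open>d = g(\<alpha>)\<close> is congruent
    to the value of \<open>g\<close> at \<open>\<alpha>^(p^i)\<close>, which is the difference of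
    the two powers chosen above.\<close>
  define g :: "int poly" where "g = pmonom 1 (p ^ m) - pmonom 1 1"
  have "ev g \<alpha> = d" using \<alpha>(1) by (simp add: g_def d_def ev_diff ev_xpow)
  moreover have "ev g (\<alpha> [^] (p ^ i)) = \<alpha> [^] (p ^ j) \<ominus> \<alpha> [^] (p ^ i)"
    using \<alpha>(1) by (simp add: g_def ev_diff ev_xpow nat_pow_pow m(2) power_add)
  ultimately have 1: "mod_pi R\<alpha> (d [^] (p ^ i)) (\<alpha> [^] (p ^ j) \<ominus> \<alpha> [^] (p ^ i))"
    using ev_frobenius_mod_pi[OF B a, of g i] by simp
  have eB: "\<alpha> [^] (p ^ j) \<ominus> \<alpha> [^] (p ^ i) \<in> R\<alpha>" by (rule B_minus[OF B pow_B[OF B a] pow_B[OF B a]])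
  have "mod_pi R\<alpha> (\<alpha> [^] (p ^ j) \<ominus> \<alpha> [^] (p ^ i)) \<zero>" using ij(2) unfolding mod_pi_zero_iff[OF B eB] by (simp add: mod_pi_def)
  then have "mod_pi R\<alpha> (d [^] (p ^ i)) \<zero>" using mod_pi_trans[OF B pow_B[OF B dB] eB B_closed(1)[OF B] 1] by blast
  then obtain w0 where w0: "w0 \<in> R\<alpha>" "d [^] (p ^ i) = \<pi> \<otimes> w0" using mod_pi_zero_iff[OF B pow_B[OF B dB]] by blast
  define F where "F = ev (pderiv f) \<alpha>"
  have FB: "F \<in> R\<alpha>" unfolding F_def by (rule ev_in_subring[OF S a])
  obtain s where s: "s \<in> R\<alpha>" "F \<otimes> s = \<one>"
    using ev_pderiv_unit_subring[OF S A_sub_B[OF B] a \<alpha>(2) f] unfolding F_def by blast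
  have "\<alpha> \<oplus> d = \<alpha> [^] (p ^ m)" unfolding d_def using \<alpha>(1) nat_pow_closed[OF \<alpha>(1), of "p ^ m"] by algebra
  then obtain v where v: "v \<in> R\<alpha>" "ev f (\<alpha> [^] (p ^ m)) = d \<otimes> F \<oplus> d \<otimes> d \<otimes> v"
    using taylor_in_subring[OF S a dB, of f] dc B_car[OF B FB] by (auto simp: \<alpha>(2) F_def)
  have "p ^ m > 0" using prime_gt_0_nat[OF prime_p] by simp
  then have z: "\<zero> [^] (p ^ m) = \<zero>" by (intro nat_pow_zero) simp
  have "mod_pi R\<alpha> (ev f \<alpha> [^] (p ^ m)) (ev f (\<alpha> [^] (p ^ m)))" by (rule ev_frobenius_mod_pi[OF B a])
  then have "mod_pi R\<alpha> \<zero> (ev f (\<alpha> [^] (p ^ m)))" unfolding \<alpha>(2) z .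
  then have "mod_pi R\<alpha> (ev f (\<alpha> [^] (p ^ m))) \<zero>"
    by (rule mod_pi_sym[OF B B_closed(1)[OF B] ev_in_subring[OF S pow_B[OF B a]]])
  then have "\<exists>w\<in>R\<alpha>. ev f (\<alpha> [^] (p ^ m)) = \<pi> \<otimes> w"
    using mod_pi_zero_iff[OF B ev_in_subring[OF S pow_B[OF B a]]] by simp
  then obtain w where w: "w \<in> R\<alpha>" "d \<otimes> F \<oplus> d \<otimes> d \<otimes> v = \<pi> \<otimes> w"
    unfolding v(2) by blast
  \<comment> \<open>Since \<open>s\<close> inverts \<open>F\<close>, the bracket
    \<open>F + d v\<close> is \<open>F (1 - y)\<close>. If \<open>y\<close> were a unit, its factor
    \<open>d\<close> would be one too, although it is nilpotent modulo \<open>p\<close>; so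
    \<open>1 - y\<close> is a unit.\<close>
  define y where "y = \<ominus> (d \<otimes> v \<otimes> s)"
  have yB: "y \<in> R\<alpha>" unfolding y_def using dB v(1) s(1) B_closed[OF B] by simp
  have cc: "d \<in> carrier L" "v \<in> carrier L" "s \<in> carrier L" "w \<in> carrier L" "F \<in> carrier L" "y \<in> carrier L"
    using dB v(1) s(1) w(1) FB yB B_car[OF B] by auto
  have "\<exists>t\<in>R\<alpha>. (\<one> \<ominus> y) \<otimes> t = \<one>"
  proof (rule disjE[OF B_local[OF B yB]])
    assume "\<exists>t\<in>R\<alpha>. y \<otimes> t = \<one>"
    then obtain t where t: "t \<in> R\<alpha>" "y \<otimes> t = \<one>" by blast
    have tc: "t \<in> carrier L" using t B_car[OF B] by blast
    have "d \<otimes> (\<ominus> (v \<otimes> s \<otimes> t)) = y \<otimes> t" unfolding y_def using cc tc by algebra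
    then have "d \<otimes> (\<ominus> (v \<otimes> s \<otimes> t)) = \<one>" using t(2) by simp
    moreover have "\<ominus> (v \<otimes> s \<otimes> t) \<in> R\<alpha>" using v(1) s(1) t(1) B_closed[OF B] by simp
    ultimately show ?thesis using unit_not_nilpotent_mod_pi[OF B dB _ _ w0] by blast
  qed
  then obtain t where t: "t \<in> R\<alpha>" "(\<one> \<ominus> y) \<otimes> t = \<one>" by blast
  have tc: "t \<in> carrier L" using t B_car[OF B] by blast
  \<comment> \<open>The added and subtracted term contains \<open>F s - 1\<close>, which is 0; with
    it the next equation becomes a polynomial identity.\<close>
  have "d = d \<otimes> (F \<otimes> s) \<otimes> ((\<one> \<ominus> y) \<otimes> t) \<oplus> d \<otimes> d \<otimes> v \<otimes> s \<otimes> t \<otimes> (F \<otimes> s \<ominus> \<one>) \<ominus> d \<otimes> d \<otimes> v \<otimes> s \<otimes> t \<otimes> (F \<otimes> s \<ominus> \<one>)"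
    unfolding s(2) t(2) using cc tc by algebra
  also have "\<dots> = (d \<otimes> F \<oplus> d \<otimes> d \<otimes> v) \<otimes> (s \<otimes> t) \<oplus> d \<otimes> d \<otimes> v \<otimes> s \<otimes> t \<otimes> (F \<otimes> s \<ominus> \<one>)"
    unfolding y_def using cc tc by algebra
  also have "\<dots> = \<pi> \<otimes> (w \<otimes> (s \<otimes> t))" unfolding s(2) w(2) using cc tc pi_car by algebra
  finally have "d = \<pi> \<otimes> (w \<otimes> (s \<otimes> t))" .
  moreover have "w \<otimes> (s \<otimes> t) \<in> R\<alpha>" using w(1) s(1) t(1) B_closed[OF B] by simp
  ultimately show ?thesis using m(1) unfolding mod_pi_def d_def by blast
qed

lemma R\<alpha>_unit_or_pi_multiple:
  assumes y: "y \<in> R\<alpha>" shows "(\<exists>w\<in>R\<alpha>. y = \<pi> \<otimes> w) \<or> (\<exists>s\<in>R\<alpha>. y \<otimes> s = \<one>)"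
proof (rule disjE[OF unit_or_nilpotent_mod_pi[OF fin_alg_R\<alpha> y]])
  note B = fin_alg_R\<alpha> and a = \<alpha>_R\<alpha>
  note S = B_subring[OF B]
  assume "\<exists>N::nat. N > 0 \<and> (\<exists>w\<in>R\<alpha>. y [^] N = \<pi> \<otimes> w)"
  then obtain N :: nat and w where w: "w \<in> R\<alpha>" "y [^] N = \<pi> \<otimes> w" by blast
  obtain m where m: "m > 0" "mod_pi R\<alpha> (\<alpha> [^] (p ^ m)) \<alpha>" using root_frobenius_fixed by blast
  define q where "q = p ^ m"
  have q2: "q \<ge> 2" unfolding q_def using m(1) prime_ge_2_nat[OF prime_p] by (metis One_nat_def Suc_leI le_trans power_increasing power_one_right prime_ge_1_nat prime_p)
  \<comment> \<open>Modulo \<open>p\<close>, \<open>y\<close> is an integer polynomial in \<alpha>,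
    and the power \<open>q\<close> acts on its value through the argument, which it fixes.\<close>
  obtain g where g: "mod_pi R\<alpha> y (ev g \<alpha>)" using residue_poly[OF B a] y unfolding R\<alpha>_def by blast
  have gB: "ev g \<alpha> \<in> R\<alpha>" by (rule ev_in_subring[OF S a])
  have "mod_pi R\<alpha> (y [^] q) (ev g \<alpha> [^] q)" by (rule mod_pi_pow[OF B y gB g])
  moreover have "mod_pi R\<alpha> (ev g \<alpha> [^] q) (ev g (\<alpha> [^] q))" unfolding q_def by (rule ev_frobenius_mod_pi[OF B a])
  moreover have "mod_pi R\<alpha> (ev g (\<alpha> [^] q)) (ev g \<alpha>)" unfolding q_def by (rule mod_pi_ev[OF B pow_B[OF B a] a m(2)])
  moreover have "mod_pi R\<alpha> (ev g \<alpha>) y" by (rule mod_pi_sym[OF B y gB g])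
  moreover have "ev g (\<alpha> [^] q) \<in> R\<alpha>" by (rule ev_in_subring[OF S pow_B[OF B a]])
  ultimately have yq: "mod_pi R\<alpha> (y [^] q) y"
    using mod_pi_trans[OF B] pow_B[OF B y] pow_B[OF B gB] gB y by meson
  have yqj: "mod_pi R\<alpha> (y [^] (q ^ j)) y" for j
  proof (induction j)
    case 0 show ?case using mod_pi_refl[OF B y] B_car[OF B y] by simp
  next
    case (Suc j)
    have "mod_pi R\<alpha> ((y [^] (q ^ j)) [^] q) (y [^] q)" by (rule mod_pi_pow[OF B pow_B[OF B y] y Suc])
    then have "mod_pi R\<alpha> (y [^] (q ^ Suc j)) (y [^] q)" using B_car[OF B y] by (simp add: nat_pow_pow mult.commute)
    then show ?case using mod_pi_trans[OF B pow_B[OF B y] pow_B[OF B y] y _ yq] by blast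
  qed
  \<comment> \<open>\<open>q^N\<close> exceeds \<open>N\<close>, so \<open>y^(q^N)\<close> contains
    the factor \<open>y^N\<close> and is 0 modulo \<open>p\<close>; but it is also congruent to
    \<open>y\<close>.\<close>
  have "N < 2 ^ N" by (rule less_exp)
  also have "\<dots> \<le> q ^ N" using q2 by (rule power_mono) simp
  finally have "q ^ N = N + (q ^ N - N)" by simp
  then have "y [^] (q ^ N) = y [^] N \<otimes> y [^] (q ^ N - N)" using B_car[OF B y] by (metis nat_pow_mult)
  also have "\<dots> = \<pi> \<otimes> (w \<otimes> y [^] (q ^ N - N))" unfolding w(2) using B_car[OF B] w(1) y by (simp add: m_assoc)
  finally have e: "y [^] (q ^ N) = \<pi> \<otimes> (w \<otimes> y [^] (q ^ N - N))" .
  have "w \<otimes> y [^] (q ^ N - N) \<in> R\<alpha>" using w(1) pow_B[OF B y] B_closed(4)[OF B] by blast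
  then have "mod_pi R\<alpha> (y [^] (q ^ N)) \<zero>" using mod_pi_zero_iff[OF B pow_B[OF B y]] e by blast
  moreover have "mod_pi R\<alpha> y (y [^] (q ^ N))" by (rule mod_pi_sym[OF B pow_B[OF B y] y yqj])
  ultimately have "mod_pi R\<alpha> y \<zero>" using mod_pi_trans[OF B y pow_B[OF B y] B_closed(1)[OF B]] by blast
  then show ?thesis using mod_pi_zero_iff[OF B y] by blast
qed blast

text \<open>Factors \<open>p\<close> are split off until a unit remains; for non-zero
  \<open>y\<close> this stops by \<open>B_separated\<close>. So \<open>p\<close> is a uniformizer of
  the ring.\<close>

lemma R\<alpha>_pi_power_unit:
  assumes y: "y \<in> R\<alpha>" and nz: "y \<noteq> \<zero>"
  shows "\<exists>i::nat. \<exists>u\<in>R\<alpha>. \<exists>v\<in>R\<alpha>. y = \<pi> [^] i \<otimes> u \<and> u \<otimes> v = \<one>"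
proof (rule ccontr)
  assume no: "\<not> ?thesis"
  note B = fin_alg_R\<alpha>
  have "\<exists>w\<in>R\<alpha>. y = \<pi> [^] k \<otimes> w" for k :: nat
  proof (induction k)
    case 0 show ?case using y B_car[OF B y] by (intro bexI[of _ y]) simp_all
  next
    case (Suc k)
    then obtain w where w: "w \<in> R\<alpha>" "y = \<pi> [^] k \<otimes> w" by blast
    then have "\<not> (\<exists>s\<in>R\<alpha>. w \<otimes> s = \<one>)" using no by blast
    then obtain w' where w': "w' \<in> R\<alpha>" "w = \<pi> \<otimes> w'" using R\<alpha>_unit_or_pi_multiple[OF w(1)] by blast
    have "y = \<pi> [^] Suc k \<otimes> w'" unfolding w(2) w'(2) using B_car[OF B w'(1)] by (simp add: m_assoc)
    then show ?case using w'(1) by blast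
  qed
  then show False using B_separated[OF B B_car[OF B y]] nz by blast
qed

text \<open>This is \<open>K(\<alpha>)\<close>; elements are inverted by extracting powers of \<open>p\<close>.\<close>

definition "E\<alpha> = {z \<in> carrier L. \<exists>j::nat. \<pi> [^] j \<otimes> z \<in> R\<alpha>}"

lemma E\<alpha>I: "z \<in> carrier L \<Longrightarrow> \<pi> [^] (j::nat) \<otimes> z \<in> R\<alpha> \<Longrightarrow> z \<in> E\<alpha>"
  by (auto simp: E\<alpha>_def)

lemma R\<alpha>_E\<alpha>: "R\<alpha> \<subseteq> E\<alpha>"
  using E\<alpha>I[of _ 0] B_car[OF fin_alg_R\<alpha>] by auto

lemma E\<alpha>_subfield: "subfield E\<alpha> L"
proof (rule subfieldI')
  note B = fin_alg_R\<alpha>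
  note cl = B_closed[OF B]
  show "subring E\<alpha> L"
  proof (rule subringI)
    show "E\<alpha> \<subseteq> carrier L" by (auto simp: E\<alpha>_def)
    show "\<one> \<in> E\<alpha>" using R\<alpha>_E\<alpha> cl(2) by blast
    fix x assume "x \<in> E\<alpha>"
    then obtain i :: nat where x: "x \<in> carrier L" "\<pi> [^] i \<otimes> x \<in> R\<alpha>" by (auto simp: E\<alpha>_def)
    have "\<pi> [^] i \<otimes> \<ominus> x = \<ominus> (\<pi> [^] i \<otimes> x)" using x(1) by (simp add: r_minus)
    then show "\<ominus> x \<in> E\<alpha>" using E\<alpha>I[of "\<ominus> x" i] x cl(3) by simp
    fix y assume "y \<in> E\<alpha>"
    then obtain j :: nat where y: "y \<in> carrier L" "\<pi> [^] j \<otimes> y \<in> R\<alpha>" by (auto simp: E\<alpha>_def)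
    define P0 Q0 where "P0 = \<pi> [^] i" and "Q0 = \<pi> [^] j"
    have cc: "P0 \<in> carrier L" "Q0 \<in> carrier L" "P0 \<in> R\<alpha>" "Q0 \<in> R\<alpha>" by (auto simp: P0_def Q0_def pi_pow_B[OF B])
    have PQ: "\<pi> [^] (i + j) = P0 \<otimes> Q0" by (simp add: P0_def Q0_def pi_pow_add)
    have "P0 \<otimes> Q0 \<otimes> (x \<otimes> y) = (P0 \<otimes> x) \<otimes> (Q0 \<otimes> y)" using cc x(1) y(1) by algebra
    then have "\<pi> [^] (i + j) \<otimes> (x \<otimes> y) \<in> R\<alpha>" unfolding PQ using x(2) y(2) cl(4) by (simp add: P0_def Q0_def)
    then show "x \<otimes> y \<in> E\<alpha>" using E\<alpha>I x(1) y(1) by blast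
    have "P0 \<otimes> Q0 \<otimes> (x \<oplus> y) = Q0 \<otimes> (P0 \<otimes> x) \<oplus> P0 \<otimes> (Q0 \<otimes> y)" using cc x(1) y(1) by algebra
    then have "\<pi> [^] (i + j) \<otimes> (x \<oplus> y) \<in> R\<alpha>" unfolding PQ using x(2) y(2) cc cl(4,5) by (simp add: P0_def Q0_def)
    then show "x \<oplus> y \<in> E\<alpha>" using E\<alpha>I x(1) y(1) by blast
  qed
  fix z assume "z \<in> E\<alpha> - {\<zero>}"
  then obtain j :: nat where z: "z \<in> carrier L" "\<pi> [^] j \<otimes> z \<in> R\<alpha>" "z \<noteq> \<zero>" by (auto simp: E\<alpha>_def)
  have nz: "\<pi> [^] j \<otimes> z \<noteq> \<zero>" using z pi_pow_nz by (simp add: integral_iff)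
  obtain i :: nat and u v where uv: "u \<in> R\<alpha>" "v \<in> R\<alpha>" "\<pi> [^] j \<otimes> z = \<pi> [^] i \<otimes> u" "u \<otimes> v = \<one>"
    using R\<alpha>_pi_power_unit[OF z(2) nz] by blast
  define iz' where "iz' = inv z"
  have iz': "iz' \<in> carrier L" "z \<otimes> iz' = \<one>" using z field_Units by (auto simp: iz'_def)
  have uc: "u \<in> carrier L" "v \<in> carrier L" using uv B_car[OF B] by auto
  have "\<pi> [^] i \<otimes> iz' = (\<pi> [^] i \<otimes> u) \<otimes> (v \<otimes> iz')" using uc iz' uv(4) by (simp add: m_assoc flip: m_assoc[of u v])
  also have "\<dots> = \<pi> [^] j \<otimes> (z \<otimes> iz') \<otimes> v" unfolding uv(3)[symmetric] using uc iz'(1) z(1) by (simp add: m_ac)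
  also have "\<dots> = \<pi> [^] j \<otimes> v" using iz' by simp
  finally have "\<pi> [^] i \<otimes> iz' \<in> R\<alpha>" using uv(2) pi_pow_B[OF B] cl(4) by simp
  then show "inv z \<in> E\<alpha>" using E\<alpha>I[OF iz'(1)] by (simp add: iz'_def)
qed

lemma K_E\<alpha>: "K \<subseteq> E\<alpha>"
proof
  fix z assume z: "z \<in> K"
  obtain k :: nat where "\<pi> [^] k \<otimes> z \<in> A" using K_denominator[OF z] by blast
  then show "z \<in> E\<alpha>" using A_sub_B[OF fin_alg_R\<alpha>] E\<alpha>I[OF K_car[OF z]] by blast
qed

text \<open>\<open>finite_unramified\<close> speaks of the integral closure in the field, so this
  has to be identified. If \<open>p^j z = p^i u\<close> with a unit \<open>u\<close>, integrality of
  \<open>z\<close> forces \<open>j \<le> i\<close>; otherwise \<open>p\<close> would have an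
  integral inverse.\<close>

lemma E\<alpha>_IL: "E\<alpha> \<inter> IL = R\<alpha>"
proof
  note B = fin_alg_R\<alpha>
  show "R\<alpha> \<subseteq> E\<alpha> \<inter> IL" using R\<alpha>_E\<alpha> B_IL[OF B] by blast
  show "E\<alpha> \<inter> IL \<subseteq> R\<alpha>"
  proof
    fix z assume z: "z \<in> E\<alpha> \<inter> IL"
    show "z \<in> R\<alpha>"
    proof (cases "z = \<zero>")
      case True then show ?thesis using B_closed(1)[OF B] by simp
    next
      case False
      obtain j :: nat where j: "z \<in> carrier L" "\<pi> [^] j \<otimes> z \<in> R\<alpha>" using z by (auto simp: E\<alpha>_def)
      have nz: "\<pi> [^] j \<otimes> z \<noteq> \<zero>" using j(1) False pi_pow_nz by (simp add: integral_iff)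
      obtain i :: nat and u v where uv: "u \<in> R\<alpha>" "v \<in> R\<alpha>" "\<pi> [^] j \<otimes> z = \<pi> [^] i \<otimes> u" "u \<otimes> v = \<one>"
        using R\<alpha>_pi_power_unit[OF j(2) nz] by blast
      have uc: "u \<in> carrier L" "v \<in> carrier L" using uv B_car[OF B] by auto
      show ?thesis
      proof (cases "j \<le> i")
        case True
        have "\<pi> [^] i = \<pi> [^] j \<otimes> \<pi> [^] (i - j)" using True by (simp flip: pi_pow_add)
        then have "\<pi> [^] j \<otimes> z = \<pi> [^] j \<otimes> (\<pi> [^] (i - j) \<otimes> u)" using uv(3) uc by (simp add: m_assoc)
        then have "z = \<pi> [^] (i - j) \<otimes> u" using m_lcancel[OF pi_pow_nz] j(1) uc by simp
        then show ?thesis using uv(1) pi_pow_B[OF B] B_closed(4)[OF B] by simp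
      next
        case False
        then obtain k where k: "j = i + Suc k" using less_iff_Suc_add[of i j] by auto
        have "\<pi> [^] i \<otimes> (\<pi> [^] Suc k \<otimes> z) = \<pi> [^] i \<otimes> u" using uv(3) j(1) unfolding k pi_pow_add by (simp add: m_assoc)
        then have "\<pi> [^] Suc k \<otimes> z = u" using m_lcancel[OF pi_pow_nz, of i "\<pi> [^] Suc k \<otimes> z" u] j(1) uc by simp
        then have "\<pi> \<otimes> (\<pi> [^] k \<otimes> z \<otimes> v) = u \<otimes> v" using j(1) uc by (auto simp: m_ac)
        then have "\<pi> \<otimes> (\<pi> [^] k \<otimes> z \<otimes> v) = \<one>" using uv(4) by simp
        moreover have "\<pi> [^] k \<otimes> z \<otimes> v \<in> IL"
          using z uv(2) B_IL[OF B] pi_pow_B[OF B] subringE(6)[OF IL_subring] by blast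
        ultimately show ?thesis using pi_not_unit_IL by blast
      qed
    qed
  qed
qed

lemma Span_eq_spn: "Span K us = spn K us"
  by (induction us) (auto simp: line_extension_mem_iff, blast+)

text \<open>A power of \<open>p\<close> brings an element of the field into the
  \<open>A\<close>-span of the powers of \<alpha>, and over \<open>K\<close> this power can be
  divided out again.\<close>

lemma E\<alpha>_finite_dimension: "finite_dimension K E\<alpha>"
proof -
  let ?us = "pw \<alpha> (pdeg f)"
  have Ks: "subring K L" by (rule subfieldE(1)[OF subfield_K])
  have M: "submod K (spn K ?us)" by (rule spn_submod[OF Ks pw_carrier[OF \<alpha>(1)]])
  have Es: "subring E\<alpha> L" by (rule subfieldE(1)[OF E\<alpha>_subfield])
  have "E\<alpha> = spn K ?us"
  proof
    show "spn K ?us \<subseteq> E\<alpha>"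
    proof (rule spn_minimal)
      show "submod K E\<alpha>" using subringE(1,2,6,7)[OF Es] K_E\<alpha> by (intro submodI) auto
      show "set ?us \<subseteq> E\<alpha>" using \<alpha>_R\<alpha> R\<alpha>_E\<alpha> pow_in_subring[OF Es] by (auto simp: set_pw)
    qed
    show "E\<alpha> \<subseteq> spn K ?us"
    proof
      fix z assume "z \<in> E\<alpha>"
      then obtain j :: nat where j: "z \<in> carrier L" "\<pi> [^] j \<otimes> z \<in> R\<alpha>" by (auto simp: E\<alpha>_def)
      have "R\<alpha> \<subseteq> spn K ?us" unfolding R\<alpha>_def
      proof (rule spn_minimal)
        show "submod A (spn K ?us)" using M A_sub_K by (auto simp: submod_def)
        show "set ?us \<subseteq> spn K ?us" using spn_mem[OF Ks pw_carrier[OF \<alpha>(1)]] by blast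
      qed
      then have 1: "\<pi> [^] j \<otimes> z \<in> spn K ?us" using j by blast
      have "\<pi> [^] j \<in> K - {\<zero>}" using pi_pow_A A_sub_K pi_pow_nz by blast
      then have i: "inv (\<pi> [^] j) \<in> K" "inv (\<pi> [^] j) \<otimes> \<pi> [^] j = \<one>"
        using subfield_m_inv[OF subfield_K] by auto
      have "inv (\<pi> [^] j) \<otimes> (\<pi> [^] j \<otimes> z) = z" using i K_car j(1) by (simp flip: m_assoc)
      then show "z \<in> spn K ?us" using submodD(4)[OF M i(1) 1] by simp
    qed
  qed
  then show ?thesis using Span_finite_dimension[OF subfield_K pw_carrier[OF \<alpha>(1)]] by (simp add: Span_eq_spn del: Span.simps)
qed

text \<open>Whatever is not a multiple of \<open>p\<close> is a unit, so an ideal that contains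
  \<open>p\<close> and more is the whole ring.\<close>

lemma R\<alpha>_maximalideal:
  "maximalideal (PIdl\<^bsub>L\<lparr>carrier := R\<alpha>\<rparr>\<^esub> (add_pow (L\<lparr>carrier := R\<alpha>\<rparr>) p \<one>)) (L\<lparr>carrier := R\<alpha>\<rparr>)"
proof -
  note B = fin_alg_R\<alpha>
  let ?S = "L\<lparr>carrier := R\<alpha>\<rparr>"
  interpret S: cring ?S by (rule sub_cring[OF B_subring[OF B]])
  have pi: "add_pow ?S p \<one> = \<pi>" using S.iz_of_nat[of p] iz_sub[OF B_subring[OF B]] by simp
  let ?I = "PIdl\<^bsub>?S\<^esub> \<pi>"
  have I: "?I = {w \<otimes> \<pi> | w. w \<in> R\<alpha>}" by (simp add: cgenideal_def)
  have "ideal ?I ?S" by (rule S.cgenideal_ideal) (simp add: pi_B[OF B])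
  moreover have "carrier ?S \<noteq> ?I"
  proof
    assume "carrier ?S = ?I"
    then have "\<one> \<in> ?I" using B_closed(2)[OF B] by auto
    then obtain w where "w \<in> R\<alpha>" "\<one> = w \<otimes> \<pi>" unfolding I by blast
    then show False using pi_not_unit_IL[of w] B_IL[OF B] B_car[OF B] by (simp add: m_comm)
  qed
  moreover have "J = ?I \<or> J = carrier ?S" if J: "ideal J ?S" "?I \<subseteq> J" for J
  proof (rule disjCI)
    assume "J \<noteq> carrier ?S"
    interpret J: ideal J ?S by (rule J(1))
    have "\<one>\<^bsub>?S\<^esub> \<notin> J" using J.one_imp_carrier \<open>J \<noteq> carrier ?S\<close> by blast
    then have n1: "\<one> \<notin> J" by simp
    have "J \<subseteq> ?I"
    proof
      fix y assume y: "y \<in> J"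
      have yR: "y \<in> R\<alpha>" using J.a_subset y by auto
      have "\<not> (\<exists>s\<in>R\<alpha>. y \<otimes> s = \<one>)" 
      proof
        assume "\<exists>s\<in>R\<alpha>. y \<otimes> s = \<one>"
        then obtain s where "s \<in> R\<alpha>" "y \<otimes> s = \<one>" by blast
        then show False using J.I_r_closed[OF y, of s] n1 by simp
      qed
      then obtain w where "w \<in> R\<alpha>" "y = \<pi> \<otimes> w" using R\<alpha>_unit_or_pi_multiple[OF yR] by blast
      then show "y \<in> ?I" unfolding I using B_car[OF B] by (auto simp: m_comm)
    qed
    then show "J = ?I" using J(2) by blast
  qed
  ultimately show ?thesis unfolding pi by (intro maximalidealI)
qed

end

end

section \<open>Roots modulo prime powers\<close>

primrec (in cring) linear_prod :: "'a list \<Rightarrow> 'a \<Rightarrow> 'a" where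
  "linear_prod [] y = \<one>"
| "linear_prod (a # as) y = (y \<ominus> a) \<otimes> linear_prod as y"

context cring
begin

lemma linear_prod_closed: "set as \<subseteq> carrier R \<Longrightarrow> y \<in> carrier R \<Longrightarrow> linear_prod as y \<in> carrier R"
  by (induction as) auto

lemma linear_prod_remove:
  "set (xs @ a # ys) \<subseteq> carrier R \<Longrightarrow> y \<in> carrier R \<Longrightarrow> linear_prod (xs @ a # ys) y = (y \<ominus> a) \<otimes> linear_prod (xs @ ys) y"
  by (induction xs) (simp_all add: m_lcomm linear_prod_closed)

lemma linear_prod_root: "set as \<subseteq> carrier R \<Longrightarrow> a \<in> set as \<Longrightarrow> linear_prod as a = \<zero>"
  by (induction as) (auto simp: linear_prod_closed a_minus_def r_neg)

end

text \<open>The crux is the number of roots in the quotient. The zeros of \<open>f\<close> in the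
  ring have unit differences, so they stay distinct modulo \<open>p^r\<close>; and a product of
  linear factors can lie in the ideal only if one factor does, so no further roots appear.\<close>

lemma (in local_cring) root_model_Quot:
  assumes p: "Factorial_Ring.prime p" and r: "r \<ge> 1"
    and p_nonunit: "iz (int p) \<notin> Units R"
    and p_cancel: "\<And>x. x \<in> carrier R \<Longrightarrow> iz (int p) \<otimes> x = \<zero> \<Longrightarrow> x = \<zero>"
    and f: "monic f" "pdeg f \<ge> 1" "\<not> int p dvd discriminant f"
    and as: "set as \<subseteq> carrier R" "length as = pdeg f" "\<And>y. y \<in> carrier R \<Longrightarrow> ev f y = linear_prod as y"
  shows "root_model (R Quot (PIdl (iz (int p ^ r)))) p r f"
proof -
  let ?\<pi> = "iz (int p)"
  define I where "I = PIdl (iz (int p ^ r))"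
  have I: "ideal I R" unfolding I_def by (rule cgenideal_ideal) simp
  interpret I: ideal I R by (rule I)
  define Q where "Q = R Quot I"
  interpret Q: cring Q unfolding Q_def by (rule I.quotient_is_cring[OF is_cring])
  define h where "h = (+>) I"
  have hom: "h \<in> Ring.ring_hom R Q" unfolding h_def Q_def by (rule I.rcos_ring_hom)
  have hc: "h x \<in> carrier Q" if "x \<in> carrier R" for x by (rule Ring.ring_hom_closed[OF hom that])
  have hm: "h (x \<otimes> y) = h x \<otimes>\<^bsub>Q\<^esub> h y" if "x \<in> carrier R" "y \<in> carrier R" for x y by (rule Ring.ring_hom_mult[OF hom that])
  have h1: "h \<one> = \<one>\<^bsub>Q\<^esub>" by (rule Ring.ring_hom_one[OF hom])
  have ha: "h (x \<oplus> y) = h x \<oplus>\<^bsub>Q\<^esub> h y" if "x \<in> carrier R" "y \<in> carrier R" for x y by (rule Ring.ring_hom_add[OF hom that])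
  have h0: "h \<zero> = \<zero>\<^bsub>Q\<^esub>" by (rule Ring.ring_hom_zero[OF hom ring_axioms Q.ring_axioms])
  have heq: "h x = h y \<longleftrightarrow> x \<ominus> y \<in> I" if "x \<in> carrier R" "y \<in> carrier R" for x y
    unfolding h_def using quotient_eq_iff_same_a_r_cos[OF I that] by simp
  have h0_iff: "h x = \<zero>\<^bsub>Q\<^esub> \<longleftrightarrow> x \<in> I" if "x \<in> carrier R" for x
    using heq[OF that zero_closed] that by (simp add: h0 a_minus_def)
  have Q_carrier: "carrier Q = h ` carrier R"
    unfolding Q_def h_def FactRing_def A_RCOSETS_def' by auto
  have I_iff: "x \<in> I \<longleftrightarrow> (\<exists>w\<in>carrier R. x = iz (int p ^ r) \<otimes> w)" for x
    unfolding I_def cgenideal_def by (auto simp: m_comm)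
  have pm: "?\<pi> \<otimes> w \<notin> Units R" if "w \<in> carrier R" for w using unit_factorD[of ?\<pi> w] that p_nonunit by auto
  have pr: "int p ^ r = int p * int p ^ (r - 1)" using r by (cases r) auto
  have I_nonunit: "x \<notin> Units R" if x: "x \<in> I" for x
  proof -
    obtain w where w: "w \<in> carrier R" "x = iz (int p ^ r) \<otimes> w" using x I_iff by blast
    have "x = ?\<pi> \<otimes> (iz (int p ^ (r - 1)) \<otimes> w)" unfolding w(2) pr iz_mult using w(1) by (simp add: m_assoc)
    then show ?thesis using pm w(1) by simp
  qed
  note iz_unit = prime_nondvd_unit[OF p p_nonunit]
  have root: "ev f a = \<zero>" if "a \<in> set as" for a
    using that as(1,3) linear_prod_root[OF as(1)] by auto
  have deriv: "ev (pderiv f) a \<in> Units R" if "a \<in> set as" for a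
    using separable_root_pderiv_unit[OF p p_nonunit f _ root[OF that]] as(1) that by blast
  have dist: "distinct as"
  proof (rule ccontr)
    assume "\<not> distinct as"
    then obtain xs ys zs a where d: "as = xs @ [a] @ ys @ [a] @ zs" using not_distinct_decomp by blast
    have ac: "a \<in> carrier R" and aa: "a \<in> set as" using as(1) d by auto
    \<comment> \<open>Were \<open>a\<close> a repeated factor, \<open>f(a + p)\<close> would be
      divisible by \<open>p^2\<close>, while Taylor's formula gives \<open>p f'(a)\<close> modulo
      \<open>p^2\<close>. After cancelling \<open>p\<close>, the unit \<open>f'(a)\<close> would be
      a multiple of \<open>p\<close>.\<close>
    define y where "y = a \<oplus> ?\<pi>"
    have yc: "y \<in> carrier R" using ac by (simp add: y_def)
    define g where "g = linear_prod (xs @ ys @ zs) y"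
    have gc: "g \<in> carrier R" unfolding g_def using as(1) d yc by (intro linear_prod_closed) auto
    have ya: "y \<ominus> a = ?\<pi>" unfolding y_def using ac iz_closed[of "int p"] by algebra
    have "linear_prod as y = (y \<ominus> a) \<otimes> linear_prod (xs @ ys @ a # zs) y"
      using linear_prod_remove[of xs a "ys @ a # zs" y] as(1) yc unfolding d by simp
    also have "linear_prod (xs @ ys @ a # zs) y = (y \<ominus> a) \<otimes> g"
      using linear_prod_remove[of "xs @ ys" a zs y] as(1) yc unfolding d g_def by simp
    finally have e1: "ev f y = ?\<pi> \<otimes> (?\<pi> \<otimes> g)" unfolding ya using as(3)[OF yc] by simp
    obtain w where w: "w \<in> carrier R" "ev f y = ?\<pi> \<otimes> ev (pderiv f) a \<oplus> ?\<pi> \<otimes> ?\<pi> \<otimes> w"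
      using ev_taylor[OF ac iz_closed[of "int p"], of f] root[OF aa] ac by (auto simp: y_def)
    define D where "D = ev (pderiv f) a"
    have Dc: "D \<in> carrier R" using ac by (simp add: D_def)
    have "?\<pi> \<otimes> (D \<ominus> ?\<pi> \<otimes> (g \<ominus> w)) = (?\<pi> \<otimes> D \<oplus> ?\<pi> \<otimes> ?\<pi> \<otimes> w) \<ominus> ?\<pi> \<otimes> (?\<pi> \<otimes> g)"
      using Dc w(1) gc iz_closed[of "int p"] by algebra
    also have "\<dots> = \<zero>" unfolding D_def w(2)[symmetric] e1 using gc by (simp add: a_minus_def r_neg)
    finally have "D \<ominus> ?\<pi> \<otimes> (g \<ominus> w) = \<zero>" by (rule p_cancel[rotated]) (use Dc w(1) gc in auto)
    then have "D = ?\<pi> \<otimes> (g \<ominus> w)" using Dc w(1) gc by (simp add: r_right_minus_eq)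
    then show False using deriv[OF aa] pm[of "g \<ominus> w"] w(1) gc by (simp add: D_def)
  qed
  have diff: "b \<ominus> a \<in> Units R" if a: "a \<in> set as" and b: "b \<in> set as" and ne: "a \<noteq> b" for a b
    using root_diff_unit[OF _ root[OF a] deriv[OF a] _ root[OF b] ne] as(1) a b by blast
  have near: "\<exists>a\<in>set bs. y \<ominus> a \<in> I" if "linear_prod bs y \<in> I" "set bs \<subseteq> set as" "distinct bs" and y: "y \<in> carrier R" for bs y
    using that(1-3)
  proof (induction bs)
    case Nil then show ?case using I_nonunit[of \<one>] by simp
  next
    case (Cons a bs)
    have c: "a \<in> carrier R" "set bs \<subseteq> carrier R" using Cons.prems as(1) by auto
    define P where "P = linear_prod bs y"
    have Pc: "P \<in> carrier R" unfolding P_def using linear_prod_closed[OF c(2) y] .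
    have m: "(y \<ominus> a) \<otimes> P \<in> I" using Cons.prems by (simp add: P_def)
    have ya: "y \<ominus> a \<in> carrier R" using y c by simp
    \<comment> \<open>A unit \<open>y - a\<close> is cancelled and the rest is left to the
      induction. Otherwise \<open>y - b = (a - b) + (y - a)\<close> is a unit for each other root
      \<open>b\<close>, the remaining product is a unit, and \<open>y - a\<close> itself lies in
      \<open>I\<close>.\<close>
    show ?case
    proof (cases "y \<ominus> a \<in> Units R")
      case True
      have "inv (y \<ominus> a) \<otimes> ((y \<ominus> a) \<otimes> P) \<in> I" using I.I_l_closed[OF m] True by simp
      then have "P \<in> I" using True Pc ya by (simp flip: m_assoc)
      then show ?thesis using Cons by (auto simp: P_def)
    next
      case False
      have u: "y \<ominus> b \<in> Units R" if b: "b \<in> set bs" for b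
      proof -
        have bc: "b \<in> carrier R" using b c by blast
        have "a \<ominus> b \<in> Units R" using diff[of b a] b Cons.prems by auto
        then have "(a \<ominus> b) \<oplus> (y \<ominus> a) \<in> Units R" by (rule unit_addI[OF _ ya False])
        moreover have "(a \<ominus> b) \<oplus> (y \<ominus> a) = y \<ominus> b" using c(1) bc y by algebra
        ultimately show ?thesis by simp
      qed
      have "linear_prod cs y \<in> Units R" if "set cs \<subseteq> set bs" for cs using that
        by (induction cs) (auto simp: u)
      then have "P \<in> Units R" by (simp add: P_def)
      then have "((y \<ominus> a) \<otimes> P) \<otimes> inv P \<in> I" using I.I_r_closed[OF m] by simp
      then have "y \<ominus> a \<in> I" using \<open>P \<in> Units R\<close> Pc ya by (simp add: m_assoc)
      then show ?thesis by simp
    qed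
  qed
  have hev: "Q.ev f (h x) = h (ev f x)" if "x \<in> carrier R" for x using ring_hom_ev[OF Q.is_cring hom that, of f] by simp
  have roots: "{x \<in> carrier Q. Q.ev f x = \<zero>\<^bsub>Q\<^esub>} = h ` set as"
  proof (intro equalityI subsetI)
    fix x assume "x \<in> {x \<in> carrier Q. Q.ev f x = \<zero>\<^bsub>Q\<^esub>}"
    then obtain y where y: "y \<in> carrier R" "x = h y" "Q.ev f (h y) = \<zero>\<^bsub>Q\<^esub>" unfolding Q_carrier by blast
    then have "linear_prod as y \<in> I" using hev[OF y(1)] h0_iff[OF ev_closed[OF y(1)], of f] as(3)[OF y(1)] by simp
    then obtain a where a: "a \<in> set as" "y \<ominus> a \<in> I" using near[OF _ order_refl dist y(1)] by blast
    then show "x \<in> h ` set as" using heq[OF y(1), of a] as(1) y(2) by blast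
  next
    fix x assume "x \<in> h ` set as"
    then obtain a where a: "a \<in> set as" "x = h a" by blast
    then show "x \<in> {x \<in> carrier Q. Q.ev f x = \<zero>\<^bsub>Q\<^esub>}" using hev[of a] root[OF a(1)] as(1) h0 hc by auto
  qed
  have inj: "inj_on h (set as)"
  proof (rule inj_onI)
    fix a b assume *: "a \<in> set as" "b \<in> set as" "h a = h b"
    then have "a \<ominus> b \<in> I" using heq as(1) by blast
    then show "a = b" using diff[of b a] * I_nonunit by blast
  qed
  have hu: "h u \<in> Units Q" if "u \<in> Units R" for u
  proof -
    have c: "u \<in> carrier R" "inv u \<in> carrier R" using that by auto
    have "h (inv u) \<otimes>\<^bsub>Q\<^esub> h u = \<one>\<^bsub>Q\<^esub>" using hm[OF c(2,1)] that h1 by simp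
    moreover have "h u \<otimes>\<^bsub>Q\<^esub> h (inv u) = \<one>\<^bsub>Q\<^esub>" using hm[OF c] that h1 by simp
    ultimately show ?thesis using hc[OF c(1)] hc[OF c(2)] unfolding Units_def by blast
  qed
  have "root_model Q p r f"
  proof (unfold_locales)
    show "\<one>\<^bsub>Q\<^esub> \<noteq> \<zero>\<^bsub>Q\<^esub>" using h0_iff[OF one_closed] I_nonunit[of \<one>] h1 by auto
    show "x \<in> Units Q \<or> \<one>\<^bsub>Q\<^esub> \<ominus>\<^bsub>Q\<^esub> x \<in> Units Q" if x: "x \<in> carrier Q" for x
    proof -
      obtain y where y: "y \<in> carrier R" "x = h y" using x Q_carrier by blast
      have "\<one>\<^bsub>Q\<^esub> = h (\<one> \<ominus> y) \<oplus>\<^bsub>Q\<^esub> h y"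
      proof -
        have "(\<one> \<ominus> y) \<oplus> y = \<one>" using y(1) by algebra
        then show ?thesis using ha[of "\<one> \<ominus> y" y] y(1) h1 by simp
      qed
      moreover have "h (\<one> \<ominus> y) \<oplus>\<^bsub>Q\<^esub> h y \<ominus>\<^bsub>Q\<^esub> h y = h (\<one> \<ominus> y)"
        using hc[of "\<one> \<ominus> y"] hc[OF y(1)] y(1) by (simp add: a_minus_def Q.a_assoc Q.r_neg)
      ultimately have "\<one>\<^bsub>Q\<^esub> \<ominus>\<^bsub>Q\<^esub> x = h (\<one> \<ominus> y)" using y(2) by simp
      then show ?thesis using local[OF y(1)] hu y(2) by auto
    qed
    show "Factorial_Ring.prime p" "1 \<le> r" "monic f" "1 \<le> pdeg f" "\<not> int p dvd discriminant f" by (fact p r f)+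
    show "card {x \<in> carrier Q. Q.ev f x = \<zero>\<^bsub>Q\<^esub>} = pdeg f"
      unfolding roots using card_image[OF inj] distinct_card[OF dist] as(2) by simp
    fix k
    have "Q.iz k = h (iz k)" using ring_hom_iz[OF Q.is_cring hom, of k] by simp
    then have "Q.iz k = \<zero>\<^bsub>Q\<^esub> \<longleftrightarrow> iz k \<in> I" using h0_iff by simp
    also have "\<dots> \<longleftrightarrow> int p ^ r dvd k"
    proof
      assume "int p ^ r dvd k"
      then obtain c where "k = int p ^ r * c" by (elim dvdE)
      then show "iz k \<in> I" unfolding I_iff by (intro bexI[of _ "iz c"]) (simp_all add: iz_mult)
    next
      assume kI: "iz k \<in> I"
      show "int p ^ r dvd k"
      proof (rule ccontr)
        assume n: "\<not> int p ^ r dvd k"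
        then have "k \<noteq> 0" by auto
        moreover have "\<not> is_unit (int p)" using prime_gt_1_nat[OF p] by simp
        ultimately obtain c where c: "k = int p ^ multiplicity (int p) k * c" "\<not> int p dvd c"
          using multiplicity_decompose' by blast
        \<comment> \<open>For \<open>k = p^e c\<close> with \<open>c\<close> prime to
          \<open>p\<close> and \<open>e < r\<close>, cancelling \<open>p^e\<close> would make the
          unit \<open>iz c\<close> a multiple of \<open>p\<close>.\<close>
        define e where "e = multiplicity (int p) k"
        have "e < r" using n c(1) unfolding e_def[symmetric] by (metis dvd_triv_left le_imp_power_dvd dvd_trans not_le_imp_less)
        then obtain j where j: "r = e + Suc j" using less_iff_Suc_add[of e r] by auto
        obtain w where w: "w \<in> carrier R" "iz k = iz (int p ^ r) \<otimes> w" using kI I_iff by blast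
        have cancel: "x = \<zero>" if "x \<in> carrier R" "iz (int p ^ i) \<otimes> x = \<zero>" for x i
          using that
        proof (induction i)
          case (Suc i)
          have "?\<pi> \<otimes> (iz (int p ^ i) \<otimes> x) = \<zero>" using Suc.prems by (simp add: iz_mult m_assoc)
          then have "iz (int p ^ i) \<otimes> x = \<zero>" using p_cancel Suc.prems(1) by simp
          then show ?case using Suc by simp
        qed simp
        define v where "v = ?\<pi> \<otimes> (iz (int p ^ j) \<otimes> w)"
        have vc: "v \<in> carrier R" using w(1) by (simp add: v_def)
        have "iz k = iz (int p ^ e) \<otimes> iz c" using c(1) unfolding e_def[symmetric] by (metis iz_mult)
        moreover have "iz k = iz (int p ^ e) \<otimes> v" unfolding w(2) j v_def power_add power_Suc iz_mult using w(1) by (simp add: m_assoc)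
        ultimately have "iz (int p ^ e) \<otimes> (iz c \<ominus> v) = \<zero>" using vc by (simp add: r_minus a_minus_def r_distr r_neg)
        then have "iz c \<ominus> v = \<zero>" by (rule cancel[rotated]) (simp add: vc)
        then have "iz c = v" using vc by (simp add: r_right_minus_eq)
        then show False using iz_unit[OF c(2)] pm[of "iz (int p ^ j) \<otimes> w"] w(1) by (simp add: v_def)
      qed
    qed
    finally show "Q.iz k = \<zero>\<^bsub>Q\<^esub> \<longleftrightarrow> int p ^ r dvd k" .
  qed
  then show ?thesis by (simp add: Q_def I_def)
qed

section \<open>Roots in the maximal unramified extension\<close>

lemma (in cring) hor_snoc:
  "set p \<subseteq> carrier R \<Longrightarrow> a \<in> carrier R \<Longrightarrow> x \<in> carrier R \<Longrightarrow> hor (p @ [a]) x = hor p x \<oplus> a \<otimes> x [^] length p"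
proof (induction p)
  case (Cons b p)
  define h P0 where "h = hor p x" and "P0 = x [^] length p"
  have c: "b \<in> carrier R" "h \<in> carrier R" "P0 \<in> carrier R" using Cons.prems by (auto simp: h_def P0_def)
  have "hor ((b # p) @ [a]) x = b \<oplus> x \<otimes> (h \<oplus> a \<otimes> P0)" using Cons by (simp add: h_def P0_def)
  also have "\<dots> = (b \<oplus> x \<otimes> h) \<oplus> a \<otimes> (P0 \<otimes> x)" using c Cons.prems by algebra
  finally show ?case by (simp add: h_def P0_def)
qed simp

text \<open>\<open>eval\<close> reads a coefficient list from the leading term, \<open>hor\<close>
  from the constant term.\<close>

lemma (in cring) eval_eq_hor: "set p \<subseteq> carrier R \<Longrightarrow> x \<in> carrier R \<Longrightarrow> eval p x = hor (rev p) x"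
proof (induction p)
  case (Cons a p)
  then have "hor (rev (a # p)) x = hor (rev p) x \<oplus> a \<otimes> x [^] length p" using hor_snoc[of "rev p" a x] by simp
  then show ?case using Cons by (simp add: a_comm)
qed simp

lemma (in cring) last_horner_quotient: "set p \<subseteq> carrier R \<Longrightarrow> x \<in> carrier R \<Longrightarrow> length p \<ge> 2 \<Longrightarrow> last (horner_quotient p x) = last p"
proof (induction p)
  case (Cons a p)
  show ?case
  proof (cases "length p \<ge> 2")
    case True
    then have "horner_quotient p x \<noteq> []" using length_horner_quotient[of p x] by auto
    then show ?thesis using Cons True by auto
  next
    case False
    then obtain b where "p = [b]" using Cons.prems(3) by (cases p) (auto simp: Suc_le_eq)
    then show ?thesis using Cons.prems by simp
  qed
qed simp

text \<open>Horner division by a root leaves a monic list that is one shorter. The zeros form a list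
  and not a set, since at this stage they may repeat.\<close>

lemma (in algebraically_closed) monic_linear_prod:
  "set p \<subseteq> carrier L \<Longrightarrow> length p = Suc n \<Longrightarrow> last p = \<one> \<Longrightarrow>
    \<exists>as. set as \<subseteq> carrier L \<and> length as = n \<and> (\<forall>y\<in>carrier L. hor p y = linear_prod as y)"
proof (induction n arbitrary: p)
  case 0
  then have "p = [\<one>]" by (cases p) auto
  then show ?case by (intro exI[of _ "[]"]) simp
next
  case (Suc n)
  have ne: "p \<noteq> []" using Suc.prems by auto
  have "polynomial (carrier L) (rev p)"
    unfolding polynomial_def using Suc.prems ne by (simp add: hd_rev)
  then have P: "rev p \<in> carrier (poly_ring L)" by (simp add: univ_poly_carrier)
  have "size (roots (rev p)) = Suc n" using roots_over_carrier[OF P] Suc.prems(2) by (simp add: splitted_def)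
  then obtain a where "a \<in># roots (rev p)" by (metis size_eq_Suc_imp_elem)
  then have a: "a \<in> carrier L" "eval (rev p) a = \<zero>" using roots_mem_iff_is_root[OF P] by (auto simp: is_root_def)
  have pa: "hor p a = \<zero>" using eval_eq_hor[of "rev p" a] Suc.prems(1) a by simp
  define q where "q = horner_quotient p a"
  have q: "set q \<subseteq> carrier L" "length q = Suc n" "last q = \<one>"
    using set_horner_quotient[OF Suc.prems(1) a(1)] length_horner_quotient[of p a] last_horner_quotient[OF Suc.prems(1) a(1)] Suc.prems(2,3)
    by (auto simp: q_def)
  then obtain as where as: "set as \<subseteq> carrier L" "length as = n" "\<forall>y\<in>carrier L. hor q y = linear_prod as y" using Suc.IH by blast
  have "hor p y = linear_prod (a # as) y" if y: "y \<in> carrier L" for y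
    using hor_quotient[OF Suc.prems(1) a(1) y] pa as(3) y a(1) linear_prod_closed[OF as(1) y] by (simp add: q_def)
  then show ?case using as a(1) by (intro exI[of _ "a # as"]) simp
qed

lemma (in algebraically_closed) int_poly_linear_prod:
  assumes f: "monic f"
  shows "\<exists>as. set as \<subseteq> carrier L \<and> length as = pdeg f \<and> (\<forall>y\<in>carrier L. ev f y = linear_prod as y)"
proof -
  have f0: "f \<noteq> 0" using f by auto
  have "last (map iz (coeffs f)) = iz (last (coeffs f))" using f0 by (simp add: last_map)
  then have "last (map iz (coeffs f)) = \<one>" using f f0 by (simp add: last_coeffs_eq_coeff_degree)
  moreover have "length (map iz (coeffs f)) = Suc (pdeg f)" using f0 by (simp add: length_coeffs_degree)
  ultimately show ?thesis using monic_linear_prod[of "map iz (coeffs f)" "pdeg f"] by (simp add: ev_hor image_subset_iff)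
qed

context padic_ext
begin

text \<open>A monic equation says that \<open>x^m\<close> is minus the value of a coefficient list
  of length \<open>m\<close>. This ties the integers of the statement to the span criterion.\<close>

lemma integral_over_iff_intg:
  assumes x: "x \<in> carrier L" shows "integral_over L A x \<longleftrightarrow> intg A x"
proof
  note M = spn_submod[OF subring_A pw_carrier[OF x]]
  assume "integral_over L A x"
  then obtain P where P: "P \<in> carrier (A[X])" "P \<noteq> []" "hd P = \<one>" "eval P x = \<zero>" by (auto simp: integral_over_def)
  then obtain q where q: "P = \<one> # q" by (cases P) auto
  have "set q \<subseteq> A" using P(1) q by (simp add: univ_poly_carrier[symmetric] polynomial_def)
  then have e: "eval q x \<in> spn A (pw x (length q))" using spn_eval_iff[OF subring_A x] by blast
  have ec: "eval q x \<in> carrier L" using e submodD(1)[OF M] by blast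
  have "x [^] length q \<oplus> eval q x = \<zero>" using P(4) q x by simp
  then have "x [^] length q = \<zero> \<ominus> eval q x" using x ec by (simp add: a_minus_def minus_equality)
  then have "x [^] length q \<in> spn A (pw x (length q))" using submod_diff[OF subring_A M submodD(2)[OF M] e] by simp
  then show "intg A x" using x by (auto simp: intg_def)
next
  note M = spn_submod[OF subring_A pw_carrier[OF x]]
  assume "intg A x"
  then obtain m where m: "x [^] m \<in> spn A (pw x m)" by (auto simp: intg_def)
  have "\<zero> \<ominus> x [^] m \<in> spn A (pw x m)" by (rule submod_diff[OF subring_A M submodD(2)[OF M] m])
  then obtain q where q: "set q \<subseteq> A" "length q = m" "\<zero> \<ominus> x [^] m = eval q x" using spn_eval_iff[OF subring_A x] by blast
  have "\<one> # q \<in> carrier (A[X])" using q(1) subringE(3)[OF subring_A] by (simp add: univ_poly_carrier[symmetric] polynomial_def)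
  moreover have "eval (\<one> # q) x = \<zero>" using q x by (simp flip: q(3)) (simp add: a_minus_def r_neg)
  ultimately show "integral_over L A x" unfolding integral_over_def by (intro bexI[of _ "\<one> # q"]) auto
qed

lemma sub_linear_prod:
  assumes B: "subring B L" and as: "set as \<subseteq> B" and y: "y \<in> B"
  shows "cring.linear_prod (L\<lparr>carrier := B\<rparr>) as y = linear_prod as y"
proof -
  interpret S: cring "L\<lparr>carrier := B\<rparr>" by (rule sub_cring[OF B])
  have m: "y \<ominus>\<^bsub>L\<lparr>carrier := B\<rparr>\<^esub> a = y \<ominus> a" if a: "a \<in> B" for a
  proof -
    define z where "z = y \<ominus>\<^bsub>L\<lparr>carrier := B\<rparr>\<^esub> a"
    have zB: "z \<in> B" using S.minus_closed[of y a] y a by (simp add: z_def)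
    have "z \<oplus>\<^bsub>L\<lparr>carrier := B\<rparr>\<^esub> a = y" unfolding z_def a_minus_def using y a S.a_assoc[of y "\<ominus>\<^bsub>L\<lparr>carrier := B\<rparr>\<^esub> a" a] S.l_neg[of a] S.r_zero[of y] S.a_inv_closed[of a] by simp
    then have "z \<oplus> a = y" by simp
    moreover have c: "z \<in> carrier L" "a \<in> carrier L" using zB a A_carrier[OF B] by auto
    moreover have "z = (z \<oplus> a) \<ominus> a" using c by algebra
    ultimately have "z = y \<ominus> a" by simp
    then show ?thesis by (simp add: z_def)
  qed
  show ?thesis using as by (induction as) (auto simp: m)
qed

text \<open>Locality passes from the integral closure in \<open>L\<close> to its intersection with a
  subfield \<open>U\<close>, because an integral inverse of an element of \<open>U\<close> is its
  inverse in \<open>U\<close>. The roots of the monic \<open>f\<close> are integral, so those in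
  \<open>U\<close> lie in this ring.\<close>

lemma root_model_sub_integers:
  assumes U: "subfield U L" and r: "r \<ge> 1" and f: "monic f" "pdeg f \<ge> 1" "\<not> int p dvd discriminant f"
    and as: "set as \<subseteq> U" "length as = pdeg f" "\<And>y. y \<in> carrier L \<Longrightarrow> ev f y = linear_prod as y"
    and S: "S = L\<lparr>carrier := U \<inter> IL\<rparr>"
  shows "root_model (S Quot (PIdl\<^bsub>S\<^esub> (add_pow S (p ^ r) \<one>\<^bsub>S\<^esub>))) p r f"
proof -
  let ?O = "U \<inter> IL"
  have O: "subring ?O L" by (rule subring_inter[OF subfieldE(1)[OF U] IL_subring])
  interpret S: cring S unfolding S by (rule sub_cring[OF O])
  have inv_O: "s \<in> ?O" if "y \<in> ?O" "s \<in> IL" "y \<otimes> s = \<one>" for y s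
  proof -
    have c: "y \<in> carrier L" "s \<in> carrier L" using that IL_carrier by auto
    have "y \<noteq> \<zero>" using that(3) c by auto
    then have "inv y \<in> U" using subfield_m_inv(1)[OF U, of y] that(1) by blast
    moreover have "inv y = s" by (rule comm_inv_char[OF c that(3)])
    ultimately show ?thesis using that(2) by simp
  qed
  have unit: "y \<in> Units S" if y: "y \<in> ?O" and inv: "\<exists>s\<in>IL. y \<otimes> s = \<one>" for y
  proof -
    obtain s where s: "s \<in> IL" "y \<otimes> s = \<one>" using inv by blast
    have "s \<in> ?O" by (rule inv_O[OF y s])
    moreover have "s \<otimes> y = \<one>" using s y IL_carrier m_comm[of s y] by auto
    ultimately show ?thesis using y s by (auto simp: Units_def S)
  qed
  interpret S: local_cring S
  proof
    show "\<one>\<^bsub>S\<^esub> \<noteq> \<zero>\<^bsub>S\<^esub>" by (simp add: S)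
    fix x assume "x \<in> carrier S"
    then have x: "x \<in> ?O" by (simp add: S)
    have xc: "x \<in> carrier L" using x IL_carrier by blast
    have m: "\<one>\<^bsub>S\<^esub> \<ominus>\<^bsub>S\<^esub> x = \<one> \<ominus> x"
    proof -
      define z where "z = \<one>\<^bsub>S\<^esub> \<ominus>\<^bsub>S\<^esub> x"
      have xS: "x \<in> carrier S" using x by (simp add: S)
      have z: "z \<in> carrier S" unfolding z_def using xS by simp
      have "z \<oplus>\<^bsub>S\<^esub> x = \<one>\<^bsub>S\<^esub>" unfolding z_def a_minus_def using xS by (simp add: S.a_assoc S.l_neg)
      then have "z \<oplus> x = \<one>" by (simp add: S)
      moreover have zc: "z \<in> carrier L" using z IL_carrier by (simp add: S)
      moreover have "z = (z \<oplus> x) \<ominus> x" using zc xc by algebra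
      ultimately have "z = \<one> \<ominus> x" by simp
      then show ?thesis by (simp add: z_def)
    qed
    have mO: "\<one> \<ominus> x \<in> ?O" unfolding a_minus_def using x subringE(3,5,7)[OF O] by blast
    show "x \<in> Units S \<or> \<one>\<^bsub>S\<^esub> \<ominus>\<^bsub>S\<^esub> x \<in> Units S"
      unfolding m using IL_local[of x] unit[OF x] unit[OF mO] x by blast
  qed
  have iz: "S.iz k = iz k" for k unfolding S by (rule iz_sub[OF O])
  have pO: "\<pi> \<in> ?O" by (rule iz_in_subring[OF O])
  have asI: "set as \<subseteq> ?O"
  proof
    fix a assume a: "a \<in> set as"
    have sc: "set as \<subseteq> carrier L" using as(1) subringE(1)[OF subfieldE(1)[OF U]] by blast
    then have "ev f a = \<zero>" using as(3)[of a] linear_prod_root[OF sc a] a by auto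
    then show "a \<in> ?O" using monic_root_IL[OF _ f(1)] a sc as(1) by auto
  qed
  have "root_model (S Quot (PIdl\<^bsub>S\<^esub> (S.iz (int p ^ r)))) p r f"
  proof (rule S.root_model_Quot[OF prime_p r _ _ f _ as(2)])
    show "S.iz (int p) \<notin> Units S"
    proof
      assume "S.iz (int p) \<in> Units S"
      then obtain w where "w \<in> ?O" "\<pi> \<otimes> w = \<one>" by (auto simp: Units_def S iz[unfolded S])
      then show False using pi_not_unit_IL by blast
    qed
    fix x assume x: "x \<in> carrier S"
    then have xO: "x \<in> ?O" by (simp add: S)
    have xc: "x \<in> carrier L" using xO IL_carrier by blast
    show "S.iz (int p) \<otimes>\<^bsub>S\<^esub> x = \<zero>\<^bsub>S\<^esub> \<Longrightarrow> x = \<zero>\<^bsub>S\<^esub>"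
      using pi_nz xc by (simp add: iz) (simp add: S integral_iff)
    show "S.ev f x = S.linear_prod as x"
      unfolding S ev_sub[OF O xO] sub_linear_prod[OF O asI xO] by (rule as(3)[OF xc])
  next
    show "set as \<subseteq> carrier S" using asI by (simp add: S)
  qed
  moreover have "add_pow S (p ^ r) \<one>\<^bsub>S\<^esub> = S.iz (int p ^ r)" using S.iz_of_nat[of "p ^ r"] by simp
  ultimately show ?thesis by simp
qed

end

context padic
begin

abbreviation "emb \<equiv> Q.indexed_const"

lemma alg_closure: "algebraic_closure (Qp_closure p) (Qp_emb p)"
  using Q.alg_closureE(1) by (simp add: Qp_closure_def Qp_emb_def)

lemma emb_hom: "emb \<in> Ring.ring_hom (Qp p) (Qp_closure p)"
  using Q.alg_closureE(2) by (simp add: Qp_closure_def)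

text \<open>The properties proved with Cauchy sequences are carried along the embedding. Its
  injectivity is needed where an equation in the closure has to be read back, as for the
  divisibility of integers by \<open>p^k\<close>.\<close>

lemma padic_ext_closure: "padic_ext (Qp_closure p) p (Zp_emb p) (Qp_emb p)"
proof -
  interpret L: algebraic_closure "Qp_closure p" "Qp_emb p" by (rule alg_closure)
  let ?L = "Qp_closure p"
  have j: "emb x \<in> carrier ?L" if "x \<in> carrier (Qp p)" for x by (rule Ring.ring_hom_closed[OF emb_hom that])
  have jm: "emb (x \<otimes>\<^bsub>Qp p\<^esub> y) = emb x \<otimes>\<^bsub>?L\<^esub> emb y" if "x \<in> carrier (Qp p)" "y \<in> carrier (Qp p)" for x y by (rule Ring.ring_hom_mult[OF emb_hom that])
  have ja: "emb (x \<oplus>\<^bsub>Qp p\<^esub> y) = emb x \<oplus>\<^bsub>?L\<^esub> emb y" if "x \<in> carrier (Qp p)" "y \<in> carrier (Qp p)" for x y by (rule Ring.ring_hom_add[OF emb_hom that])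
  have j1: "emb \<one>\<^bsub>Qp p\<^esub> = \<one>\<^bsub>?L\<^esub>" by (rule Ring.ring_hom_one[OF emb_hom])
  have j0: "emb \<zero>\<^bsub>Qp p\<^esub> = \<zero>\<^bsub>?L\<^esub>" by (rule Ring.ring_hom_zero[OF emb_hom Q.ring_axioms L.ring_axioms])
  have inj: "(emb x :: padic_alg) = emb y \<longleftrightarrow> x = y" for x y using Q.indexed_const_is_inj by (auto simp: inj_def)
  have ji: "emb (Q.iz m) = L.iz m" for m by (rule Q.ring_hom_iz[OF L.is_cring emb_hom])
  have jd: "emb (x \<ominus>\<^bsub>Qp p\<^esub> y) = emb x \<ominus>\<^bsub>?L\<^esub> emb y" if xy: "x \<in> carrier (Qp p)" "y \<in> carrier (Qp p)" for x y
  proof -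
    have "(x \<ominus>\<^bsub>Qp p\<^esub> y) \<oplus>\<^bsub>Qp p\<^esub> y = x" using xy by (simp add: a_minus_def Q.a_assoc Q.l_neg)
    then have "emb (x \<ominus>\<^bsub>Qp p\<^esub> y) \<oplus>\<^bsub>?L\<^esub> emb y = emb x" using ja[of "x \<ominus>\<^bsub>Qp p\<^esub> y" y] xy by simp
    then show ?thesis using j[of "x \<ominus>\<^bsub>Qp p\<^esub> y"] j[OF xy(2)] xy L.a_assoc L.r_neg by (metis Q.minus_closed L.a_inv_closed L.r_zero a_minus_def)
  qed
  have jp: "emb (ppi [^]\<^bsub>Qp p\<^esub> (k::nat)) = L.iz (int p) [^]\<^bsub>?L\<^esub> k" for k
    using ji[of "int p ^ k"] by (simp add: Q.iz_power L.iz_power)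
  have jv: "inv\<^bsub>?L\<^esub> (emb u) = emb (inv\<^bsub>Qp p\<^esub> u)" if u: "u \<in> carrier (Qp p)" "u \<noteq> \<zero>\<^bsub>Qp p\<^esub>" for u
  proof -
    have v: "inv\<^bsub>Qp p\<^esub> u \<in> carrier (Qp p)" "u \<otimes>\<^bsub>Qp p\<^esub> inv\<^bsub>Qp p\<^esub> u = \<one>\<^bsub>Qp p\<^esub>" using u Q.field_Units by auto
    show ?thesis using L.comm_inv_char[OF j[OF u(1)] j[OF v(1)]] jm[OF u(1) v(1)] v(2) j1 by simp
  qed
  have hr: "RingHom.ring_hom_ring (Qp p) ?L emb"
    by (rule ring_hom_ringI2[OF Q.ring_axioms L.ring_axioms emb_hom])
  show ?thesis
  proof (intro padic_ext.intro padic_ext_axioms.intro L.field_axioms)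
    show "Factorial_Ring.prime p" by (rule prime_p)
    show "subring (Zp_emb p) ?L" unfolding Zp_emb_def by (rule ring_hom_ring.img_is_subring[OF hr Zp_subring])
    show "subfield (Qp_emb p) ?L" by (rule L.subfield_axioms)
    show "Zp_emb p \<subseteq> Qp_emb p" unfolding Zp_emb_def Qp_emb_def using Zp_carrier by blast
    show "L.iz (int p) \<noteq> \<zero>\<^bsub>?L\<^esub>" using ppi_not_zero inj[of ppi "\<zero>\<^bsub>Qp p\<^esub>"] by (simp add: ji j0)
    show "(L.algebraic over Qp_emb p) x" if "x \<in> carrier ?L" for x by (rule L.algebraic_extension[OF that])
    show "L.iz (int p) \<otimes>\<^bsub>?L\<^esub> w \<noteq> \<one>\<^bsub>?L\<^esub>" if w: "w \<in> Zp_emb p" for w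
    proof -
      obtain w' where w': "w' \<in> Zp p" "w = emb w'" using w by (auto simp: Zp_emb_def)
      show ?thesis using ppi_inv_not_Zp[OF w'(1)] inj[of "ppi \<otimes>\<^bsub>Qp p\<^esub> w'" "\<one>\<^bsub>Qp p\<^esub>"] jm[of ppi w'] Zp_carrier[OF w'(1)]
        by (simp add: ji j1 w'(2))
    qed
    show "\<exists>k::nat. \<exists>u\<in>Zp_emb p. inv\<^bsub>?L\<^esub> u \<in> Zp_emb p \<and> u \<noteq> \<zero>\<^bsub>?L\<^esub> \<and>
        (z = L.iz (int p) [^]\<^bsub>?L\<^esub> k \<otimes>\<^bsub>?L\<^esub> u \<or> z \<otimes>\<^bsub>?L\<^esub> L.iz (int p) [^]\<^bsub>?L\<^esub> k = u)"
      if z: "z \<in> Qp_emb p" "z \<noteq> \<zero>\<^bsub>?L\<^esub>" for z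
    proof -
      obtain z' where z': "z' \<in> carrier (Qp p)" "z = emb z'" using z by (auto simp: Qp_emb_def)
      have "z' \<noteq> \<zero>\<^bsub>Qp p\<^esub>" using z(2) z'(2) j0 by auto
      then obtain k u where u: "u \<in> Zp p" "inv\<^bsub>Qp p\<^esub> u \<in> Zp p" "u \<noteq> \<zero>\<^bsub>Qp p\<^esub>"
        and *: "z' = ppi [^]\<^bsub>Qp p\<^esub> (k::nat) \<otimes>\<^bsub>Qp p\<^esub> u \<or> z' \<otimes>\<^bsub>Qp p\<^esub> ppi [^]\<^bsub>Qp p\<^esub> k = u"
        using Zp_unit_decomp[OF z'(1)] by blast
      have uc: "u \<in> carrier (Qp p)" by (rule Zp_carrier[OF u(1)])
      have "z = L.iz (int p) [^]\<^bsub>?L\<^esub> k \<otimes>\<^bsub>?L\<^esub> emb u \<or> z \<otimes>\<^bsub>?L\<^esub> L.iz (int p) [^]\<^bsub>?L\<^esub> k = emb u"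
        using * jm[of "ppi [^]\<^bsub>Qp p\<^esub> k" u] jm[OF z'(1), of "ppi [^]\<^bsub>Qp p\<^esub> k"] uc by (auto simp: z'(2) jp)
      moreover have "emb u \<in> Zp_emb p" "inv\<^bsub>?L\<^esub> (emb u) \<in> Zp_emb p" using u by (auto simp: Zp_emb_def jv[OF uc u(3)])
      moreover have "emb u \<noteq> \<zero>\<^bsub>?L\<^esub>" using u(3) inj j0 by metis
      ultimately show ?thesis by blast
    qed
    show "\<exists>m. \<exists>w\<in>Zp_emb p. z \<ominus>\<^bsub>?L\<^esub> L.iz m = L.iz (int p) \<otimes>\<^bsub>?L\<^esub> w" if z: "z \<in> Zp_emb p" for z
    proof -
      obtain z' where z': "z' \<in> Zp p" "z = emb z'" using z by (auto simp: Zp_emb_def)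
      obtain m w where w: "w \<in> Zp p" "z' \<ominus>\<^bsub>Qp p\<^esub> Q.iz m = ppi \<otimes>\<^bsub>Qp p\<^esub> w" using Zp_residue[OF z'(1)] by blast
      have "z \<ominus>\<^bsub>?L\<^esub> L.iz m = emb (z' \<ominus>\<^bsub>Qp p\<^esub> Q.iz m)" using jd[OF Zp_carrier[OF z'(1)], of "Q.iz m"] by (simp add: z'(2) ji)
      also have "\<dots> = L.iz (int p) \<otimes>\<^bsub>?L\<^esub> emb w" unfolding w(2) using jm[of ppi w] Zp_carrier[OF w(1)] by (simp add: ji)
      finally show ?thesis using w(1) by (auto simp: Zp_emb_def)
    qed
    show "int p ^ k dvd m" if w: "w \<in> Zp_emb p" "L.iz m = L.iz (int p) [^]\<^bsub>?L\<^esub> k \<otimes>\<^bsub>?L\<^esub> w" for w m and k :: nat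
    proof -
      obtain w' where w': "w' \<in> Zp p" "w = emb w'" using w by (auto simp: Zp_emb_def)
      have "(emb (Q.iz m) :: padic_alg) = emb (ppi [^]\<^bsub>Qp p\<^esub> k \<otimes>\<^bsub>Qp p\<^esub> w')" using w(2) jm[of "ppi [^]\<^bsub>Qp p\<^esub> k" w'] Zp_carrier[OF w'(1)] by (simp add: ji jp w'(2))
      then show ?thesis using iz_dvd_of_ppi_pow[OF w'(1)] inj by blast
    qed
    show "\<exists>s\<in>Zp_emb p. \<forall>k. \<exists>w\<in>Zp_emb p. s \<ominus>\<^bsub>?L\<^esub> L.iz (t k) = L.iz (int p) [^]\<^bsub>?L\<^esub> k \<otimes>\<^bsub>?L\<^esub> w"
      if t: "\<And>k. int p ^ k dvd t (Suc k) - t k" for t :: "nat \<Rightarrow> int"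
    proof -
      obtain s where s: "s \<in> Zp p" "\<forall>k. \<exists>w\<in>Zp p. s \<ominus>\<^bsub>Qp p\<^esub> Q.iz (t k) = ppi [^]\<^bsub>Qp p\<^esub> k \<otimes>\<^bsub>Qp p\<^esub> w" using int_seq_limit[OF t] by blast
      have "\<exists>w\<in>Zp_emb p. emb s \<ominus>\<^bsub>?L\<^esub> L.iz (t k) = L.iz (int p) [^]\<^bsub>?L\<^esub> k \<otimes>\<^bsub>?L\<^esub> w" for k
      proof -
        obtain w where w: "w \<in> Zp p" "s \<ominus>\<^bsub>Qp p\<^esub> Q.iz (t k) = ppi [^]\<^bsub>Qp p\<^esub> k \<otimes>\<^bsub>Qp p\<^esub> w" using s(2) by blast
        have "emb s \<ominus>\<^bsub>?L\<^esub> L.iz (t k) = emb (s \<ominus>\<^bsub>Qp p\<^esub> Q.iz (t k))" using jd[OF Zp_carrier[OF s(1)], of "Q.iz (t k)"] by (simp add: ji)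
        also have "\<dots> = L.iz (int p) [^]\<^bsub>?L\<^esub> k \<otimes>\<^bsub>?L\<^esub> emb w" unfolding w(2) using jm[of "ppi [^]\<^bsub>Qp p\<^esub> k" w] Zp_carrier[OF w(1)] by (simp add: jp)
        finally show ?thesis using w(1) by (auto simp: Zp_emb_def)
      qed
      then show ?thesis using s(1) by (auto simp: Zp_emb_def)
    qed
  qed
qed

lemma root_model_Zp_ur_mod:
  assumes r: "r \<ge> 1" and f: "monic f" "pdeg f \<ge> 1" "\<not> int p dvd discriminant f"
  shows "root_model (Zp_ur_mod p r) p r f"
proof -
  let ?L = "Qp_closure p"
  interpret M: algebraic_closure ?L "Qp_emb p" by (rule alg_closure)
  interpret E: padic_ext ?L p "Zp_emb p" "Qp_emb p" by (rule padic_ext_closure)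
  have integers: "integers_of p U = ?L\<lparr>carrier := U \<inter> E.IL\<rparr>" if "U \<subseteq> carrier ?L" for U
  proof -
    have "{x \<in> U. integral_over ?L (Zp_emb p) x} = U \<inter> E.IL" using that E.integral_over_iff_intg by (auto simp: E.IL_def)
    then show ?thesis by (simp add: integers_of_def)
  qed
  obtain as where as: "set as \<subseteq> carrier ?L" "length as = pdeg f" "\<forall>y\<in>carrier ?L. M.ev f y = M.linear_prod as y"
    using M.int_poly_linear_prod[OF f(1)] by blast
  define H where "H = \<Union>{E. finite_unramified p E}"
  have H: "H \<subseteq> carrier ?L" unfolding H_def finite_unramified_def using subfieldE(3) by blast
  have U: "subfield (Qp_ur p) ?L" unfolding Qp_ur_def H_def[symmetric] by (rule M.generate_field_is_subfield[OF H])
  \<comment> \<open>Each root lies in the field that it generates, and this is one of the fields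
    whose compositum is \<open>Qp_ur\<close>.\<close>
  have "set as \<subseteq> Qp_ur p"
  proof
    fix a assume a: "a \<in> set as"
    have ac: "a \<in> carrier ?L" using a as(1) by blast
    have e: "M.ev f a = \<zero>\<^bsub>?L\<^esub>" using as(3) ac M.linear_prod_root[OF as(1) a] by simp
    note X = f ac e
    let ?E = "E.E\<alpha> f a"
    have sf: "subfield ?E ?L" by (rule E.E\<alpha>_subfield[OF X])
    have i: "integers_of p ?E = ?L\<lparr>carrier := E.R\<alpha> f a\<rparr>"
      using integers[OF subfieldE(3)[OF sf]] E.E\<alpha>_IL[OF X] by simp
    have "finite_unramified p ?E"
      unfolding finite_unramified_def i using sf E.K_E\<alpha>[OF X] E.E\<alpha>_finite_dimension[OF X] E.R\<alpha>_maximalideal[OF X] by simp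
    moreover have "a \<in> ?E" using E.\<alpha>_R\<alpha>[OF X] E.R\<alpha>_E\<alpha>[OF X] by blast
    ultimately have "a \<in> H" by (auto simp: H_def)
    then show "a \<in> Qp_ur p" unfolding Qp_ur_def H_def[symmetric] by (rule generate_field.incl)
  qed
  then have "root_model (integers_of p (Qp_ur p) Quot (PIdl\<^bsub>integers_of p (Qp_ur p)\<^esub> (add_pow (integers_of p (Qp_ur p)) (p ^ r) \<one>\<^bsub>integers_of p (Qp_ur p)\<^esub>))) p r f"
    using as by (intro E.root_model_sub_integers[OF U r f _ as(2) _ integers[OF subfieldE(3)[OF U]]]) auto
  then show ?thesis by (simp add: Zp_ur_mod_def Zp_ur_def)
qed

end

theorem theorem2p13:
  fixes n d :: nat and f :: "int poly" and \<sigma> :: "nat \<Rightarrow> nat"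
  assumes "n > 1" and "odd n"
    and "Polynomial.lead_coeff f = 1" and "Polynomial.degree f = d" and "d \<ge> 1"
    and "coprime (int n) (discriminant f * poly f 0)"
    and "\<sigma> permutes {1..d}"
  shows "(frobenius_pseudoprime f n \<and> has_cycle_structure f n \<sigma>) \<longleftrightarrow>
    (\<forall>p r. exactly_divides p r n \<longrightarrow>
       (bij_betw (power_map n p r) (roots_mod f p r) (roots_mod f p r) \<and>
        cycle_type (power_map n p r) (roots_mod f p r) = cycle_type \<sigma> {1..d}) \<and>
       Jacobi (discriminant f) n = sign \<sigma>)"
proof -
  let ?r = "\<lambda>p. multiplicity p n"
  \<comment> \<open>Exact divisibility fixes the exponent, so the quantifier over prime powers
    becomes one over prime factors.\<close>
  have ed: "exactly_divides p r n \<longleftrightarrow> p \<in> prime_factors n \<and> r = ?r p" for p r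
  proof
    assume e: "exactly_divides p r n"
    then have p: "Factorial_Ring.prime p" "p dvd n" by (auto simp: exactly_divides_def intro: dvd_trans[OF dvd_power])
    moreover have "r = ?r p" using e by (intro multiplicity_eqI[symmetric]) (auto simp: exactly_divides_def)
    ultimately show "p \<in> prime_factors n \<and> r = ?r p" using \<open>n > 1\<close> by (auto simp: prime_factors_dvd)
  next
    assume "p \<in> prime_factors n \<and> r = ?r p"
    then have p: "Factorial_Ring.prime p" "p dvd n" and r: "r = ?r p" by auto
    have "?r p \<ge> 1" using p \<open>n > 1\<close> by (intro multiplicity_geI) (auto simp: prime_gt_1_nat)
    moreover have "p ^ ?r p dvd n" by (rule multiplicity_dvd)
    moreover have "\<not> p ^ (?r p + 1) dvd n"
    proof
      assume "p ^ (?r p + 1) dvd n"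
      then have "?r p + 1 \<le> ?r p" using p \<open>n > 1\<close> by (intro multiplicity_geI) (auto simp: prime_gt_1_nat)
      then show False by simp
    qed
    ultimately show "exactly_divides p r n" using p(1) r by (simp add: exactly_divides_def)
  qed
  have rm: "root_model (Zp_ur_mod p (?r p)) p (?r p) f" if p: "p \<in> prime_factors n" for p
  proof -
    have pp: "Factorial_Ring.prime p" "p dvd n" using p by auto
    interpret padic p by (rule padic.intro[OF pp(1)])
    have "?r p \<ge> 1" using ed[of p "?r p"] p by (simp add: exactly_divides_def)
    moreover have "\<not> int p dvd discriminant f"
    proof
      assume d: "int p dvd discriminant f"
      have "int p dvd int n" using pp(2) by simp
      then have "is_unit (int p)" using d assms(6) by (meson coprime_common_divisor dvd_mult2)
      then show False using prime_gt_1_nat[OF pp(1)] by simp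
    qed
    ultimately show ?thesis using root_model_Zp_ur_mod assms(3,4,5) by auto
  qed
  have main: "(frobenius_pseudoprime f n \<and> has_cycle_structure f n \<sigma>) \<longleftrightarrow>
    (\<forall>p\<in>prime_factors n.
       bij_betw (root_model.\<phi> (Zp_ur_mod p (?r p)) n) (root_model.T (Zp_ur_mod p (?r p)) f) (root_model.T (Zp_ur_mod p (?r p)) f) \<and>
       cycle_type (root_model.\<phi> (Zp_ur_mod p (?r p)) n) (root_model.T (Zp_ur_mod p (?r p)) f) = cycle_type \<sigma> {1..pdeg f}) \<and>
    Jacobi (discriminant f) n = sign \<sigma>"
    by (rule pseudoprime_iff_root_models[where Rr = "\<lambda>p. Zp_ur_mod p (?r p)"]) (use assms rm in auto)
  have T: "root_model.T (Zp_ur_mod p (?r p)) f = roots_mod f p (?r p)" if p: "p \<in> prime_factors n" for p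
  proof -
    interpret root_model "Zp_ur_mod p (?r p)" p "?r p" f by (rule rm[OF p])
    show ?thesis by (simp add: T_def ev_def roots_mod_def)
  qed
  have \<phi>: "root_model.\<phi> (Zp_ur_mod p (?r p)) n = power_map n p (?r p)" if p: "p \<in> prime_factors n" for p
  proof -
    interpret root_model "Zp_ur_mod p (?r p)" p "?r p" f by (rule rm[OF p])
    show ?thesis by (simp add: fun_eq_iff \<phi>_def power_map_def)
  qed
  \<comment> \<open>The Jacobi condition stands under the quantifier over prime powers; since
    \<open>n > 1\<close> has a prime factor, it can be extracted from there.\<close>
  obtain p0 where "p0 \<in> prime_factors n" using prime_factor_nat[of n] \<open>n > 1\<close> by (auto simp: prime_factors_dvd)
  then show ?thesis unfolding main ed using T \<phi> assms(4) by auto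
qed

end
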